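(* Let $0<s<1$ with $Q>2s$, and let $2^*(s)=\frac{2Q}{Q-2s}$. (a) For some constant $S=S(s,Q)$ (the group $\mathbb G$ and its homogeneous norm being fixed), every $u\in C_0^\infty(\mathbb G)$ satisfies $$\left(\int_{\mathbb G}|u(g)|^{2^*(s)}\,dg\right)^{1/2^*(s)}\le S\left(\int_{\mathbb G}\int_{\mathbb G}\frac{|u(g)-u(h)|^2}{|h^{-1}g|^{Q+2s}}\,dg\,dh\right)^{1/2}.$$ (b) Equality in this fractional Sobolev inequality on $\mathbb G$ is achieved: taking $S$ to be the best (smallest) constant, i.e. the norm of the embedding $\mathcal{D}^{s,2}(\mathbb G)\hookrightarrow L^{2^*(s)}(\mathbb G)$, there is a nonzero $u\in\mathcal{D}^{s,2}(\mathbb G)$ for which equality holds. (c) If $\Omega\subset\mathbb G$ is a bounded domain, then the inclusion (restriction) $\iota:\mathcal{D}^{s,2}(\mathbb G)\hookrightarrow L^q(\Omega)$ is compact for every $q\in[1,2^*(s))$.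
   Context: $\mathbb G$ is a homogeneous group: a connected, simply connected nilpotent Lie group whose Lie algebra $\mathfrak g$ carries a family of automorphisms (dilations) $\{\Delta_\lambda\}_{\lambda>0}$ for which there are a basis $X_1,\dots,X_n$ of $\mathfrak g$ and reals $1=d_1\le d_2\le\dots\le d_n$ with $\Delta_\lambda X_j=\lambda^{d_j}X_j$. The group is not assumed to be Carnot (stratified). Group dilations are $\delta_\lambda=\exp\circ\Delta_\lambda\circ\exp^{-1}$, and $Q=d_1+\dots+d_n$ is the homogeneous dimension. $dg$ (or $dh$) is a fixed bi-invariant Haar measure (the push-forward of Lebesgue measure on $\mathfrak g$ under $\exp$), so $d(\delta_\lambda g)=\lambda^Q dg$. $|\cdot|$ is a fixed homogeneous norm: $|\cdot|\in C(\mathbb G)\cap C^\infty(\mathbb G\setminus\{e\})$ ($e$ the identity), $|g|\ge 0$ with $|g|=0$ iff $g=e$, $|g^{-1}|=|g|$, $|\delta_\lambda g|=\lambda|g|$, and $|gh|\le|g|+|h|$. Balls are $B_R(g)=\{h:|g^{-1}h|<R\}$. For $0<s<1$ the Dirichlet space $\mathcal{D}^{s,2}(\mathbb G)$ is the completion of $C_0^\infty(\mathbb G)$ with respect to $$\|u\|_{\mathcal{D}^{s,2}(\mathbb G)}=[u]_{s,2}=\left(\int_{\mathbb G}\int_{\mathbb G}\frac{|u(g)-u(h)|^2}{|h^{-1}g|^{Q+2s}}\,dg\,dh\right)^{1/2}.$$ By the inequality in (a), $\mathcal{D}^{s,2}(\mathbb G)$ is regarded as a space of functions in $L^{2^*(s)}(\mathbb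 G)$. *)

theory Defs
  imports "HOL-Analysis.Analysis" "HOL-Algebra.Group"
begin

section \<open>Smooth manifolds and smooth maps\<close>

text \<open>\<open>Ck_on k S f\<close> for open \<open>S\<close>: all iterated directional derivatives of order at most \<open>k\<close> exist
  and are continuous.\<close>

fun Ck_on :: "nat \<Rightarrow> 'a::euclidean_space set \<Rightarrow> ('a \<Rightarrow> 'b::euclidean_space) \<Rightarrow> bool" where
  "Ck_on 0 S f \<longleftrightarrow> continuous_on S f"
| "Ck_on (Suc k) S f \<longleftrightarrow> (\<forall>x\<in>S. f differentiable (at x)) \<and>
     (\<forall>v. Ck_on k S (\<lambda>x. frechet_derivative f (at x) v))"

definition smooth_on :: "'a::euclidean_space set \<Rightarrow> ('a \<Rightarrow> 'b::euclidean_space) \<Rightarrow> bool" where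
  "smooth_on S f \<longleftrightarrow> (\<forall>k. Ck_on k S f)"

text \<open>A chart is a pair of an open domain and a coordinate map; the model space is \<open>'a\<close>.\<close>

type_synonym ('m, 'a) charts = "('m set \<times> ('m \<Rightarrow> 'a)) set"

definition smooth_atlas :: "('m::topological_space, 'a::euclidean_space) charts \<Rightarrow> bool" where
  "smooth_atlas A \<longleftrightarrow>
     (\<forall>(U, \<phi>)\<in>A. open U \<and> open (\<phi> ` U) \<and> (\<exists>\<psi>. homeomorphism U (\<phi> ` U) \<phi> \<psi>)) \<and>
     (\<Union>(U, \<phi>)\<in>A. U) = UNIV \<and>
     (\<forall>(U, \<phi>)\<in>A. \<forall>(V, \<psi>)\<in>A. smooth_on (\<phi> ` (U \<inter> V)) (\<psi> \<circ> inv_into U \<phi>))"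

definition flat_atlas :: "('a::euclidean_space, 'a) charts" where
  "flat_atlas = {(UNIV, id)}"

definition prod_atlas ::
    "('m, 'a) charts \<Rightarrow> ('n, 'b) charts \<Rightarrow> ('m \<times> 'n, 'a \<times> 'b) charts" where
  "prod_atlas A B = {(U \<times> V, map_prod \<phi> \<psi>) | U \<phi> V \<psi>. (U, \<phi>) \<in> A \<and> (V, \<psi>) \<in> B}"

text \<open>Smoothness on an open subset \<open>W\<close> of the manifold with atlas \<open>A\<close>.\<close>

definition smooth_map_on ::
    "('m::topological_space, 'a::euclidean_space) charts
      \<Rightarrow> ('n::topological_space, 'b::euclidean_space) charts \<Rightarrow> 'm set \<Rightarrow> ('m \<Rightarrow> 'n) \<Rightarrow> bool" where
  "smooth_map_on A B W f \<longleftrightarrow> continuous_on W f \<and>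
     (\<forall>(U, \<phi>)\<in>A. \<forall>(V, \<psi>)\<in>B. smooth_on (\<phi> ` (U \<inter> W \<inter> f -` V)) (\<psi> \<circ> f \<circ> inv_into U \<phi>))"

section \<open>Lie groups and homogeneous groups\<close>

text \<open>The underlying manifold is the whole type \<open>'g\<close>, with its type-class topology; the Lie algebra
  (the tangent space at the identity) has underlying vector space \<open>'a\<close>.
  The field \<open>lexp\<close> is the exponential map,
  \<open>dil\<close> the family \<open>\<Delta>\<^sub>\<lambda>\<close> of dilations of the Lie algebra, \<open>weight j\<close> is \<open>d\<^sub>j\<close>
  (for \<open>1 \<le> j \<le> DIM('a)\<close>) and \<open>hnorm\<close> the homogeneous norm.\<close>

record ('g, 'a) homogeneous_structure = "'g monoid" +
  atlas :: "('g, 'a) charts"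
  lexp :: "'a \<Rightarrow> 'g"
  dil :: "real \<Rightarrow> 'a \<Rightarrow> 'a"
  weight :: "nat \<Rightarrow> real"
  hnorm :: "'g \<Rightarrow> real"

type_synonym ('g, 'a) hgroup = "('g, 'a) homogeneous_structure"

definition lie_group ::
    "('g::{t2_space, second_countable_topology}, 'a::euclidean_space) hgroup \<Rightarrow> bool" where
  "lie_group G \<longleftrightarrow> group G \<and> carrier G = UNIV \<and> smooth_atlas (atlas G) \<and>
     smooth_map_on (prod_atlas (atlas G) (atlas G)) (atlas G) UNIV (\<lambda>(g, h). g \<otimes>\<^bsub>G\<^esub> h) \<and>
     smooth_map_on (atlas G) (atlas G) UNIV (\<lambda>g. inv\<^bsub>G\<^esub> g)"

text \<open>The exponential map of a Lie group is characterised, once \<open>'a\<close> is identified with the tangent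
  space at the identity, as the smooth map such that \<open>t \<mapsto> exp (t x)\<close> is the one-parameter subgroup
  with initial velocity \<open>x\<close>. The identification is the differential of \<open>exp\<close> at \<open>0\<close>; the last
  clause says (in charts) that it is a linear isomorphism.\<close>

definition exponential_map ::
    "('g::{t2_space, second_countable_topology}, 'a::euclidean_space) hgroup \<Rightarrow> bool" where
  "exponential_map G \<longleftrightarrow> smooth_map_on flat_atlas (atlas G) UNIV (lexp G) \<and>
     (\<forall>s t x. lexp G ((s + t) *\<^sub>R x) = lexp G (s *\<^sub>R x) \<otimes>\<^bsub>G\<^esub> lexp G (t *\<^sub>R x)) \<and>
     (\<forall>(U, \<phi>)\<in>atlas G. \<one>\<^bsub>G\<^esub> \<in> U \<longrightarrow> (\<exists>D. (\<phi> \<circ> lexp G has_derivative D) (at 0) \<and> bij D))"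

text \<open>The adjoint representation, \<open>g (exp (t y)) g\<inverse> = exp (t Ad\<^sub>g y)\<close>, and the Lie bracket
  \<open>[x, y] = ad\<^sub>x y\<close> as the derivative of \<open>Ad\<close> at the identity.\<close>

definition Ad :: "('g, 'a::euclidean_space) hgroup \<Rightarrow> 'g \<Rightarrow> 'a \<Rightarrow> 'a" where
  "Ad G g y = (THE z. \<forall>t. lexp G (t *\<^sub>R z) = g \<otimes>\<^bsub>G\<^esub> lexp G (t *\<^sub>R y) \<otimes>\<^bsub>G\<^esub> inv\<^bsub>G\<^esub> g)"

definition bracket :: "('g, 'a::euclidean_space) hgroup \<Rightarrow> 'a \<Rightarrow> 'a \<Rightarrow> 'a" where
  "bracket G x y = vector_derivative (\<lambda>s. Ad G (lexp G (s *\<^sub>R x)) y) (at 0)"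

primrec lower_central :: "('g, 'a::euclidean_space) hgroup \<Rightarrow> nat \<Rightarrow> 'a set" where
  "lower_central G 0 = UNIV"
| "lower_central G (Suc k) = span {bracket G x y | x y. y \<in> lower_central G k}"

definition nilpotent_lie_algebra :: "('g, 'a::euclidean_space) hgroup \<Rightarrow> bool" where
  "nilpotent_lie_algebra G \<longleftrightarrow> (\<exists>k. lower_central G k = {0})"

definition lie_algebra_automorphism ::
    "('g, 'a::euclidean_space) hgroup \<Rightarrow> ('a \<Rightarrow> 'a) \<Rightarrow> bool" where
  "lie_algebra_automorphism G T \<longleftrightarrow> linear T \<and> bij T \<and>
     (\<forall>x y. T (bracket G x y) = bracket G (T x) (T y))"

definition dilations :: "('g, 'a::euclidean_space) hgroup \<Rightarrow> bool" where
  "dilations G \<longleftrightarrow>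
     (\<forall>l>0. lie_algebra_automorphism G (dil G l)) \<and>
     weight G 1 = 1 \<and> (\<forall>i\<in>{1..DIM('a)}. \<forall>j\<in>{1..DIM('a)}. i \<le> j \<longrightarrow> weight G i \<le> weight G j) \<and>
     (\<exists>X :: nat \<Rightarrow> 'a. inj_on X {1..DIM('a)} \<and> independent (X ` {1..DIM('a)}) \<and>
        span (X ` {1..DIM('a)}) = UNIV \<and>
        (\<forall>l>0. \<forall>j\<in>{1..DIM('a)}. dil G l (X j) = (l powr weight G j) *\<^sub>R X j))"

text \<open>The group dilations \<open>\<delta>\<^sub>\<lambda>\<close>; the exponential map of a simply connected nilpotent Lie group
  is bijective.\<close>

definition gdil :: "('g, 'a::euclidean_space) hgroup \<Rightarrow> real \<Rightarrow> 'g \<Rightarrow> 'g" where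
  "gdil G l = lexp G \<circ> dil G l \<circ> inv_into UNIV (lexp G)"

definition homogeneous_norm ::
    "('g::{t2_space, second_countable_topology}, 'a::euclidean_space) hgroup \<Rightarrow> bool" where
  "homogeneous_norm G \<longleftrightarrow> continuous_on UNIV (hnorm G) \<and>
     smooth_map_on (atlas G) flat_atlas (- {\<one>\<^bsub>G\<^esub>}) (hnorm G) \<and>
     (\<forall>g. hnorm G g \<ge> 0) \<and> (\<forall>g. hnorm G g = 0 \<longleftrightarrow> g = \<one>\<^bsub>G\<^esub>) \<and>
     (\<forall>g. hnorm G (inv\<^bsub>G\<^esub> g) = hnorm G g) \<and>
     (\<forall>l>0. \<forall>g. hnorm G (gdil G l g) = l * hnorm G g) \<and>
     (\<forall>g h. hnorm G (g \<otimes>\<^bsub>G\<^esub> h) \<le> hnorm G g + hnorm G h)"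

definition homogeneous_group ::
    "('g::{t2_space, second_countable_topology}, 'a::euclidean_space) hgroup \<Rightarrow> bool" where
  "homogeneous_group G \<longleftrightarrow> lie_group G \<and> connected (UNIV :: 'g set) \<and>
     simply_connected (UNIV :: 'g set) \<and> exponential_map G \<and> nilpotent_lie_algebra G \<and>
     dilations G \<and> homogeneous_norm G"

definition hom_dim :: "('g, 'a::euclidean_space) hgroup \<Rightarrow> real" where
  "hom_dim G = (\<Sum>j = 1..DIM('a). weight G j)"

definition haar :: "('g::topological_space, 'a::euclidean_space) hgroup \<Rightarrow> 'g measure" where
  "haar G = distr lborel borel (lexp G)"

definition hball :: "('g, 'a) hgroup \<Rightarrow> 'g \<Rightarrow> real \<Rightarrow> 'g set" where
  "hball G g R = {h. hnorm G (inv\<^bsub>G\<^esub> g \<otimes>\<^bsub>G\<^esub> h) < R}"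

definition bounded_domain :: "('g::topological_space, 'a) hgroup \<Rightarrow> 'g set \<Rightarrow> bool" where
  "bounded_domain G \<Omega> \<longleftrightarrow> open \<Omega> \<and> connected \<Omega> \<and> \<Omega> \<noteq> {} \<and> (\<exists>R. \<Omega> \<subseteq> hball G \<one>\<^bsub>G\<^esub> R)"

section \<open>Function spaces\<close>

text \<open>Elements of \<open>L\<^sup>p\<close> are represented by measurable functions, equality being equality
  almost everywhere.\<close>

definition in_Lp :: "'b measure \<Rightarrow> real \<Rightarrow> ('b \<Rightarrow> real) \<Rightarrow> bool" where
  "in_Lp M p u \<longleftrightarrow> u \<in> borel_measurable M \<and> integrable M (\<lambda>x. \<bar>u x\<bar> powr p)"

definition Lp_norm :: "'b measure \<Rightarrow> real \<Rightarrow> ('b \<Rightarrow> real) \<Rightarrow> real" where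
  "Lp_norm M p u = (LINT x|M. \<bar>u x\<bar> powr p) powr (1 / p)"

definition test_functions ::
    "('g::topological_space, 'a::euclidean_space) hgroup \<Rightarrow> ('g \<Rightarrow> real) set" where
  "test_functions G = {u. smooth_map_on (atlas G) flat_atlas UNIV u \<and> compact (closure {g. u g \<noteq> 0})}"

definition crit_exp :: "('g, 'a::euclidean_space) hgroup \<Rightarrow> real \<Rightarrow> real" where
  "crit_exp G s = 2 * hom_dim G / (hom_dim G - 2 * s)"

text \<open>The seminorm \<open>[u]\<close>. The double integral is finite for test functions and, by Fatou's lemma,
  for members of \<open>dirichlet_space\<close>. On the null set \<open>g = h\<close> the integrand is \<open>0\<close>.\<close>

definition gagliardo ::
    "('g::topological_space, 'a::euclidean_space) hgroup \<Rightarrow> real \<Rightarrow> ('g \<Rightarrow> real) \<Rightarrow> real" where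
  "gagliardo G s u = sqrt (enn2real
     (\<integral>\<^sup>+ h. (\<integral>\<^sup>+ g. ennreal (\<bar>u g - u h\<bar>\<^sup>2 / hnorm G (inv\<^bsub>G\<^esub> h \<otimes>\<^bsub>G\<^esub> g) powr (hom_dim G + 2 * s))
        \<partial>haar G) \<partial>haar G))"

text \<open>The completion of the test functions with respect to \<open>gagliardo\<close>, realised in the Lebesgue
  space of the critical exponent: by the Sobolev inequality, a sequence of test functions that is
  Cauchy for \<open>gagliardo\<close> converges in that space, and its limit represents the element of the
  completion. The norm of that element is \<open>gagliardo G s u\<close>.\<close>

definition dirichlet_space ::
    "('g::topological_space, 'a::euclidean_space) hgroup \<Rightarrow> real \<Rightarrow> ('g \<Rightarrow> real) set" where
  "dirichlet_space G s = {u. in_Lp (haar G) (crit_exp G s) u \<and>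
     (\<exists>\<phi>. (\<forall>k::nat. \<phi> k \<in> test_functions G) \<and>
        (\<forall>\<epsilon>>0. \<exists>M. \<forall>j\<ge>M. \<forall>k\<ge>M. gagliardo G s (\<lambda>g. \<phi> j g - \<phi> k g) < \<epsilon>) \<and>
        (\<lambda>k. Lp_norm (haar G) (crit_exp G s) (\<lambda>g. \<phi> k g - u g)) \<longlonglongrightarrow> 0)}"

definition sobolev_ineq ::
    "('g::topological_space, 'a::euclidean_space) hgroup \<Rightarrow> real \<Rightarrow> real \<Rightarrow> ('g \<Rightarrow> real) \<Rightarrow> bool" where
  "sobolev_ineq G s S u \<longleftrightarrow> Lp_norm (haar G) (crit_exp G s) u \<le> S * gagliardo G s u"

text \<open>The best constant: valid on the Dirichlet space (which contains the test functions), and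
  smallest already among the constants valid for the test functions. Equivalently, it is the norm of
  the embedding of the Dirichlet space.\<close>

definition best_sobolev_const ::
    "('g::topological_space, 'a::euclidean_space) hgroup \<Rightarrow> real \<Rightarrow> real \<Rightarrow> bool" where
  "best_sobolev_const G s S \<longleftrightarrow> (\<forall>u\<in>dirichlet_space G s. sobolev_ineq G s S u) \<and>
     (\<forall>C. (\<forall>u\<in>test_functions G. sobolev_ineq G s C u) \<longrightarrow> S \<le> C)"

text \<open>Restriction to \<open>\<Omega>\<close> maps the Dirichlet space into \<open>L\<^sup>q(\<Omega>)\<close> and sends bounded sequences to
  sequences with a convergent subsequence.\<close>

definition compact_restriction ::
    "('g::topological_space, 'a::euclidean_space) hgroup \<Rightarrow> real \<Rightarrow> 'g set \<Rightarrow> real \<Rightarrow> bool" where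
  "compact_restriction G s \<Omega> q \<longleftrightarrow>
     (\<forall>u\<in>dirichlet_space G s. in_Lp (restrict_space (haar G) \<Omega>) q u) \<and>
     (\<forall>u :: nat \<Rightarrow> 'g \<Rightarrow> real. (\<forall>k. u k \<in> dirichlet_space G s) \<and> (\<exists>B. \<forall>k. gagliardo G s (u k) \<le> B) \<longrightarrow>
        (\<exists>r v. strict_mono (r :: nat \<Rightarrow> nat) \<and> in_Lp (restrict_space (haar G) \<Omega>) q v \<and>
          (\<lambda>k. Lp_norm (restrict_space (haar G) \<Omega>) q (\<lambda>g. u (r k) g - v g)) \<longlonglongrightarrow> 0))"

end

theory Submission
  imports Defs "HOL-Complex_Analysis.Great_Picard"
begin

text \<open>In exponential coordinates the group becomes a Euclidean space with a smooth product
  \<open>x \<odot> y = log (exp x exp y)\<close>. This product exists near \<open>0\<close> by the inverse function theorem. A Lie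
  algebra automorphism intertwines the local products, because the differential of \<open>exp\<close> is determined
  by the adjoint representation through a cocycle identity; the dilations therefore extend the local
  product to the whole Lie algebra, and connectedness and simple connectedness make \<open>exp\<close> bijective.
  By homogeneity, left translations are triangular with unit diagonal in the coordinates
  \<open>X\<^sub>1, \<dots>, X\<^sub>n\<close>, that is, products of shears, so Lebesgue measure is left invariant.

  For the analysis, let \<open>M\<close> bound the means of \<open>\<bar>u\<bar>\<close> over balls of radius \<open>r\<close> multiplied by \<open>r\<^bsup>Q/p\<^esup>\<close>,
  where \<open>p\<close> is the critical exponent.
  Comparing \<open>u y\<close> with the mean over a ball of suitable radius gives the pointwise estimate
  \<open>\<bar>u y\<bar>\<^sup>p \<le> C M\<^bsup>p - 2\<^esup> F y\<close>, where \<open>F y\<close> is the inner Gagliardo integral at \<open>y\<close>. Integrated, it is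
  the Sobolev inequality refined by a Morrey norm. The refinement prevents a maximising sequence from
  vanishing, once suitably translated and dilated; a local compactness theorem yields a limit almost
  everywhere, and the Brezis-Lieb lemma, applied to the mass and to the energy, shows that the limit
  is an extremal function.\<close>

section \<open>Smooth maps between Euclidean spaces\<close>

text \<open>Two obstacles shape the proof. The hypotheses on the group are infinitesimal: dilations
  preserve the bracket, which is a derivative of the adjoint representation. To integrate them, let
  b(t) be t times the differential of exp at t x, translated to the origin. Then b(s + t) = Ad (exp
  (- s x)) b(t) + b(s). The defect D of equivariance under a Lie algebra map obeys the same law, so
  D(1) is at most a constant times n |D(1/n)|, which tends to 0; no expansion of the product in
  brackets is involved. Second, the Dirichlet space consists of limits of energy-Cauchy sequences of
  test functions, while compactness yields only a limit almost everywhere with bounded energy. A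
  minimisation by the parallelogram law replaces weak convergence and puts this limit into the
  space. The critical exponent enters through 2 s p / Q = p - 2. It makes the powers of the radius
  in the pointwise estimate combine to (M / |u y|)^(p - 2), and it makes mass and energy invariant
  under the same normalised dilations, so that a maximising sequence can be recentred on the unit
  ball at no cost.\<close>

lemma Ck_on_subset: "Ck_on k S f \<Longrightarrow> T \<subseteq> S \<Longrightarrow> Ck_on k T f"
  by (induction k arbitrary: f) (auto intro: continuous_on_subset)

lemma frechet_derivative_cong_open:
  assumes "open S" "x \<in> S" "\<And>y. y \<in> S \<Longrightarrow> f y = g y"
  shows "frechet_derivative f (at x) = frechet_derivative g (at x)"
proof -
  have "(f has_derivative D) (at x) \<longleftrightarrow> (g has_derivative D) (at x)" for D
    using has_derivative_transform_within_open[of f D x UNIV S g] has_derivative_transform_within_open[of g D x UNIV S f]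
      assms(1,2) assms(3) assms(3)[symmetric] by blast
  then show ?thesis by (simp add: frechet_derivative_def)
qed

lemma Ck_on_cong:
  assumes "open S" "\<And>x. x \<in> S \<Longrightarrow> f x = g x" "Ck_on k S f"
  shows "Ck_on k S g"
  using assms(2,3)
proof (induction k arbitrary: f g)
  case 0
  then show ?case by (simp cong: continuous_on_cong)
next
  case (Suc k)
  have "g differentiable (at x)" if "x \<in> S" for x
  proof -
    have "f differentiable (at x)" using Suc.prems that by simp
    then obtain D where "(f has_derivative D) (at x)" unfolding differentiable_def by blast
    then have "(g has_derivative D) (at x)"
      using has_derivative_transform_within_open[of f D x UNIV S g] assms(1) that Suc.prems(1) by auto
    then show ?thesis by (auto simp: differentiable_def)
  qed
  moreover have "Ck_on k S (\<lambda>x. frechet_derivative g (at x) v)" for v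
  proof (rule Suc.IH[of "\<lambda>x. frechet_derivative f (at x) v"])
    show "frechet_derivative f (at x) v = frechet_derivative g (at x) v" if "x \<in> S" for x
      by (rule fun_cong[OF frechet_derivative_cong_open[OF assms(1) that Suc.prems(1)]])
    show "Ck_on k S (\<lambda>x. frechet_derivative f (at x) v)" using Suc.prems(2) by simp
  qed
  ultimately show ?case by simp
qed

lemma Ck_on_SucI:
  assumes "open S" and d: "\<And>x. x \<in> S \<Longrightarrow> (f has_derivative D x) (at x)"
    and Ck: "\<And>v. Ck_on k S (\<lambda>x. D x v)"
  shows "Ck_on (Suc k) S f"
  unfolding Ck_on.simps
proof (intro conjI ballI allI)
  show "f differentiable (at x)" if "x \<in> S" for x unfolding differentiable_def using d[OF that] by blast
  show "Ck_on k S (\<lambda>x. frechet_derivative f (at x) v)" for v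
  proof (rule Ck_on_cong[OF assms(1) _ Ck])
    show "D x v = frechet_derivative f (at x) v" if "x \<in> S" for x
      by (rule fun_cong[OF frechet_derivative_at[OF d[OF that]]])
  qed
qed

lemma Ck_on_Suc_has_derivative:
  "Ck_on (Suc k) S f \<Longrightarrow> x \<in> S \<Longrightarrow> (f has_derivative frechet_derivative f (at x)) (at x)"
  by (simp add: frechet_derivative_works[symmetric])

lemma Ck_on_Suc_frechet: "Ck_on (Suc k) S f \<Longrightarrow> Ck_on k S (\<lambda>x. frechet_derivative f (at x) v)"
  by simp

text \<open>Derivatives are taken at a point of the whole space, not within \<open>S\<close>, so the
  property can be tested on neighbourhoods of the points of \<open>S\<close>.\<close>

lemma Ck_on_local:
  assumes "\<And>x. x \<in> S \<Longrightarrow> \<exists>T. open T \<and> x \<in> T \<and> Ck_on k T f"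
  shows "Ck_on k S f"
  using assms
proof (induction k arbitrary: f)
  case 0
  show ?case unfolding Ck_on.simps continuous_on_eq_continuous_within
  proof
    fix x assume "x \<in> S"
    then obtain T where "open T" "x \<in> T" "continuous_on T f" using 0 by force
    then show "continuous (at x within S) f"
      using continuous_on_eq_continuous_at continuous_at_imp_continuous_at_within by blast
  qed
next
  case (Suc k)
  have "Ck_on k S (\<lambda>x. frechet_derivative f (at x) v)" for v
    by (rule Suc.IH) (use Suc.prems in fastforce)
  then show ?case using Suc.prems by fastforce
qed

lemma Ck_on_Suc_imp: "Ck_on (Suc k) S f \<Longrightarrow> Ck_on k S f"
proof (induction k arbitrary: f)
  case 0
  then show ?case
    by (auto intro!: continuous_at_imp_continuous_on differentiable_imp_continuous_within)
qed auto

lemma Ck_on_const: "Ck_on k S (\<lambda>x. c)"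
  by (induction k arbitrary: c) auto

lemma Ck_on_linear: assumes "linear f" shows "Ck_on k S f"
proof (cases k)
  case 0
  then show ?thesis using assms by (simp add: linear_continuous_on linear_conv_bounded_linear)
next
  case (Suc j)
  have d: "(f has_derivative f) (at x)" for x
    using assms by (simp add: bounded_linear_imp_has_derivative linear_conv_bounded_linear)
  have "frechet_derivative f (at x) = f" for x using frechet_derivative_at[OF d] by (rule sym)
  then show ?thesis using Suc d by (auto simp: Ck_on_const differentiable_def)
qed

lemma Ck_on_linear_compose:
  assumes "open S" "linear L" "Ck_on k S f"
  shows "Ck_on k S (\<lambda>x. L (f x))"
  using assms(3)
proof (induction k arbitrary: f)
  case 0
  have "continuous_on UNIV L" using assms(2) by (simp add: linear_continuous_on linear_conv_bounded_linear)
  then show ?case using continuous_on_compose2[of UNIV L S f] 0 by simp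
next
  case (Suc k)
  show ?case
  proof (rule Ck_on_SucI[OF assms(1)])
    show "((\<lambda>x. L (f x)) has_derivative (\<lambda>v. L (frechet_derivative f (at x) v))) (at x)" if "x \<in> S" for x
      using Ck_on_Suc_has_derivative[OF Suc.prems that] assms(2)
      by (simp add: bounded_linear.has_derivative linear_conv_bounded_linear)
    show "Ck_on k S (\<lambda>x. L (frechet_derivative f (at x) v))" for v
      by (rule Suc.IH[OF Ck_on_Suc_frechet[OF Suc.prems]])
  qed
qed

lemma Ck_on_add:
  assumes "open S" "Ck_on k S f" "Ck_on k S g"
  shows "Ck_on k S (\<lambda>x. f x + g x)"
  using assms(2,3)
proof (induction k arbitrary: f g)
  case 0
  then show ?case by (simp add: continuous_on_add)
next
  case (Suc k)
  show ?case
  proof (rule Ck_on_SucI[OF assms(1)])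
    show "((\<lambda>x. f x + g x) has_derivative (\<lambda>v. frechet_derivative f (at x) v + frechet_derivative g (at x) v)) (at x)" if "x \<in> S" for x
      by (intro has_derivative_add Ck_on_Suc_has_derivative[OF Suc.prems(1) that] Ck_on_Suc_has_derivative[OF Suc.prems(2) that])
    show "Ck_on k S (\<lambda>x. frechet_derivative f (at x) v + frechet_derivative g (at x) v)" for v
      by (rule Suc.IH[OF Ck_on_Suc_frechet[OF Suc.prems(1)] Ck_on_Suc_frechet[OF Suc.prems(2)]])
  qed
qed

lemma Ck_on_sum:
  assumes "open S" "\<And>i. i \<in> I \<Longrightarrow> Ck_on k S (f i)"
  shows "Ck_on k S (\<lambda>x. \<Sum>i\<in>I. f i x)"
  using assms(2)
proof (induction I rule: infinite_finite_induct)
  case (insert i I)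
  then have "Ck_on k S (\<lambda>x. f i x + (\<Sum>i\<in>I. f i x))" by (intro Ck_on_add[OF assms(1)]) auto
  then show ?case using insert by simp
qed (simp_all add: Ck_on_const)

lemma Ck_on_scaleR:
  fixes f :: "'a::euclidean_space \<Rightarrow> real"
  assumes "open S" "Ck_on k S f" "Ck_on k S g"
  shows "Ck_on k S (\<lambda>x. f x *\<^sub>R g x)"
  using assms(2,3)
proof (induction k arbitrary: f g)
  case 0
  then show ?case by (simp add: continuous_on_scaleR)
next
  case (Suc k)
  show ?case
  proof (rule Ck_on_SucI[OF assms(1)])
    show "((\<lambda>x. f x *\<^sub>R g x) has_derivative (\<lambda>v. f x *\<^sub>R frechet_derivative g (at x) v + frechet_derivative f (at x) v *\<^sub>R g x)) (at x)"
      if "x \<in> S" for x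
      by (intro has_derivative_scaleR Ck_on_Suc_has_derivative[OF Suc.prems(1) that] Ck_on_Suc_has_derivative[OF Suc.prems(2) that])
    show "Ck_on k S (\<lambda>x. f x *\<^sub>R frechet_derivative g (at x) v + frechet_derivative f (at x) v *\<^sub>R g x)" for v
      by (intro Ck_on_add[OF assms(1)]
          Suc.IH[OF Ck_on_Suc_imp[OF Suc.prems(1)] Ck_on_Suc_frechet[OF Suc.prems(2)]]
          Suc.IH[OF Ck_on_Suc_frechet[OF Suc.prems(1)] Ck_on_Suc_imp[OF Suc.prems(2)]])
  qed
qed

lemma Ck_on_inner: "open S \<Longrightarrow> Ck_on k S f \<Longrightarrow> Ck_on k S (\<lambda>x. f x \<bullet> b)"
  by (rule Ck_on_linear_compose) (auto simp: linear_iff inner_add_left)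

lemma linear_basis_expansion:
  fixes D :: "'a::euclidean_space \<Rightarrow> 'b::real_vector"
  assumes "linear D" shows "D v = (\<Sum>b\<in>Basis. (v \<bullet> b) *\<^sub>R D b)"
proof -
  have "D v = D (\<Sum>b\<in>Basis. (v \<bullet> b) *\<^sub>R b)" by (simp add: euclidean_representation)
  also have "\<dots> = (\<Sum>b\<in>Basis. (v \<bullet> b) *\<^sub>R D b)"
    using assms by (simp add: linear_sum linear_scale)
  finally show ?thesis .
qed

text \<open>\<open>Ck_on\<close> controls derivatives in fixed directions only, but the chain rule
  evaluates the derivative of \<open>g\<close> in the moving direction \<open>Df(x) v\<close>.
  Expanding that direction in the basis turns the derivative into a finite sum of products of
  functions covered by the induction hypothesis.\<close>

lemma Ck_on_compose:
  fixes f :: "'a::euclidean_space \<Rightarrow> 'b::euclidean_space" and g :: "'b \<Rightarrow> 'c::euclidean_space"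
  assumes S: "open S" and T: "open T" and fS: "f ` S \<subseteq> T" and "Ck_on k S f" "Ck_on k T g"
  shows "Ck_on k S (\<lambda>x. g (f x))"
  using assms(4-)
proof (induction k arbitrary: g)
  case 0
  then show ?case using continuous_on_compose2[of T g S f] fS by simp
next
  case (Suc k)
  let ?D = "\<lambda>x v. \<Sum>b\<in>Basis. (frechet_derivative f (at x) v \<bullet> b) *\<^sub>R frechet_derivative g (at (f x)) b"
  show ?case
  proof (rule Ck_on_SucI[OF S])
    fix x assume x: "x \<in> S"
    then have fx: "f x \<in> T" using fS by auto
    note df = Ck_on_Suc_has_derivative[OF Suc.prems(1) x] and dg = Ck_on_Suc_has_derivative[OF Suc.prems(2) fx]
    have "frechet_derivative g (at (f x)) (frechet_derivative f (at x) v) = ?D x v" for v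
      by (rule linear_basis_expansion[OF has_derivative_linear[OF dg]])
    then show "((\<lambda>x. g (f x)) has_derivative ?D x) (at x)" using diff_chain_at[OF df dg] by (simp add: o_def)
  next
    fix v
    show "Ck_on k S (\<lambda>x. ?D x v)"
    proof (intro Ck_on_sum[OF S] Ck_on_scaleR[OF S] Ck_on_inner[OF S])
      show "Ck_on k S (\<lambda>x. frechet_derivative f (at x) v)" by (rule Ck_on_Suc_frechet[OF Suc.prems(1)])
      show "Ck_on k S (\<lambda>x. frechet_derivative g (at (f x)) b)" for b
        by (rule Suc.IH[OF Ck_on_Suc_imp[OF Suc.prems(1)] Ck_on_Suc_frechet[OF Suc.prems(2)]])
    qed
  qed
qed

section \<open>Closure properties of smooth maps\<close>

lemma smooth_on_subset: "smooth_on S f \<Longrightarrow> T \<subseteq> S \<Longrightarrow> smooth_on T f"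
  by (auto simp: smooth_on_def intro: Ck_on_subset)

lemma smooth_on_cong: "open S \<Longrightarrow> (\<And>x. x \<in> S \<Longrightarrow> f x = g x) \<Longrightarrow> smooth_on S f \<Longrightarrow> smooth_on S g"
  unfolding smooth_on_def using Ck_on_cong by blast

lemma smooth_on_local: "(\<And>x. x \<in> S \<Longrightarrow> \<exists>T. open T \<and> x \<in> T \<and> smooth_on T f) \<Longrightarrow> smooth_on S f"
  unfolding smooth_on_def by (intro allI Ck_on_local) blast

lemma smooth_on_const: "smooth_on S (\<lambda>x. c)" by (simp add: smooth_on_def Ck_on_const)

lemma smooth_on_linear: "linear f \<Longrightarrow> smooth_on S f" by (simp add: smooth_on_def Ck_on_linear)

lemma smooth_on_linear_compose: "open S \<Longrightarrow> linear L \<Longrightarrow> smooth_on S f \<Longrightarrow> smooth_on S (\<lambda>x. L (f x))"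
  by (simp add: smooth_on_def Ck_on_linear_compose)

lemma smooth_on_add: "open S \<Longrightarrow> smooth_on S f \<Longrightarrow> smooth_on S g \<Longrightarrow> smooth_on S (\<lambda>x. f x + g x)"
  by (simp add: smooth_on_def Ck_on_add)

lemma smooth_on_sum: "open S \<Longrightarrow> (\<And>i. i \<in> I \<Longrightarrow> smooth_on S (f i)) \<Longrightarrow> smooth_on S (\<lambda>x. \<Sum>i\<in>I. f i x)"
  by (simp add: smooth_on_def Ck_on_sum)

lemma smooth_on_scaleR: "open S \<Longrightarrow> smooth_on S f \<Longrightarrow> smooth_on S g \<Longrightarrow> smooth_on S (\<lambda>x. f x *\<^sub>R g x)"
  by (simp add: smooth_on_def Ck_on_scaleR)

lemma smooth_on_compose:
  "open S \<Longrightarrow> open T \<Longrightarrow> f ` S \<subseteq> T \<Longrightarrow> smooth_on S f \<Longrightarrow> smooth_on T g \<Longrightarrow> smooth_on S (\<lambda>x. g (f x))"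
  unfolding smooth_on_def using Ck_on_compose by blast

lemma smooth_on_Pair:
  fixes f :: "'a::euclidean_space \<Rightarrow> 'b::euclidean_space" and g :: "'a \<Rightarrow> 'c::euclidean_space"
  assumes "open S" "smooth_on S f" "smooth_on S g"
  shows "smooth_on S (\<lambda>x. (f x, g x))"
proof -
  have "linear (\<lambda>y :: 'b. (y, 0 :: 'c))" "linear (\<lambda>y :: 'c. (0 :: 'b, y))" by (auto simp: linear_iff)
  then have "smooth_on S (\<lambda>x. (f x, 0) + (0, g x))"
    using assms by (intro smooth_on_add smooth_on_linear_compose[of S "\<lambda>y. (y, 0)"] smooth_on_linear_compose[of S "\<lambda>y. (0, y)"])
  then show ?thesis by simp
qed

lemma smooth_on_fst: "smooth_on S fst" and smooth_on_snd: "smooth_on S snd"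
  by (auto intro!: smooth_on_linear simp: linear_iff)

lemma smooth_on_id: "smooth_on S (\<lambda>x. x)" by (auto intro!: smooth_on_linear simp: linear_iff)

lemma smooth_on_continuous: "smooth_on S f \<Longrightarrow> continuous_on S f"
  unfolding smooth_on_def using Ck_on.simps(1) by blast

lemma smooth_on_differentiable: "smooth_on S f \<Longrightarrow> x \<in> S \<Longrightarrow> f differentiable (at x)"
  unfolding smooth_on_def using Ck_on.simps(2)[of 0] by blast

lemma smooth_on_has_derivative:
  "smooth_on S f \<Longrightarrow> x \<in> S \<Longrightarrow> (f has_derivative frechet_derivative f (at x)) (at x)"
  using smooth_on_differentiable frechet_derivative_works by blast

lemma smooth_on_frechet: "smooth_on S f \<Longrightarrow> smooth_on S (\<lambda>x. frechet_derivative f (at x) v)"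
  unfolding smooth_on_def using Ck_on.simps(2) by blast

text \<open>A product rule that asks only for continuity of the second factor: since
  \<open>\<phi> x = 0\<close>, the increment of \<open>\<psi>\<close> enters only multiplied by a
  quantity of order \<open>norm (y - x)\<close>. It differentiates the inverse of a family of linear
  maps when nothing but its continuity is known yet.\<close>

lemma has_derivative_scaleR_zero:
  fixes \<phi> :: "'a::euclidean_space \<Rightarrow> real" and \<psi> :: "'a \<Rightarrow> 'b::real_normed_vector"
  assumes \<phi>: "(\<phi> has_derivative \<phi>') (at x)" "\<phi> x = 0" and \<psi>: "isCont \<psi> x"
  shows "((\<lambda>y. \<phi> y *\<^sub>R \<psi> y) has_derivative (\<lambda>h. \<phi>' h *\<^sub>R \<psi> x)) (at x)"
proof -
  obtain B where B: "\<And>h. norm (\<phi>' h) \<le> norm h * B" "0 < B"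
    using bounded_linear.pos_bounded[OF has_derivative_bounded_linear[OF \<phi>(1)]] by auto
  have lim: "((\<lambda>y. (\<phi> y - \<phi> x - \<phi>' (y - x)) /\<^sub>R norm (y - x)) \<longlongrightarrow> 0) (at x)"
    using \<phi>(1) by (simp add: has_derivative_iff_norm has_derivative_at_within has_derivative_def)
  have \<psi>l: "(\<psi> \<longlongrightarrow> \<psi> x) (at x)" using \<psi> by (simp add: isCont_def)
  have "((\<lambda>y. ((\<phi> y - \<phi> x - \<phi>' (y - x)) /\<^sub>R norm (y - x)) *\<^sub>R \<psi> y) \<longlongrightarrow> 0 *\<^sub>R \<psi> x) (at x)"
    by (rule tendsto_scaleR[OF lim \<psi>l])
  moreover have "((\<lambda>y. (\<phi>' (y - x) / norm (y - x)) *\<^sub>R (\<psi> y - \<psi> x)) \<longlongrightarrow> 0) (at x)"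
  proof (rule Lim_null_comparison)
    have "((\<lambda>y. B * norm (\<psi> y - \<psi> x)) \<longlongrightarrow> B * norm (\<psi> x - \<psi> x)) (at x)" by (intro tendsto_intros \<psi>l)
    then show "((\<lambda>y. B * norm (\<psi> y - \<psi> x)) \<longlongrightarrow> 0) (at x)" by simp
    have "norm ((\<phi>' (y - x) / norm (y - x)) *\<^sub>R (\<psi> y - \<psi> x)) \<le> B * norm (\<psi> y - \<psi> x)" for y
    proof -
      have "norm (\<phi>' (y - x) / norm (y - x)) \<le> B"
        using B(1)[of "y - x"] B(2) by (cases "y = x") (auto simp: divide_le_eq mult.commute)
      then have "norm (\<phi>' (y - x) / norm (y - x)) * norm (\<psi> y - \<psi> x) \<le> B * norm (\<psi> y - \<psi> x)"
        by (rule mult_right_mono) simp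
      then show ?thesis by simp
    qed
    then show "\<forall>\<^sub>F y in at x. norm ((\<phi>' (y - x) / norm (y - x)) *\<^sub>R (\<psi> y - \<psi> x)) \<le> B * norm (\<psi> y - \<psi> x)" by simp
  qed
  ultimately have "((\<lambda>y. ((\<phi> y - \<phi> x - \<phi>' (y - x)) /\<^sub>R norm (y - x)) *\<^sub>R \<psi> y + (\<phi>' (y - x) / norm (y - x)) *\<^sub>R (\<psi> y - \<psi> x)) \<longlongrightarrow> 0) (at x)"
    by (auto intro: tendsto_add_zero)
  moreover have "((\<phi> y - \<phi> x - \<phi>' (y - x)) /\<^sub>R norm (y - x)) *\<^sub>R \<psi> y + (\<phi>' (y - x) / norm (y - x)) *\<^sub>R (\<psi> y - \<psi> x)
    = (\<phi> y *\<^sub>R \<psi> y - \<phi> x *\<^sub>R \<psi> x - \<phi>' (y - x) *\<^sub>R \<psi> x) /\<^sub>R norm (y - x)" for y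
    using \<phi>(2) by (simp add: algebra_simps divide_inverse)
  ultimately have "((\<lambda>y. (\<phi> y *\<^sub>R \<psi> y - \<phi> x *\<^sub>R \<psi> x - \<phi>' (y - x) *\<^sub>R \<psi> x) /\<^sub>R norm (y - x)) \<longlongrightarrow> 0) (at x)" by simp
  moreover have "bounded_linear (\<lambda>h. \<phi>' h *\<^sub>R \<psi> x)"
    using has_derivative_bounded_linear[OF \<phi>(1)] by (rule bounded_linear_scaleR_const)
  ultimately show ?thesis by (simp add: has_derivative_def netlimit_at)
qed

section \<open>Inverses of smoothly varying linear maps and the inverse function theorem\<close>

locale pointwise_invertible =
  fixes U :: "'a::euclidean_space set" and A :: "'a \<Rightarrow> 'b::euclidean_space \<Rightarrow> 'b"
  assumes U: "open U" and lin: "x \<in> U \<Longrightarrow> linear (A x)" and bij: "x \<in> U \<Longrightarrow> bij (A x)"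
begin

lemma lin_inv: "x \<in> U \<Longrightarrow> linear (inv_into UNIV (A x))"
  using lin bij bij_is_inj inj_linear_imp_inv_linear by blast

lemma A_inv [simp]: "x \<in> U \<Longrightarrow> A x (inv_into UNIV (A x) v) = v" using bij by (metis bij_inv_eq_iff)
lemma inv_A [simp]: "x \<in> U \<Longrightarrow> inv_into UNIV (A x) (A x v) = v" using bij by (metis bij_inv_eq_iff)

text \<open>The resolvent identity; the dependence of the inverse on the point is read off from
  it.\<close>

lemma inv_diff: "x \<in> U \<Longrightarrow> y \<in> U \<Longrightarrow> inv_into UNIV (A y) v - inv_into UNIV (A x) v = - inv_into UNIV (A y) (A y (inv_into UNIV (A x) v) - A x (inv_into UNIV (A x) v))"
  using linear_diff[OF lin_inv[of y]] by simp

text \<open>A lower bound \<open>m * norm w \<le> norm (A x w)\<close> survives with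
  \<open>m / 2\<close> at nearby points, so the inverses there are bounded by \<open>2 / m\<close>
  and the resolvent identity gives continuity.\<close>

lemma isCont_inv:
  assumes cont: "\<And>v. continuous_on U (\<lambda>x. A x v)" and x: "x \<in> U"
  shows "isCont (\<lambda>y. inv_into UNIV (A y) v) x"
proof -
  obtain m where m: "0 < m" "\<And>w. m * norm w \<le> norm (A x w)"
    using linear_inj_bounded_below_pos[OF lin[OF x] bij_is_inj[OF bij[OF x]]] by (metis mult.commute)
  have c: "isCont (\<lambda>y. A y w) x" for w using cont U x continuous_on_eq_continuous_at by blast
  have lim: "((\<lambda>y. A y w) \<longlongrightarrow> A x w) (at x)" for w using c by (simp add: isCont_def)
  have "((\<lambda>y. \<Sum>b\<in>Basis. norm (A y b - A x b)) \<longlongrightarrow> (\<Sum>b\<in>Basis. norm (A x b - A x b))) (at x)"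
    by (intro tendsto_intros lim)
  then have "\<forall>\<^sub>F y in at x. (\<Sum>b\<in>Basis. norm (A y b - A x b)) < m / 2"
    using m by (intro order_tendstoD) auto
  moreover have "\<forall>\<^sub>F y in at x. y \<in> U" using U x by (rule eventually_at_in_open')
  ultimately have ev: "\<forall>\<^sub>F y in at x. norm (inv_into UNIV (A y) v - inv_into UNIV (A x) v) \<le> 2 / m * norm (A y (inv_into UNIV (A x) v) - A x (inv_into UNIV (A x) v))"
  proof eventually_elim
    case (elim y)
    have low: "m / 2 * norm w \<le> norm (A y w)" for w
    proof -
      have "A y w - A x w = (\<Sum>b\<in>Basis. (w \<bullet> b) *\<^sub>R (A y b - A x b))"
        using linear_basis_expansion[OF lin[OF elim(2)], of w] linear_basis_expansion[OF lin[OF x], of w]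
        by (simp add: sum_subtractf scaleR_diff_right)
      also have "norm \<dots> \<le> (\<Sum>b\<in>Basis. norm w * norm (A y b - A x b))"
        by (rule sum_norm_le) (auto intro!: mult_right_mono Basis_le_norm)
      also have "\<dots> = norm w * (\<Sum>b\<in>Basis. norm (A y b - A x b))" by (simp add: sum_distrib_left)
      also have "\<dots> \<le> norm w * (m / 2)" using elim(1) by (intro mult_left_mono) auto
      finally have "norm (A y w - A x w) \<le> norm w * (m / 2)" .
      moreover have "norm (A x w) \<le> norm (A y w) + norm (A y w - A x w)"
        using norm_triangle_sub[of "A x w" "A y w"] by (simp add: norm_minus_commute)
      ultimately show ?thesis using m(2)[of w] by (simp add: field_simps)
    qed
    show ?case using low[of "inv_into UNIV (A y) (A y (inv_into UNIV (A x) v) - A x (inv_into UNIV (A x) v))"] m(1) elim(2)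
      unfolding inv_diff[OF x elim(2)] by (simp add: field_simps)
  qed
  have "((\<lambda>y. 2 / m * norm (A y (inv_into UNIV (A x) v) - A x (inv_into UNIV (A x) v))) \<longlongrightarrow> 2 / m * norm (A x (inv_into UNIV (A x) v) - A x (inv_into UNIV (A x) v))) (at x)"
    by (intro tendsto_intros lim)
  then have "((\<lambda>y. inv_into UNIV (A y) v - inv_into UNIV (A x) v) \<longlongrightarrow> 0) (at x)"
    by (intro Lim_null_comparison[OF ev]) simp
  then show ?thesis by (simp add: isCont_def LIM_zero_iff)
qed

lemma Ck_on_inv: "(\<And>v. Ck_on k U (\<lambda>x. A x v)) \<Longrightarrow> Ck_on k U (\<lambda>x. inv_into UNIV (A x) v)"
proof (induction k arbitrary: v)
  case 0
  then have "isCont (\<lambda>y. inv_into UNIV (A y) v) x" if "x \<in> U" for x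
    using that by (intro isCont_inv) auto
  then show ?case unfolding Ck_on.simps by (intro continuous_at_imp_continuous_on ballI)
next
  case (Suc k)
  have Ck: "Ck_on k U (\<lambda>x. A x v)" for v using Suc.prems by (rule Ck_on_Suc_imp)
  have cont: "continuous_on U (\<lambda>x. A x v)" for v
    using Suc.prems[of v] by (intro continuous_at_imp_continuous_on ballI) (auto intro: differentiable_imp_continuous_within)
  let ?D = "\<lambda>x b. frechet_derivative (\<lambda>x. A x b) (at x)"
  \<comment> \<open>In coordinates: minus the inverse, after the derivative of \<open>A\<close>,
    after the inverse.\<close>
  let ?G = "\<lambda>x u. - (\<Sum>b\<in>Basis. \<Sum>c\<in>Basis. ((inv_into UNIV (A x) v \<bullet> b) * (?D x b u \<bullet> c)) *\<^sub>R inv_into UNIV (A x) c)"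
  have d: "((\<lambda>x. inv_into UNIV (A x) v) has_derivative ?G x) (at x)" if x: "x \<in> U" for x
  proof -
    define h where "h = inv_into UNIV (A x) v"
    have dA: "((\<lambda>y. A y b) has_derivative ?D x b) (at x)" for b
      using Suc.prems x by (auto simp: frechet_derivative_works[symmetric])
    have dw: "((\<lambda>y. (A y b - A x b) \<bullet> c) has_derivative (\<lambda>u. ?D x b u \<bullet> c)) (at x)" for b c
      by (auto intro!: derivative_eq_intros dA)
    have eq: "inv_into UNIV (A x) v - (\<Sum>b\<in>Basis. (h \<bullet> b) *\<^sub>R (\<Sum>c\<in>Basis. ((A y b - A x b) \<bullet> c) *\<^sub>R inv_into UNIV (A y) c)) = inv_into UNIV (A y) v" if y: "y \<in> U" for y
    proof -
      have "(\<Sum>b\<in>Basis. (h \<bullet> b) *\<^sub>R (\<Sum>c\<in>Basis. ((A y b - A x b) \<bullet> c) *\<^sub>R inv_into UNIV (A y) c)) = (\<Sum>b\<in>Basis. (h \<bullet> b) *\<^sub>R inv_into UNIV (A y) (A y b - A x b))"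
        by (simp only: linear_basis_expansion[OF lin_inv[OF y], symmetric])
      also have "\<dots> = inv_into UNIV (A y) (\<Sum>b\<in>Basis. (h \<bullet> b) *\<^sub>R (A y b - A x b))"
        using lin_inv[OF y] by (simp add: linear_sum linear_scale)
      also have "(\<Sum>b\<in>Basis. (h \<bullet> b) *\<^sub>R (A y b - A x b)) = A y h - A x h"
        using linear_basis_expansion[OF lin[OF y], of h] linear_basis_expansion[OF lin[OF x], of h]
        by (simp add: sum_subtractf scaleR_diff_right)
      finally show ?thesis using inv_diff[OF x y, of v] by (simp add: h_def algebra_simps)
    qed
    \<comment> \<open>The coefficient \<open>A y b - A x b\<close> vanishes at \<open>y = x\<close>,
      so continuity of the inverse suffices to differentiate this product.\<close>
    have "((\<lambda>y. ((A y b - A x b) \<bullet> c) *\<^sub>R inv_into UNIV (A y) c) has_derivative (\<lambda>u. (?D x b u \<bullet> c) *\<^sub>R inv_into UNIV (A x) c)) (at x)" for b c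
      by (rule has_derivative_scaleR_zero[OF dw _ isCont_inv[OF cont x]]) simp
    then have "((\<lambda>y. inv_into UNIV (A x) v - (\<Sum>b\<in>Basis. (h \<bullet> b) *\<^sub>R (\<Sum>c\<in>Basis. ((A y b - A x b) \<bullet> c) *\<^sub>R inv_into UNIV (A y) c)))
      has_derivative (\<lambda>u. 0 - (\<Sum>b\<in>Basis. (h \<bullet> b) *\<^sub>R (\<Sum>c\<in>Basis. (?D x b u \<bullet> c) *\<^sub>R inv_into UNIV (A x) c)))) (at x)"
      by (intro has_derivative_diff has_derivative_const has_derivative_sum has_derivative_scaleR_right)
    from has_derivative_transform_within_open[OF this U x eq]
    have "((\<lambda>y. inv_into UNIV (A y) v) has_derivative (\<lambda>u. 0 - (\<Sum>b\<in>Basis. (h \<bullet> b) *\<^sub>R (\<Sum>c\<in>Basis. (?D x b u \<bullet> c) *\<^sub>R inv_into UNIV (A x) c)))) (at x)"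
      .
    then show ?thesis by (simp add: h_def scaleR_sum_right)
  qed
  show ?case
  proof (rule Ck_on_SucI[OF U d])
    fix u
    have *: "Ck_on k U (\<lambda>x. (inv_into UNIV (A x) v \<bullet> b) *\<^sub>R (?D x b u \<bullet> c))" for b c
      by (intro Ck_on_scaleR[OF U] Ck_on_inner[OF U] Suc.IH[OF Ck] Ck_on_Suc_frechet[OF Suc.prems])
    have "Ck_on k U (\<lambda>x. \<Sum>b\<in>Basis. \<Sum>c\<in>Basis. ((inv_into UNIV (A x) v \<bullet> b) *\<^sub>R (?D x b u \<bullet> c)) *\<^sub>R inv_into UNIV (A x) c)"
      by (intro Ck_on_sum[OF U] Ck_on_scaleR[OF U * Suc.IH[OF Ck]])
    from Ck_on_linear_compose[OF U _ this, of uminus]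
    show "Ck_on k U (\<lambda>x. ?G x u)" by (simp add: linear_iff)
  qed
qed

end

text \<open>The classical theorem gives a differentiable inverse \<open>g\<close> with
  \<open>Dg(y)\<close> the inverse of \<open>Df(g y)\<close>. Since inversion preserves the order of
  smoothness, this formula raises the order of \<open>g\<close> from \<open>k\<close> to
  \<open>k + 1\<close>, indefinitely.\<close>

theorem smooth_inverse_function:
  fixes f :: "'a::euclidean_space \<Rightarrow> 'a"
  assumes S: "open S" and f: "smooth_on S f" and x0: "x0 \<in> S" and D: "(f has_derivative D) (at x0)" "bij D"
  obtains U V g where "open U" "U \<subseteq> S" "x0 \<in> U" "open V" "homeomorphism U V f g" "smooth_on V g"
proof -
  define f' where "f' x = Blinfun (frechet_derivative f (at x))" for x
  have der: "(f has_derivative frechet_derivative f (at x)) (at x)" if "x \<in> S" for x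
    using smooth_on_has_derivative[OF f that] .
  have f': "blinfun_apply (f' x) = frechet_derivative f (at x)" if "x \<in> S" for x
    unfolding f'_def by (rule bounded_linear_Blinfun_apply[OF has_derivative_bounded_linear[OF der[OF that]]])
  have contf: "continuous_on S f'"
  proof (rule continuous_on_blinfun_componentwise)
    fix i :: 'a
    have "continuous_on S (\<lambda>x. frechet_derivative f (at x) i)"
      by (rule smooth_on_continuous[OF smooth_on_frechet[OF f]])
    then show "continuous_on S (\<lambda>x. blinfun_apply (f' x) i)" by (simp add: f' cong: continuous_on_cong)
  qed
  have Deq: "frechet_derivative f (at x0) = D" using frechet_derivative_at[OF D(1)] by simp
  have linD: "linear D" using D(1) by (rule has_derivative_linear)
  have linI: "bounded_linear (inv_into UNIV D)"
    using inj_linear_imp_inv_linear[OF linD bij_is_inj[OF D(2)]] by (simp add: linear_conv_bounded_linear)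
  have ie: "Blinfun (inv_into UNIV D) o\<^sub>L f' x0 = id_blinfun"
    by (rule blinfun_eqI) (simp add: bounded_linear_Blinfun_apply[OF linI] f'[OF x0] Deq bij_is_inj[OF D(2)])
  have der': "(f has_derivative blinfun_apply (f' x)) (at x)" if "x \<in> S" for x
    unfolding f'[OF that] by (rule der[OF that])
  obtain U V g g' where UV: "open U" "U \<subseteq> S" "x0 \<in> U" "open V" "homeomorphism U V f g"
    and g: "\<And>y. y \<in> V \<Longrightarrow> (g has_derivative g' y) (at y)"
    "\<And>y. y \<in> V \<Longrightarrow> g' y = inv_into UNIV (blinfun_apply (f' (g y)))" "\<And>y. y \<in> V \<Longrightarrow> bij (blinfun_apply (f' (g y)))"
    by (rule inverse_function_theorem[OF S der' contf x0 ie]) blast+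
  have gV: "g ` V = U" and fU: "f ` U = V" and gf: "\<And>x. x \<in> U \<Longrightarrow> g (f x) = x" using UV(5) by (auto simp: homeomorphism_def)
  interpret A: pointwise_invertible U "\<lambda>x. frechet_derivative f (at x)"
  proof (rule pointwise_invertible.intro)
    show "open U" by fact
    fix x assume x: "x \<in> U"
    then have xS: "x \<in> S" using UV(2) by auto
    show "linear (frechet_derivative f (at x))" by (rule has_derivative_linear[OF der[OF xS]])
    have "f x \<in> V" using x fU by auto
    from g(3)[OF this] show "bij (frechet_derivative f (at x))" unfolding gf[OF x] f'[OF xS] .
  qed
  have "Ck_on k V g" for k
  proof (induction k)
    case 0
    show ?case using UV(5) by (simp add: homeomorphism_def)
  next
    case (Suc k)
    have gfr: "g' y = inv_into UNIV (frechet_derivative f (at (g y)))" if "y \<in> V" for y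
    proof -
      have "g y \<in> S" using that gV UV(2) by auto
      then show ?thesis using g(2)[OF that] f' by simp
    qed
    have "Ck_on k U (\<lambda>x. frechet_derivative f (at x) v)" for v
      using smooth_on_subset[OF smooth_on_frechet[OF f] UV(2)] unfolding smooth_on_def by blast
    then have Ci: "Ck_on k U (\<lambda>x. inv_into UNIV (frechet_derivative f (at x)) v)" for v by (rule A.Ck_on_inv)
    have "Ck_on k V (\<lambda>y. inv_into UNIV (frechet_derivative f (at (g y))) v)" for v
      using Ck_on_compose[OF UV(4,1) _ Suc Ci] gV by simp
    then have Cg: "Ck_on k V (\<lambda>y. g' y v)" for v
      by (rule Ck_on_cong[OF UV(4), rotated]) (simp add: gfr)
    show ?case by (rule Ck_on_SucI[OF UV(4) g(1) Cg])
  qed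
  then have "smooth_on V g" by (simp add: smooth_on_def)
  with UV show thesis by (intro that)
qed

section \<open>A smooth bump function\<close>

definition flat_exp :: "nat \<Rightarrow> real \<Rightarrow> real" where
  "flat_exp n t = (if t \<le> 0 then 0 else (1 / t) ^ n * exp (- (1 / t)))"

lemma flat_exp_tendsto: "(flat_exp n \<longlongrightarrow> 0) (at 0)"
proof -
  have "((\<lambda>y::real. y ^ n / exp y) \<longlongrightarrow> 0) at_top" by (rule tendsto_power_div_exp_0)
  then have "((\<lambda>t::real. (1 / t) ^ n / exp (1 / t)) \<longlongrightarrow> 0) (at_right 0)"
    by (rule filterlim_compose) (simp add: divide_inverse filterlim_inverse_at_top_right)
  then have "(flat_exp n \<longlongrightarrow> 0) (at_right 0)"
    by (rule Lim_transform_eventually)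
      (auto simp: eventually_at_right_less flat_exp_def exp_minus divide_inverse intro!: eventually_at_rightI[of 0 1])
  moreover have "(flat_exp n \<longlongrightarrow> 0) (at_left 0)"
    by (rule Lim_transform_eventually[OF tendsto_const])
      (auto simp: flat_exp_def intro!: eventually_at_leftI[of "-1" 0])
  ultimately show ?thesis by (simp add: filterlim_split_at)
qed

text \<open>Derivatives of members of the family are combinations of later members. This is why the
  power \<open>(1 / t) ^ n\<close> is carried along: one induction covers all derivatives.\<close>

lemma flat_exp_deriv:
  "(flat_exp n has_real_derivative (flat_exp (Suc (Suc n)) t - real n * flat_exp (Suc n) t)) (at t)"
proof (cases t "0::real" rule: linorder_cases)
  case less
  have "((\<lambda>t. 0) has_real_derivative 0) (at t)" by simp
  then have "(flat_exp n has_real_derivative 0) (at t)"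
    by (rule has_field_derivative_transform_within_open[where S = "{..<0}"]) (use less in \<open>auto simp: flat_exp_def\<close>)
  then show ?thesis using less by (simp add: flat_exp_def)
next
  case equal
  \<comment> \<open>At 0 the difference quotient is \<open>flat_exp (Suc n)\<close>, which tends to
    0 as well.\<close>
  have "((\<lambda>h. (flat_exp n (0 + h) - flat_exp n 0) / h) \<longlongrightarrow> 0) (at 0)"
  proof (rule Lim_transform_eventually[OF flat_exp_tendsto[of "Suc n"]])
    show "\<forall>\<^sub>F h in at 0. flat_exp (Suc n) h = (flat_exp n (0 + h) - flat_exp n 0) / h"
      by (rule eventually_at_filter[THEN iffD2], rule always_eventually) (auto simp: flat_exp_def)
  qed
  then have "(flat_exp n has_real_derivative 0) (at 0)" by (simp add: DERIV_def)
  then show ?thesis using equal by (simp add: flat_exp_def)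
next
  case greater
  have "((\<lambda>y. y ^ n * exp (- y)) has_real_derivative (real n * y ^ (n - 1) * exp (- y) - y ^ n * exp (- y))) (at y)" for y :: real
    by (auto intro!: derivative_eq_intros)
  moreover have "((\<lambda>t. 1 / t) has_real_derivative (- ((1 / t)\<^sup>2))) (at t)"
    using greater by (auto intro!: derivative_eq_intros simp: power2_eq_square)
  ultimately have "((\<lambda>t. (1 / t) ^ n * exp (- (1 / t))) has_real_derivative
      (real n * (1 / t) ^ (n - 1) * exp (- (1 / t)) - (1 / t) ^ n * exp (- (1 / t))) * (- ((1 / t)\<^sup>2))) (at t)"
    by (rule DERIV_chain2)
  then have "(flat_exp n has_real_derivative
      (real n * (1 / t) ^ (n - 1) * exp (- (1 / t)) - (1 / t) ^ n * exp (- (1 / t))) * (- ((1 / t)\<^sup>2))) (at t)"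
    by (rule has_field_derivative_transform_within_open[where S = "{0<..}"]) (use greater in \<open>auto simp: flat_exp_def\<close>)
  moreover have "(real n * (1 / t) ^ (n - 1) * exp (- (1 / t)) - (1 / t) ^ n * exp (- (1 / t))) * (- ((1 / t)\<^sup>2))
      = flat_exp (Suc (Suc n)) t - real n * flat_exp (Suc n) t"
  proof -
    have "(real n * y ^ (n - 1) * e - y ^ n * e) * (- (y\<^sup>2)) = y ^ Suc (Suc n) * e - real n * (y ^ Suc n * e)" for y e :: real
      by (cases n) (simp_all add: algebra_simps power2_eq_square)
    then show ?thesis using greater by (simp only: flat_exp_def not_le[symmetric] if_False)
  qed
  ultimately show ?thesis by simp
qed

lemma smooth_flat_exp: "smooth_on UNIV (flat_exp n)"
proof -
  have "Ck_on k UNIV (flat_exp n)" for k n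
  proof (induction k arbitrary: n)
    case 0
    have "isCont (flat_exp n) t" for t using DERIV_isCont[OF flat_exp_deriv] .
    then show ?case by (simp add: continuous_at_imp_continuous_on)
  next
    case (Suc k)
    let ?D = "\<lambda>t. flat_exp (Suc (Suc n)) t - real n * flat_exp (Suc n) t"
    show ?case
    proof (rule Ck_on_SucI[OF open_UNIV])
      show "(flat_exp n has_derivative (\<lambda>v. ?D t * v)) (at t)" for t
        using flat_exp_deriv by (simp add: has_field_derivative_def)
      have "Ck_on k UNIV (\<lambda>t. v *\<^sub>R (flat_exp (Suc (Suc n)) t + (- real n) *\<^sub>R flat_exp (Suc n) t))" for v
        by (intro Ck_on_scaleR Ck_on_add Ck_on_const Suc open_UNIV)
      then show "Ck_on k UNIV (\<lambda>t. ?D t * v)" for v by (simp add: mult.commute)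
    qed
  qed
  then show ?thesis by (simp add: smooth_on_def)
qed

lemma smooth_bump:
  "\<exists>u :: 'a::euclidean_space \<Rightarrow> real. smooth_on UNIV u \<and> bounded {x. u x \<noteq> 0} \<and> u 0 \<noteq> 0"
proof (intro exI conjI)
  \<comment> \<open>The profile is \<open>exp (- 1 / (1 - |x|^2))\<close> inside the unit ball. The
    square of the norm is written out in coordinates so that the closure properties of
    \<open>smooth_on\<close> apply.\<close>
  let ?u = "\<lambda>x::'a. flat_exp 0 (1 + (-1) *\<^sub>R (\<Sum>b\<in>Basis. (x \<bullet> b) *\<^sub>R (x \<bullet> b)))"
  have "smooth_on UNIV (\<lambda>x::'a. x \<bullet> b)" for b by (rule smooth_on_linear) (auto simp: linear_iff inner_add_left)
  then show "smooth_on UNIV ?u"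
    by (intro smooth_on_compose[OF _ _ _ _ smooth_flat_exp] smooth_on_add smooth_on_scaleR smooth_on_sum smooth_on_const) auto
  have "(\<Sum>b\<in>Basis. (x \<bullet> b) *\<^sub>R (x \<bullet> b)) = (norm x)\<^sup>2" for x :: 'a
    by (simp add: power2_norm_eq_inner euclidean_inner[of x x])
  then have "{x. ?u x \<noteq> 0} \<subseteq> cball 0 1"
    by (auto simp: flat_exp_def not_le abs_square_less_1)
  then show "bounded {x. ?u x \<noteq> 0}" using bounded_cball bounded_subset by blast
  show "?u 0 \<noteq> 0" by (simp add: flat_exp_def)
qed

section \<open>The fractional Sobolev inequality and local compactness\<close>

lemma young_threshold:
  fixes a t p :: real
  assumes "0 \<le> a" "0 < t" "1 \<le> p"
  shows "a \<le> t + t powr (1 - p) * a powr p"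
proof (cases "a \<le> t")
  case True
  then show ?thesis by (meson add_increasing2 assms(2) mult_nonneg_nonneg powr_ge_zero)
next
  case False
  then have "a powr (1 - p) \<le> t powr (1 - p)"
    using assms by (intro powr_mono2') auto
  then have "a powr (1 - p) * a powr p \<le> t powr (1 - p) * a powr p"
    by (rule mult_right_mono) auto
  moreover have "a powr (1 - p) * a powr p = a"
    using False assms by (simp flip: powr_add)
  ultimately show ?thesis using assms by linarith
qed

text \<open>Stands in for Hoelder's inequality: the threshold \<open>t\<close> is free, and
  optimising it recovers the usual power of the measure of \<open>A\<close>, while a large
  \<open>t\<close> makes the second term small.\<close>

lemma nn_integral_abs_le_threshold:
  fixes u :: "'b \<Rightarrow> real"
  assumes [measurable]: "u \<in> borel_measurable M" "A \<in> sets M" and t: "0 < t" and p: "1 \<le> p"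
  shows "(\<integral>\<^sup>+x. ennreal \<bar>u x\<bar> * indicator A x \<partial>M)
    \<le> ennreal t * emeasure M A + ennreal (t powr (1 - p)) * (\<integral>\<^sup>+x. ennreal (\<bar>u x\<bar> powr p) \<partial>M)"
proof -
  have "(\<integral>\<^sup>+x. ennreal \<bar>u x\<bar> * indicator A x \<partial>M)
      \<le> (\<integral>\<^sup>+x. ennreal t * indicator A x + ennreal (t powr (1 - p)) * ennreal (\<bar>u x\<bar> powr p) \<partial>M)"
  proof (rule nn_integral_mono)
    fix x
    have "ennreal \<bar>u x\<bar> \<le> ennreal t + ennreal (t powr (1 - p)) * ennreal (\<bar>u x\<bar> powr p)"
      using young_threshold[of "\<bar>u x\<bar>" t p] t p
      by (simp flip: ennreal_mult ennreal_plus)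
    then show "ennreal \<bar>u x\<bar> * indicator A x
        \<le> ennreal t * indicator A x + ennreal (t powr (1 - p)) * ennreal (\<bar>u x\<bar> powr p)"
      by (auto simp: indicator_def)
  qed
  also have "\<dots> = ennreal t * emeasure M A + ennreal (t powr (1 - p)) * (\<integral>\<^sup>+x. ennreal (\<bar>u x\<bar> powr p) \<partial>M)"
    by (simp add: nn_integral_add nn_integral_cmult)
  finally show ?thesis .
qed

text \<open>If \<open>b\<close> is small relative to \<open>a\<close>, continuity of
  \<open>|1 + t| powr p\<close> at 0 gives the first term; otherwise \<open>a\<close> is bounded by
  a multiple of \<open>b\<close> and everything goes into the second.\<close>

lemma powr_diff_small:
  fixes p e :: real
  assumes p: "0 < p" and e: "0 < e"
  obtains C where "0 \<le> C"
    "\<And>a b :: real. \<bar>\<bar>a + b\<bar> powr p - \<bar>a\<bar> powr p\<bar> \<le> e * \<bar>a\<bar> powr p + C * \<bar>b\<bar> powr p"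
proof -
  have "((\<lambda>t. \<bar>\<bar>1 + t\<bar> powr p - 1\<bar>) \<longlongrightarrow> \<bar>\<bar>1 + 0\<bar> powr p - 1\<bar>) (at 0)"
    using p by (intro tendsto_intros) auto
  then have "\<forall>\<^sub>F t in at 0. \<bar>\<bar>1 + t\<bar> powr p - 1\<bar> < e" using e by (intro order_tendstoD) auto
  then obtain \<delta> where \<delta>: "0 < \<delta>" "\<And>t. t \<noteq> 0 \<Longrightarrow> \<bar>t\<bar> < \<delta> \<Longrightarrow> \<bar>\<bar>1 + t\<bar> powr p - 1\<bar> < e"
    unfolding eventually_at by (auto simp: dist_real_def)
  \<comment> \<open>For \<open>|a| \<le> |b| / \<delta>\<close> the two summands bound
    \<open>|a + b| powr p\<close> and \<open>|a| powr p\<close>.\<close>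
  define C where "C = (1 / \<delta> + 1) powr p + (1 / \<delta>) powr p"
  show thesis
  proof (rule that[of C])
    show "0 \<le> C" by (simp add: C_def)
    fix a b :: real
    show "\<bar>\<bar>a + b\<bar> powr p - \<bar>a\<bar> powr p\<bar> \<le> e * \<bar>a\<bar> powr p + C * \<bar>b\<bar> powr p"
    proof (cases "\<bar>b\<bar> < \<delta> * \<bar>a\<bar>")
      case True
      then have a: "a \<noteq> 0" by auto
      define t where "t = b / a"
      have t: "\<bar>t\<bar> < \<delta>" using True a by (simp add: t_def abs_divide pos_divide_less_eq)
      have "\<bar>\<bar>1 + t\<bar> powr p - 1\<bar> \<le> e" using \<delta>(2)[of t] t e by (cases "t = 0") auto
      then have "\<bar>a\<bar> powr p * \<bar>\<bar>1 + t\<bar> powr p - 1\<bar> \<le> \<bar>a\<bar> powr p * e" by (intro mult_left_mono) auto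
      also have "\<bar>a\<bar> powr p * \<bar>\<bar>1 + t\<bar> powr p - 1\<bar> = \<bar>\<bar>a * (1 + t)\<bar> powr p - \<bar>a\<bar> powr p\<bar>"
      proof -
        have "\<bar>a * (1 + t)\<bar> powr p - \<bar>a\<bar> powr p = \<bar>a\<bar> powr p * (\<bar>1 + t\<bar> powr p - 1)"
          by (simp only: abs_mult powr_mult abs_ge_zero right_diff_distrib mult_1_right)
        then show ?thesis by (simp only: abs_mult abs_of_nonneg[OF powr_ge_zero])
      qed
      also have "a * (1 + t) = a + b" using a by (simp add: t_def distrib_left)
      finally show ?thesis using \<open>0 \<le> C\<close> by (simp add: mult.commute add_increasing2)
    next
      case False
      then have ab: "\<bar>a\<bar> \<le> 1 / \<delta> * \<bar>b\<bar>" using \<delta>(1) by (simp add: field_simps)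
      then have "\<bar>a + b\<bar> \<le> (1 / \<delta> + 1) * \<bar>b\<bar>" by (simp add: distrib_right)
      then have "\<bar>a + b\<bar> powr p \<le> ((1 / \<delta> + 1) * \<bar>b\<bar>) powr p" using p by (intro powr_mono2) auto
      moreover have "\<bar>a\<bar> powr p \<le> (1 / \<delta> * \<bar>b\<bar>) powr p" using p ab by (intro powr_mono2) auto
      ultimately have "\<bar>a + b\<bar> powr p + \<bar>a\<bar> powr p \<le> C * \<bar>b\<bar> powr p"
        unfolding C_def distrib_right[of "(1 / \<delta> + 1) powr p"] powr_mult by linarith
      moreover have "\<bar>\<bar>a + b\<bar> powr p - \<bar>a\<bar> powr p\<bar> \<le> \<bar>a + b\<bar> powr p + \<bar>a\<bar> powr p"
        by (rule abs_leI) (auto simp: add_increasing add_increasing2)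
      ultimately show ?thesis using e by (smt (verit) mult_nonneg_nonneg powr_ge_zero)
    qed
  qed
qed

lemma powr_add_le:
  fixes a b p :: real assumes "0 < p"
  shows "\<bar>a - b\<bar> powr p \<le> 2 powr p * (\<bar>a\<bar> powr p + \<bar>b\<bar> powr p)"
proof -
  have "\<bar>a - b\<bar> powr p \<le> (2 * max \<bar>a\<bar> \<bar>b\<bar>) powr p" using assms by (intro powr_mono2) auto
  also have "\<dots> = 2 powr p * (max \<bar>a\<bar> \<bar>b\<bar>) powr p" by (simp add: powr_mult)
  also have "(max \<bar>a\<bar> \<bar>b\<bar>) powr p \<le> \<bar>a\<bar> powr p + \<bar>b\<bar> powr p" by (auto simp: max_def)
  finally show ?thesis by (simp add: mult_left_mono)
qed

text \<open>The defect \<open>h\<close> is bounded by a small multiple of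
  \<open>|f k - g| powr p\<close> plus a multiple of the integrable function
  \<open>|g| powr p\<close>. The excess \<open>w\<close> over the small multiple tends to 0 in the
  mean by dominated convergence, and the small multiple has bounded integral.\<close>

theorem brezis_lieb:
  fixes f :: "nat \<Rightarrow> 'b \<Rightarrow> real" and p :: real
  assumes meas [measurable]: "\<And>k. f k \<in> borel_measurable M" "g \<in> borel_measurable M" and p: "0 < p"
    and bd: "\<And>k. (\<integral>\<^sup>+x. ennreal (\<bar>f k x\<bar> powr p) \<partial>M) \<le> ennreal A"
    and lim: "AE x in M. (\<lambda>k. f k x) \<longlonglongrightarrow> g x"
  shows "(\<lambda>k. (\<integral>x. \<bar>f k x\<bar> powr p \<partial>M) - (\<integral>x. \<bar>f k x - g x\<bar> powr p \<partial>M)) \<longlonglongrightarrow> (\<integral>x. \<bar>g x\<bar> powr p \<partial>M)"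
    and "integrable M (\<lambda>x. \<bar>f k x\<bar> powr p)" "integrable M (\<lambda>x. \<bar>f k x - g x\<bar> powr p)"
    "integrable M (\<lambda>x. \<bar>g x\<bar> powr p)"
proof -
  define A' where "A' = max A 0"
  have bd': "(\<integral>\<^sup>+x. ennreal (\<bar>f k x\<bar> powr p) \<partial>M) \<le> ennreal A'" for k
    using bd[of k] by (auto simp: A'_def max_def ennreal_neg)
  have A': "0 \<le> A'" by (simp add: A'_def)
  show if_: "integrable M (\<lambda>x. \<bar>f k x\<bar> powr p)" for k
    by (rule integrableI_bounded) (use bd[of k] in \<open>auto simp: order_le_less_trans[OF _ ennreal_less_top]\<close>)
  have "(\<integral>\<^sup>+x. ennreal (\<bar>g x\<bar> powr p) \<partial>M) \<le> (\<integral>\<^sup>+x. liminf (\<lambda>k. ennreal (\<bar>f k x\<bar> powr p)) \<partial>M)"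
  proof (rule nn_integral_mono_AE, use lim in eventually_elim)
    fix x assume "(\<lambda>k. f k x) \<longlonglongrightarrow> g x"
    then have "(\<lambda>k. ennreal (\<bar>f k x\<bar> powr p)) \<longlonglongrightarrow> ennreal (\<bar>g x\<bar> powr p)"
      using p by (intro tendsto_ennrealI tendsto_powr2 tendsto_intros) auto
    from lim_imp_Liminf[OF trivial_limit_sequentially this]
    show "ennreal (\<bar>g x\<bar> powr p) \<le> liminf (\<lambda>k. ennreal (\<bar>f k x\<bar> powr p))" by simp
  qed
  also have "\<dots> \<le> liminf (\<lambda>k. \<integral>\<^sup>+x. ennreal (\<bar>f k x\<bar> powr p) \<partial>M)" by (rule nn_integral_liminf) simp
  also have "\<dots> \<le> liminf (\<lambda>k. ennreal A')" by (intro Liminf_mono always_eventually allI bd')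
  finally have gbd: "(\<integral>\<^sup>+x. ennreal (\<bar>g x\<bar> powr p) \<partial>M) \<le> ennreal A'" by (simp add: Liminf_const)
  then show ig: "integrable M (\<lambda>x. \<bar>g x\<bar> powr p)"
    by (intro integrableI_bounded) (auto simp: order_le_less_trans[OF _ ennreal_less_top])
  show id: "integrable M (\<lambda>x. \<bar>f k x - g x\<bar> powr p)" for k
  proof (rule Bochner_Integration.integrable_bound)
    show "integrable M (\<lambda>x. 2 powr p * (\<bar>f k x\<bar> powr p + \<bar>g x\<bar> powr p))" using if_ ig by simp
    show "AE x in M. norm (\<bar>f k x - g x\<bar> powr p) \<le> norm (2 powr p * (\<bar>f k x\<bar> powr p + \<bar>g x\<bar> powr p))"
      using powr_add_le[OF p] by simp
  qed measurable
  have le: "(\<integral>x. \<bar>f k x\<bar> powr p \<partial>M) \<le> A'" for k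
    using bd'[of k] A' by (subst integral_eq_nn_integral) (auto simp: enn2real_leI)
  have gle: "(\<integral>x. \<bar>g x\<bar> powr p \<partial>M) \<le> A'"
    using gbd A' by (subst integral_eq_nn_integral) (auto simp: enn2real_leI)
  define B where "B = 2 powr p * (2 * A')"
  have B: "0 \<le> B" using A' by (simp add: B_def)
  have dle: "(\<integral>x. \<bar>f k x - g x\<bar> powr p \<partial>M) \<le> B" for k
  proof -
    have "(\<integral>x. \<bar>f k x - g x\<bar> powr p \<partial>M) \<le> (\<integral>x. 2 powr p * (\<bar>f k x\<bar> powr p + \<bar>g x\<bar> powr p) \<partial>M)"
      using powr_add_le[OF p] if_ ig id by (intro integral_mono) auto
    also have "\<dots> = 2 powr p * ((\<integral>x. \<bar>f k x\<bar> powr p \<partial>M) + (\<integral>x. \<bar>g x\<bar> powr p \<partial>M))"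
      using if_ ig by simp
    also have "\<dots> \<le> B" unfolding B_def using le[of k] gle by (intro mult_left_mono) auto
    finally show ?thesis .
  qed
  define h where "h k x = \<bar>f k x\<bar> powr p - \<bar>f k x - g x\<bar> powr p - \<bar>g x\<bar> powr p" for k x
  have ih: "integrable M (h k)" for k unfolding h_def using if_ ig id by simp
  have "(\<lambda>k. \<integral>x. h k x \<partial>M) \<longlonglongrightarrow> 0"
  proof (rule tendstoI)
    fix \<epsilon> :: real assume \<epsilon>: "0 < \<epsilon>"
    \<comment> \<open>\<open>B\<close> bounds the integrals of \<open>|f k - g| powr p\<close>, so
      with this choice they contribute at most \<open>\<epsilon> / 2\<close>.\<close>
    define e where "e = \<epsilon> / (2 * (B + 1))"
    have e: "0 < e" using \<epsilon> B by (simp add: e_def)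
    obtain C where C: "0 \<le> C"
      "\<And>a b :: real. \<bar>\<bar>a + b\<bar> powr p - \<bar>a\<bar> powr p\<bar> \<le> e * \<bar>a\<bar> powr p + C * \<bar>b\<bar> powr p"
      using powr_diff_small[OF p e] by blast
    define w where "w k x = max 0 (\<bar>h k x\<bar> - e * \<bar>f k x - g x\<bar> powr p)" for k x
    have [measurable]: "w k \<in> borel_measurable M" for k unfolding w_def h_def by measurable
    have wb: "\<bar>w k x\<bar> \<le> (C + 1) * \<bar>g x\<bar> powr p" for k x
    proof -
      have "\<bar>\<bar>(f k x - g x) + g x\<bar> powr p - \<bar>f k x - g x\<bar> powr p\<bar> \<le> e * \<bar>f k x - g x\<bar> powr p + C * \<bar>g x\<bar> powr p"
        by (rule C(2))
      then have "\<bar>h k x\<bar> \<le> e * \<bar>f k x - g x\<bar> powr p + C * \<bar>g x\<bar> powr p + \<bar>g x\<bar> powr p"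
        unfolding h_def using abs_triangle_ineq4[of "\<bar>f k x\<bar> powr p - \<bar>f k x - g x\<bar> powr p" "\<bar>g x\<bar> powr p"] by simp
      then show ?thesis unfolding w_def using C(1) by (auto simp: distrib_right max_def)
    qed
    have "(\<lambda>k. \<integral>x. w k x \<partial>M) \<longlonglongrightarrow> (\<integral>x. 0 \<partial>M)"
    proof (rule integral_dominated_convergence[where w = "\<lambda>x. (C + 1) * \<bar>g x\<bar> powr p"])
      show "AE x in M. (\<lambda>k. w k x) \<longlonglongrightarrow> 0"
        using lim
      proof eventually_elim
        case (elim x)
        have "(\<lambda>k. max 0 (\<bar>\<bar>f k x\<bar> powr p - \<bar>f k x - g x\<bar> powr p - \<bar>g x\<bar> powr p\<bar> - e * \<bar>f k x - g x\<bar> powr p))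
          \<longlonglongrightarrow> max 0 (\<bar>\<bar>g x\<bar> powr p - \<bar>g x - g x\<bar> powr p - \<bar>g x\<bar> powr p\<bar> - e * \<bar>g x - g x\<bar> powr p)"
          using elim p by (intro tendsto_intros tendsto_powr2) auto
        then show ?case unfolding w_def h_def by simp
      qed
    qed (use wb ig in auto)
    then have "(\<lambda>k. \<integral>x. w k x \<partial>M) \<longlonglongrightarrow> 0" by simp
    then have "\<forall>\<^sub>F k in sequentially. (\<integral>x. w k x \<partial>M) < \<epsilon> / 2" using \<epsilon> by (intro order_tendstoD) auto
    then show "\<forall>\<^sub>F k in sequentially. dist (\<integral>x. h k x \<partial>M) 0 < \<epsilon>"
    proof eventually_elim
      case (elim k)
      have iw: "integrable M (w k)"
        by (rule Bochner_Integration.integrable_bound[where f = "\<lambda>x. (C + 1) * \<bar>g x\<bar> powr p"])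
          (use wb[of k] ig C(1) in \<open>auto simp: abs_mult\<close>)
      have "\<bar>\<integral>x. h k x \<partial>M\<bar> \<le> (\<integral>x. \<bar>h k x\<bar> \<partial>M)" by (rule integral_abs_bound)
      also have "\<dots> \<le> (\<integral>x. w k x + e * \<bar>f k x - g x\<bar> powr p \<partial>M)"
      proof (rule integral_mono)
        show "integrable M (\<lambda>x. \<bar>h k x\<bar>)" using ih by simp
        show "integrable M (\<lambda>x. w k x + e * \<bar>f k x - g x\<bar> powr p)" using iw id by simp
      qed (auto simp: w_def)
      also have "\<dots> = (\<integral>x. w k x \<partial>M) + e * (\<integral>x. \<bar>f k x - g x\<bar> powr p \<partial>M)"
        using iw id by simp
      also have "\<dots> < \<epsilon> / 2 + e * (B + 1)"
        using elim dle[of k] e by (intro add_less_le_mono mult_left_mono) auto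
      also have "e * (B + 1) = \<epsilon> / 2" using B by (simp add: e_def field_simps)
      finally show ?case by simp
    qed
  qed
  moreover have "(\<integral>x. h k x \<partial>M) = (\<integral>x. \<bar>f k x\<bar> powr p \<partial>M) - (\<integral>x. \<bar>f k x - g x\<bar> powr p \<partial>M) - (\<integral>x. \<bar>g x\<bar> powr p \<partial>M)" for k
    unfolding h_def using if_ ig id by simp
  ultimately have "(\<lambda>k. (\<integral>x. \<bar>f k x\<bar> powr p \<partial>M) - (\<integral>x. \<bar>f k x - g x\<bar> powr p \<partial>M) - (\<integral>x. \<bar>g x\<bar> powr p \<partial>M)) \<longlonglongrightarrow> 0" by simp
  then show "(\<lambda>k. (\<integral>x. \<bar>f k x\<bar> powr p \<partial>M) - (\<integral>x. \<bar>f k x - g x\<bar> powr p \<partial>M)) \<longlonglongrightarrow> (\<integral>x. \<bar>g x\<bar> powr p \<partial>M)"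
    by (subst (asm) LIM_zero_iff)
qed

text \<open>Below the level \<open>L\<close> dominated convergence applies on the set
  \<open>W\<close> of finite measure; above it the bound in the larger exponent \<open>p\<close>
  leaves at most \<open>L powr (q - p) * A\<close>.\<close>

lemma local_Lq_convergence:
  fixes f :: "nat \<Rightarrow> 'b \<Rightarrow> real" and p q :: real
  assumes [measurable]: "\<And>k. f k \<in> borel_measurable M" "W \<in> sets M"
    and pq: "0 < q" "q < p" and W: "emeasure M W < \<infinity>"
    and bd: "\<And>k. (\<integral>\<^sup>+x. ennreal (\<bar>f k x\<bar> powr p) \<partial>M) \<le> ennreal A" and A: "0 \<le> A"
    and lim: "AE x in M. (\<lambda>k. f k x) \<longlonglongrightarrow> 0"
  shows "(\<lambda>k. \<integral>\<^sup>+x. ennreal (\<bar>f k x\<bar> powr q) * indicator W x \<partial>M) \<longlonglongrightarrow> 0"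
proof -
  have "\<forall>\<^sub>F k in sequentially. (\<integral>\<^sup>+x. ennreal (\<bar>f k x\<bar> powr q) * indicator W x \<partial>M) < ennreal e" if e: "0 < e" for e
  proof -
    \<comment> \<open>Solves \<open>L powr (p - q) = 2 * (A + 1) / e\<close>; the summand 1 keeps
      the level positive when \<open>A = 0\<close>.\<close>
    define L where "L = (2 * (A + 1) / e) powr (1 / (p - q))"
    have L: "0 < L" using e A by (simp add: L_def)
    have LA: "L powr (q - p) * A \<le> e / 2"
    proof -
      have "L powr (p - q) = 2 * (A + 1) / e"
        unfolding L_def powr_powr using pq e A by simp
      then have "L powr (q - p) = e / (2 * (A + 1))"
        using powr_minus_divide[of L "p - q"] by simp
      moreover have "e / (2 * (A + 1)) * A \<le> e / 2" using e A by (simp add: field_simps)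
      ultimately show ?thesis by simp
    qed
    have pt: "\<bar>t\<bar> powr q \<le> (min \<bar>t\<bar> L) powr q + L powr (q - p) * \<bar>t\<bar> powr p" for t
    proof (cases "\<bar>t\<bar> \<le> L")
      case False
      then have "\<bar>t\<bar> powr (q - p) \<le> L powr (q - p)" using L pq by (intro powr_mono2') auto
      then have "\<bar>t\<bar> powr (q - p) * \<bar>t\<bar> powr p \<le> L powr (q - p) * \<bar>t\<bar> powr p" by (rule mult_right_mono) simp
      then have "\<bar>t\<bar> powr q \<le> L powr (q - p) * \<bar>t\<bar> powr p" by (simp flip: powr_add)
      then show ?thesis by (simp add: add_increasing)
    qed (simp add: min_def)
    have "(\<lambda>k. \<integral>\<^sup>+x. ennreal ((min \<bar>f k x\<bar> L) powr q) * indicator W x \<partial>M) \<longlonglongrightarrow> (\<integral>\<^sup>+x. 0 \<partial>M)"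
    proof (rule nn_integral_dominated_convergence[where w = "\<lambda>x. ennreal (L powr q) * indicator W x"])
      show "AE x in M. ennreal ((min \<bar>f k x\<bar> L) powr q) * indicator W x \<le> ennreal (L powr q) * indicator W x" for k
        using pq L by (intro AE_I2 mult_right_mono ennreal_leI powr_mono2) auto
      show "(\<integral>\<^sup>+x. ennreal (L powr q) * indicator W x \<partial>M) < \<infinity>"
        using W by (simp add: nn_integral_cmult_indicator ennreal_mult_less_top)
      show "AE x in M. (\<lambda>k. ennreal ((min \<bar>f k x\<bar> L) powr q) * indicator W x) \<longlonglongrightarrow> 0"
        using lim
      proof eventually_elim
        case (elim x)
        have "(\<lambda>k. (min \<bar>f k x\<bar> L) powr q) \<longlonglongrightarrow> (min \<bar>0\<bar> L) powr q"
          using elim pq L by (intro tendsto_powr2 tendsto_intros) auto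
        then have "(\<lambda>k. ennreal ((min \<bar>f k x\<bar> L) powr q)) \<longlonglongrightarrow> ennreal 0"
          using L by (intro tendsto_ennrealI) simp
        then show ?case by (auto simp: indicator_def)
      qed
    qed auto
    then have "\<forall>\<^sub>F k in sequentially. (\<integral>\<^sup>+x. ennreal ((min \<bar>f k x\<bar> L) powr q) * indicator W x \<partial>M) < ennreal (e / 4)"
      using e by (intro order_tendstoD) auto
    then show ?thesis
    proof eventually_elim
      case (elim k)
      have "(\<integral>\<^sup>+x. ennreal (\<bar>f k x\<bar> powr q) * indicator W x \<partial>M)
        \<le> (\<integral>\<^sup>+x. ennreal ((min \<bar>f k x\<bar> L) powr q) * indicator W x + ennreal (L powr (q - p)) * ennreal (\<bar>f k x\<bar> powr p) \<partial>M)"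
        using pt by (intro nn_integral_mono) (auto simp: indicator_def simp flip: ennreal_mult ennreal_plus intro!: ennreal_leI)
      also have "\<dots> = (\<integral>\<^sup>+x. ennreal ((min \<bar>f k x\<bar> L) powr q) * indicator W x \<partial>M) + ennreal (L powr (q - p)) * (\<integral>\<^sup>+x. ennreal (\<bar>f k x\<bar> powr p) \<partial>M)"
        by (simp add: nn_integral_add nn_integral_cmult)
      also have "\<dots> \<le> ennreal (e / 4) + ennreal (L powr (q - p)) * ennreal A"
        using elim bd by (intro add_mono mult_left_mono) auto
      also have "\<dots> = ennreal (e / 4 + L powr (q - p) * A)"
        using e A by (simp flip: ennreal_mult ennreal_plus)
      also have "\<dots> < ennreal e" using LA e by (intro ennreal_lessI) auto
      finally show ?case .
    qed
  qed
  then show ?thesis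
    unfolding order_tendsto_iff
  proof (intro conjI allI impI)
    fix a :: ennreal assume a: "0 < a"
    assume H: "\<And>e. 0 < e \<Longrightarrow> \<forall>\<^sub>F k in sequentially. (\<integral>\<^sup>+x. ennreal (\<bar>f k x\<bar> powr q) * indicator W x \<partial>M) < ennreal e"
    obtain e where e: "0 < e" "ennreal e \<le> a"
      using a by (cases a) (auto simp: ennreal_zero_less_top intro: that[of 1])
    show "\<forall>\<^sub>F k in sequentially. (\<integral>\<^sup>+x. ennreal (\<bar>f k x\<bar> powr q) * indicator W x \<partial>M) < a"
      using H[OF e(1)] by eventually_elim (use e in auto)
  qed auto
qed

text \<open>For \<open>0 < a < 1\<close> both \<open>a\<close> and \<open>1 - a\<close> are strictly
  smaller than their powers with exponent \<open>t < 1\<close>, so the sum of the powers would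
  exceed 1. This forces the limit of a maximising sequence to carry all of the mass.\<close>

lemma concave_split:
  fixes a t :: real
  assumes "0 < a" "a \<le> 1" "0 < t" "t < 1" "a powr t + (1 - a) powr t \<le> 1"
  shows "a = 1"
proof (rule ccontr)
  assume "a \<noteq> 1"
  then have a: "0 < a" "a < 1" using assms by auto
  have "a powr 1 < a powr t" using a assms by (intro powr_less_mono') auto
  moreover have "(1 - a) powr 1 < (1 - a) powr t" using a assms by (intro powr_less_mono') auto
  ultimately show False using a assms by simp
qed

text \<open>What the analysis takes from the group, in exponential coordinates. The inverse of
  \<open>x\<close> is \<open>- x\<close> because both lie on one one-parameter subgroup. The
  dimension \<open>Q\<close> enters as the exponent by which \<open>dl\<close> scales the
  measure.\<close>

locale homogeneous_model =
  fixes star :: "'a::euclidean_space \<Rightarrow> 'a \<Rightarrow> 'a" (infixl "\<odot>" 70)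
    and dl :: "real \<Rightarrow> 'a \<Rightarrow> 'a" and N :: "'a \<Rightarrow> real" and Q s :: real
  assumes star_assoc: "x \<odot> y \<odot> z = x \<odot> (y \<odot> z)"
    and star_0_left [simp]: "0 \<odot> x = x" and star_0_right [simp]: "x \<odot> 0 = x"
    and star_minus_right [simp]: "x \<odot> - x = 0" and star_minus_left [simp]: "- x \<odot> x = 0"
    and continuous_star: "continuous_on UNIV (\<lambda>p. fst p \<odot> snd p)"
    and continuous_dl: "0 < l \<Longrightarrow> continuous_on UNIV (dl l)"
    and dl_star: "0 < l \<Longrightarrow> dl l (x \<odot> y) = dl l x \<odot> dl l y"
    and dl_dl: "0 < l \<Longrightarrow> 0 < m \<Longrightarrow> dl l (dl m x) = dl (l * m) x"
    and dl_1 [simp]: "dl 1 x = x"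
    and nn_integral_star: "f \<in> borel_measurable borel \<Longrightarrow> (\<integral>\<^sup>+x. f (a \<odot> x) \<partial>lborel) = (\<integral>\<^sup>+x. f x \<partial>lborel)"
    and nn_integral_dl: "0 < l \<Longrightarrow> f \<in> borel_measurable borel \<Longrightarrow>
        (\<integral>\<^sup>+x. f (dl l x) \<partial>lborel) = ennreal (l powr - Q) * (\<integral>\<^sup>+x. f x \<partial>lborel)"
    and continuous_N: "continuous_on UNIV N"
    and N_nonneg [simp]: "0 \<le> N x" and N_eq_0_iff [simp]: "N x = 0 \<longleftrightarrow> x = 0"
    and N_minus [simp]: "N (- x) = N x"
    and N_dl [simp]: "0 < l \<Longrightarrow> N (dl l x) = l * N x"
    and N_star: "N (x \<odot> y) \<le> N x + N y"
    and bounded_N: "bounded {x. N x < r}"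
    and s_pos: "0 < s" and s_less_1: "s < 1" and Q_gt: "2 * s < Q"
begin

section \<open>Balls of the homogeneous norm and their volumes\<close>

lemma Q_pos: "0 < Q" using s_pos Q_gt by linarith

lemma N_0 [simp]: "N 0 = 0" by simp

lemma star_cancel [simp]: "- x \<odot> (x \<odot> y) = y" "x \<odot> (- x \<odot> y) = y"
  by (simp_all flip: star_assoc)

lemma minus_star: "- (x \<odot> y) = - y \<odot> - x"
proof -
  have *: "a \<odot> b = 0 \<Longrightarrow> b = - a" for a b
    by (metis star_assoc star_0_left star_0_right star_minus_left)
  have "(x \<odot> y) \<odot> (- y \<odot> - x) = 0"
    by (simp add: star_assoc)
  then show ?thesis by (metis *)
qed

lemma minus_dl: "0 < l \<Longrightarrow> dl l (- x) = - dl l x"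
proof -
  assume l: "0 < l"
  have "N (dl l 0) = 0" using l by (subst N_dl) auto
  then have "dl l 0 = 0" by (simp only: N_eq_0_iff)
  then have "dl l x \<odot> dl l (- x) = 0" using l by (simp flip: dl_star)
  then show ?thesis by (metis star_0_right star_cancel(1))
qed

definition d :: "'a \<Rightarrow> 'a \<Rightarrow> real" where "d x y = N (- x \<odot> y)"

lemma d_nonneg [simp]: "0 \<le> d x y" by (simp add: d_def)

lemma d_commute: "d x y = d y x"
  unfolding d_def by (metis N_minus minus_star minus_minus)

lemma d_eq_0_iff [simp]: "d x y = 0 \<longleftrightarrow> x = y"
  by (metis N_eq_0_iff d_def star_cancel(2) star_minus_left star_0_right)

lemma d_triangle: "d x z \<le> d x y + d y z"
proof -
  have "- x \<odot> z = (- x \<odot> y) \<odot> (- y \<odot> z)" by (simp add: star_assoc)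
  then show ?thesis unfolding d_def using N_star by metis
qed

lemma d_star [simp]: "d (a \<odot> x) (a \<odot> y) = d x y"
  by (simp add: d_def minus_star star_assoc)

lemma d_dl [simp]: "0 < l \<Longrightarrow> d (dl l x) (dl l y) = l * d x y"
  unfolding d_def by (metis N_dl dl_star minus_dl)

lemma measurable_star [measurable (raw)]:
  assumes [measurable]: "f \<in> borel_measurable M" "g \<in> borel_measurable M"
  shows "(\<lambda>x. f x \<odot> g x) \<in> borel_measurable M"
  using borel_measurable_continuous_Pair[OF assms, of "(\<odot>)"] continuous_star by simp

lemma measurable_N [measurable]: "N \<in> borel_measurable borel"
  by (rule borel_measurable_continuous_onI[OF continuous_N])

lemma measurable_d [measurable (raw)]:
  assumes [measurable]: "f \<in> borel_measurable M" "g \<in> borel_measurable M"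
  shows "(\<lambda>x. d (f x) (g x)) \<in> borel_measurable M"
  unfolding d_def by measurable

lemma measurable_dl [measurable]: "0 < l \<Longrightarrow> dl l \<in> borel_measurable borel"
  by (rule borel_measurable_continuous_onI[OF continuous_dl])

lemma continuous_on_star [continuous_intros]:
  "continuous_on A f \<Longrightarrow> continuous_on A g \<Longrightarrow> continuous_on A (\<lambda>x. f x \<odot> g x)"
  using continuous_on_compose2[OF continuous_star, of A "\<lambda>x. (f x, g x)"]
  by (simp add: continuous_on_Pair)

lemma continuous_on_d [continuous_intros]:
  "continuous_on A f \<Longrightarrow> continuous_on A g \<Longrightarrow> continuous_on A (\<lambda>x. d (f x) (g x))"
  unfolding d_def
  by (rule continuous_on_compose2[OF continuous_N]) (auto intro!: continuous_intros)

definition v1 :: real where "v1 = measure lborel {x. N x < 1}"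

lemma emeasure_N_finite: "emeasure lborel {x. N x < r} < \<infinity>"
  using emeasure_bounded_finite[OF bounded_N] .

lemma open_ball_d: "open {y. d x y < r}"
  by (intro open_Collect_less continuous_intros)

lemma v1_pos: "0 < v1"
proof -
  have "open {x. N x < 1}" using continuous_N by (intro open_Collect_less) auto
  moreover have "{x. N x < 1} \<noteq> {}" by (auto intro!: exI[of _ 0] simp: N_eq_0_iff[THEN iffD2])
  ultimately have "emeasure lborel {x. N x < 1} \<noteq> 0"
    using open_not_negligible[of "{x. N x < 1}"] negligible_iff_emeasure0[of "{x. N x < 1}"]
    by (auto simp: lmeasurable_iff_integrable)
  then show ?thesis unfolding v1_def measure_def
    using emeasure_N_finite[of 1] by (simp add: enn2real_positive_iff zero_less_iff_neq_zero)
qed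

lemma emeasure_N: assumes "0 < r" shows "emeasure lborel {x. N x < r} = ennreal (v1 * r powr Q)"
proof -
  have "emeasure lborel {x. N x < 1} = (\<integral>\<^sup>+x. indicator {x. N x < r} (dl r x) \<partial>lborel)"
  proof -
    have "emeasure lborel {x. N x < 1} = (\<integral>\<^sup>+x. indicator {x. N x < 1} x \<partial>lborel)" by simp
    then show ?thesis using assms by (simp only:) (intro nn_integral_cong, auto simp: indicator_def)
  qed
  also have "\<dots> = ennreal (r powr - Q) * emeasure lborel {x. N x < r}"
    using assms by (subst nn_integral_dl) auto
  finally have "ennreal (r powr Q) * emeasure lborel {x. N x < 1}
      = ennreal (r powr Q) * ennreal (r powr - Q) * emeasure lborel {x. N x < r}"
    by (simp add: mult.assoc)
  also have "ennreal (r powr Q) * ennreal (r powr - Q) = 1"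
    using assms by (simp flip: ennreal_mult powr_add)
  finally have "emeasure lborel {x. N x < r} = ennreal (r powr Q) * emeasure lborel {x. N x < 1}" by simp
  also have "emeasure lborel {x. N x < 1} = ennreal v1"
    unfolding v1_def using emeasure_N_finite[of 1] by (intro emeasure_eq_ennreal_measure) auto
  finally show ?thesis by (simp add: ennreal_mult mult.commute v1_def)
qed

lemma emeasure_d_ball: assumes "0 < r" shows "emeasure lborel {y. d x y < r} = ennreal (v1 * r powr Q)"
proof -
  have "emeasure lborel {y. d x y < r} = (\<integral>\<^sup>+y. indicator {y. N y < r} (- x \<odot> y) \<partial>lborel)"
  proof -
    have "emeasure lborel {y. d x y < r} = (\<integral>\<^sup>+y. indicator {y. d x y < r} y \<partial>lborel)" by simp
    then show ?thesis by (simp only:) (intro nn_integral_cong, auto simp: indicator_def d_def)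
  qed
  also have "\<dots> = emeasure lborel {y. N y < r}" by (subst nn_integral_star) auto
  finally show ?thesis using emeasure_N[OF assms] by simp
qed

section \<open>Energy, critical exponent and the refined Sobolev inequality\<close>

definition K :: "('a \<Rightarrow> real) \<Rightarrow> 'a \<Rightarrow> 'a \<Rightarrow> ennreal" where
  "K u y x = ennreal ((u x - u y)\<^sup>2 / d y x powr (Q + 2 * s))"

definition E :: "('a \<Rightarrow> real) \<Rightarrow> ennreal" where
  "E u = (\<integral>\<^sup>+y. \<integral>\<^sup>+x. K u y x \<partial>lborel \<partial>lborel)"

definition p :: real where "p = 2 * Q / (Q - 2 * s)"

definition P :: "('a \<Rightarrow> real) \<Rightarrow> ennreal" where "P u = (\<integral>\<^sup>+x. ennreal (\<bar>u x\<bar> powr p) \<partial>lborel)"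

text \<open>With the radius \<open>(4 * M / a) powr (p / Q)\<close> chosen in
  \<open>pointwise_morrey\<close>, the identity \<open>p_minus_2\<close> below turns the factor
  \<open>r powr (2 * s)\<close> into \<open>(4 * M / a) powr (p - 2)\<close>; positivity of that
  exponent is the content of \<open>p_gt_2\<close>.\<close>

lemma p_gt_2: "2 < p" unfolding p_def using Q_gt s_pos by (simp add: field_simps)

lemma p_minus_2: "2 * s * p / Q = p - 2" unfolding p_def using Q_gt Q_pos by (simp add: field_simps)

lemma measurable_K [measurable (raw)]:
  assumes [measurable]: "u \<in> borel_measurable borel" "f \<in> borel_measurable M" "g \<in> borel_measurable M"
  shows "(\<lambda>x. K u (f x) (g x)) \<in> borel_measurable M"
  unfolding K_def by measurable

text \<open>Applied on the ball around \<open>y\<close> whose radius is chosen so that the mean of \<open>\<bar>u\<bar>\<close> is at most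
  a quarter of \<open>\<bar>u y\<bar>\<close>: there \<open>u\<close> differs from \<open>u y\<close> by a definite amount, which bounds the energy
  density at \<open>y\<close> from below.\<close>

lemma pointwise_morrey:
  fixes u :: "'a \<Rightarrow> real"
  assumes [measurable]: "u \<in> borel_measurable borel" and M: "0 < M"
    and H: "\<And>r. 0 < r \<Longrightarrow>
      (\<integral>\<^sup>+x. ennreal \<bar>u x\<bar> * indicator {x. d y x < r} x \<partial>lborel) \<le> ennreal (v1 * M * r powr (Q - Q / p))"
  shows "ennreal (\<bar>u y\<bar> powr p) \<le> ennreal (2 / v1 * (4 * M) powr (p - 2)) * (\<integral>\<^sup>+x. K u y x \<partial>lborel)"
    (is "_ \<le> ennreal ?c * ?F")
proof (cases "u y = 0 \<or> ?F = \<infinity>")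
  case True
  moreover have "0 < ?c" using v1_pos M by simp
  ultimately show ?thesis using p_gt_2 by (auto simp: ennreal_mult_top)
next
  case False
  define a where "a = \<bar>u y\<bar>"
  have a: "0 < a" using False by (simp add: a_def)
  obtain f where f: "?F = ennreal f" "0 \<le> f"
    using False by (cases ?F) auto
  \<comment> \<open>Solves \<open>M * r powr (- Q / p) = a / 4\<close>, the left-hand side being the
    bound that the hypothesis gives for the mean of \<open>|u|\<close> over the ball.\<close>
  define r where "r = (4 * M / a) powr (p / Q)"
  have r: "0 < r" using a M by (simp add: r_def)
  let ?B = "{x. d y x < r}"
  have pt: "ennreal (a / 2) * indicator ?B x
      \<le> ennreal (r powr (Q + 2 * s) / (2 * a)) * K u y x + ennreal \<bar>u x\<bar> * indicator ?B x" for x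
  proof (cases "x \<in> ?B")
    case xB: True
    have K: "(u x - u y)\<^sup>2 \<le> r powr (Q + 2 * s) * ((u x - u y)\<^sup>2 / d y x powr (Q + 2 * s))"
    proof (cases "x = y")
      case False
      then have "0 < d y x" by (metis d_eq_0_iff d_nonneg order_le_less)
      moreover have "d y x powr (Q + 2 * s) \<le> r powr (Q + 2 * s)"
        using xB Q_pos s_pos by (intro powr_mono2) auto
      ultimately show ?thesis
        using mult_left_mono[of "d y x powr (Q + 2 * s)" "r powr (Q + 2 * s)" "(u x - u y)\<^sup>2"]
        unfolding times_divide_eq_right using False by (subst pos_le_divide_eq) (auto simp: mult.commute)
    qed simp
    have "a \<le> \<bar>u x - u y\<bar> + \<bar>u x\<bar>" unfolding a_def by linarith
    \<comment> \<open>Bounds the difference by its square, which the kernel controls, at the price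
      of a second share \<open>a / 2\<close>.\<close>
    moreover have "\<bar>u x - u y\<bar> \<le> a / 2 + (u x - u y)\<^sup>2 / (2 * a)"
    proof -
      have "0 \<le> (\<bar>u x - u y\<bar> - a)\<^sup>2" by simp
      then have "2 * a * \<bar>u x - u y\<bar> \<le> a\<^sup>2 + (u x - u y)\<^sup>2" by (simp add: power2_diff mult.commute mult.left_commute)
      then show ?thesis using a by (simp add: field_simps power2_eq_square)
    qed
    moreover have "(u x - u y)\<^sup>2 / (2 * a) \<le> r powr (Q + 2 * s) * ((u x - u y)\<^sup>2 / d y x powr (Q + 2 * s)) / (2 * a)"
      using K a by (intro divide_right_mono) auto
    ultimately have "a / 2 \<le> r powr (Q + 2 * s) * ((u x - u y)\<^sup>2 / d y x powr (Q + 2 * s)) / (2 * a) + \<bar>u x\<bar>"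
      by linarith
    then have "a / 2 \<le> r powr (Q + 2 * s) / (2 * a) * ((u x - u y)\<^sup>2 / d y x powr (Q + 2 * s)) + \<bar>u x\<bar>"
      by (simp only: times_divide_eq_left)
    then have "ennreal (a / 2) \<le> ennreal (r powr (Q + 2 * s) / (2 * a)) * K u y x + ennreal \<bar>u x\<bar>"
      unfolding K_def using a by (simp flip: ennreal_mult ennreal_plus add: ennreal_leI)
    then show ?thesis using xB by simp
  qed simp
  have "ennreal (a / 2) * ennreal (v1 * r powr Q) = (\<integral>\<^sup>+x. ennreal (a / 2) * indicator ?B x \<partial>lborel)"
    using r by (simp add: nn_integral_cmult emeasure_d_ball)
  also have "\<dots> \<le> (\<integral>\<^sup>+x. ennreal (r powr (Q + 2 * s) / (2 * a)) * K u y x + ennreal \<bar>u x\<bar> * indicator ?B x \<partial>lborel)"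
    by (rule nn_integral_mono[OF pt])
  also have "\<dots> = ennreal (r powr (Q + 2 * s) / (2 * a)) * ?F + (\<integral>\<^sup>+x. ennreal \<bar>u x\<bar> * indicator ?B x \<partial>lborel)"
    by (simp add: nn_integral_add nn_integral_cmult)
  also have "\<dots> \<le> ennreal (r powr (Q + 2 * s) / (2 * a)) * ennreal f + ennreal (v1 * M * r powr (Q - Q / p))"
    using H[OF r] f by (intro add_mono) auto
  finally have "a / 2 * (v1 * r powr Q) \<le> r powr (Q + 2 * s) / (2 * a) * f + v1 * M * r powr (Q - Q / p)"
    using a f v1_pos M by (simp flip: ennreal_mult ennreal_plus)
  moreover have "r powr (Q - Q / p) = r powr Q * (a / (4 * M))"
  proof -
    have "r powr (Q / p) = 4 * M / a"
      unfolding r_def powr_powr using Q_pos p_gt_2 a M by simp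
    then show ?thesis using a M by (simp add: powr_diff)
  qed
  moreover have "r powr (Q + 2 * s) = r powr Q * (4 * M / a) powr (p - 2)"
  proof -
    have "p / Q * (2 * s) = p - 2" using p_minus_2 by (simp add: mult_ac)
    then show ?thesis unfolding powr_add by (simp add: r_def powr_powr)
  qed
  \<comment> \<open>After division by \<open>r powr Q\<close> the mean contributes
    \<open>v1 * a / 4\<close>, half of the left-hand side, and can be absorbed.\<close>
  ultimately have "r powr Q * (a / 2 * v1) \<le> r powr Q * ((4 * M / a) powr (p - 2) / (2 * a) * f + v1 * a / 4)"
    using M by (simp add: algebra_simps)
  then have "a / 2 * v1 \<le> (4 * M / a) powr (p - 2) / (2 * a) * f + v1 * a / 4"
    using r by (metis mult_le_cancel_left_pos powr_gt_zero less_irrefl)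
  then have "a\<^sup>2 * v1 \<le> 2 * (4 * M / a) powr (p - 2) * f"
    using a by (simp add: field_simps power2_eq_square)
  also have "(4 * M / a) powr (p - 2) = (4 * M) powr (p - 2) / a powr (p - 2)"
    using a M by (simp add: powr_divide)
  finally have "a\<^sup>2 * a powr (p - 2) \<le> ?c * f"
    using a v1_pos by (simp add: field_simps)
  moreover have "a\<^sup>2 * a powr (p - 2) = a powr p"
    using a by (simp flip: powr_numeral powr_add)
  ultimately have "a powr p \<le> ?c * f" by simp
  then show ?thesis unfolding f a_def[symmetric]
    using f(2) v1_pos by (simp flip: ennreal_mult add: ennreal_leI)
qed

lemma morrey:
  assumes [measurable]: "u \<in> borel_measurable borel" and M: "0 < M"
    and H: "\<And>y r. 0 < r \<Longrightarrow>
      (\<integral>\<^sup>+x. ennreal \<bar>u x\<bar> * indicator {x. d y x < r} x \<partial>lborel) \<le> ennreal (v1 * M * r powr (Q - Q / p))"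
  shows "P u \<le> ennreal (2 / v1 * (4 * M) powr (p - 2)) * E u"
proof -
  have "P u \<le> (\<integral>\<^sup>+y. ennreal (2 / v1 * (4 * M) powr (p - 2)) * (\<integral>\<^sup>+x. K u y x \<partial>lborel) \<partial>lborel)"
    unfolding P_def by (intro nn_integral_mono pointwise_morrey M H) auto
  then show ?thesis unfolding E_def by (simp add: nn_integral_cmult)
qed

text \<open>Hoelder's inequality on a ball of volume \<open>V\<close>, through the threshold
  \<open>t\<close> that makes both terms equal to \<open>A * V powr (1 - 1 / p)\<close>; hence the
  factor 2.\<close>

lemma Lp_imp_morrey:
  assumes [measurable]: "u \<in> borel_measurable borel" and A: "0 < A" "P u \<le> ennreal (A powr p)" and r: "0 < r"
  shows "(\<integral>\<^sup>+x. ennreal \<bar>u x\<bar> * indicator {x. d y x < r} x \<partial>lborel)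
    \<le> ennreal (v1 * (2 * A * v1 powr (- 1 / p)) * r powr (Q - Q / p))"
proof -
  define V where "V = v1 * r powr Q"
  have V: "0 < V" using r v1_pos by (simp add: V_def)
  define t where "t = A * V powr (- 1 / p)"
  have t: "0 < t" using A V by (simp add: t_def)
  have "(\<integral>\<^sup>+x. ennreal \<bar>u x\<bar> * indicator {x. d y x < r} x \<partial>lborel)
    \<le> ennreal t * ennreal V + ennreal (t powr (1 - p)) * ennreal (A powr p)"
    using nn_integral_abs_le_threshold[of u lborel "{x. d y x < r}" t p] A(2) t p_gt_2 r
    by (simp add: emeasure_d_ball V_def P_def) (meson add_left_mono mult_left_mono order_trans zero_le)
  also have "\<dots> = ennreal (t * V + t powr (1 - p) * A powr p)"
    using t V by (simp flip: ennreal_mult ennreal_plus)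
  also have "t powr (1 - p) * A powr p = A * V powr (1 - 1 / p)"
  proof -
    have "t powr (1 - p) = A powr (1 - p) * V powr (- 1 / p * (1 - p))"
      using A V by (simp add: t_def powr_mult powr_powr)
    moreover have "- 1 / p * (1 - p) = 1 - 1 / p" using p_gt_2 by (simp add: field_simps)
    moreover have "A powr (1 - p) * A powr p = A" using A by (simp flip: powr_add)
    ultimately show ?thesis by (simp add: mult.commute mult.left_commute)
  qed
  also have "t * V = A * V powr (1 - 1 / p)"
    using V by (simp add: t_def powr_diff powr_minus_divide)
  also have "V powr (1 - 1 / p) = v1 * v1 powr (- 1 / p) * r powr (Q - Q / p)"
    using v1_pos r by (simp add: V_def powr_mult powr_powr powr_diff powr_minus_divide field_simps)
  finally show ?thesis by (simp add: mult_ac)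
qed

text \<open>The square root of the constant of \<open>morrey\<close> for
  \<open>M = 2 * A * v1 powr (- 1 / p)\<close> after the factor \<open>A powr (p - 2)\<close> has
  been cancelled; 8 is 4 times this 2.\<close>

definition C0 :: real where "C0 = sqrt (2 / v1 * (8 * v1 powr (- 1 / p)) powr (p - 2))"

lemma P_powr:
  assumes "P u < \<infinity>"
  shows "P u = ennreal ((enn2real (P u) powr (1 / p)) powr p)"
  using assms p_gt_2 by (simp add: powr_powr)

text \<open>Feeding the Morrey bound that the norm \<open>A\<close> itself provides into the refined
  inequality gives \<open>A powr p \<le> C * A powr (p - 2) * E u\<close>. Since \<open>A\<close> is
  finite and positive, the power can be cancelled.\<close>

lemma sobolev:
  assumes [measurable]: "u \<in> borel_measurable borel" and P: "P u < \<infinity>" and E: "E u < \<infinity>"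
  shows "enn2real (P u) powr (1 / p) \<le> C0 * sqrt (enn2real (E u))"
proof (cases "enn2real (P u) = 0")
  case True
  then show ?thesis using v1_pos by (simp add: C0_def)
next
  case False
  define A where "A = enn2real (P u) powr (1 / p)"
  have A: "0 < A" using False by (simp add: A_def)
  have PA: "P u = ennreal (A powr p)" unfolding A_def by (rule P_powr[OF P])
  define e where "e = enn2real (E u)"
  have e: "E u = ennreal e" "0 \<le> e" using E by (simp_all add: e_def)
  have "P u \<le> ennreal (2 / v1 * (4 * (2 * A * v1 powr (- 1 / p))) powr (p - 2)) * E u"
    using A v1_pos Lp_imp_morrey[of u A] PA by (intro morrey) auto
  then have "A powr p \<le> 2 / v1 * (4 * (2 * A * v1 powr (- 1 / p))) powr (p - 2) * e"
    unfolding PA e(1) using e(2) v1_pos by (simp flip: ennreal_mult)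
  also have "(4 * (2 * A * v1 powr (- 1 / p))) powr (p - 2) = A powr (p - 2) * (8 * v1 powr (- 1 / p)) powr (p - 2)"
    using A v1_pos by (simp flip: powr_mult add: mult_ac)
  also have "A powr p = A powr (p - 2) * A\<^sup>2"
    using A by (simp flip: powr_numeral powr_add)
  finally have "A powr (p - 2) * A\<^sup>2 \<le> A powr (p - 2) * (2 / v1 * (8 * v1 powr (- 1 / p)) powr (p - 2) * e)"
    by (simp add: mult_ac)
  then have "A\<^sup>2 \<le> 2 / v1 * (8 * v1 powr (- 1 / p)) powr (p - 2) * e"
    using A by (metis mult_le_cancel_left_pos powr_gt_zero less_irrefl)
  then have "A \<le> sqrt (2 / v1 * (8 * v1 powr (- 1 / p)) powr (p - 2) * e)"
    by (rule real_le_rsqrt)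
  then show ?thesis by (simp only: real_sqrt_mult C0_def A_def e_def)
qed

text \<open>Dilation by \<open>\<rho> powr (- k)\<close> maps the \<open>k\<close>-th shell to the
  fixed shell between 1 and \<open>\<rho>\<close>, so the integrals over shells form a geometric
  series with ratio \<open>\<rho> powr (b + Q)\<close>. Taking \<open>\<rho> < 1\<close> covers
  \<open>N x \<le> 1\<close> and \<open>\<rho> > 1\<close> covers \<open>1 \<le> N x\<close>, so one
  statement serves both ends.\<close>

lemma nn_integral_N_powr_finite:
  assumes \<rho>: "0 < \<rho>" "\<rho> \<noteq> 1" "\<rho> powr (b + Q) < 1"
  shows "(\<integral>\<^sup>+x. ennreal (N x powr b) * indicator {x. x \<noteq> 0 \<and> 0 \<le> log \<rho> (N x)} x \<partial>lborel) < \<infinity>"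
proof -
  let ?A = "{x. min 1 \<rho> \<le> N x \<and> N x \<le> max 1 \<rho>}"
  define J where "J = (\<integral>\<^sup>+x. ennreal (N x powr b) * indicator ?A x \<partial>lborel)"
  define g where "g k x = ennreal (N x powr b) * indicator ?A (dl (\<rho> powr - real k) x)" for k x
  have [measurable]: "dl (\<rho> powr - real k) \<in> borel_measurable borel" for k
    using \<rho> by (intro measurable_dl) simp
  have [measurable]: "g k \<in> borel_measurable borel" for k
    unfolding g_def using \<rho> by measurable
  have J: "J < \<infinity>"
  proof -
    define c where "c = (min 1 \<rho>) powr b + (max 1 \<rho>) powr b"
    have "N x powr b \<le> c" if "x \<in> ?A" for x
    proof (cases "b \<ge> 0")
      case True
      then have "N x powr b \<le> (max 1 \<rho>) powr b" using that by (intro powr_mono2) auto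
      then show ?thesis by (simp add: c_def add_increasing)
    next
      case False
      then have "N x powr b \<le> (min 1 \<rho>) powr b" using that \<rho> by (intro powr_mono2') auto
      then show ?thesis by (simp add: c_def add_increasing2)
    qed
    then have "J \<le> (\<integral>\<^sup>+x. ennreal c * indicator {x. N x < max 1 \<rho> + 1} x \<partial>lborel)"
      unfolding J_def by (intro nn_integral_mono) (auto simp: indicator_def intro!: ennreal_leI)
    also have "\<dots> = ennreal c * emeasure lborel {x. N x < max 1 \<rho> + 1}"
      by (subst nn_integral_cmult_indicator) auto
    also have "\<dots> < \<infinity>" using emeasure_N_finite by (simp add: ennreal_mult_less_top)
    finally show ?thesis .
  qed
  have g: "(\<integral>\<^sup>+x. g k x \<partial>lborel) = ennreal ((\<rho> powr (b + Q)) ^ k) * J" for k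
  proof -
    have "(\<integral>\<^sup>+x. g k x \<partial>lborel) = (\<integral>\<^sup>+x. (\<lambda>z. ennreal ((\<rho> powr real k * N z) powr b) * indicator ?A z) (dl (\<rho> powr - real k) x) \<partial>lborel)"
      using \<rho> unfolding g_def by (intro nn_integral_cong) (simp flip: powr_add mult.assoc)
    also have "\<dots> = ennreal ((\<rho> powr - real k) powr - Q) * (\<integral>\<^sup>+z. ennreal ((\<rho> powr real k * N z) powr b) * indicator ?A z \<partial>lborel)"
      using \<rho> by (subst nn_integral_dl) auto
    also have "(\<integral>\<^sup>+z. ennreal ((\<rho> powr real k * N z) powr b) * indicator ?A z \<partial>lborel) = ennreal ((\<rho> powr real k) powr b) * J"
      unfolding J_def using \<rho>
      by (subst nn_integral_cmult[symmetric]) (auto intro!: nn_integral_cong simp: powr_mult ennreal_mult mult.assoc)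
    also have "ennreal ((\<rho> powr - real k) powr - Q) * (ennreal ((\<rho> powr real k) powr b) * J)
        = ennreal ((\<rho> powr (b + Q)) powr real k) * J"
      using \<rho> by (simp add: powr_powr algebra_simps flip: mult.assoc ennreal_mult powr_add)
    finally show ?thesis using \<rho> by (simp add: powr_realpow)
  qed
  have "(\<integral>\<^sup>+x. ennreal (N x powr b) * indicator {x. x \<noteq> 0 \<and> 0 \<le> log \<rho> (N x)} x \<partial>lborel)
      \<le> (\<integral>\<^sup>+x. (\<Sum>k. g k x) \<partial>lborel)"
  proof (rule nn_integral_mono)
    fix x
    show "ennreal (N x powr b) * indicator {x. x \<noteq> 0 \<and> 0 \<le> log \<rho> (N x)} x \<le> (\<Sum>k. g k x)"
    proof (cases "x \<noteq> 0 \<and> 0 \<le> log \<rho> (N x)")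
      case True
      define t where "t = log \<rho> (N x)"
      define k where "k = nat \<lfloor>t\<rfloor>"
      have Nx: "0 < N x" using True by (metis N_eq_0_iff N_nonneg order_le_less)
      have k: "0 \<le> t - k" "t - k < 1" using True by (auto simp: k_def t_def) linarith+
      have "N x = \<rho> powr t" unfolding t_def using \<rho> Nx by simp
      then have "N (dl (\<rho> powr - real k) x) = \<rho> powr (t - k)"
        using \<rho> by (simp flip: powr_add)
      moreover have "min 1 \<rho> \<le> \<rho> powr (t - k) \<and> \<rho> powr (t - k) \<le> max 1 \<rho>"
      proof (cases "\<rho> < 1")
        case True
        then show ?thesis using powr_mono'[of "t - k" 1 \<rho>] powr_mono'[of 0 "t - k" \<rho>] \<rho> k by auto
      next
        case False
        then show ?thesis using powr_mono[of "t - k" 1 \<rho>] powr_mono[of 0 "t - k" \<rho>] \<rho> k by auto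
      qed
      ultimately have "ennreal (N x powr b) = g k x" by (simp add: g_def)
      also have "\<dots> \<le> (\<Sum>k. g k x)" using sum_le_suminf[of "\<lambda>k. g k x" "{k}"] by simp
      finally show ?thesis using True by simp
    qed simp
  qed
  also have "\<dots> = (\<Sum>k. ennreal ((\<rho> powr (b + Q)) ^ k) * J)"
    by (subst nn_integral_suminf) (auto simp: g)
  also have "\<dots> = (\<Sum>k. ennreal ((\<rho> powr (b + Q)) ^ k)) * J"
    by simp
  also have "(\<Sum>k. ennreal ((\<rho> powr (b + Q)) ^ k)) = ennreal (1 / (1 - \<rho> powr (b + Q)))"
    using \<rho> by (intro suminf_ennreal_eq geometric_sums) auto
  also have "\<dots> * J < \<infinity>" using J by (simp add: ennreal_mult_less_top)
  finally show ?thesis .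
qed

text \<open>Near the diagonal the Lipschitz bound leaves \<open>d powr (2 - Q - 2 * s)\<close>,
  integrable because \<open>s < 1\<close>; away from it boundedness leaves
  \<open>d powr (- Q - 2 * s)\<close>, integrable because \<open>0 < s\<close>.\<close>

lemma E_finite:
  assumes [measurable]: "u \<in> borel_measurable borel" and S: "bounded {x. u x \<noteq> 0}"
    and M: "\<And>x. \<bar>u x\<bar> \<le> M" and C: "\<And>x y. \<bar>u x - u y\<bar> \<le> C * d y x"
  shows "E u < \<infinity>"
proof -
  let ?S = "{x. u x \<noteq> 0}"
  define k where "k z = ennreal (C\<^sup>2) * (ennreal (N z powr (2 - Q - 2 * s)) * indicator {x. x \<noteq> 0 \<and> 0 \<le> log (1/2) (N x)} z)
    + ennreal ((2 * M)\<^sup>2) * (ennreal (N z powr (- Q - 2 * s)) * indicator {x. x \<noteq> 0 \<and> 0 \<le> log 2 (N x)} z)" for z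
  have [measurable]: "k \<in> borel_measurable borel" unfolding k_def by measurable
  have k_fin: "(\<integral>\<^sup>+z. k z \<partial>lborel) < \<infinity>"
  proof -
    have "(1/2::real) powr (2 - Q - 2 * s + Q) < 1" using s_less_1 by (simp add: powr_divide)
    moreover have "(2::real) powr (- Q - 2 * s + Q) < 1" using s_pos by (simp add: powr_minus_divide)
    ultimately show ?thesis unfolding k_def
      using nn_integral_N_powr_finite[of "1/2" "2 - Q - 2 * s"] nn_integral_N_powr_finite[of 2 "- Q - 2 * s"]
      by (simp add: nn_integral_add nn_integral_cmult ennreal_mult_less_top)
  qed
  have Kk: "K u y x \<le> k (- y \<odot> x)" for x y
  proof (cases "x = y")
    case False
    then have d: "0 < d y x" by (metis d_eq_0_iff d_nonneg order_le_less)
    have nz: "- y \<odot> x \<noteq> 0" using d unfolding d_def by auto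
    have b1: "(u x - u y)\<^sup>2 \<le> C\<^sup>2 * (d y x)\<^sup>2"
      using power_mono[OF C[of x y], of 2] by (simp add: power_mult_distrib)
    have "\<bar>u x - u y\<bar> \<le> 2 * M" using M[of x] M[of y] by linarith
    then have b2: "(u x - u y)\<^sup>2 \<le> (2 * M)\<^sup>2" by (metis abs_ge_zero power2_abs power_mono)
    show ?thesis
    proof (cases "d y x \<le> 1")
      case True
      then have "0 \<le> log (1/2) (d y x)" using d by (simp add: log_def divide_nonpos_neg)
      have "K u y x \<le> ennreal (C\<^sup>2 * (d y x powr 2) / d y x powr (Q + 2 * s))"
        unfolding K_def using b1 d by (intro ennreal_leI divide_right_mono) auto
      also have "C\<^sup>2 * (d y x powr 2) / d y x powr (Q + 2 * s) = C\<^sup>2 * d y x powr (2 - Q - 2 * s)"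
      proof -
        have "2 - Q - 2 * s = 2 - (Q + 2 * s)" by simp
        then have "d y x powr (2 - Q - 2 * s) = d y x powr 2 / d y x powr (Q + 2 * s)" by (simp only: powr_diff)
        then show ?thesis by simp
      qed
      also have "ennreal \<dots> = ennreal (C\<^sup>2) * ennreal (d y x powr (2 - Q - 2 * s))" by (simp add: ennreal_mult)
      finally show ?thesis unfolding k_def using nz \<open>0 \<le> log (1/2) (d y x)\<close>
        by (simp add: d_def add_increasing2)
    next
      case False
      then have "0 \<le> log 2 (d y x)" by simp
      have "K u y x \<le> ennreal ((2 * M)\<^sup>2 / d y x powr (Q + 2 * s))"
        unfolding K_def using b2 d by (intro ennreal_leI divide_right_mono) auto
      also have "(2 * M)\<^sup>2 / d y x powr (Q + 2 * s) = (2 * M)\<^sup>2 * d y x powr (- Q - 2 * s)"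
        using powr_minus_divide[of "d y x" "Q + 2 * s"] by simp
      also have "ennreal \<dots> = ennreal ((2 * M)\<^sup>2) * ennreal (d y x powr (- Q - 2 * s))" by (simp add: ennreal_mult)
      finally show ?thesis unfolding k_def using nz \<open>0 \<le> log 2 (d y x)\<close>
        by (simp add: d_def add_increasing)
    qed
  qed (simp add: K_def)
  \<comment> \<open>The kernel vanishes unless one of the two points lies in the support; the second
    case integrates to the same finite value as the first after exchanging the integrals.\<close>
  have KS: "K u y x \<le> indicator ?S y * k (- y \<odot> x) + indicator ?S x * k (- x \<odot> y)" for x y
  proof (cases "u x = 0 \<and> u y = 0")
    case False
    moreover have "K u y x = K u x y" by (simp add: K_def d_commute power2_commute)
    ultimately show ?thesis using Kk[of y x] Kk[of x y] by (auto simp: add_increasing2 indicator_def)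
  qed (simp add: K_def)
  have meas: "(\<lambda>(y, x). indicator ?S x * k (- x \<odot> y)) \<in> borel_measurable (lborel \<Otimes>\<^sub>M lborel)"
    by measurable
  have one: "(\<integral>\<^sup>+y. \<integral>\<^sup>+x. indicator ?S y * k (- y \<odot> x) \<partial>lborel \<partial>lborel) < \<infinity>"
  proof -
    have "(\<integral>\<^sup>+y. \<integral>\<^sup>+x. indicator ?S y * k (- y \<odot> x) \<partial>lborel \<partial>lborel) = (\<integral>\<^sup>+y. indicator ?S y * (\<integral>\<^sup>+x. k x \<partial>lborel) \<partial>lborel)"
      by (simp add: nn_integral_cmult nn_integral_star)
    also have "\<dots> = (\<integral>\<^sup>+x. k x \<partial>lborel) * emeasure lborel ?S"
      by (subst mult.commute, subst nn_integral_cmult_indicator) auto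
    finally show ?thesis using k_fin emeasure_bounded_finite[OF S] by (simp add: ennreal_mult_less_top)
  qed
  have "E u \<le> (\<integral>\<^sup>+y. \<integral>\<^sup>+x. indicator ?S y * k (- y \<odot> x) + indicator ?S x * k (- x \<odot> y) \<partial>lborel \<partial>lborel)"
    unfolding E_def by (intro nn_integral_mono KS)
  also have "\<dots> = (\<integral>\<^sup>+y. \<integral>\<^sup>+x. indicator ?S y * k (- y \<odot> x) \<partial>lborel \<partial>lborel)
     + (\<integral>\<^sup>+y. \<integral>\<^sup>+x. indicator ?S x * k (- x \<odot> y) \<partial>lborel \<partial>lborel)"
    by (simp add: nn_integral_add)
  also have "(\<integral>\<^sup>+y. \<integral>\<^sup>+x. indicator ?S x * k (- x \<odot> y) \<partial>lborel \<partial>lborel) =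
      (\<integral>\<^sup>+x. \<integral>\<^sup>+y. indicator ?S x * k (- x \<odot> y) \<partial>lborel \<partial>lborel)"
    using lborel_pair.Fubini[OF meas] by simp
  finally show ?thesis using one by (auto intro: le_less_trans simp: ennreal_add_less_top)
qed

section \<open>Ball integrals and local compactness\<close>

definition J :: "real \<Rightarrow> ('a \<Rightarrow> real) \<Rightarrow> 'a \<Rightarrow> real" where
  "J r u y = (\<integral>x. u x * indicator {..<r} (d y x) \<partial>lborel)"

lemma measurable_J [measurable]:
  assumes [measurable]: "u \<in> borel_measurable borel" shows "J r u \<in> borel_measurable borel"
  unfolding J_def by measurable

lemma ball_L1:
  assumes [measurable]: "u \<in> borel_measurable borel" and P: "P u \<le> ennreal A" "0 \<le> A" and r: "0 < r"
  shows "(\<integral>\<^sup>+x. ennreal \<bar>u x\<bar> * indicator {x. d y x < r} x \<partial>lborel) \<le> ennreal (v1 * r powr Q + A)"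
proof -
  have "(\<integral>\<^sup>+x. ennreal \<bar>u x\<bar> * indicator {x. d y x < r} x \<partial>lborel) \<le> ennreal (v1 * r powr Q) + P u"
    using nn_integral_abs_le_threshold[of u lborel "{x. d y x < r}" 1 p] p_gt_2 r
    by (simp add: emeasure_d_ball P_def)
  also have "\<dots> \<le> ennreal (v1 * r powr Q + A)"
    using P v1_pos by (simp add: add_left_mono)
  finally show ?thesis .
qed

lemma indicator_ball: "indicator {..<r} (d y x) = indicator {x. d y x < r} x"
  by (auto simp: indicator_def)

lemma ball_integrable:
  assumes [measurable]: "u \<in> borel_measurable borel" and P: "P u < \<infinity>" and r: "0 < r"
  shows "integrable lborel (\<lambda>x. u x * indicator {..<r} (d y x))"
proof (rule integrableI_bounded)
  have "(\<integral>\<^sup>+x. ennreal (norm (u x * indicator {..<r} (d y x))) \<partial>lborel)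
      = (\<integral>\<^sup>+x. ennreal \<bar>u x\<bar> * indicator {x. d y x < r} x \<partial>lborel)"
    by (intro nn_integral_cong) (auto simp: indicator_def)
  also have "\<dots> < \<infinity>"
    using ball_L1[of u "enn2real (P u)" r y] P r by (simp add: order_le_less_trans[OF _ ennreal_less_top])
  finally show "(\<integral>\<^sup>+x. ennreal (norm (u x * indicator {..<r} (d y x))) \<partial>lborel) < \<infinity>" .
qed measurable

lemma J_bound:
  assumes [measurable]: "u \<in> borel_measurable borel" and P: "P u \<le> ennreal A" "0 \<le> A" and r: "0 < r"
  shows "\<bar>J r u y\<bar> \<le> v1 * r powr Q + A"
proof -
  have Pf: "P u < \<infinity>" using P(1) by (simp add: order_le_less_trans[OF _ ennreal_less_top])
  have "ennreal \<bar>J r u y\<bar> \<le> (\<integral>\<^sup>+x. ennreal (norm (u x * indicator {..<r} (d y x))) \<partial>lborel)"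
    unfolding J_def using integral_norm_bound_ennreal[OF ball_integrable[OF assms(1) Pf r, of y]] by simp
  also have "\<dots> = (\<integral>\<^sup>+x. ennreal \<bar>u x\<bar> * indicator {x. d y x < r} x \<partial>lborel)"
    by (intro nn_integral_cong) (auto simp: indicator_def)
  also have "\<dots> \<le> ennreal (v1 * r powr Q + A)" by (rule ball_L1[OF assms])
  finally show ?thesis using P(2) v1_pos by (subst (asm) ennreal_le_iff) auto
qed

text \<open>\<open>J r u y / (v1 * r powr Q)\<close> is the mean over the ball. The difference
  \<open>u y - u x\<close> is split at the level \<open>r powr s\<close>: where it is larger, its
  square divided by \<open>r powr s\<close> takes over, and the kernel bounds it. The error is of
  order \<open>r powr s\<close>, with the energy density at \<open>y\<close> as the only quantity
  depending on \<open>u\<close>.\<close>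

lemma avg_approx_pointwise:
  assumes [measurable]: "u \<in> borel_measurable borel" and P: "P u < \<infinity>" and r: "0 < r"
  shows "ennreal \<bar>u y - J r u y / (v1 * r powr Q)\<bar> \<le> ennreal (r powr s) + ennreal (r powr s / v1) * (\<integral>\<^sup>+x. K u y x \<partial>lborel)"
proof -
  define V where "V = v1 * r powr Q"
  have V: "0 < V" using v1_pos r by (simp add: V_def)
  let ?B = "{x. d y x < r}"
  have mB: "measure lborel ?B = V" using V r by (simp add: measure_def emeasure_d_ball V_def)
  have iB: "integrable lborel (\<lambda>x. indicator ?B x :: real)"
    using r by (simp add: integrable_indicator_iff emeasure_d_ball)
  have "u y * V - J r u y = (\<integral>x. u y * indicator ?B x - u x * indicator {..<r} (d y x) \<partial>lborel)"
    unfolding J_def using ball_integrable[OF assms, of y] iB mB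
    by (subst Bochner_Integration.integral_diff) auto
  also have "\<dots> = (\<integral>x. (u y - u x) * indicator ?B x \<partial>lborel)"
    by (simp add: indicator_ball left_diff_distrib)
  finally have eq: "u y * V - J r u y = (\<integral>x. (u y - u x) * indicator ?B x \<partial>lborel)" .
  have int: "integrable lborel (\<lambda>x. (u y - u x) * indicator ?B x)"
    using Bochner_Integration.integrable_diff[OF integrable_mult_right[OF iB, of "u y"] ball_integrable[OF assms, of y]]
    by (simp add: indicator_ball left_diff_distrib)
  have "ennreal \<bar>u y * V - J r u y\<bar> \<le> (\<integral>\<^sup>+x. ennreal \<bar>(u y - u x) * indicator ?B x\<bar> \<partial>lborel)"
    unfolding eq using integral_norm_bound_ennreal[OF int] by simp
  also have "\<dots> \<le> (\<integral>\<^sup>+x. ennreal (r powr s) * indicator ?B x + ennreal (r powr (Q + s)) * K u y x \<partial>lborel)"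
  proof (rule nn_integral_mono)
    fix x
    show "ennreal \<bar>(u y - u x) * indicator ?B x\<bar> \<le> ennreal (r powr s) * indicator ?B x + ennreal (r powr (Q + s)) * K u y x"
    proof (cases "x \<in> ?B \<and> x \<noteq> y")
      case True
      then have d: "0 < d y x" by (metis d_eq_0_iff d_nonneg order_le_less)
      define t where "t = r powr s"
      have t: "0 < t" using r by (simp add: t_def)
      define e where "e = \<bar>u y - u x\<bar>"
      have "e \<le> t + e\<^sup>2 / t"
      proof (cases "e \<le> t")
        case True then show ?thesis using t by (simp add: add_increasing2)
      next
        case False
        then have "e * t \<le> e\<^sup>2" using mult_left_mono[of t e e] by (simp add: power2_eq_square e_def)
        then have "e \<le> e\<^sup>2 / t" using t by (simp add: pos_le_divide_eq)
        then show ?thesis using t by linarith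
      qed
      also have "e\<^sup>2 / t \<le> r powr (Q + s) * ((u x - u y)\<^sup>2 / d y x powr (Q + 2 * s))"
      proof -
        have "d y x powr (Q + 2 * s) \<le> r powr (Q + 2 * s)"
          using True Q_pos s_pos by (intro powr_mono2) auto
        also have "r powr (Q + 2 * s) = r powr (Q + s) * t"
          unfolding t_def powr_add[symmetric] by (simp add: algebra_simps)
        finally have "(u x - u y)\<^sup>2 / (r powr (Q + s) * t) \<le> (u x - u y)\<^sup>2 / d y x powr (Q + 2 * s)"
            using d t r True by (intro divide_left_mono mult_pos_pos) auto
        then have "r powr (Q + s) * ((u x - u y)\<^sup>2 / (r powr (Q + s) * t)) \<le> r powr (Q + s) * ((u x - u y)\<^sup>2 / d y x powr (Q + 2 * s))"
          by (rule mult_left_mono) simp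
        moreover have "e\<^sup>2 = (u x - u y)\<^sup>2" by (simp add: e_def power2_commute)
        ultimately show ?thesis using r by simp
      qed
      finally have "ennreal e \<le> ennreal (t + r powr (Q + s) * ((u x - u y)\<^sup>2 / d y x powr (Q + 2 * s)))"
        by (intro ennreal_leI) simp
      also have "\<dots> = ennreal t + ennreal (r powr (Q + s)) * K u y x"
        unfolding K_def using t by (simp flip: ennreal_mult ennreal_plus)
      finally show ?thesis using True by (simp add: e_def t_def)
    qed auto
  qed
  also have "\<dots> = ennreal (r powr s) * ennreal V + ennreal (r powr (Q + s)) * (\<integral>\<^sup>+x. K u y x \<partial>lborel)"
    using r by (simp add: nn_integral_add nn_integral_cmult emeasure_d_ball V_def)
  finally have le: "ennreal \<bar>u y * V - J r u y\<bar> \<le> ennreal (r powr s) * ennreal V + ennreal (r powr (Q + s)) * (\<integral>\<^sup>+x. K u y x \<partial>lborel)" .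
  have "ennreal \<bar>u y - J r u y / V\<bar> = ennreal (1 / V) * ennreal \<bar>u y * V - J r u y\<bar>"
    using V by (simp flip: ennreal_mult add: abs_mult[symmetric] field_simps)
       (simp add: abs_mult field_simps)?
  also have "\<dots> \<le> ennreal (1 / V) * (ennreal (r powr s) * ennreal V + ennreal (r powr (Q + s)) * (\<integral>\<^sup>+x. K u y x \<partial>lborel))"
    by (rule mult_left_mono[OF le]) simp
  also have "\<dots> = ennreal (1 / V * (r powr s * V)) + ennreal (1 / V * r powr (Q + s)) * (\<integral>\<^sup>+x. K u y x \<partial>lborel)"
  proof -
    have "ennreal (1 / V) * (ennreal (r powr s) * ennreal V) = ennreal (1 / V * (r powr s * V))"
      using V by (simp flip: ennreal_mult)
    moreover have "ennreal (1 / V) * (ennreal (r powr (Q + s)) * (\<integral>\<^sup>+x. K u y x \<partial>lborel)) = ennreal (1 / V * r powr (Q + s)) * (\<integral>\<^sup>+x. K u y x \<partial>lborel)"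
      using V by (subst ennreal_mult) (auto simp: mult.assoc)
    ultimately show ?thesis by (simp only: distrib_left)
  qed
  also have "1 / V * (r powr s * V) = r powr s" using V by simp
  also have "1 / V * r powr (Q + s) = r powr s / v1" using r v1_pos by (simp add: V_def powr_add)
  finally show ?thesis by (simp add: V_def)
qed

text \<open>Functions of bounded energy are approximated by their means at scale \<open>r\<close> in
  \<open>L1\<close> on sets of finite measure, at a rate common to all of them. This plays the part
  of a Poincare inequality.\<close>

lemma avg_approx:
  assumes [measurable]: "u \<in> borel_measurable borel" "W \<in> sets borel" and P: "P u < \<infinity>" and r: "0 < r"
  shows "(\<integral>\<^sup>+y. ennreal \<bar>u y - J r u y / (v1 * r powr Q)\<bar> * indicator W y \<partial>lborel)
    \<le> ennreal (r powr s) * emeasure lborel W + ennreal (r powr s / v1) * E u"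
proof -
  have "(\<integral>\<^sup>+y. ennreal \<bar>u y - J r u y / (v1 * r powr Q)\<bar> * indicator W y \<partial>lborel)
    \<le> (\<integral>\<^sup>+y. ennreal (r powr s) * indicator W y + ennreal (r powr s / v1) * (\<integral>\<^sup>+x. K u y x \<partial>lborel) \<partial>lborel)"
    using avg_approx_pointwise[OF assms(1) P r] by (intro nn_integral_mono) (auto simp: indicator_def)
  also have "\<dots> = ennreal (r powr s) * emeasure lborel W + ennreal (r powr s / v1) * E u"
    unfolding E_def by (simp add: nn_integral_add nn_integral_cmult)
  finally show ?thesis .
qed

text \<open>By the triangle inequality the symmetric difference lies in the shell between
  \<open>r - \<eta>\<close> and \<open>r + \<eta>\<close>, whose volume \<open>h \<eta>\<close>
  tends to 0 with \<open>\<eta>\<close>.\<close>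

lemma d_ball_eq_if_close:
  assumes e: "0 < e" and r: "0 < r"
  obtains \<eta> where "0 < \<eta>" and
    "\<And>y y'. d y y' < \<eta> \<Longrightarrow> emeasure lborel ({x. d y x < r} - {x. d y' x < r} \<union> ({x. d y' x < r} - {x. d y x < r})) \<le> ennreal e"
proof -
  define h where "h \<eta> = v1 * (r + \<eta>) powr Q - v1 * (r - \<eta>) powr Q" for \<eta>
  have "isCont h 0" unfolding h_def using r by (intro continuous_intros) auto
  then have "(h \<longlongrightarrow> h 0) (at 0)" by (simp add: isCont_def)
  then have "\<forall>\<^sub>F \<eta> in at 0. dist (h \<eta>) 0 < e" using e by (auto simp: tendsto_iff h_def)
  then obtain \<delta> where \<delta>: "0 < \<delta>" "\<And>\<eta>. \<eta> \<noteq> 0 \<Longrightarrow> \<bar>\<eta>\<bar> < \<delta> \<Longrightarrow> \<bar>h \<eta>\<bar> < e"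
    unfolding eventually_at by (auto simp: dist_real_def)
  define \<eta> where "\<eta> = min (\<delta> / 2) (r / 2)"
  have \<eta>: "0 < \<eta>" "\<eta> < \<delta>" "\<eta> < r" using \<delta> r by (auto simp: \<eta>_def min_def)
  show thesis
  proof (rule that[OF \<eta>(1)])
    fix y y' assume yy: "d y y' < \<eta>"
    let ?D = "{x. d y x < r} - {x. d y' x < r} \<union> ({x. d y' x < r} - {x. d y x < r})"
    have "?D \<subseteq> {x. d y x < r + \<eta>} - {x. d y x < r - \<eta>}"
    proof
      fix x assume x: "x \<in> ?D"
      have "d y x \<le> d y y' + d y' x" "d y' x \<le> d y y' + d y x"
        using d_triangle[of y x y'] d_triangle[of y' x y] d_commute[of y y'] by auto
      then show "x \<in> {x. d y x < r + \<eta>} - {x. d y x < r - \<eta>}" using x yy \<eta> by auto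
    qed
    then have "emeasure lborel ?D \<le> emeasure lborel ({x. d y x < r + \<eta>} - {x. d y x < r - \<eta>})"
      by (rule emeasure_mono) measurable
    also have "\<dots> = emeasure lborel {x. d y x < r + \<eta>} - emeasure lborel {x. d y x < r - \<eta>}"
      using \<eta> r by (intro emeasure_Diff) (auto simp: emeasure_d_ball)
    also have "\<dots> = ennreal (h \<eta>)"
      using \<eta> r v1_pos by (simp add: emeasure_d_ball h_def ennreal_minus)
    also have "\<dots> \<le> ennreal e" using \<delta>(2)[of \<eta>] \<eta> by (intro ennreal_leI) auto
    finally show "emeasure lborel ?D \<le> ennreal e" .
  qed
qed

text \<open>Two ball integrals differ by at most the integral of \<open>|u|\<close> over the
  symmetric difference of the balls, which the threshold bound controls uniformly in
  \<open>u\<close>.\<close>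

lemma J_equicontinuous:
  assumes e: "0 < e" and r: "0 < r" and A: "0 \<le> A"
  obtains \<eta> where "0 < \<eta>" and
    "\<And>u y y'. u \<in> borel_measurable borel \<Longrightarrow> P u \<le> ennreal A \<Longrightarrow> d y y' < \<eta> \<Longrightarrow> \<bar>J r u y - J r u y'\<bar> \<le> e"
proof -
  \<comment> \<open>Makes the tail term \<open>t powr (1 - p) * A\<close> at most
    \<open>e / 2\<close>; the measure of the symmetric difference is then kept below
    \<open>e / (2 * t)\<close>.\<close>
  define t where "t = (2 * (A + 1) / e) powr (1 / (p - 1))"
  have t: "0 < t" using e A by (simp add: t_def)
  have tA: "t powr (1 - p) * A \<le> e / 2"
  proof -
    have "t powr (p - 1) = 2 * (A + 1) / e"
      unfolding t_def powr_powr using p_gt_2 e A by simp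
    then have "t powr (1 - p) = e / (2 * (A + 1))"
      using powr_minus_divide[of t "p - 1"] by simp
    moreover have "e / (2 * (A + 1)) * A \<le> e / 2" using e A by (simp add: field_simps)
    ultimately show ?thesis by simp
  qed
  obtain \<eta> where \<eta>: "0 < \<eta>" "\<And>y y'. d y y' < \<eta> \<Longrightarrow>
    emeasure lborel ({x. d y x < r} - {x. d y' x < r} \<union> ({x. d y' x < r} - {x. d y x < r})) \<le> ennreal (e / (2 * t))"
    using d_ball_eq_if_close[of "e / (2 * t)" r] e r t by auto
  show thesis
  proof (rule that[OF \<eta>(1)])
    fix u y y' assume [measurable]: "u \<in> borel_measurable borel" and P: "P u \<le> ennreal A" and yy: "d y y' < \<eta>"
    let ?D = "{x. d y x < r} - {x. d y' x < r} \<union> ({x. d y' x < r} - {x. d y x < r})"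
    have Pf: "P u < \<infinity>" using P by (simp add: order_le_less_trans[OF _ ennreal_less_top])
    note int = Bochner_Integration.integrable_diff[OF ball_integrable[of u r y] ball_integrable[of u r y']]
    have eq: "J r u y - J r u y' = (\<integral>x. u x * indicator {..<r} (d y x) - u x * indicator {..<r} (d y' x) \<partial>lborel)"
      unfolding J_def using Pf r by (subst Bochner_Integration.integral_diff) (auto intro: ball_integrable)
    have "ennreal \<bar>J r u y - J r u y'\<bar> \<le> (\<integral>\<^sup>+x. ennreal (norm (u x * indicator {..<r} (d y x) - u x * indicator {..<r} (d y' x))) \<partial>lborel)"
      unfolding eq real_norm_def[symmetric] using Pf r by (intro integral_norm_bound_ennreal int) auto
    also have "\<dots> = (\<integral>\<^sup>+x. ennreal \<bar>u x\<bar> * indicator ?D x \<partial>lborel)"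
      by (intro nn_integral_cong) (auto simp: indicator_def)
    also have "\<dots> \<le> ennreal t * emeasure lborel ?D + ennreal (t powr (1 - p)) * P u"
      unfolding P_def using p_gt_2 t by (intro nn_integral_abs_le_threshold) auto
    also have "\<dots> \<le> ennreal t * ennreal (e / (2 * t)) + ennreal (t powr (1 - p)) * ennreal A"
      using \<eta>(2)[OF yy] P by (intro add_mono mult_left_mono) auto
    also have "\<dots> = ennreal (e / 2 + t powr (1 - p) * A)"
      using t e A by (simp flip: ennreal_mult ennreal_plus)
    also have "\<dots> \<le> ennreal e" using tA by (intro ennreal_leI) simp
    finally show "\<bar>J r u y - J r u y'\<bar> \<le> e" using e by simp
  qed
qed

text \<open>A diagonal extraction over pairs of a point of a countable dense set and a radius
  \<open>1 / (m + 1)\<close>; equicontinuity carries the convergence from the dense set to all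
  points.\<close>

lemma J_convergent_subseq:
  fixes u :: "nat \<Rightarrow> 'a \<Rightarrow> real"
  assumes [measurable]: "\<And>k. u k \<in> borel_measurable borel" and P: "\<And>k. P (u k) \<le> ennreal A" and A: "0 \<le> A"
  obtains r where "strict_mono r" "\<And>m y. convergent (\<lambda>k. J (1 / real (Suc m)) (u (r k)) y)"
proof -
  obtain D :: "'a set" where D: "countable D" "\<And>X. open X \<Longrightarrow> X \<noteq> {} \<Longrightarrow> \<exists>d\<in>D. d \<in> X"
    using countable_dense_setE by blast
  have bd: "norm (case z of (y, m) \<Rightarrow> J (1 / real (Suc m)) (u k) y) \<le> v1 + A" for k z
  proof (cases z)
    case (Pair y m)
    have "\<bar>J (1 / real (Suc m)) (u k) y\<bar> \<le> v1 * (1 / real (Suc m)) powr Q + A"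
      by (rule J_bound[OF _ P A]) auto
    also have "v1 * (1 / real (Suc m)) powr Q \<le> v1 * 1"
      using v1_pos Q_pos by (intro mult_left_mono powr_le1) auto
    finally show ?thesis using Pair by simp
  qed
  obtain r where r: "strict_mono (r :: nat \<Rightarrow> nat)"
    "\<And>z. z \<in> D \<times> (UNIV :: nat set) \<Longrightarrow> \<exists>l. (\<lambda>k. case z of (y, m) \<Rightarrow> J (1 / real (Suc m)) (u (r k)) y) \<longlonglongrightarrow> l"
    using function_convergent_subsequence[of "D \<times> (UNIV :: nat set)" "\<lambda>k z. case z of (y, m) \<Rightarrow> J (1 / real (Suc m)) (u k) y" "v1 + A"] D(1) bd
    by (metis countable_SIGMA countableI_type)
  show thesis
  proof (rule that[OF r(1)])
    fix m y
    let ?r = "1 / real (Suc m)"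
    show "convergent (\<lambda>k. J ?r (u (r k)) y)"
    proof (rule Cauchy_convergent, rule metric_CauchyI)
      fix e :: real assume e: "0 < e"
      obtain \<eta> where \<eta>: "0 < \<eta>" and
        H: "\<And>u y y'. u \<in> borel_measurable borel \<Longrightarrow> P u \<le> ennreal A \<Longrightarrow> d y y' < \<eta> \<Longrightarrow> \<bar>J ?r u y - J ?r u y'\<bar> \<le> e / 4"
        using J_equicontinuous[of "e / 4" ?r A] e A by auto
      have "y \<in> {y'. d y y' < \<eta>}" using \<eta> by (simp add: d_eq_0_iff[THEN iffD2])
      then obtain y' where y': "y' \<in> D" "d y y' < \<eta>" using D(2)[OF open_ball_d, of y \<eta>] by auto
      have "Cauchy (\<lambda>k. J ?r (u (r k)) y')"
        using r(2)[of "(y', m)"] y'(1) by (auto intro!: convergent_Cauchy simp: convergent_def)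
      then obtain M where M: "\<And>i j. i \<ge> M \<Longrightarrow> j \<ge> M \<Longrightarrow> dist (J ?r (u (r i)) y') (J ?r (u (r j)) y') < e / 4"
        using metric_CauchyD[of _ "e / 4"] e by (metis divide_pos_pos zero_less_numeral)
      show "\<exists>M. \<forall>i\<ge>M. \<forall>j\<ge>M. dist (J ?r (u (r i)) y) (J ?r (u (r j)) y) < e"
      proof (intro exI[of _ M] allI impI)
        fix i j assume "i \<ge> M" "j \<ge> M"
        then have "\<bar>J ?r (u (r i)) y' - J ?r (u (r j)) y'\<bar> < e / 4" using M by (simp add: dist_real_def)
        moreover have "\<bar>J ?r (u (r i)) y - J ?r (u (r i)) y'\<bar> \<le> e / 4" "\<bar>J ?r (u (r j)) y - J ?r (u (r j)) y'\<bar> \<le> e / 4"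
          using H[OF _ P y'(2)] by auto
        ultimately show "dist (J ?r (u (r i)) y) (J ?r (u (r j)) y) < e"
          using e unfolding dist_real_def by linarith
      qed
    qed
  qed
qed

text \<open>\<open>u i\<close> and \<open>u j\<close> are compared with their means at a common
  small radius: both errors are uniform in the index, and the means converge boundedly on a set of
  finite measure.\<close>

lemma L1_local_Cauchy:
  fixes u :: "nat \<Rightarrow> 'a \<Rightarrow> real"
  assumes [measurable]: "\<And>k. u k \<in> borel_measurable borel" "W \<in> sets borel"
    and P: "\<And>k. P (u k) \<le> ennreal A" and A: "0 \<le> A" and E: "\<And>k. E (u k) \<le> ennreal B" and B: "0 \<le> B"
    and J: "\<And>m y. convergent (\<lambda>k. J (1 / real (Suc m)) (u k) y)"
    and W: "emeasure lborel W < \<infinity>" and e: "0 < e"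
  shows "\<exists>M. \<forall>i\<ge>M. \<forall>j\<ge>M. (\<integral>\<^sup>+y. ennreal \<bar>u i y - u j y\<bar> * indicator W y \<partial>lborel) < ennreal e"
proof -
  define w where "w = measure lborel W"
  have w: "emeasure lborel W = ennreal w" "0 \<le> w"
    using W by (auto simp: w_def emeasure_eq_ennreal_measure)
  \<comment> \<open>\<open>r powr s * c\<close> bounds the distance to the means; the summand 1
    makes \<open>c\<close> positive.\<close>
  define c where "c = w + B / v1 + 1"
  have c: "0 < c" using w B v1_pos by (simp add: c_def add_nonneg_pos)
  have "(\<lambda>m. (1 / real (Suc m)) powr s) \<longlonglongrightarrow> 0 powr s"
    using s_pos by (intro tendsto_powr2 LIMSEQ_inverse_real_of_nat[unfolded inverse_eq_divide] tendsto_const) auto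
  then have "(\<lambda>m. (1 / real (Suc m)) powr s) \<longlonglongrightarrow> 0" by simp
  then have "\<forall>\<^sub>F m in sequentially. (1 / real (Suc m)) powr s < e / (4 * c)"
    using e c by (intro order_tendstoD) auto
  then obtain m where m: "(1 / real (Suc m)) powr s < e / (4 * c)"
    by (auto simp: eventually_sequentially)
  define r where "r = 1 / real (Suc m)"
  have r: "0 < r" "r \<le> 1" by (auto simp: r_def)
  define V where "V = v1 * r powr Q"
  have V: "0 < V" using v1_pos r by (simp add: V_def)
  define a where "a k y = J r (u k) y / V" for k y
  have [measurable]: "a k \<in> borel_measurable borel" for k unfolding a_def by measurable
  have Pf: "P (u k) < \<infinity>" for k using P[of k] by (simp add: order_le_less_trans[OF _ ennreal_less_top])
  have ua: "(\<integral>\<^sup>+y. ennreal \<bar>u k y - a k y\<bar> * indicator W y \<partial>lborel) \<le> ennreal (e / 4)" for k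
  proof -
    have "(\<integral>\<^sup>+y. ennreal \<bar>u k y - a k y\<bar> * indicator W y \<partial>lborel) \<le> ennreal (r powr s) * ennreal w + ennreal (r powr s / v1) * E (u k)"
      unfolding a_def V_def w(1)[symmetric] using r by (intro avg_approx Pf) auto
    also have "\<dots> \<le> ennreal (r powr s) * ennreal w + ennreal (r powr s / v1) * ennreal B"
      using E by (intro add_mono mult_left_mono) auto
    also have "\<dots> = ennreal (r powr s * (w + B / v1))"
      using w v1_pos B by (simp flip: ennreal_mult ennreal_plus add: algebra_simps)
    also have "\<dots> \<le> ennreal (e / 4)"
    proof (rule ennreal_leI)
      have "w + B / v1 \<le> c" "0 \<le> w + B / v1" using w B v1_pos by (auto simp: c_def)
      then have "r powr s * (w + B / v1) \<le> e / (4 * c) * c"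
        using m c e unfolding r_def[symmetric] by (intro mult_mono) auto
      then show "r powr s * (w + B / v1) \<le> e / 4" using c by simp
    qed
    finally show ?thesis .
  qed
  define l where "l y = lim (\<lambda>k. a k y)" for y
  have al: "(\<lambda>k. a k y) \<longlonglongrightarrow> l y" for y
  proof -
    have "(\<lambda>k. a k y) \<longlonglongrightarrow> lim (\<lambda>k. J r (u k) y) / V"
      unfolding a_def using J[of m y] V
      by (intro tendsto_intros) (auto simp: r_def convergent_LIMSEQ_iff)
    then have "convergent (\<lambda>k. a k y)" by (rule convergentI)
    then show ?thesis by (simp add: l_def convergent_LIMSEQ_iff)
  qed
  have [measurable]: "l \<in> borel_measurable borel" unfolding l_def by (rule borel_measurable_lim_metric) simp
  define b where "b = (V + A) / V"
  have ab: "\<bar>a k y\<bar> \<le> b" for k y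
    unfolding a_def b_def abs_divide abs_of_pos[OF V]
    using J_bound[OF _ P A r(1), of k y] V by (intro divide_right_mono) (auto simp: V_def)
  have lb: "\<bar>l y\<bar> \<le> b" for y
    by (rule LIMSEQ_le_const2[OF tendsto_rabs[OF al]]) (use ab in auto)
  have "(\<lambda>k. \<integral>\<^sup>+y. ennreal \<bar>a k y - l y\<bar> * indicator W y \<partial>lborel) \<longlonglongrightarrow> (\<integral>\<^sup>+y. 0 \<partial>(lborel :: 'a measure))"
  proof (rule nn_integral_dominated_convergence[where w = "\<lambda>y. ennreal (2 * b) * indicator W y"])
    show "AE y in lborel. ennreal \<bar>a k y - l y\<bar> * indicator W y \<le> ennreal (2 * b) * indicator W y" for k
    proof (rule AE_I2)
      fix y
      have "\<bar>a k y - l y\<bar> \<le> 2 * b" using ab[of k y] lb[of y] by linarith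
      then show "ennreal \<bar>a k y - l y\<bar> * indicator W y \<le> ennreal (2 * b) * indicator W y"
        by (intro mult_right_mono ennreal_leI) auto
    qed
    show "(\<integral>\<^sup>+y. ennreal (2 * b) * indicator W y \<partial>lborel) < \<infinity>"
      using W by (simp add: nn_integral_cmult_indicator ennreal_mult_less_top)
    show "AE y in lborel. (\<lambda>k. ennreal \<bar>a k y - l y\<bar> * indicator W y) \<longlonglongrightarrow> 0"
    proof (rule AE_I2)
      fix y
      have "(\<lambda>k. \<bar>a k y - l y\<bar>) \<longlonglongrightarrow> 0" using al[of y] by (simp add: LIM_zero tendsto_rabs_zero)
      then have "(\<lambda>k. ennreal \<bar>a k y - l y\<bar>) \<longlonglongrightarrow> ennreal 0" by (intro tendsto_ennrealI)
      then show "(\<lambda>k. ennreal \<bar>a k y - l y\<bar> * indicator W y) \<longlonglongrightarrow> 0" by (auto simp: indicator_def)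
    qed
  qed auto
  then have "\<forall>\<^sub>F k in sequentially. (\<integral>\<^sup>+y. ennreal \<bar>a k y - l y\<bar> * indicator W y \<partial>lborel) < ennreal (e / 8)"
    using e by (intro order_tendstoD) auto
  then obtain M where M: "\<And>k. k \<ge> M \<Longrightarrow> (\<integral>\<^sup>+y. ennreal \<bar>a k y - l y\<bar> * indicator W y \<partial>lborel) \<le> ennreal (e / 8)"
    unfolding eventually_sequentially by (meson less_imp_le)
  show ?thesis
  proof (intro exI[of _ M] allI impI)
    fix i j assume ij: "i \<ge> M" "j \<ge> M"
    let ?I = "\<lambda>f. \<integral>\<^sup>+y. ennreal \<bar>f y\<bar> * indicator W y \<partial>lborel"
    have "?I (\<lambda>y. u i y - u j y) \<le> (\<integral>\<^sup>+y. ennreal \<bar>u i y - a i y\<bar> * indicator W y + (ennreal \<bar>a i y - l y\<bar> * indicator W y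
        + (ennreal \<bar>a j y - l y\<bar> * indicator W y + ennreal \<bar>u j y - a j y\<bar> * indicator W y)) \<partial>lborel)"
      by (intro nn_integral_mono) (auto simp: indicator_def simp flip: ennreal_plus intro!: ennreal_leI)
    also have "\<dots> = ?I (\<lambda>y. u i y - a i y) + (?I (\<lambda>y. a i y - l y) + (?I (\<lambda>y. a j y - l y) + ?I (\<lambda>y. u j y - a j y)))"
      by (simp add: nn_integral_add)
    also have "\<dots> \<le> ennreal (e / 4) + (ennreal (e / 8) + (ennreal (e / 8) + ennreal (e / 4)))"
      using ij by (intro add_mono ua M) auto
    also have "\<dots> = ennreal (3 * e / 4)" using e by (simp flip: ennreal_plus)
    also have "\<dots> < ennreal e" using e by (simp add: ennreal_less_iff)
    finally show "?I (\<lambda>y. u i y - u j y) < ennreal e" .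
  qed
qed

text \<open>The means over balls of a bounded sequence are equicontinuous, so a diagonal subsequence of them
  converges; they approximate the functions in \<open>L\<^sup>1\<close> uniformly along the sequence.\<close>

theorem rellich:
  fixes u :: "nat \<Rightarrow> 'a \<Rightarrow> real"
  assumes [measurable]: "\<And>k. u k \<in> borel_measurable borel"
    and P: "\<And>k. P (u k) \<le> ennreal A" and A: "0 \<le> A" and E: "\<And>k. E (u k) \<le> ennreal B" and B: "0 \<le> B"
  obtains r v where "strict_mono r" "v \<in> borel_measurable borel" "AE x in lborel. (\<lambda>k. u (r k) x) \<longlonglongrightarrow> v x"
proof -
  obtain r0 where r0: "strict_mono r0" "\<And>m y. convergent (\<lambda>k. J (1 / real (Suc m)) (u (r0 k)) y)"
    using J_convergent_subseq[of u A] P A by auto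
  define W where "W n = {x. N x < real n}" for n :: nat
  have [measurable]: "W n \<in> sets borel" for n unfolding W_def by measurable
  define I where "I n i j = (\<integral>\<^sup>+y. ennreal \<bar>u (r0 i) y - u (r0 j) y\<bar> * indicator (W n) y \<partial>lborel)" for n i j
  have C: "\<exists>M. \<forall>i\<ge>M. \<forall>j\<ge>M. I n i j < ennreal e" if "0 < e" for n e
    unfolding I_def using emeasure_N_finite[of "real n"] P A E B r0(2) that
    by (intro L1_local_Cauchy[where A = A and B = B]) (auto simp: W_def[symmetric])
  \<comment> \<open>Indices beyond which the sequence varies by less than \<open>(1 / 2) ^ n\<close>
    in \<open>L1\<close> of the \<open>n\<close>-th ball, so that the increments along
    \<open>r1\<close> are summable.\<close>
  have "\<exists>r1. \<forall>n. (\<forall>i\<ge>r1 n. \<forall>j\<ge>r1 n. I n i j < ennreal ((1 / 2) ^ n)) \<and> (r1 n :: nat) < r1 (Suc n)"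
  proof (intro dependent_nat_choice, goal_cases)
    case 1
    show ?case using C[of "(1/2) ^ 0" 0] by simp
  next
    case (2 x n)
    obtain M where M: "\<forall>i\<ge>M. \<forall>j\<ge>M. I (Suc n) i j < ennreal ((1 / 2) ^ Suc n)"
      using C[of "(1 / 2) ^ Suc n" "Suc n"] by auto
    show ?case by (rule exI[of _ "max M (Suc x)"]) (use M in auto)
  qed
  then obtain r1 where r1: "\<And>n i j. i \<ge> r1 n \<Longrightarrow> j \<ge> r1 n \<Longrightarrow> I n i j < ennreal ((1 / 2) ^ n)" "strict_mono r1"
    by (auto simp: strict_mono_Suc_iff)
  define r where "r = r0 \<circ> r1"
  have r: "strict_mono r" unfolding r_def using r0(1) r1(2) by (rule strict_mono_o)
  define g where "g k x = ennreal (\<bar>u (r (Suc k)) x - u (r k) x\<bar> * indicator (W k) x)" for k x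
  have [measurable]: "g k \<in> borel_measurable borel" for k unfolding g_def by measurable
  have "(\<integral>\<^sup>+x. (\<Sum>k. g k x) \<partial>lborel) = (\<Sum>k. \<integral>\<^sup>+x. g k x \<partial>lborel)"
    by (rule nn_integral_suminf) simp
  also have "\<dots> \<le> (\<Sum>k. ennreal ((1 / 2) ^ k))"
  proof (intro suminf_le summableI)
    fix k
    have "(\<integral>\<^sup>+x. g k x \<partial>lborel) = I k (r1 (Suc k)) (r1 k)"
      unfolding g_def I_def r_def by (intro nn_integral_cong) (auto simp: indicator_def)
    also have "\<dots> \<le> ennreal ((1 / 2) ^ k)"
      using strict_monoD[OF r1(2), of k "Suc k"] by (intro less_imp_le[OF r1(1)]) auto
    finally show "(\<integral>\<^sup>+x. g k x \<partial>lborel) \<le> ennreal ((1 / 2) ^ k)" .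
  qed
  also have "\<dots> = ennreal (1 / (1 - 1 / 2))"
    by (intro suminf_ennreal_eq geometric_sums) auto
  finally have "(\<integral>\<^sup>+x. (\<Sum>k. g k x) \<partial>lborel) \<noteq> \<infinity>" by (auto simp: top_unique)
  then have "AE x in lborel. (\<Sum>k. g k x) \<noteq> \<infinity>"
    by (intro nn_integral_PInf_AE) auto
  then have conv: "AE x in lborel. convergent (\<lambda>k. u (r k) x)"
  proof eventually_elim
    case (elim x)
    obtain n :: nat where n: "N x < real n" using reals_Archimedean2 by blast
    have sm: "summable (\<lambda>k. \<bar>u (r (Suc k)) x - u (r k) x\<bar> * indicator (W k) x)"
      using elim unfolding g_def by (intro summable_suminf_not_top) auto
    \<comment> \<open>For fixed \<open>x\<close> all but finitely many of the balls contain it, so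
      the indicators do not affect summability.\<close>
    have ev: "\<forall>\<^sub>F k in sequentially. \<bar>u (r (Suc k)) x - u (r k) x\<bar> * indicator (W k) x = norm (u (r (Suc k)) x - u (r k) x)"
      unfolding eventually_sequentially
    proof (intro exI[of _ n] allI impI)
      fix k assume "n \<le> k"
      then have "N x < real k" using n by linarith
      then show "\<bar>u (r (Suc k)) x - u (r k) x\<bar> * indicator (W k) x = norm (u (r (Suc k)) x - u (r k) x)"
        by (simp add: W_def)
    qed
    have "summable (\<lambda>k. norm (u (r (Suc k)) x - u (r k) x))"
      using sm unfolding summable_cong[OF ev] .
    then have "summable (\<lambda>k. u (r (Suc k)) x - u (r k) x)" by (rule summable_norm_cancel)
    then have "convergent (\<lambda>n. \<Sum>k<n. u (r (Suc k)) x - u (r k) x)" by (simp add: summable_iff_convergent)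
    then have "convergent (\<lambda>n. u (r n) x - u (r 0) x)" by (simp only: sum_lessThan_telescope[of "\<lambda>k. u (r k) x"])
    from convergent_add[OF this convergent_const[of "u (r 0) x"]]
    show ?case by simp
  qed
  define v where "v x = lim (\<lambda>k. u (r k) x)" for x
  have "v \<in> borel_measurable borel" unfolding v_def by (rule borel_measurable_lim_metric) simp
  moreover have "AE x in lborel. (\<lambda>k. u (r k) x) \<longlonglongrightarrow> v x"
    using conv by eventually_elim (simp add: v_def convergent_LIMSEQ_iff)
  ultimately show thesis using that r by blast
qed

section \<open>Semicontinuity, scaling and splitting of mass and energy\<close>

lemma E_Fatou:
  fixes u :: "nat \<Rightarrow> 'a \<Rightarrow> real"
  assumes [measurable]: "\<And>k. u k \<in> borel_measurable borel" "v \<in> borel_measurable borel"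
    and lim: "AE x in lborel. (\<lambda>k. u k x) \<longlonglongrightarrow> v x"
  shows "E v \<le> liminf (\<lambda>k. E (u k))"
proof -
  have K: "K v y x \<le> liminf (\<lambda>k. K (u k) y x)"
    if "(\<lambda>k. u k x) \<longlonglongrightarrow> v x" "(\<lambda>k. u k y) \<longlonglongrightarrow> v y" for x y
  proof -
    have "(\<lambda>k. (u k x - u k y)\<^sup>2 / d y x powr (Q + 2 * s)) \<longlonglongrightarrow> (v x - v y)\<^sup>2 / d y x powr (Q + 2 * s)"
      using that by (cases "x = y") (auto intro!: tendsto_intros)
    then have "(\<lambda>k. K (u k) y x) \<longlonglongrightarrow> K v y x" unfolding K_def by (rule tendsto_ennrealI)
    then show ?thesis by (simp add: lim_imp_Liminf)
  qed
  have "E v \<le> (\<integral>\<^sup>+y. liminf (\<lambda>k. \<integral>\<^sup>+x. K (u k) y x \<partial>lborel) \<partial>lborel)"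
    unfolding E_def
  proof (rule nn_integral_mono_AE)
    show "AE y in lborel. (\<integral>\<^sup>+x. K v y x \<partial>lborel) \<le> liminf (\<lambda>k. \<integral>\<^sup>+x. K (u k) y x \<partial>lborel)"
      using lim
    proof eventually_elim
      case (elim y)
      have "(\<integral>\<^sup>+x. K v y x \<partial>lborel) \<le> (\<integral>\<^sup>+x. liminf (\<lambda>k. K (u k) y x) \<partial>lborel)"
        by (rule nn_integral_mono_AE) (use lim in eventually_elim, use K elim in auto)
      also have "\<dots> \<le> liminf (\<lambda>k. \<integral>\<^sup>+x. K (u k) y x \<partial>lborel)"
        by (rule nn_integral_liminf) simp
      finally show ?case .
    qed
  qed
  also have "\<dots> \<le> liminf (\<lambda>k. E (u k))"
    unfolding E_def by (rule nn_integral_liminf) simp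
  finally show ?thesis .
qed

lemma P_Fatou:
  fixes u :: "nat \<Rightarrow> 'a \<Rightarrow> real"
  assumes [measurable]: "\<And>k. u k \<in> borel_measurable borel" "v \<in> borel_measurable borel"
    and lim: "AE x in lborel. (\<lambda>k. u k x) \<longlonglongrightarrow> v x"
  shows "P v \<le> liminf (\<lambda>k. P (u k))"
proof -
  have "P v \<le> (\<integral>\<^sup>+x. liminf (\<lambda>k. ennreal (\<bar>u k x\<bar> powr p)) \<partial>lborel)"
    unfolding P_def
  proof (rule nn_integral_mono_AE, use lim in eventually_elim)
    fix x assume "(\<lambda>k. u k x) \<longlonglongrightarrow> v x"
    then have "(\<lambda>k. ennreal (\<bar>u k x\<bar> powr p)) \<longlonglongrightarrow> ennreal (\<bar>v x\<bar> powr p)"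
      using p_gt_2 by (intro tendsto_ennrealI tendsto_powr2 tendsto_intros) auto
    from lim_imp_Liminf[OF trivial_limit_sequentially this]
    show "ennreal (\<bar>v x\<bar> powr p) \<le> liminf (\<lambda>k. ennreal (\<bar>u k x\<bar> powr p))" by simp
  qed
  also have "\<dots> \<le> liminf (\<lambda>k. P (u k))"
    unfolding P_def by (rule nn_integral_liminf) simp
  finally show ?thesis .
qed

lemma P_scale: "P (\<lambda>x. a * u x) = ennreal (\<bar>a\<bar> powr p) * P u" if [measurable]: "u \<in> borel_measurable borel"
  unfolding P_def by (subst nn_integral_cmult[symmetric]) (auto simp: abs_mult powr_mult ennreal_mult)

lemma E_scale: "E (\<lambda>x. a * u x) = ennreal (a\<^sup>2) * E u" if [measurable]: "u \<in> borel_measurable borel"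
proof -
  have "K (\<lambda>x. a * u x) y x = ennreal (a\<^sup>2) * K u y x" for x y
    unfolding K_def by (simp flip: ennreal_mult right_diff_distrib add: power_mult_distrib)
  then have "E (\<lambda>x. a * u x) = (\<integral>\<^sup>+y. \<integral>\<^sup>+x. ennreal (a\<^sup>2) * K u y x \<partial>lborel \<partial>lborel)"
    unfolding E_def by (intro nn_integral_cong)
  then show ?thesis unfolding E_def by (simp add: nn_integral_cmult)
qed

lemma E_minus: "E (\<lambda>x. u x - v x) = E (\<lambda>x. v x - u x)"
  unfolding E_def K_def by (simp add: power2_commute algebra_simps)

lemma P_minus: "P (\<lambda>x. u x - v x) = P (\<lambda>x. v x - u x)"
  unfolding P_def by (simp add: abs_minus_commute)

lemma P_add_le:
  assumes [measurable]: "u \<in> borel_measurable borel" "v \<in> borel_measurable borel"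
  shows "P (\<lambda>x. u x - v x) \<le> ennreal (2 powr p) * (P u + P v)"
proof -
  have "P (\<lambda>x. u x - v x) \<le> (\<integral>\<^sup>+x. ennreal (2 powr p) * (ennreal (\<bar>u x\<bar> powr p) + ennreal (\<bar>v x\<bar> powr p)) \<partial>lborel)"
    unfolding P_def using powr_add_le[of p] p_gt_2
    by (intro nn_integral_mono) (auto simp flip: ennreal_mult ennreal_plus intro!: ennreal_leI)
  then show ?thesis unfolding P_def by (simp add: nn_integral_cmult nn_integral_add)
qed

text \<open>From \<open>(a + b)^2 \<le> (1 + t) * a^2 + (1 + 1 / t) * b^2\<close>. A factor at
  \<open>E v\<close> that may be chosen close to 1 preserves the sharp Sobolev constant under
  approximation.\<close>

lemma E_diff_le:
  assumes [measurable]: "u \<in> borel_measurable borel" "v \<in> borel_measurable borel" and t: "0 < t"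
  shows "E u \<le> ennreal (1 + t) * E v + ennreal (1 + 1 / t) * E (\<lambda>x. u x - v x)"
proof -
  have K: "K u y x \<le> ennreal (1 + t) * K v y x + ennreal (1 + 1 / t) * K (\<lambda>x. u x - v x) y x" for x y
  proof -
    define a b where "a = v x - v y" and "b = (u x - v x) - (u y - v y)"
    have "0 \<le> (t * a - b)\<^sup>2" by simp
    then have "2 * t * a * b \<le> t\<^sup>2 * a\<^sup>2 + b\<^sup>2" by (simp add: power2_diff power_mult_distrib algebra_simps)
    then have "2 * a * b \<le> t * a\<^sup>2 + b\<^sup>2 / t" using t by (simp add: field_simps power2_eq_square)
    then have "(a + b)\<^sup>2 \<le> (1 + t) * a\<^sup>2 + (1 + 1 / t) * b\<^sup>2"
      by (simp add: power2_sum algebra_simps)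
    moreover have "u x - u y = a + b" by (simp add: a_def b_def)
    ultimately have "(u x - u y)\<^sup>2 / d y x powr (Q + 2 * s)
      \<le> ((1 + t) * a\<^sup>2 + (1 + 1 / t) * b\<^sup>2) / d y x powr (Q + 2 * s)" by (intro divide_right_mono) auto
    also have "\<dots> = (1 + t) * (a\<^sup>2 / d y x powr (Q + 2 * s)) + (1 + 1 / t) * (b\<^sup>2 / d y x powr (Q + 2 * s))"
      by (simp add: add_divide_distrib)
    finally show ?thesis unfolding K_def a_def[symmetric] b_def[symmetric] using t
      by (simp flip: ennreal_mult ennreal_plus add: ennreal_leI)
  qed
  have "E u \<le> (\<integral>\<^sup>+y. \<integral>\<^sup>+x. ennreal (1 + t) * K v y x + ennreal (1 + 1 / t) * K (\<lambda>x. u x - v x) y x \<partial>lborel \<partial>lborel)"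
    unfolding E_def by (intro nn_integral_mono K)
  then show ?thesis unfolding E_def by (simp add: nn_integral_cmult nn_integral_add)
qed

text \<open>Taken about a third function \<open>w\<close>, because the minimisation in
  \<open>Dir_of_AE_limit\<close> measures distances to a limit that is not known to lie in the
  space.\<close>

lemma E_parallelogram:
  assumes [measurable]: "u \<in> borel_measurable borel" "v \<in> borel_measurable borel" "w \<in> borel_measurable borel"
  shows "E (\<lambda>x. u x - v x) + 4 * E (\<lambda>x. (u x + v x) / 2 - w x)
    = 2 * E (\<lambda>x. u x - w x) + 2 * E (\<lambda>x. v x - w x)"
proof -
  have K: "K (\<lambda>x. u x - v x) y x + 4 * K (\<lambda>x. (u x + v x) / 2 - w x) y x
    = 2 * K (\<lambda>x. u x - w x) y x + 2 * K (\<lambda>x. v x - w x) y x" for x y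
  proof -
    define D where "D = d y x powr (Q + 2 * s)"
    have D: "0 \<le> D" by (simp add: D_def)
    define a b where "a = (u x - w x) - (u y - w y)" and "b = (v x - w x) - (v y - w y)"
    have 1: "u x - v x - (u y - v y) = a - b" "(u x + v x) / 2 - w x - ((u y + v y) / 2 - w y) = (a + b) / 2"
      by (simp_all add: a_def b_def field_simps)
    have "(a - b)\<^sup>2 / D + 4 * (((a + b) / 2)\<^sup>2 / D) = 2 * (a\<^sup>2 / D) + 2 * (b\<^sup>2 / D)"
      by (simp add: power2_eq_square algebra_simps add_divide_distrib diff_divide_distrib)
    then have "ennreal ((a - b)\<^sup>2 / D) + ennreal 4 * ennreal (((a + b) / 2)\<^sup>2 / D)
        = ennreal 2 * ennreal (a\<^sup>2 / D) + ennreal 2 * ennreal (b\<^sup>2 / D)"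
      using D by (simp only: ennreal_mult[symmetric] ennreal_plus[symmetric] zero_le_power2 divide_nonneg_nonneg zero_le_numeral mult_nonneg_nonneg)
    then show ?thesis unfolding K_def D_def[symmetric] 1 a_def[symmetric] b_def[symmetric] by simp
  qed
  have "E (\<lambda>x. u x - v x) + 4 * E (\<lambda>x. (u x + v x) / 2 - w x)
    = (\<integral>\<^sup>+y. \<integral>\<^sup>+x. K (\<lambda>x. u x - v x) y x + 4 * K (\<lambda>x. (u x + v x) / 2 - w x) y x \<partial>lborel \<partial>lborel)"
    unfolding E_def by (simp add: nn_integral_cmult nn_integral_add)
  also have "\<dots> = 2 * E (\<lambda>x. u x - w x) + 2 * E (\<lambda>x. v x - w x)"
    unfolding E_def K by (simp add: nn_integral_cmult nn_integral_add)
  finally show ?thesis .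
qed

text \<open>Translations preserve \<open>d\<close> and dilations multiply it, so the amplitude
  \<open>r powr (Q / p)\<close> has to balance two volume factors and the kernel: the total exponent
  \<open>2 * Q / p + 2 * s - Q\<close> is 0. The same amplitude preserves \<open>P\<close>.\<close>

lemma E_rescale:
  assumes [measurable]: "u \<in> borel_measurable borel" and r: "0 < r"
  shows "E (\<lambda>x. r powr (Q / p) * u (a \<odot> dl r x)) = E u"
proof -
  have [measurable]: "dl r \<in> borel_measurable borel" using r by (rule measurable_dl)
  define c where "c = r powr (2 * Q / p) * r powr (Q + 2 * s)"
  have K: "K (\<lambda>x. r powr (Q / p) * u (a \<odot> dl r x)) y x = ennreal c * K u (a \<odot> dl r y) (a \<odot> dl r x)" for x y
  proof -
    have dd: "d (a \<odot> dl r y) (a \<odot> dl r x) = r * d y x" using r by simp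
    have "(r powr (Q / p) * u (a \<odot> dl r x) - r powr (Q / p) * u (a \<odot> dl r y))\<^sup>2 / d y x powr (Q + 2 * s)
      = (r powr (Q / p))\<^sup>2 * (u (a \<odot> dl r x) - u (a \<odot> dl r y))\<^sup>2 / d y x powr (Q + 2 * s)"
      by (simp flip: right_diff_distrib power_mult_distrib)
    also have "(r powr (Q / p))\<^sup>2 = r powr (2 * Q / p)"
      using r by (simp add: power2_eq_square flip: powr_add)
    also have "r powr (2 * Q / p) * (u (a \<odot> dl r x) - u (a \<odot> dl r y))\<^sup>2 / d y x powr (Q + 2 * s)
       = c * ((u (a \<odot> dl r x) - u (a \<odot> dl r y))\<^sup>2 / (r * d y x) powr (Q + 2 * s))"
      using r by (simp add: c_def powr_mult)
    finally have fin: "(r powr (Q / p) * u (a \<odot> dl r x) - r powr (Q / p) * u (a \<odot> dl r y))\<^sup>2 / d y x powr (Q + 2 * s)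
      = c * ((u (a \<odot> dl r x) - u (a \<odot> dl r y))\<^sup>2 / (r * d y x) powr (Q + 2 * s))" .
    show ?thesis unfolding K_def dd fin by (rule ennreal_mult) (auto simp: c_def)
  qed
  have inner: "(\<integral>\<^sup>+x. K u z (a \<odot> dl r x) \<partial>lborel) = ennreal (r powr - Q) * (\<integral>\<^sup>+x. K u z x \<partial>lborel)" for z
    using nn_integral_dl[OF r, of "\<lambda>x. K u z (a \<odot> x)"] nn_integral_star[of "\<lambda>x. K u z x" a] by simp
  have outer: "(\<integral>\<^sup>+y. (\<integral>\<^sup>+x. K u (a \<odot> dl r y) x \<partial>lborel) \<partial>lborel) = ennreal (r powr - Q) * E u"
    using nn_integral_dl[OF r, of "\<lambda>y. \<integral>\<^sup>+x. K u (a \<odot> y) x \<partial>lborel"] nn_integral_star[of "\<lambda>y. \<integral>\<^sup>+x. K u y x \<partial>lborel" a]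
    by (simp add: E_def)
  have "E (\<lambda>x. r powr (Q / p) * u (a \<odot> dl r x)) = ennreal c * (ennreal (r powr - Q) * (ennreal (r powr - Q) * E u))"
    unfolding E_def[of "\<lambda>x. r powr (Q / p) * u (a \<odot> dl r x)"] K
    by (simp add: nn_integral_cmult inner outer)
  also have "\<dots> = ennreal (c * (r powr - Q * r powr - Q)) * E u"
    by (simp add: c_def ennreal_mult mult.assoc)
  also have "c * (r powr - Q * r powr - Q) = r powr (2 * Q / p + 2 * s - Q)"
    unfolding c_def by (simp flip: powr_add)
  also have "2 * Q / p + 2 * s - Q = 0" unfolding p_def using Q_gt Q_pos by (simp add: field_simps)
  finally show ?thesis using r by simp
qed

lemma P_rescale:
  assumes [measurable]: "u \<in> borel_measurable borel" and r: "0 < r"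
  shows "P (\<lambda>x. r powr (Q / p) * u (a \<odot> dl r x)) = P u"
proof -
  have [measurable]: "dl r \<in> borel_measurable borel" using r by (rule measurable_dl)
  have "P (\<lambda>x. r powr (Q / p) * u (a \<odot> dl r x)) = ennreal ((r powr (Q / p)) powr p) * P (\<lambda>x. u (a \<odot> dl r x))"
    by (subst P_scale) auto
  also have "P (\<lambda>x. u (a \<odot> dl r x)) = ennreal (r powr - Q) * P u"
    unfolding P_def using nn_integral_dl[OF r, of "\<lambda>x. ennreal (\<bar>u (a \<odot> x)\<bar> powr p)"]
      nn_integral_star[of "\<lambda>x. ennreal (\<bar>u x\<bar> powr p)" a] by simp
  also have "ennreal ((r powr (Q / p)) powr p) * (ennreal (r powr - Q) * P u) = P u"
    using r p_gt_2 by (simp add: powr_powr flip: mult.assoc ennreal_mult powr_add)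
  finally show ?thesis .
qed

text \<open>Carries the integral over an arbitrary ball to the unit ball, which fixes the place and
  the scale of a concentrating sequence.\<close>

lemma L1_rescale:
  assumes [measurable]: "u \<in> borel_measurable borel" and r: "0 < r"
  shows "(\<integral>\<^sup>+x. ennreal \<bar>r powr (Q / p) * u (a \<odot> dl r x)\<bar> * indicator {x. N x < 1} x \<partial>lborel)
    = ennreal (r powr (Q / p - Q)) * (\<integral>\<^sup>+x. ennreal \<bar>u x\<bar> * indicator {x. d a x < r} x \<partial>lborel)"
proof -
  have [measurable]: "dl r \<in> borel_measurable borel" using r by (rule measurable_dl)
  have "(\<integral>\<^sup>+x. ennreal \<bar>r powr (Q / p) * u (a \<odot> dl r x)\<bar> * indicator {x. N x < 1} x \<partial>lborel)
    = (\<integral>\<^sup>+x. ennreal (r powr (Q / p)) * (ennreal \<bar>u (a \<odot> dl r x)\<bar> * indicator {z. d a z < r} (a \<odot> dl r x)) \<partial>lborel)"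
    using r by (intro nn_integral_cong) (auto simp: indicator_def d_def abs_mult ennreal_mult)
  also have "\<dots> = ennreal (r powr (Q / p)) * (\<integral>\<^sup>+x. ennreal \<bar>u (a \<odot> dl r x)\<bar> * indicator {z. d a z < r} (a \<odot> dl r x) \<partial>lborel)"
    by (rule nn_integral_cmult) measurable
  also have "(\<integral>\<^sup>+x. ennreal \<bar>u (a \<odot> dl r x)\<bar> * indicator {z. d a z < r} (a \<odot> dl r x) \<partial>lborel)
     = ennreal (r powr - Q) * (\<integral>\<^sup>+x. ennreal \<bar>u x\<bar> * indicator {x. d a x < r} x \<partial>lborel)"
    using nn_integral_dl[OF r, of "\<lambda>x. ennreal \<bar>u (a \<odot> x)\<bar> * indicator {z. d a z < r} (a \<odot> x)"]
      nn_integral_star[of "\<lambda>x. ennreal \<bar>u x\<bar> * indicator {z. d a z < r} x" a] by simp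
  finally show ?thesis using r by (simp flip: mult.assoc ennreal_mult powr_add)
qed

text \<open>Puts the energy into the form of a squared \<open>L2\<close> norm of difference
  quotients on the product space, to which the Brezis-Lieb lemma with exponent 2 applies.\<close>

lemma E_eq_pair:
  assumes [measurable]: "u \<in> borel_measurable borel"
  shows "E u = (\<integral>\<^sup>+z. ennreal (\<bar>(u (snd z) - u (fst z)) / d (fst z) (snd z) powr (Q / 2 + s)\<bar> powr 2) \<partial>(lborel \<Otimes>\<^sub>M lborel))"
proof -
  have "ennreal (\<bar>(u x - u y) / d y x powr (Q / 2 + s)\<bar> powr 2) = K u y x" for x y
  proof -
    have "(d y x powr (Q / 2 + s))\<^sup>2 = d y x powr (Q + 2 * s)"
      by (simp add: power2_eq_square flip: powr_add)
    then show ?thesis by (simp add: K_def power_divide)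
  qed
  then show ?thesis unfolding E_def
    by (subst lborel.nn_integral_fst[symmetric]) auto
qed

lemma E_brezis_lieb:
  fixes u :: "nat \<Rightarrow> 'a \<Rightarrow> real"
  assumes [measurable]: "\<And>k. u k \<in> borel_measurable borel" "v \<in> borel_measurable borel"
    and lim: "AE x in lborel. (\<lambda>k. u k x) \<longlonglongrightarrow> v x" and bd: "\<And>k. E (u k) \<le> ennreal B"
  shows "(\<lambda>k. enn2real (E (u k)) - enn2real (E (\<lambda>x. u k x - v x))) \<longlonglongrightarrow> enn2real (E v)"
proof -
  let ?M = "lborel \<Otimes>\<^sub>M lborel :: ('a \<times> 'a) measure"
  define T where "T w z = (w (snd z) - w (fst z)) / d (fst z) (snd z) powr (Q / 2 + s)" for w :: "'a \<Rightarrow> real" and z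
  have [measurable]: "T w \<in> borel_measurable ?M" if [measurable]: "w \<in> borel_measurable borel" for w
    unfolding T_def by measurable
  have ET: "E w = (\<integral>\<^sup>+z. ennreal (\<bar>T w z\<bar> powr 2) \<partial>?M)" if "w \<in> borel_measurable borel" for w
    unfolding T_def using E_eq_pair[OF that] .
  have Er: "enn2real (E w) = (\<integral>z. \<bar>T w z\<bar> powr 2 \<partial>?M)" if [measurable]: "w \<in> borel_measurable borel" for w
    unfolding ET[OF that] by (subst integral_eq_nn_integral) auto
  have TD: "T (\<lambda>x. u k x - v x) z = T (u k) z - T v z" for k z
    by (simp add: T_def diff_divide_distrib[symmetric] algebra_simps)
  \<comment> \<open>A null set containing the points of non-convergence; almost every pair has both
    coordinates outside it.\<close>
  obtain Z where Z: "{x. \<not> (\<lambda>k. u k x) \<longlonglongrightarrow> v x} \<subseteq> Z" "Z \<in> null_sets lborel"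
    using AE_E[OF lim] by (auto simp: null_sets_def)
  have [measurable]: "Z \<in> sets borel" using Z(2) by auto
  have [measurable]: "{z \<in> space ?M. fst z \<notin> Z} \<in> sets ?M" "{z \<in> space ?M. snd z \<notin> Z} \<in> sets ?M"
    by measurable
  have "AE z in ?M. fst z \<notin> Z"
  proof (rule lborel_pair.AE_pair_measure)
    show "AE x in lborel. AE y in lborel. fst (x, y) \<notin> Z" using AE_not_in[OF Z(2)] by eventually_elim simp
  qed measurable
  moreover have "AE z in ?M. snd z \<notin> Z"
  proof (rule lborel_pair.AE_pair_measure)
    show "AE x in lborel. AE y in lborel. snd (x, y) \<notin> Z" using AE_not_in[OF Z(2)] by simp
  qed measurable
  ultimately have limT: "AE z in ?M. (\<lambda>k. T (u k) z) \<longlonglongrightarrow> T v z"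
  proof eventually_elim
    case (elim z)
    then have "(\<lambda>k. u k (fst z)) \<longlonglongrightarrow> v (fst z)" "(\<lambda>k. u k (snd z)) \<longlonglongrightarrow> v (snd z)" using Z(1) by auto
    then show ?case unfolding T_def by (cases "fst z = snd z") (auto intro!: tendsto_intros)
  qed
  have bdT: "(\<integral>\<^sup>+z. ennreal (\<bar>T (u k) z\<bar> powr 2) \<partial>?M) \<le> ennreal B" for k
    using bd[of k] unfolding ET[OF assms(1)] .
  have "(\<lambda>k. (\<integral>z. \<bar>T (u k) z\<bar> powr 2 \<partial>?M) - (\<integral>z. \<bar>T (u k) z - T v z\<bar> powr 2 \<partial>?M)) \<longlonglongrightarrow> (\<integral>z. \<bar>T v z\<bar> powr 2 \<partial>?M)"
    by (rule brezis_lieb(1)[OF _ _ _ bdT limT]) auto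
  then show ?thesis by (simp add: Er TD)
qed

end

section \<open>Extremal functions\<close>

text \<open>\<open>T\<close> stands for the test functions in exponential coordinates. Invariance
  under translations and dilations keeps a renormalised maximising sequence in \<open>T\<close>; the
  Lipschitz bound with respect to \<open>N\<close> gives finite energy.\<close>

locale homogeneous_model_test = homogeneous_model star dl N Q s
  for star :: "'a::euclidean_space \<Rightarrow> 'a \<Rightarrow> 'a" (infixl "\<odot>" 70)
    and dl :: "real \<Rightarrow> 'a \<Rightarrow> 'a" and N :: "'a \<Rightarrow> real" and Q s :: real +
  fixes T :: "('a \<Rightarrow> real) set"
  assumes T_continuous: "u \<in> T \<Longrightarrow> continuous_on UNIV u"
    and T_bounded: "u \<in> T \<Longrightarrow> bounded {x. u x \<noteq> 0}"
    and T_linear: "u \<in> T \<Longrightarrow> v \<in> T \<Longrightarrow> (\<lambda>x. a * u x + b * v x) \<in> T"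
    and T_star: "u \<in> T \<Longrightarrow> (\<lambda>x. u (z \<odot> x)) \<in> T"
    and T_dl: "u \<in> T \<Longrightarrow> 0 < l \<Longrightarrow> (\<lambda>x. u (dl l x)) \<in> T"
    and T_Lipschitz: "u \<in> T \<Longrightarrow> \<exists>C. \<forall>x y. \<bar>u x - u y\<bar> \<le> C * N (- y \<odot> x)"
    and T_nonzero: "\<exists>u\<in>T. \<exists>x. u x \<noteq> 0"
begin

lemma T_measurable: "u \<in> T \<Longrightarrow> u \<in> borel_measurable borel"
  by (rule borel_measurable_continuous_onI[OF T_continuous])

lemma T_diff: "u \<in> T \<Longrightarrow> v \<in> T \<Longrightarrow> (\<lambda>x. u x - v x) \<in> T"
  using T_linear[of u v 1 "-1"] by simp

lemma T_scale: "u \<in> T \<Longrightarrow> (\<lambda>x. a * u x) \<in> T"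
  using T_linear[of u u a 0] by simp

lemma T_bound: assumes "u \<in> T" obtains M where "0 \<le> M" "\<And>x. \<bar>u x\<bar> \<le> M"
proof -
  have "compact (closure {x. u x \<noteq> 0})" using T_bounded[OF assms] by (simp add: compact_closure)
  then have "compact (u ` closure {x. u x \<noteq> 0})"
    by (intro compact_continuous_image continuous_on_subset[OF T_continuous[OF assms]]) auto
  then have "bounded (u ` closure {x. u x \<noteq> 0})" by (rule compact_imp_bounded)
  then obtain M where M: "\<forall>y \<in> u ` closure {x. u x \<noteq> 0}. norm y \<le> M"
    unfolding bounded_iff ..
  have "\<bar>u x\<bar> \<le> max M 0" for x
  proof (cases "u x = 0")
    case False
    then have "x \<in> closure {x. u x \<noteq> 0}" by (intro subsetD[OF closure_subset]) simp
    then have "u x \<in> u ` closure {x. u x \<noteq> 0}" by (rule imageI)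
    then show ?thesis using bspec[OF M, of "u x"] by simp
  qed simp
  then show thesis using that[of "max M 0"] by simp
qed

lemma T_E: assumes "u \<in> T" shows "E u < \<infinity>"
proof -
  obtain M where "\<And>x. \<bar>u x\<bar> \<le> M" using T_bound[OF assms] by metis
  moreover obtain C where "\<And>x y. \<bar>u x - u y\<bar> \<le> C * d y x" using T_Lipschitz[OF assms] unfolding d_def by blast
  ultimately show ?thesis using assms T_bounded[OF assms]
    by (intro E_finite[where C = C and M = M]) (auto simp: d_commute T_measurable)
qed

lemma T_P: assumes "u \<in> T" shows "P u < \<infinity>"
proof -
  obtain M where M: "0 \<le> M" "\<And>x. \<bar>u x\<bar> \<le> M" using T_bound[OF assms] by metis
  have [measurable]: "u \<in> borel_measurable borel" using assms by (rule T_measurable)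
  have "P u \<le> (\<integral>\<^sup>+x. ennreal (M powr p) * indicator {x. u x \<noteq> 0} x \<partial>lborel)"
    unfolding P_def using M p_gt_2
    by (intro nn_integral_mono) (auto simp: indicator_def intro!: ennreal_leI powr_mono2)
  also have "\<dots> = ennreal (M powr p) * emeasure lborel {x. u x \<noteq> 0}"
    by (rule nn_integral_cmult_indicator) measurable
  also have "\<dots> < \<infinity>" using emeasure_bounded_finite[OF T_bounded[OF assms]] by (simp add: ennreal_mult_less_top)
  finally show ?thesis .
qed

section \<open>The Dirichlet space\<close>

definition ga :: "('a \<Rightarrow> real) \<Rightarrow> real" where "ga u = sqrt (enn2real (E u))"

definition nrm :: "('a \<Rightarrow> real) \<Rightarrow> real" where "nrm u = enn2real (P u) powr (1 / p)"

text \<open>Follows \<open>dirichlet_space\<close> clause by clause, so that the two spaces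
  correspond under the exponential map.\<close>

definition Dir :: "('a \<Rightarrow> real) set" where
  "Dir = {u. u \<in> borel_measurable borel \<and> P u < \<infinity> \<and>
     (\<exists>\<phi>. (\<forall>k::nat. \<phi> k \<in> T) \<and>
        (\<forall>\<epsilon>>0. \<exists>M. \<forall>j\<ge>M. \<forall>k\<ge>M. ga (\<lambda>x. \<phi> j x - \<phi> k x) < \<epsilon>) \<and>
        (\<lambda>k. nrm (\<lambda>x. \<phi> k x - u x)) \<longlonglongrightarrow> 0)}"

lemma ga_nonneg [simp]: "0 \<le> ga u" by (simp add: ga_def)
lemma nrm_nonneg [simp]: "0 \<le> nrm u" by (simp add: nrm_def)

lemma E_ga: "E u < \<infinity> \<Longrightarrow> E u = ennreal ((ga u)\<^sup>2)" by (simp add: ga_def)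

lemma P_nrm: "P u < \<infinity> \<Longrightarrow> P u = ennreal (nrm u powr p)" unfolding nrm_def by (rule P_powr)

lemma sobolev': "u \<in> borel_measurable borel \<Longrightarrow> P u < \<infinity> \<Longrightarrow> E u < \<infinity> \<Longrightarrow> nrm u \<le> C0 * ga u"
  unfolding nrm_def ga_def by (rule sobolev)

lemma nrm_le: assumes "P u \<le> ennreal (a powr p)" "0 \<le> a" shows "nrm u \<le> a"
proof -
  have "enn2real (P u) \<le> a powr p" using assms(1) by (intro enn2real_leI) auto
  then have "nrm u \<le> (a powr p) powr (1 / p)" unfolding nrm_def using p_gt_2 by (intro powr_mono2) auto
  then show ?thesis using assms p_gt_2 by (simp add: powr_powr)
qed

lemma E_le_of_tail:
  fixes u :: "nat \<Rightarrow> 'a \<Rightarrow> real"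
  assumes "\<And>k. u k \<in> borel_measurable borel" "v \<in> borel_measurable borel"
    and "AE x in lborel. (\<lambda>k. u k x) \<longlonglongrightarrow> v x" and "\<forall>\<^sub>F k in sequentially. E (u k) \<le> B"
  shows "E v \<le> B"
proof -
  have "E v \<le> liminf (\<lambda>k. E (u k))" using assms(1-3) by (rule E_Fatou)
  also have "\<dots> \<le> liminf (\<lambda>k. B)" using assms(4) by (rule Liminf_mono)
  finally show ?thesis by (simp add: Liminf_const)
qed

lemma P_le_of_tail:
  fixes u :: "nat \<Rightarrow> 'a \<Rightarrow> real"
  assumes "\<And>k. u k \<in> borel_measurable borel" "v \<in> borel_measurable borel"
    and "AE x in lborel. (\<lambda>k. u k x) \<longlonglongrightarrow> v x" and "\<forall>\<^sub>F k in sequentially. P (u k) \<le> B"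
  shows "P v \<le> B"
proof -
  have "P v \<le> liminf (\<lambda>k. P (u k))" using assms(1-3) by (rule P_Fatou)
  also have "\<dots> \<le> liminf (\<lambda>k. B)" using assms(4) by (rule Liminf_mono)
  finally show ?thesis by (simp add: Liminf_const)
qed

text \<open>Convergence in the norm is convergence of \<open>|u k - v| powr p\<close> to 0 in
  \<open>L1\<close>, where a subsequence converges almost everywhere.\<close>

lemma nrm_imp_AE_subseq:
  fixes u :: "nat \<Rightarrow> 'a \<Rightarrow> real"
  assumes [measurable]: "\<And>k. u k \<in> borel_measurable borel" "v \<in> borel_measurable borel"
    and fin: "\<And>k. P (\<lambda>x. u k x - v x) < \<infinity>" and lim: "(\<lambda>k. nrm (\<lambda>x. u k x - v x)) \<longlonglongrightarrow> 0"
  obtains r where "strict_mono r" "AE x in lborel. (\<lambda>k. u (r k) x) \<longlonglongrightarrow> v x"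
proof -
  have int: "integrable lborel (\<lambda>x. \<bar>u k x - v x\<bar> powr p)" for k
    using fin[of k] by (intro integrableI_bounded) (auto simp: P_def)
  have eq: "(\<integral>x. norm (\<bar>u k x - v x\<bar> powr p) \<partial>lborel) = nrm (\<lambda>x. u k x - v x) powr p" for k
  proof -
    have "(\<integral>x. norm (\<bar>u k x - v x\<bar> powr p) \<partial>lborel) = enn2real (P (\<lambda>x. u k x - v x))"
      unfolding P_def by (subst integral_eq_nn_integral) auto
    then show ?thesis by (subst (asm) P_nrm[OF fin]) simp
  qed
  have "(\<lambda>k. nrm (\<lambda>x. u k x - v x) powr p) \<longlonglongrightarrow> 0 powr p"
    using p_gt_2 by (intro tendsto_powr2 lim tendsto_const) auto
  then have "(\<lambda>k. \<integral>x. norm (\<bar>u k x - v x\<bar> powr p) \<partial>lborel) \<longlonglongrightarrow> 0" unfolding eq by simp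
  then obtain r where r: "strict_mono r" "AE x in lborel. (\<lambda>k. \<bar>u (r k) x - v x\<bar> powr p) \<longlonglongrightarrow> 0"
    using tendsto_L1_AE_subseq[where u = "\<lambda>k x. \<bar>u k x - v x\<bar> powr p", OF int] by blast
  have "AE x in lborel. (\<lambda>k. u (r k) x) \<longlonglongrightarrow> v x"
    using r(2)
  proof eventually_elim
    case (elim x)
    have "(\<lambda>k. (\<bar>u (r k) x - v x\<bar> powr p) powr (1 / p)) \<longlonglongrightarrow> 0 powr (1 / p)"
      using p_gt_2 by (intro tendsto_powr2 elim tendsto_const) auto
    then have "(\<lambda>k. \<bar>u (r k) x - v x\<bar>) \<longlonglongrightarrow> 0" using p_gt_2 by (simp add: powr_powr)
    then have "(\<lambda>k. u (r k) x - v x) \<longlonglongrightarrow> 0" by (simp add: tendsto_rabs_zero_iff)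
    then show ?case by (simp add: LIM_zero_iff)
  qed
  with r(1) show thesis by (rule that)
qed

text \<open>Membership in \<open>Dir\<close> gives a sequence that is Cauchy for the energy and
  convergent in the norm. Fatou's lemma in the second index, along a subsequence converging almost
  everywhere, turns the Cauchy property into convergence of the energy distance to \<open>u\<close>
  itself.\<close>

lemma Dir_approx:
  assumes "u \<in> Dir"
  obtains \<phi> where "\<And>k::nat. \<phi> k \<in> T" "(\<lambda>k. nrm (\<lambda>x. \<phi> k x - u x)) \<longlonglongrightarrow> 0"
    "(\<lambda>k. E (\<lambda>x. \<phi> k x - u x)) \<longlonglongrightarrow> 0" "E u < \<infinity>"
    "\<exists>r. strict_mono r \<and> (AE x in lborel. (\<lambda>k. \<phi> (r k) x) \<longlonglongrightarrow> u x)"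
proof -
  from assms obtain \<phi> where [measurable]: "u \<in> borel_measurable borel" and Pu: "P u < \<infinity>"
    and \<phi>: "\<And>k::nat. \<phi> k \<in> T" and cau: "\<And>\<epsilon>. 0 < \<epsilon> \<Longrightarrow> \<exists>M. \<forall>j\<ge>M. \<forall>k\<ge>M. ga (\<lambda>x. \<phi> j x - \<phi> k x) < \<epsilon>"
    and lim: "(\<lambda>k. nrm (\<lambda>x. \<phi> k x - u x)) \<longlonglongrightarrow> 0"
    unfolding Dir_def by blast
  have [measurable]: "\<phi> k \<in> borel_measurable borel" for k by (rule T_measurable[OF \<phi>])
  have fin: "P (\<lambda>x. \<phi> k x - u x) < \<infinity>" for k
  proof -
    have "P (\<lambda>x. \<phi> k x - u x) \<le> ennreal (2 powr p) * (P (\<phi> k) + P u)" by (rule P_add_le) auto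
    also have "\<dots> < \<infinity>" using Pu T_P[OF \<phi>, of k] by (simp add: ennreal_mult_less_top)
    finally show ?thesis .
  qed
  obtain r where r: "strict_mono r" "AE x in lborel. (\<lambda>k. \<phi> (r k) x) \<longlonglongrightarrow> u x"
    using nrm_imp_AE_subseq[OF _ _ fin lim] by auto
  have small: "\<exists>M. \<forall>j\<ge>M. E (\<lambda>x. \<phi> j x - u x) \<le> ennreal (e\<^sup>2)" if e: "0 < e" for e
  proof -
    obtain M where M: "\<And>j k. j \<ge> M \<Longrightarrow> k \<ge> M \<Longrightarrow> ga (\<lambda>x. \<phi> j x - \<phi> k x) < e" using cau[OF e] by blast
    have "E (\<lambda>x. \<phi> j x - u x) \<le> ennreal (e\<^sup>2)" if j: "j \<ge> M" for j
    proof (rule E_le_of_tail[where u = "\<lambda>k x. \<phi> j x - \<phi> (r k) x"])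
      show "AE x in lborel. (\<lambda>k. \<phi> j x - \<phi> (r k) x) \<longlonglongrightarrow> \<phi> j x - u x"
        using r(2) by eventually_elim (intro tendsto_intros)
      show "\<forall>\<^sub>F k in sequentially. E (\<lambda>x. \<phi> j x - \<phi> (r k) x) \<le> ennreal (e\<^sup>2)"
        unfolding eventually_sequentially
      proof (intro exI[of _ M] allI impI)
        fix k assume "M \<le> k"
        then have "M \<le> r k" using seq_suble[OF r(1), of k] by linarith
        then have "ga (\<lambda>x. \<phi> j x - \<phi> (r k) x) < e" using M j by blast
        then have "(ga (\<lambda>x. \<phi> j x - \<phi> (r k) x))\<^sup>2 \<le> e\<^sup>2" by (intro power_mono) auto
        then show "E (\<lambda>x. \<phi> j x - \<phi> (r k) x) \<le> ennreal (e\<^sup>2)"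
          using E_ga[OF T_E[OF T_diff[OF \<phi> \<phi>]], of j "r k"] by (simp add: ennreal_leI)
      qed
    qed auto
    then show ?thesis by blast
  qed
  have E0: "(\<lambda>k. E (\<lambda>x. \<phi> k x - u x)) \<longlonglongrightarrow> 0"
    unfolding order_tendsto_iff
  proof (intro conjI allI impI)
    fix a :: ennreal assume a: "0 < a"
    obtain e where e: "0 < e" "ennreal (e\<^sup>2) < a"
    proof (cases a)
      case (real c)
      then have "0 < c" using a by auto
      then show thesis using that[of "sqrt (c / 2)"] real by (auto simp: ennreal_less_iff)
    next
      case top
      then show thesis using that[of 1] by simp
    qed
    obtain M where "\<And>j. j \<ge> M \<Longrightarrow> E (\<lambda>x. \<phi> j x - u x) \<le> ennreal (e\<^sup>2)" using small[OF e(1)] by blast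
    then show "\<forall>\<^sub>F k in sequentially. E (\<lambda>x. \<phi> k x - u x) < a"
      unfolding eventually_sequentially using e(2) order_le_less_trans by blast
  qed auto
  obtain M where M: "E (\<lambda>x. \<phi> M x - u x) \<le> ennreal (1\<^sup>2)" using small[of 1] by auto
  have "E u \<le> ennreal (1 + 1) * E (\<phi> M) + ennreal (1 + 1 / 1) * E (\<lambda>x. u x - \<phi> M x)"
    by (rule E_diff_le) auto
  also have "\<dots> < \<infinity>" using M T_E[OF \<phi>, of M] E_minus[of u "\<phi> M"]
    by (auto simp: ennreal_mult_less_top order_le_less_trans[OF _ ennreal_one_less_top])
  finally have "E u < \<infinity>" .
  with that \<phi> lim E0 r show thesis by blast
qed

lemma Dir_measurable: "u \<in> Dir \<Longrightarrow> u \<in> borel_measurable borel" by (simp add: Dir_def)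
lemma Dir_P: "u \<in> Dir \<Longrightarrow> P u < \<infinity>" by (simp add: Dir_def)
lemma Dir_E: "u \<in> Dir \<Longrightarrow> E u < \<infinity>" by (erule Dir_approx)

lemma ga_zero [simp]: "ga (\<lambda>x. 0) = 0" by (simp add: ga_def E_def K_def)
lemma nrm_zero [simp]: "nrm (\<lambda>x. 0) = 0" using p_gt_2 by (simp add: nrm_def P_def)

lemma T_subset_Dir: "u \<in> T \<Longrightarrow> u \<in> Dir"
  unfolding Dir_def using T_P by (auto intro!: exI[of _ "\<lambda>k::nat. u"] T_measurable)

text \<open>Makes the sharp inequality applicable to what remains of a maximising sequence after its
  limit has been subtracted.\<close>

lemma Dir_T_diff: assumes u: "u \<in> T" and v: "v \<in> Dir" shows "(\<lambda>x. u x - v x) \<in> Dir"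
proof -
  from v obtain \<phi> where [measurable]: "v \<in> borel_measurable borel" and Pv: "P v < \<infinity>"
    and \<phi>: "\<And>k::nat. \<phi> k \<in> T" and cau: "\<And>\<epsilon>. 0 < \<epsilon> \<Longrightarrow> \<exists>M. \<forall>j\<ge>M. \<forall>k\<ge>M. ga (\<lambda>x. \<phi> j x - \<phi> k x) < \<epsilon>"
    and lim: "(\<lambda>k. nrm (\<lambda>x. \<phi> k x - v x)) \<longlonglongrightarrow> 0"
    unfolding Dir_def by blast
  have [measurable]: "u \<in> borel_measurable borel" using u by (rule T_measurable)
  have "P (\<lambda>x. u x - v x) \<le> ennreal (2 powr p) * (P u + P v)" by (rule P_add_le) auto
  also have "\<dots> < \<infinity>" using Pv T_P[OF u] by (simp add: ennreal_mult_less_top)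
  finally have fin: "P (\<lambda>x. u x - v x) < \<infinity>" .
  define \<psi> where "\<psi> k x = u x - \<phi> k x" for k x
  have \<psi>: "\<psi> k \<in> T" for k unfolding \<psi>_def by (rule T_diff[OF u \<phi>])
  have 1: "(\<lambda>x. \<psi> j x - \<psi> k x) = (\<lambda>x. \<phi> k x - \<phi> j x)" "(\<lambda>x. \<psi> k x - (u x - v x)) = (\<lambda>x. v x - \<phi> k x)" for j k
    by (simp_all add: \<psi>_def)
  have "nrm (\<lambda>x. v x - \<phi> k x) = nrm (\<lambda>x. \<phi> k x - v x)" for k
    unfolding nrm_def by (simp only: P_minus[of v "\<phi> k"])
  then have "(\<lambda>k. nrm (\<lambda>x. \<psi> k x - (u x - v x))) \<longlonglongrightarrow> 0"
    unfolding 1 using lim by (simp only:)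
  moreover have "\<forall>\<epsilon>>0. \<exists>M. \<forall>j\<ge>M. \<forall>k\<ge>M. ga (\<lambda>x. \<psi> j x - \<psi> k x) < \<epsilon>"
    unfolding 1 using cau by blast
  ultimately show ?thesis unfolding Dir_def using \<psi> fin by auto
qed

text \<open>The constant must not deteriorate in the limit, so energies are compared with the factor
  \<open>1 + t\<close> and \<open>t\<close> tends to 0 at the end.\<close>

lemma Dir_sobolev:
  assumes S: "\<And>u. u \<in> T \<Longrightarrow> nrm u \<le> S * ga u" and S0: "0 \<le> S" and v: "v \<in> Dir"
  shows "nrm v \<le> S * ga v"
proof -
  obtain \<phi> r where \<phi>: "\<And>k::nat. \<phi> k \<in> T" and E0: "(\<lambda>k. E (\<lambda>x. \<phi> k x - v x)) \<longlonglongrightarrow> 0"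
    and Ev: "E v < \<infinity>" and r: "strict_mono r" and lim: "AE x in lborel. (\<lambda>k. \<phi> (r k) x) \<longlonglongrightarrow> v x"
    by (rule Dir_approx[OF v]) blast
  have [measurable]: "v \<in> borel_measurable borel" "\<phi> k \<in> borel_measurable borel" for k using \<phi> v by (auto intro: T_measurable Dir_measurable)
  have *: "nrm v \<le> S * sqrt ((1 + t) * (ga v)\<^sup>2 + t)" if t: "0 < t" for t
  proof (rule nrm_le)
    have "(\<lambda>k. ennreal (1 + 1 / t) * E (\<lambda>x. \<phi> k x - v x)) \<longlonglongrightarrow> ennreal (1 + 1 / t) * 0"
      by (intro ennreal_tendsto_cmult E0) simp
    then have "(\<lambda>k. ennreal (1 + 1 / t) * E (\<lambda>x. \<phi> (r k) x - v x)) \<longlonglongrightarrow> 0"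
      using LIMSEQ_subseq_LIMSEQ[OF _ r] by (auto simp: o_def)
    then have "\<forall>\<^sub>F k in sequentially. ennreal (1 + 1 / t) * E (\<lambda>x. \<phi> (r k) x - v x) < ennreal t"
      using t by (intro order_tendstoD) auto
    then have "\<forall>\<^sub>F k in sequentially. P (\<phi> (r k)) \<le> ennreal ((S * sqrt ((1 + t) * (ga v)\<^sup>2 + t)) powr p)"
    proof eventually_elim
      case (elim k)
      have "E (\<phi> (r k)) \<le> ennreal (1 + t) * E v + ennreal (1 + 1 / t) * E (\<lambda>x. \<phi> (r k) x - v x)"
        using t by (intro E_diff_le) auto
      also have "\<dots> \<le> ennreal (1 + t) * ennreal ((ga v)\<^sup>2) + ennreal t"
        using elim E_ga[OF Ev] by (intro add_mono) auto
      also have "\<dots> = ennreal ((1 + t) * (ga v)\<^sup>2 + t)" using t by (simp flip: ennreal_mult ennreal_plus)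
      finally have "enn2real (E (\<phi> (r k))) \<le> (1 + t) * (ga v)\<^sup>2 + t" using t by (intro enn2real_leI) auto
      then have "ga (\<phi> (r k)) \<le> sqrt ((1 + t) * (ga v)\<^sup>2 + t)" unfolding ga_def by simp
      then have "nrm (\<phi> (r k)) \<le> S * sqrt ((1 + t) * (ga v)\<^sup>2 + t)"
        using S[OF \<phi>, of "r k"] S0 by (meson mult_left_mono order_trans)
      then show ?case using P_nrm[OF T_P[OF \<phi>], of "r k"] p_gt_2 by (auto intro!: ennreal_leI powr_mono2)
    qed
    then show "P v \<le> ennreal ((S * sqrt ((1 + t) * (ga v)\<^sup>2 + t)) powr p)"
      using lim by (intro P_le_of_tail[where u = "\<lambda>k. \<phi> (r k)"]) auto
    show "0 \<le> S * sqrt ((1 + t) * (ga v)\<^sup>2 + t)" using S0 t by simp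
  qed
  have "((\<lambda>t. S * sqrt ((1 + t) * (ga v)\<^sup>2 + t)) \<longlongrightarrow> S * sqrt ((1 + 0) * (ga v)\<^sup>2 + 0)) (at_right 0)"
    by (intro tendsto_intros)
  then have "nrm v \<le> S * sqrt ((1 + 0) * (ga v)\<^sup>2 + 0)"
    by (rule tendsto_lowerbound) (auto simp: eventually_at_right_less intro!: eventually_at_rightI[of 0 1] *)
  then show ?thesis by simp
qed

lemma E_diff_finite:
  assumes [measurable]: "u \<in> borel_measurable borel" "v \<in> borel_measurable borel"
    and "E u \<le> ennreal A" "E v \<le> ennreal B" and AB: "0 \<le> A" "0 \<le> B"
  shows "E (\<lambda>x. u x - v x) \<le> ennreal (2 * A + 2 * B)"
proof -
  have "E (\<lambda>x. u x - v x) \<le> ennreal (1 + 1) * E u + ennreal (1 + 1 / 1) * E (\<lambda>x. (u x - v x) - u x)"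
    by (rule E_diff_le) auto
  also have "(\<lambda>x. (u x - v x) - u x) = (\<lambda>x. (-1) * v x)" by auto
  also have "E \<dots> = E v" by (subst E_scale) auto
  also have "ennreal (1 + 1) * E u + ennreal (1 + 1 / 1) * E v \<le> ennreal 2 * ennreal A + ennreal 2 * ennreal B"
    using assms by (intro add_mono mult_mono) auto
  also have "\<dots> = ennreal (2 * A + 2 * B)" using AB by (simp add: ennreal_mult ennreal_plus)
  finally show ?thesis .
qed

text \<open>Mazur's lemma without convex combinations: the test functions that are pointwise at least as
  close to \<open>v\<close> as the tail of the sequence form a convex set, and by the parallelogram law a sequence
  that minimises the energy distance to \<open>v\<close> in these sets is Cauchy.\<close>

lemma Dir_of_AE_limit:
  fixes u :: "nat \<Rightarrow> 'a \<Rightarrow> real"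
  assumes u: "\<And>k. u k \<in> T" and [measurable]: "v \<in> borel_measurable borel"
    and lim: "AE x in lborel. (\<lambda>k. u k x) \<longlonglongrightarrow> v x"
    and B: "\<And>k. E (u k) \<le> ennreal B" "0 \<le> B" and A: "\<And>k. P (u k) \<le> ennreal A"
  shows "v \<in> Dir"
proof -
  have um [measurable]: "u k \<in> borel_measurable borel" for k by (rule T_measurable[OF u])
  have Ev: "E v \<le> ennreal B" by (rule E_le_of_tail[OF _ _ lim]) (auto intro!: always_eventually B)
  have "P v \<le> ennreal A" by (rule P_le_of_tail[OF _ _ lim]) (auto intro!: always_eventually A)
  then have Pv: "P v < \<infinity>" by (simp add: order_le_less_trans[OF _ ennreal_less_top])
  \<comment> \<open>The quantifier over \<open>\<epsilon>\<close> stands for the supremum of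
    \<open>|u i x - v x|\<close> over \<open>i \<ge> k\<close>, which need not be finite; where it
    is infinite the condition is empty.\<close>
  define C where "C k = {w \<in> T. \<forall>x \<epsilon>. (\<forall>i\<ge>k. \<bar>u i x - v x\<bar> \<le> \<epsilon>) \<longrightarrow> \<bar>w x - v x\<bar> \<le> \<epsilon>}" for k
  define e where "e w = enn2real (E (\<lambda>x. w x - v x))" for w
  have Efin: "E (\<lambda>x. w x - v x) < \<infinity>" if "w \<in> T" for w
  proof -
    have "E w \<le> ennreal ((ga w)\<^sup>2)" using E_ga[OF T_E[OF that]] by simp
    then have "E (\<lambda>x. w x - v x) \<le> ennreal (2 * (ga w)\<^sup>2 + 2 * B)"
      using Ev B(2) by (intro E_diff_finite T_measurable[OF that]) auto
    then show ?thesis by (simp add: order_le_less_trans[OF _ ennreal_less_top])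
  qed
  have uC: "u k \<in> C k" for k using u by (auto simp: C_def)
  have C_mono: "C j \<subseteq> C k" if "k \<le> j" for j k using that unfolding C_def by (auto dest: order_trans)
  have CT: "w \<in> T" if "w \<in> C k" for w k using that by (simp add: C_def)
  define m where "m k = Inf (e ` C k)" for k
  have bdd: "bdd_below (e ` C k)" for k by (rule bdd_belowI[of _ 0]) (auto simp: e_def)
  have m_le: "m k \<le> e w" if "w \<in> C k" for w k
    unfolding m_def using that bdd by (intro cInf_lower) auto
  have ne: "e ` C k \<noteq> {}" for k using uC by blast
  have "incseq m"
    unfolding incseq_def m_def using C_mono by (intro allI impI cInf_superset_mono ne bdd image_mono) auto
  moreover have m_bd: "m k \<le> 4 * B" for k
  proof -
    have "E (\<lambda>x. u k x - v x) \<le> ennreal (2 * B + 2 * B)"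
      by (intro E_diff_finite B Ev) auto
    then have "e (u k) \<le> 4 * B" unfolding e_def using B(2) by (intro enn2real_leI) auto
    then show ?thesis using m_le[OF uC, of k] by linarith
  qed
  ultimately obtain L where L: "m \<longlonglongrightarrow> L" "\<And>i. m i \<le> L" using incseq_convergent[of m "4 * B"] by blast
  have "\<exists>w\<in>C k. e w < m k + 1 / real (Suc k)" for k
  proof -
    have "Inf (e ` C k) < m k + 1 / real (Suc k)" by (simp add: m_def)
    then show ?thesis using cInf_lessD[of "e ` C k" "m k + 1 / real (Suc k)"] uC by blast
  qed
  then obtain w where w: "\<And>k. w k \<in> C k" "\<And>k. e (w k) < m k + 1 / real (Suc k)" by metis
  have wT: "w k \<in> T" for k using w(1) CT by blast
  have wm [measurable]: "w k \<in> borel_measurable borel" for k by (rule T_measurable[OF wT])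
  \<comment> \<open>The parallelogram law gives \<open>2 * e (w i) + 2 * e (w j) - 4 * e c\<close>
    for the midpoint \<open>c\<close>, which lies in \<open>C k\<close>. Here \<open>m k\<close>
    bounds \<open>e c\<close> from below and \<open>L + 1 / (k + 1)\<close> bounds the other two
    values from above.\<close>
  define \<delta> where "\<delta> k = 4 * (L - m k) + 4 * (1 / real (Suc k))" for k
  have dE: "E (\<lambda>x. w i x - w j x) \<le> ennreal (\<delta> k)" if ij: "k \<le> i" "k \<le> j" for i j k
  proof -
    define c where "c x = (w i x + w j x) / 2" for x
    have "c = (\<lambda>x. 1 / 2 * w i x + 1 / 2 * w j x)" by (auto simp: c_def field_simps)
    then have cT: "c \<in> T" using T_linear[OF wT wT] by (simp only:)
    have "c \<in> C k"
      unfolding C_def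
    proof (intro CollectI conjI allI impI cT)
      fix x \<epsilon> assume H: "\<forall>i\<ge>k. \<bar>u i x - v x\<bar> \<le> \<epsilon>"
      have "w i \<in> C k" "w j \<in> C k" using w(1) C_mono ij by blast+
      then have "\<bar>w i x - v x\<bar> \<le> \<epsilon>" "\<bar>w j x - v x\<bar> \<le> \<epsilon>" using H by (auto simp: C_def)
      moreover have "c x - v x = ((w i x - v x) + (w j x - v x)) / 2" by (simp add: c_def field_simps)
      ultimately show "\<bar>c x - v x\<bar> \<le> \<epsilon>" by (simp add: abs_le_iff)
    qed
    then have mc: "m k \<le> e c" by (rule m_le)
    have "E (\<lambda>x. w i x - w j x) + 4 * E (\<lambda>x. c x - v x) = 2 * E (\<lambda>x. w i x - v x) + 2 * E (\<lambda>x. w j x - v x)"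
      unfolding c_def by (rule E_parallelogram) auto
    then have "ennreal ((ga (\<lambda>x. w i x - w j x))\<^sup>2) + ennreal 4 * ennreal (e c) = ennreal 2 * ennreal (e (w i)) + ennreal 2 * ennreal (e (w j))"
      using E_ga[OF T_E[OF T_diff[OF wT wT]], of i j] Efin[OF cT] Efin[OF wT] unfolding e_def by simp
    then have "ennreal ((ga (\<lambda>x. w i x - w j x))\<^sup>2 + 4 * e c) = ennreal (2 * e (w i) + 2 * e (w j))"
      by (simp add: e_def ennreal_mult ennreal_plus)
    then have "(ga (\<lambda>x. w i x - w j x))\<^sup>2 + 4 * e c = 2 * e (w i) + 2 * e (w j)"
      by (subst (asm) ennreal_inj) (auto simp: e_def)
    moreover have "e (w i) \<le> L + 1 / real (Suc k)" "e (w j) \<le> L + 1 / real (Suc k)"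
    proof -
      have "1 / real (Suc i) \<le> 1 / real (Suc k)" "1 / real (Suc j) \<le> 1 / real (Suc k)" using ij by (auto intro!: divide_left_mono)
      then show "e (w i) \<le> L + 1 / real (Suc k)" "e (w j) \<le> L + 1 / real (Suc k)"
        using w(2)[of i] w(2)[of j] L(2)[of i] L(2)[of j] by linarith+
    qed
    moreover have "X \<le> 4 * (l - n) + 4 * h" if "X + 4 * c = 2 * a + 2 * b" "a \<le> l + h" "b \<le> l + h" "n \<le> c"
      for X a b c l n h :: real using that by argo
    ultimately have "(ga (\<lambda>x. w i x - w j x))\<^sup>2 \<le> \<delta> k" using mc unfolding \<delta>_def by blast
    then show ?thesis using E_ga[OF T_E[OF T_diff[OF wT wT]], of i j] by (simp add: ennreal_leI)
  qed
  have "\<delta> \<longlonglongrightarrow> 4 * (L - L) + 4 * 0"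
    unfolding \<delta>_def using L(1) LIMSEQ_inverse_real_of_nat by (intro tendsto_intros) (auto simp: inverse_eq_divide)
  then have \<delta>0: "\<delta> \<longlonglongrightarrow> 0" by simp
  have \<delta>_nn: "0 \<le> \<delta> k" for k using L(2)[of k] by (simp add: \<delta>_def)
  have wlim: "AE x in lborel. (\<lambda>k. w k x) \<longlonglongrightarrow> v x"
    using lim
  proof eventually_elim
    case (elim x)
    show ?case
    proof (rule metric_LIMSEQ_I)
      fix r :: real assume r: "0 < r"
      obtain k where k: "\<And>i. i \<ge> k \<Longrightarrow> dist (u i x) (v x) < r / 2"
        using metric_LIMSEQ_D[OF elim, of "r / 2"] r by auto
      then have H: "\<forall>i\<ge>k. \<bar>u i x - v x\<bar> \<le> r / 2" by (auto simp: dist_real_def less_imp_le)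
      have "\<bar>w j x - v x\<bar> \<le> r / 2" if "j \<ge> k" for j
      proof -
        have "w j \<in> C k" using w(1)[of j] C_mono[OF that] by blast
        then have "(\<forall>i\<ge>k. \<bar>u i x - v x\<bar> \<le> r / 2) \<longrightarrow> \<bar>w j x - v x\<bar> \<le> r / 2" unfolding C_def by blast
        with H show ?thesis by blast
      qed
      then show "\<exists>no. \<forall>n\<ge>no. dist (w n x) (v x) < r" using r by (force simp: dist_real_def)
    qed
  qed
  \<comment> \<open>For fixed \<open>j\<close>, Fatou's lemma in the index \<open>i\<close> turns
    the Cauchy estimate into one for the energy distance to \<open>v\<close>; the Sobolev inequality
    then gives convergence in the norm.\<close>
  have wE: "E (\<lambda>x. w j x - v x) \<le> ennreal (\<delta> j)" for j
  proof (rule E_le_of_tail[where u = "\<lambda>i x. w j x - w i x"])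
    show "AE x in lborel. (\<lambda>i. w j x - w i x) \<longlonglongrightarrow> w j x - v x"
      using wlim by eventually_elim (intro tendsto_intros)
    show "\<forall>\<^sub>F i in sequentially. E (\<lambda>x. w j x - w i x) \<le> ennreal (\<delta> j)"
      using eventually_ge_at_top[of j] by eventually_elim (simp add: dE)
  qed auto
  have nw: "nrm (\<lambda>x. w j x - v x) \<le> C0 * sqrt (\<delta> j)" for j
  proof -
    have "P (\<lambda>x. w j x - v x) \<le> ennreal (2 powr p) * (P (w j) + P v)" by (rule P_add_le) auto
    also have "\<dots> < \<infinity>" using Pv T_P[OF wT, of j] by (simp add: ennreal_mult_less_top)
    finally have "nrm (\<lambda>x. w j x - v x) \<le> C0 * ga (\<lambda>x. w j x - v x)"
      using Efin[OF wT] by (intro sobolev') auto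
    also have "\<dots> \<le> C0 * sqrt (\<delta> j)"
    proof (rule mult_left_mono)
      show "0 \<le> C0" using v1_pos by (simp add: C0_def)
      show "ga (\<lambda>x. w j x - v x) \<le> sqrt (\<delta> j)"
        unfolding ga_def using enn2real_leI[OF \<delta>_nn wE] by simp
    qed
    finally show ?thesis .
  qed
  have "(\<lambda>j. nrm (\<lambda>x. w j x - v x)) \<longlonglongrightarrow> 0"
  proof (rule tendsto_sandwich[OF _ _ tendsto_const])
    show "(\<lambda>j. C0 * sqrt (\<delta> j)) \<longlonglongrightarrow> 0" using tendsto_mult[OF tendsto_const[of C0] tendsto_real_sqrt[OF \<delta>0]] by simp
  qed (use nw in auto)
  moreover have "\<forall>\<epsilon>>0. \<exists>M. \<forall>j\<ge>M. \<forall>k\<ge>M. ga (\<lambda>x. w j x - w k x) < \<epsilon>"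
  proof (intro allI impI)
    fix \<epsilon> :: real assume \<epsilon>: "0 < \<epsilon>"
    then have "\<forall>\<^sub>F k in sequentially. \<delta> k < \<epsilon>\<^sup>2" using \<delta>0 by (intro order_tendstoD) auto
    then obtain M where M: "\<delta> M < \<epsilon>\<^sup>2" by (auto simp: eventually_sequentially)
    have "ga (\<lambda>x. w j x - w k x) < \<epsilon>" if "j \<ge> M" "k \<ge> M" for j k
    proof -
      have "enn2real (E (\<lambda>x. w j x - w k x)) \<le> \<delta> M" using dE[OF that] \<delta>_nn by (intro enn2real_leI) auto
      then have "enn2real (E (\<lambda>x. w j x - w k x)) < \<epsilon>\<^sup>2" using M by linarith
      then show ?thesis unfolding ga_def using \<epsilon> by (metis abs_of_pos real_sqrt_abs real_sqrt_less_iff)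
    qed
    then show "\<exists>M. \<forall>j\<ge>M. \<forall>k\<ge>M. ga (\<lambda>x. w j x - w k x) < \<epsilon>" by blast
  qed
  ultimately show ?thesis unfolding Dir_def using wT Pv by auto
qed

section \<open>Existence of extremal functions\<close>

lemma nrm_scale: "u \<in> borel_measurable borel \<Longrightarrow> nrm (\<lambda>x. a * u x) = \<bar>a\<bar> * nrm u"
  unfolding nrm_def using p_gt_2 by (simp add: P_scale enn2real_mult powr_mult powr_powr)

lemma ga_scale: "u \<in> borel_measurable borel \<Longrightarrow> ga (\<lambda>x. a * u x) = \<bar>a\<bar> * ga u"
  unfolding ga_def by (simp add: E_scale enn2real_mult real_sqrt_mult)

lemma nrm_pos: assumes u: "u \<in> T" "u x \<noteq> 0" shows "0 < nrm u"
proof -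
  have [measurable]: "u \<in> borel_measurable borel" using u(1) by (rule T_measurable)
  have "P u \<noteq> 0"
  proof
    assume "P u = 0"
    then have "AE x in lborel. u x = 0" unfolding P_def using p_gt_2 by (subst (asm) nn_integral_0_iff_AE) auto
    then have "emeasure lborel {x. u x \<noteq> 0} = 0" by (simp add: AE_iff_measurable[where M = lborel, OF _ refl])
    moreover have "open {x. u x \<noteq> 0}" using T_continuous[OF u(1)] by (intro open_Collect_neq) auto
    moreover have "{x. u x \<noteq> 0} \<noteq> {}" using u(2) by auto
    ultimately show False
      using open_not_negligible[of "{x. u x \<noteq> 0}"] negligible_iff_emeasure0[of "{x. u x \<noteq> 0}"] by auto
  qed
  then have "0 < enn2real (P u)" using T_P[OF u(1)] by (simp add: enn2real_positive_iff zero_less_iff_neq_zero)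
  then show ?thesis by (simp add: nrm_def)
qed

text \<open>The Morrey bound keeps the local mass of a maximising sequence away from \<open>0\<close> after translations
  and dilations, so it has a nonzero limit; by the Brezis-Lieb lemma and strict concavity of
  \<open>t \<mapsto> t powr (2 / p)\<close> the limit carries all of the mass.\<close>

theorem extremal:
  "\<exists>S. (\<forall>u\<in>Dir. nrm u \<le> S * ga u) \<and> (\<forall>C. (\<forall>u\<in>T. nrm u \<le> C * ga u) \<longrightarrow> S \<le> C) \<and>
    (\<exists>u\<in>Dir. \<not> (AE x in lborel. u x = 0) \<and> nrm u = S * ga u)"
proof -
  define R where "R = {nrm u / ga u | u. u \<in> T \<and> 0 < ga u}"
  have C0: "0 \<le> C0" using v1_pos by (simp add: C0_def)
  have TC0: "nrm u \<le> C0 * ga u" if "u \<in> T" for u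
    using sobolev'[OF T_measurable[OF that] T_P[OF that] T_E[OF that]] .
  obtain u0 x0 where u0: "u0 \<in> T" "u0 x0 \<noteq> 0" using T_nonzero by blast
  have n0: "0 < nrm u0" using nrm_pos[OF u0] .
  then have g0: "0 < ga u0" using TC0[OF u0(1)] ga_nonneg[of u0] by (cases "ga u0 = 0") (simp_all add: order_le_less)
  have bdd: "bdd_above R" unfolding R_def using TC0 by (intro bdd_aboveI[of _ C0]) (auto simp: divide_le_eq)
  define S where "S = Sup R"
  have Rle: "x \<le> S" if "x \<in> R" for x unfolding S_def using that bdd by (rule cSup_upper)
  have "nrm u0 / ga u0 \<in> R" using u0 g0 by (auto simp: R_def)
  then have S: "0 < S" using Rle n0 g0 by (meson divide_pos_pos order_less_le_trans)
  have ST: "nrm u \<le> S * ga u" if u: "u \<in> T" for u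
  proof (cases "ga u = 0")
    case True then show ?thesis using TC0[OF u] by simp
  next
    case False
    then have "0 < ga u" using ga_nonneg[of u] by linarith
    then have "nrm u / ga u \<le> S" using u by (intro Rle) (auto simp: R_def)
    then show ?thesis using \<open>0 < ga u\<close> by (simp add: divide_le_eq)
  qed
  have SD: "nrm u \<le> S * ga u" if "u \<in> Dir" for u using Dir_sobolev[OF ST _ that] S by simp
  have best: "S \<le> C" if "\<forall>u\<in>T. nrm u \<le> C * ga u" for C
    unfolding S_def using that u0 g0 by (intro cSup_least) (auto simp: R_def divide_le_eq)
  \<comment> \<open>The infimum of \<open>ga\<close> over test functions of norm 1; a maximising
    sequence for the quotient is normalised to approach it.\<close>
  define \<gamma> where "\<gamma> = 1 / S"
  have \<gamma>: "0 < \<gamma>" using S by (simp add: \<gamma>_def)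
  have "\<exists>u\<in>T. nrm u = 1 \<and> ga u < \<gamma> + 1 / real (Suc k)" for k
  proof -
    define S' where "S' = 1 / (\<gamma> + 1 / real (Suc k))"
    have "S' < 1 / \<gamma>" unfolding S'_def using \<gamma> by (intro divide_strict_left_mono mult_pos_pos add_pos_pos) auto
    then have "S' < Sup R" by (simp add: \<gamma>_def S_def[symmetric])
    then obtain u where u: "u \<in> T" "0 < ga u" "S' < nrm u / ga u"
      using less_cSup_iff[of R S'] bdd \<open>nrm u0 / ga u0 \<in> R\<close> by (auto simp: R_def)
    have S': "0 < S'" unfolding S'_def using \<gamma> by (simp add: add_pos_pos)
    then have nu: "0 < nrm u" using u by (metis divide_pos_pos less_trans nrm_nonneg order_le_less divide_eq_0_iff less_irrefl)
    have um: "u \<in> borel_measurable borel" using u(1) by (rule T_measurable)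
    define w where "w x = 1 / nrm u * u x" for x
    have "w \<in> T" unfolding w_def by (rule T_scale[OF u(1)])
    moreover have "nrm w = 1" unfolding w_def using nu by (subst nrm_scale[OF um]) simp
    moreover have "ga w < \<gamma> + 1 / real (Suc k)"
    proof -
      have "ga w = ga u / nrm u" unfolding w_def using nu by (subst ga_scale[OF um]) simp
      also have "\<dots> < 1 / S'" using u nu S' by (simp add: field_simps)
      finally show ?thesis by (simp add: S'_def)
    qed
    ultimately show ?thesis by blast
  qed
  then obtain u where u: "\<And>k. u k \<in> T" "\<And>k. nrm (u k) = 1" "\<And>k. ga (u k) < \<gamma> + 1 / real (Suc k)" by metis
  have um [measurable]: "u k \<in> borel_measurable borel" for k by (rule T_measurable[OF u(1)])
  define B where "B = (\<gamma> + 1)\<^sup>2"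
  have B: "0 < B" using \<gamma> by (simp add: B_def add_pos_pos)
  have EB: "E (u k) \<le> ennreal B" for k
  proof -
    have "1 / real (Suc k) \<le> 1" by simp
    then have "ga (u k) \<le> \<gamma> + 1" using u(3)[of k] by linarith
    then have "(ga (u k))\<^sup>2 \<le> B" unfolding B_def by (intro power_mono) auto
    then show ?thesis using E_ga[OF T_E[OF u(1)], of k] by (simp add: ennreal_leI)
  qed
  have P1: "P (u k) = 1" for k using P_nrm[OF T_P[OF u(1)], of k] u(2)[of k] by simp
  \<comment> \<open>If all ball integrals of \<open>u k\<close> obeyed the Morrey bound with this
    \<open>c\<close>, the refined inequality would give \<open>P (u k) \<le> 1 / 2\<close>, against
    the normalisation \<open>P (u k) = 1\<close>.\<close>
  define c where "c = (v1 / (4 * B)) powr (1 / (p - 2)) / 4"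
  have c: "0 < c" using v1_pos B by (simp add: c_def)
  have cB: "2 / v1 * (4 * c) powr (p - 2) * B = 1 / 2"
    using v1_pos B p_gt_2 by (simp add: c_def powr_powr)
  have "\<exists>y r. 0 < r \<and> ennreal (v1 * c * r powr (Q - Q / p)) < (\<integral>\<^sup>+x. ennreal \<bar>u k x\<bar> * indicator {x. d y x < r} x \<partial>lborel)" for k
  proof (rule ccontr)
    assume "\<not> ?thesis"
    then have H: "\<And>y r. 0 < r \<Longrightarrow> (\<integral>\<^sup>+x. ennreal \<bar>u k x\<bar> * indicator {x. d y x < r} x \<partial>lborel) \<le> ennreal (v1 * c * r powr (Q - Q / p))"
      by (meson not_less)
    have "P (u k) \<le> ennreal (2 / v1 * (4 * c) powr (p - 2)) * E (u k)"
      by (rule morrey[OF um c H])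
    also have "\<dots> \<le> ennreal (2 / v1 * (4 * c) powr (p - 2)) * ennreal B" by (intro mult_left_mono EB) simp
    also have "\<dots> = ennreal (1 / 2)" unfolding cB[symmetric] by (rule ennreal_mult[symmetric]) (use v1_pos B in auto)
    finally have "ennreal 1 \<le> ennreal (1 / 2)" using P1 by simp
    then show False by (subst (asm) ennreal_le_iff) auto
  qed
  then obtain y r where yr: "\<And>k. 0 < r k" "\<And>k. ennreal (v1 * c * r k powr (Q - Q / p)) < (\<integral>\<^sup>+x. ennreal \<bar>u k x\<bar> * indicator {x. d (y k) x < r k} x \<partial>lborel)"
    by metis
  \<comment> \<open>The ball violating the Morrey bound is moved to the unit ball; mass and energy
    are unchanged.\<close>
  define v where "v k x = r k powr (Q / p) * u k (y k \<odot> dl (r k) x)" for k x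
  have vT: "v k \<in> T" for k unfolding v_def by (intro T_scale T_dl[where u = "\<lambda>x. u k (y k \<odot> x)"] T_star u yr)
  have vm [measurable]: "v k \<in> borel_measurable borel" for k by (rule T_measurable[OF vT])
  have vP: "P (v k) = 1" for k unfolding v_def using yr P1 by (subst P_rescale) auto
  have vE: "E (v k) = E (u k)" for k unfolding v_def using yr by (subst E_rescale) auto
  let ?W = "{x. N x < 1}"
  have vL: "ennreal (v1 * c) \<le> (\<integral>\<^sup>+x. ennreal \<bar>v k x\<bar> * indicator ?W x \<partial>lborel)" for k
  proof -
    have "ennreal (v1 * c) = ennreal (r k powr (Q / p - Q)) * ennreal (v1 * c * r k powr (Q - Q / p))"
      using yr(1)[of k] v1_pos c by (simp add: mult.assoc flip: ennreal_mult powr_add) (simp add: mult.commute mult.left_commute flip: powr_add)?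
    also have "\<dots> \<le> ennreal (r k powr (Q / p - Q)) * (\<integral>\<^sup>+x. ennreal \<bar>u k x\<bar> * indicator {x. d (y k) x < r k} x \<partial>lborel)"
      using yr(2)[of k] by (intro mult_left_mono) auto
    also have "\<dots> = (\<integral>\<^sup>+x. ennreal \<bar>v k x\<bar> * indicator ?W x \<partial>lborel)"
      unfolding v_def using yr(1) by (subst L1_rescale) auto
    finally show ?thesis .
  qed
  obtain \<rho> g where \<rho>: "strict_mono \<rho>" and gm [measurable]: "g \<in> borel_measurable borel"
    and glim: "AE x in lborel. (\<lambda>k. v (\<rho> k) x) \<longlonglongrightarrow> g x"
    using rellich[of v 1 B] vP vE EB B by auto
  define f where "f k = v (\<rho> k)" for k
  have fT: "f k \<in> T" for k unfolding f_def by (rule vT)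
  have fm [measurable]: "f k \<in> borel_measurable borel" for k by (rule T_measurable[OF fT])
  have flim: "AE x in lborel. (\<lambda>k. f k x) \<longlonglongrightarrow> g x" unfolding f_def by (rule glim)
  have fP: "P (f k) = 1" for k unfolding f_def by (rule vP)
  have fE: "E (f k) \<le> ennreal B" for k unfolding f_def vE by (rule EB)
  have gD: "g \<in> Dir" by (rule Dir_of_AE_limit[OF fT gm flim fE _, where A = 1]) (use B fP in auto)
  have gP1: "P g \<le> 1" by (rule P_le_of_tail[OF _ gm flim]) (auto simp: fP)
  have fgP: "P (\<lambda>x. f k x - g x) \<le> ennreal (2 powr p * 2)" for k
  proof -
    have "P (\<lambda>x. f k x - g x) \<le> ennreal (2 powr p) * (P (f k) + P g)" by (rule P_add_le) auto
    also have "\<dots> \<le> ennreal (2 powr p) * (1 + 1)" using gP1 fP by (intro mult_left_mono add_mono) auto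
    finally show ?thesis by (simp add: ennreal_mult)
  qed
  \<comment> \<open>On the unit ball, convergence almost everywhere and the bound in the critical
    exponent give convergence in \<open>L1\<close>, so a zero limit would contradict the lower bound
    \<open>v1 * c\<close>.\<close>
  have g0: "\<not> (AE x in lborel. g x = 0)"
  proof
    assume g0: "AE x in lborel. g x = 0"
    have "(\<lambda>k. \<integral>\<^sup>+x. ennreal (\<bar>f k x - g x\<bar> powr 1) * indicator ?W x \<partial>lborel) \<longlonglongrightarrow> 0"
    proof (rule local_Lq_convergence[where p = p and A = "2 powr p * 2"])
      show "AE x in lborel. (\<lambda>k. f k x - g x) \<longlonglongrightarrow> 0" using flim by eventually_elim (simp add: LIM_zero_iff)
      show "(\<integral>\<^sup>+x. ennreal (\<bar>f k x - g x\<bar> powr p) \<partial>lborel) \<le> ennreal (2 powr p * 2)" for k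
        using fgP[of k] unfolding P_def .
    qed (use emeasure_N_finite p_gt_2 in auto)
    then have "\<forall>\<^sub>F k in sequentially. (\<integral>\<^sup>+x. ennreal (\<bar>f k x - g x\<bar> powr 1) * indicator ?W x \<partial>lborel) < ennreal (v1 * c)"
      using v1_pos c by (intro order_tendstoD) auto
    then obtain k where "(\<integral>\<^sup>+x. ennreal (\<bar>f k x - g x\<bar> powr 1) * indicator ?W x \<partial>lborel) < ennreal (v1 * c)"
      by (auto simp: eventually_sequentially)
    moreover have "(\<integral>\<^sup>+x. ennreal (\<bar>f k x - g x\<bar> powr 1) * indicator ?W x \<partial>lborel) = (\<integral>\<^sup>+x. ennreal \<bar>f k x\<bar> * indicator ?W x \<partial>lborel)"
      by (rule nn_integral_cong_AE) (use g0 in eventually_elim, auto)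
    ultimately show False using vL[of "\<rho> k"] unfolding f_def by auto
  qed
  \<comment> \<open>\<open>a\<close> is the mass of the limit and \<open>b k\<close> below that of
    the remainder; by the Brezis-Lieb lemma \<open>b k\<close> tends to
    \<open>1 - a\<close>.\<close>
  define a where "a = nrm g powr p"
  have Pa: "P g = ennreal a" unfolding a_def by (rule P_nrm[OF Dir_P[OF gD]])
  have a1: "a \<le> 1" using gP1 unfolding Pa by simp
  have a0: "0 < a"
  proof -
    have "P g \<noteq> 0" using g0 p_gt_2 unfolding P_def by (subst nn_integral_0_iff_AE) auto
    then show ?thesis unfolding Pa by (auto simp: ennreal_eq_0_iff not_le)
  qed
  have hD: "(\<lambda>x. f k x - g x) \<in> Dir" for k by (rule Dir_T_diff[OF fT gD])
  define b where "b k = nrm (\<lambda>x. f k x - g x) powr p" for k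
  have int_P: "(\<integral>x. \<bar>w x\<bar> powr p \<partial>lborel) = enn2real (P w)" if [measurable]: "w \<in> borel_measurable borel" for w
    unfolding P_def by (subst integral_eq_nn_integral) auto
  have Pb: "P (\<lambda>x. f k x - g x) = ennreal (b k)" for k unfolding b_def by (rule P_nrm[OF Dir_P[OF hD]])
  have bnn: "0 \<le> b k" for k by (simp add: b_def)
  have "(\<lambda>k. (\<integral>x. \<bar>f k x\<bar> powr p \<partial>lborel) - (\<integral>x. \<bar>f k x - g x\<bar> powr p \<partial>lborel)) \<longlonglongrightarrow> (\<integral>x. \<bar>g x\<bar> powr p \<partial>lborel)"
    by (rule brezis_lieb(1)[OF _ _ _ _ flim, where A = 1]) (use p_gt_2 fP in \<open>auto simp: P_def\<close>)
  then have "(\<lambda>k. 1 - b k) \<longlonglongrightarrow> a"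
    using a0 by (simp add: int_P fP Pb Pa bnn)
  then have "(\<lambda>k. 1 - (1 - b k)) \<longlonglongrightarrow> 1 - a" by (intro tendsto_intros)
  then have blim: "b \<longlonglongrightarrow> 1 - a" by simp
  have nb: "(nrm (\<lambda>x. f k x - g x))\<^sup>2 = b k powr (2 / p)" for k
    unfolding b_def powr_powr using p_gt_2 by simp
  have nblim: "(\<lambda>k. (nrm (\<lambda>x. f k x - g x))\<^sup>2) \<longlonglongrightarrow> (1 - a) powr (2 / p)"
    unfolding nb using p_gt_2 bnn by (intro tendsto_powr2 blim tendsto_const) auto
  have gaf: "ga (f k) = ga (u (\<rho> k))" for k unfolding f_def ga_def vE ..
  have galim: "(\<lambda>k. ga (f k)) \<longlonglongrightarrow> \<gamma>"
  proof -
    have "(\<lambda>k. ga (u k)) \<longlonglongrightarrow> \<gamma>"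
    proof (rule tendsto_sandwich[OF _ _ tendsto_const])
      show "(\<lambda>k. \<gamma> + 1 / real (Suc k)) \<longlonglongrightarrow> \<gamma>"
        using tendsto_add[OF tendsto_const[of \<gamma>] LIMSEQ_inverse_real_of_nat] by (simp add: inverse_eq_divide)
      show "\<forall>\<^sub>F k in sequentially. \<gamma> \<le> ga (u k)"
      proof (rule always_eventually, rule allI)
        fix k show "\<gamma> \<le> ga (u k)" using ST[OF u(1), of k] u(2)[of k] S by (simp add: \<gamma>_def divide_le_eq mult.commute)
      qed
    qed (use u(3) in \<open>auto intro!: always_eventually less_imp_le\<close>)
    then show ?thesis unfolding gaf using LIMSEQ_subseq_LIMSEQ[OF _ \<rho>] by (auto simp: o_def)
  qed
  have ga2: "enn2real (E w) = (ga w)\<^sup>2" for w by (simp add: ga_def)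
  have "(\<lambda>k. (ga (f k))\<^sup>2 - (ga (\<lambda>x. f k x - g x))\<^sup>2) \<longlonglongrightarrow> (ga g)\<^sup>2"
    using E_brezis_lieb[OF fm gm flim fE] unfolding ga2 .
  then have "(\<lambda>k. (ga (f k))\<^sup>2 - ((ga (f k))\<^sup>2 - (ga (\<lambda>x. f k x - g x))\<^sup>2)) \<longlonglongrightarrow> \<gamma>\<^sup>2 - (ga g)\<^sup>2"
    by (intro tendsto_diff tendsto_power galim)
  then have ghlim: "(\<lambda>k. S\<^sup>2 * (ga (\<lambda>x. f k x - g x))\<^sup>2) \<longlonglongrightarrow> S\<^sup>2 * (\<gamma>\<^sup>2 - (ga g)\<^sup>2)"
    by (intro tendsto_mult tendsto_const) simp
  \<comment> \<open>The sharp inequality for the remainder, in the limit: by the splitting of the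
    energy, \<open>\<gamma>\<^sup>2 - (ga g)\<^sup>2\<close> is left over for it.\<close>
  have "(1 - a) powr (2 / p) \<le> S\<^sup>2 * (\<gamma>\<^sup>2 - (ga g)\<^sup>2)"
  proof (rule LIMSEQ_le[OF nblim ghlim], intro exI[of _ 0] allI impI)
    fix k show "(nrm (\<lambda>x. f k x - g x))\<^sup>2 \<le> S\<^sup>2 * (ga (\<lambda>x. f k x - g x))\<^sup>2"
      using power_mono[OF SD[OF hD], of k 2] by (simp add: power_mult_distrib)
  qed
  also have "S\<^sup>2 * (\<gamma>\<^sup>2 - (ga g)\<^sup>2) = 1 - (S * ga g)\<^sup>2"
    using S by (simp add: \<gamma>_def power_mult_distrib right_diff_distrib power_divide)
  finally have le1: "(S * ga g)\<^sup>2 \<le> 1 - (1 - a) powr (2 / p)" by linarith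
  have "a powr (2 / p) = (nrm g)\<^sup>2" unfolding a_def powr_powr using p_gt_2 by simp
  also have "\<dots> \<le> (S * ga g)\<^sup>2" using SD[OF gD] by (intro power_mono) auto
  \<comment> \<open>The limit and the remainder each pay for their mass in energy, and the total is
    exhausted. By strict concavity a genuine splitting of the mass would be too expensive.\<close>
  finally have "a powr (2 / p) + (1 - a) powr (2 / p) \<le> 1" using le1 by linarith
  then have a: "a = 1" using a0 a1 p_gt_2 by (intro concave_split[of a "2 / p"]) auto
  have "nrm g = (nrm g powr p) powr (1 / p)" using p_gt_2 by (simp add: powr_powr)
  then have n1: "nrm g = 1" using a by (simp add: a_def)
  have "(S * ga g)\<^sup>2 \<le> 1\<^sup>2" using le1 a by simp
  then have "S * ga g \<le> 1" by (rule power2_le_imp_le) simp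
  then have "nrm g = S * ga g" using SD[OF gD] n1 by linarith
  then show ?thesis using SD best gD g0 by blast
qed

section \<open>Compactness in subcritical norms\<close>

lemma Lq_finite:
  assumes [measurable]: "u \<in> borel_measurable borel" "W \<in> sets borel" and P: "P u < \<infinity>"
    and W: "emeasure lborel W < \<infinity>" and q: "1 \<le> q" "q < p"
  shows "(\<integral>\<^sup>+x. ennreal (\<bar>u x\<bar> powr q) * indicator W x \<partial>lborel) < \<infinity>"
proof -
  have "\<bar>t\<bar> powr q \<le> 1 + \<bar>t\<bar> powr p" for t
  proof (cases "\<bar>t\<bar> \<le> 1")
    case True then show ?thesis using powr_le1[of q "\<bar>t\<bar>"] q by (simp add: add_increasing2)
  next
    case False
    then have "\<bar>t\<bar> powr q \<le> \<bar>t\<bar> powr p" using q by (intro powr_mono) auto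
    then show ?thesis by simp
  qed
  then have "ennreal (\<bar>t\<bar> powr q) \<le> ennreal (1 + \<bar>t\<bar> powr p)" for t by (rule ennreal_leI)
  then have "ennreal (\<bar>t\<bar> powr q) \<le> 1 + ennreal (\<bar>t\<bar> powr p)" for t by simp
  then have "(\<integral>\<^sup>+x. ennreal (\<bar>u x\<bar> powr q) * indicator W x \<partial>lborel) \<le> (\<integral>\<^sup>+x. indicator W x + ennreal (\<bar>u x\<bar> powr p) \<partial>lborel)"
    by (intro nn_integral_mono) (auto simp: indicator_def)
  also have "\<dots> = emeasure lborel W + P u" unfolding P_def by (simp add: nn_integral_add)
  finally show ?thesis using P W by (auto intro: le_less_trans simp: ennreal_add_less_top)
qed

text \<open>The Sobolev inequality bounds the mass, so a subsequence converges almost everywhere;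
  the bound in the exponent \<open>p\<close> excludes concentration in the smaller exponent
  \<open>q\<close>.\<close>

theorem compact_embedding:
  fixes u :: "nat \<Rightarrow> 'a \<Rightarrow> real"
  assumes u: "\<And>k. u k \<in> Dir" and B: "\<And>k. ga (u k) \<le> B" and [measurable]: "W \<in> sets borel"
    and W: "emeasure lborel W < \<infinity>" and q: "1 \<le> q" "q < p"
  obtains r v where "strict_mono r" "v \<in> borel_measurable borel" "P v < \<infinity>"
    "(\<lambda>k. \<integral>\<^sup>+x. ennreal (\<bar>u (r k) x - v x\<bar> powr q) * indicator W x \<partial>lborel) \<longlonglongrightarrow> 0"
proof -
  have um [measurable]: "u k \<in> borel_measurable borel" for k by (rule Dir_measurable[OF u])
  have B0: "0 \<le> B" using B[of 0] ga_nonneg[of "u 0"] by linarith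
  have E: "E (u k) \<le> ennreal (B\<^sup>2)" for k
    using E_ga[OF Dir_E[OF u], of k] B[of k] by (auto intro!: ennreal_leI power_mono)
  define A where "A = (C0 * B) powr p"
  have C0: "0 \<le> C0" using v1_pos by (simp add: C0_def)
  have P: "P (u k) \<le> ennreal A" for k
  proof -
    have "nrm (u k) \<le> C0 * ga (u k)" by (intro sobolev' Dir_P Dir_E u um)
    also have "\<dots> \<le> C0 * B" using B C0 by (intro mult_left_mono)
    finally show ?thesis using P_nrm[OF Dir_P[OF u], of k] p_gt_2 by (auto simp: A_def intro!: ennreal_leI powr_mono2)
  qed
  obtain r v where r: "strict_mono r" and [measurable]: "v \<in> borel_measurable borel" and lim: "AE x in lborel. (\<lambda>k. u (r k) x) \<longlonglongrightarrow> v x"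
    using rellich[of u A "B\<^sup>2"] P E by (auto simp: A_def)
  have Pv: "P v \<le> ennreal A" by (rule P_le_of_tail[OF _ _ lim]) (auto intro!: always_eventually P)
  have "(\<lambda>k. \<integral>\<^sup>+x. ennreal (\<bar>u (r k) x - v x\<bar> powr q) * indicator W x \<partial>lborel) \<longlonglongrightarrow> 0"
  proof (rule local_Lq_convergence[where p = p and A = "2 powr p * (A + A)"])
    show "AE x in lborel. (\<lambda>k. u (r k) x - v x) \<longlonglongrightarrow> 0" using lim by eventually_elim (simp add: LIM_zero_iff)
    show "(\<integral>\<^sup>+x. ennreal (\<bar>u (r k) x - v x\<bar> powr p) \<partial>lborel) \<le> ennreal (2 powr p * (A + A))" for k
    proof -
      have "P (\<lambda>x. u (r k) x - v x) \<le> ennreal (2 powr p) * (P (u (r k)) + P v)" by (rule P_add_le) auto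
      also have "\<dots> \<le> ennreal (2 powr p) * (ennreal A + ennreal A)" using P Pv by (intro mult_left_mono add_mono) auto
      also have "\<dots> = ennreal (2 powr p * (A + A))" by (simp add: A_def flip: ennreal_mult ennreal_plus)
      finally show ?thesis unfolding P_def .
    qed
  qed (use W q in \<open>auto simp: A_def\<close>)
  moreover have "P v < \<infinity>" using Pv by (simp add: order_le_less_trans[OF _ ennreal_less_top])
  ultimately show thesis by (intro that[OF r]) auto
qed

end

section \<open>Logarithmic coordinates near the identity\<close>

lemma eventually_nhds_ball: "eventually P (nhds (x::'a::metric_space)) \<longleftrightarrow> (\<exists>r>0. \<forall>y. dist y x < r \<longrightarrow> P y)"
  by (simp add: eventually_nhds_metric)

text \<open>The identities between derivatives in this section come from differentiating a group
  identity that holds only near the base point.\<close>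

lemma has_derivative_unique_eventually:
  assumes "(f has_derivative f') (at x)" "(g has_derivative g') (at x)" "\<forall>\<^sub>F y in nhds x. f y = g y"
  shows "f' = g'"
proof -
  obtain S where S: "open S" "x \<in> S" "\<And>y. y \<in> S \<Longrightarrow> f y = g y" using assms(3) unfolding eventually_nhds by blast
  have "(g has_derivative f') (at x)"
    by (rule has_derivative_transform_within_open[OF assms(1) S])
  then show ?thesis using assms(2) by (rule has_derivative_unique)
qed

text \<open>The picture near the identity: \<open>e\<close> is the exponential map, \<open>W\<close>
  a neighbourhood of 0 on which it has the continuous inverse \<open>L\<close>. Continuity of the
  group operations is global; smoothness is stated for the product read through
  \<open>L\<close>.\<close>

locale local_exp =
  fixes mul :: "'g::t2_space \<Rightarrow> 'g \<Rightarrow> 'g" (infixl "\<cdot>" 70) and iv :: "'g \<Rightarrow> 'g" and un :: 'g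
    and e :: "'a::euclidean_space \<Rightarrow> 'g" and W :: "'a set" and L :: "'g \<Rightarrow> 'a"
  assumes mul_assoc: "x \<cdot> y \<cdot> z = x \<cdot> (y \<cdot> z)"
    and un_left [simp]: "un \<cdot> x = x" and un_right [simp]: "x \<cdot> un = x"
    and iv_left [simp]: "iv x \<cdot> x = un" and iv_right [simp]: "x \<cdot> iv x = un"
    and cont_mul: "continuous_on UNIV (\<lambda>p. fst p \<cdot> snd p)" and cont_iv: "continuous_on UNIV iv"
    and cont_e: "continuous_on UNIV e" and e_add: "e ((s + t) *\<^sub>R v) = e (s *\<^sub>R v) \<cdot> e (t *\<^sub>R v)"
    and W: "open W" "0 \<in> W" and open_eW: "open (e ` W)"
    and L_e: "v \<in> W \<Longrightarrow> L (e v) = v" and cont_L: "continuous_on (e ` W) L"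
    and smooth_mu: "smooth_on {p. fst p \<in> W \<and> snd p \<in> W \<and> e (fst p) \<cdot> e (snd p) \<in> e ` W}
      (\<lambda>p. L (e (fst p) \<cdot> e (snd p)))"
begin

lemma iv_cancel [simp]: "iv x \<cdot> (x \<cdot> y) = y" "x \<cdot> (iv x \<cdot> y) = y"
  by (simp_all flip: mul_assoc)

lemma cancel_left: "x \<cdot> y = x \<cdot> z \<longleftrightarrow> y = z" by (metis iv_cancel(1))

lemma iv_eqI: "x \<cdot> y = un \<Longrightarrow> iv x = y" by (metis iv_cancel(1) un_right)

lemma iv_mul: "iv (x \<cdot> y) = iv y \<cdot> iv x"
  by (rule iv_eqI) (simp add: mul_assoc)

lemma e_0 [simp]: "e 0 = un"
proof -
  have "e 0 \<cdot> e 0 = e 0 \<cdot> un" using e_add[of 0 0 0] by simp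
  then show ?thesis by (simp only: cancel_left)
qed

lemma e_minus: "e (- x) = iv (e x)"
  using e_add[of 1 "-1" x] by (intro iv_eqI[symmetric]) simp

lemma e_minus_cancel [simp]: "e x \<cdot> e (- x) = un" "e (- x) \<cdot> e x = un"
  by (simp_all add: e_minus)

lemma continuous_on_mul [continuous_intros]:
  "continuous_on A f \<Longrightarrow> continuous_on A g \<Longrightarrow> continuous_on A (\<lambda>x. f x \<cdot> g x)"
  using continuous_on_compose2[OF cont_mul, of A "\<lambda>x. (f x, g x)"] by (simp add: continuous_on_Pair)

lemma continuous_on_e [continuous_intros]: "continuous_on A f \<Longrightarrow> continuous_on A (\<lambda>x. e (f x))"
  using continuous_on_compose2[OF cont_e, of A f] by simp

lemma continuous_on_iv [continuous_intros]: "continuous_on A f \<Longrightarrow> continuous_on A (\<lambda>x. iv (f x))"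
  using continuous_on_compose2[OF cont_iv, of A f] by simp

lemma e_L: "g \<in> e ` W \<Longrightarrow> e (L g) = g" using L_e by auto

lemma L_in_W: "g \<in> e ` W \<Longrightarrow> L g \<in> W" using L_e by auto

lemma e_inj: "x \<in> W \<Longrightarrow> y \<in> W \<Longrightarrow> e x = e y \<Longrightarrow> x = y" using L_e by metis

lemma open_e_image: assumes "open B" "B \<subseteq> W" shows "open (e ` B)"
proof -
  have "e ` B = L -` B \<inter> e ` W" using assms L_e by (auto simp: image_iff)
  moreover have "\<forall>B. open B \<longrightarrow> open (L -` B \<inter> e ` W)"
    using cont_L continuous_on_open_vimage[OF open_eW, of L] by blast
  ultimately show ?thesis using assms(1) by simp
qed

text \<open>Near 0 square roots are unique, so a continuous homomorphism is determined by one small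
  value: halving gives dyadic parameters, the homomorphism property their integer multiples, and
  continuity the rest.\<close>

lemma one_parameter_subgroup:
  assumes cont: "continuous_on UNIV \<gamma>" and hom: "\<And>s t :: real. \<gamma> (s + t) = \<gamma> s \<cdot> \<gamma> t"
  shows "\<exists>z. \<forall>t. \<gamma> t = e (t *\<^sub>R z)"
proof -
  obtain r where r: "0 < r" "ball 0 r \<subseteq> W" using W open_contains_ball by blast
  \<comment> \<open>Half the radius, so that doubling a logarithm from \<open>B\<close> does not
    leave \<open>W\<close>.\<close>
  define B where "B = ball (0::'a) (r / 2)"
  have BW: "B \<subseteq> W" using r unfolding B_def by (auto simp: subset_iff dist_norm)
  have "\<gamma> 0 \<cdot> \<gamma> 0 = \<gamma> 0 \<cdot> un" using hom[of 0 0] by simp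
  then have \<gamma>0: "\<gamma> 0 = un" by (simp only: cancel_left)
  have "open (\<gamma> -` (e ` B))" using cont open_e_image[OF _ BW] by (simp add: B_def open_vimage)
  moreover have "0 \<in> \<gamma> -` (e ` B)" using \<gamma>0 r by (auto simp: B_def image_iff intro!: bexI[of _ 0])
  ultimately obtain t0' where "0 < t0'" "ball 0 t0' \<subseteq> \<gamma> -` (e ` B)" using open_contains_ball by blast
  then obtain t0 where t0: "0 < t0" "\<And>t. \<bar>t\<bar> \<le> t0 \<Longrightarrow> \<gamma> t \<in> e ` B"
    by (intro that[of "t0' / 2"]) (auto simp: subset_iff)
  define c where "c t = L (\<gamma> t)" for t
  have c: "c t \<in> B" "e (c t) = \<gamma> t" if t: "\<bar>t\<bar> \<le> t0" for t
    using t0(2)[OF t] BW L_e by (auto simp: c_def)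
  have half: "c (t / 2) = (1 / 2) *\<^sub>R c t" if t: "\<bar>t\<bar> \<le> t0" for t
  proof -
    have "e (2 *\<^sub>R c (t / 2)) = e (c (t / 2)) \<cdot> e (c (t / 2))" using e_add[of 1 1 "c (t / 2)"] by simp
    also have "\<dots> = e (c t)" using c(2)[of "t / 2"] c(2)[of t] t hom[of "t / 2" "t / 2"] by simp
    finally have eq: "e (2 *\<^sub>R c (t / 2)) = e (c t)" .
    have "\<bar>t / 2\<bar> \<le> t0" using t t0(1) by simp
    from c(1)[OF this] have "2 *\<^sub>R c (t / 2) \<in> ball 0 r" by (simp add: B_def)
    then have "2 *\<^sub>R c (t / 2) \<in> W" using r by blast
    then have "2 *\<^sub>R c (t / 2) = c t" using eq c(1)[OF t] BW e_inj by blast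
    then show ?thesis by (metis scaleR_half_double scaleR_2 scaleR_add_right)
  qed
  define z where "z = (1 / t0) *\<^sub>R c t0"
  have pow: "\<gamma> (t0 / 2 ^ n) = e ((t0 / 2 ^ n) *\<^sub>R z)" for n
  proof -
    have "c (t0 / 2 ^ n) = (1 / 2 ^ n) *\<^sub>R c t0"
    proof (induction n)
      case (Suc n)
      have "\<bar>t0 / 2 ^ n\<bar> \<le> t0" using t0(1) by (simp add: divide_le_eq mult_le_cancel_left1)
      then show ?case using half[of "t0 / 2 ^ n"] Suc by (simp add: mult.commute)
    qed simp
    moreover have "\<bar>t0 / 2 ^ n\<bar> \<le> t0" using t0(1) by (simp add: divide_le_eq mult_le_cancel_left1)
    ultimately show ?thesis using c(2)[of "t0 / 2 ^ n"] t0(1) by (simp add: z_def)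
  qed
  have nat_mult: "\<gamma> (real m * a) = e ((real m * a) *\<^sub>R z)" if "\<gamma> a = e (a *\<^sub>R z)" for m a
  proof (induction m)
    case 0
    then show ?case by (simp add: \<gamma>0)
  next
    case (Suc m)
    then show ?case using that hom[of a "real m * a"] e_add[of a "real m * a" z] by (simp add: distrib_right)
  qed
  have neg: "\<gamma> (- a) = e ((- a) *\<^sub>R z)" if "\<gamma> a = e (a *\<^sub>R z)" for a
  proof -
    have "\<gamma> a \<cdot> \<gamma> (- a) = \<gamma> a \<cdot> e ((- a) *\<^sub>R z)" using hom[of a "- a"] that by (simp add: \<gamma>0)
    then show ?thesis by (simp only: cancel_left)
  qed
  have int_mult: "\<gamma> (real_of_int m * a) = e ((real_of_int m * a) *\<^sub>R z)" if "\<gamma> a = e (a *\<^sub>R z)" for m a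
  proof (cases "m \<ge> 0")
    case True
    then show ?thesis using nat_mult[OF that, of "nat m"] by simp
  next
    case False
    then have "real_of_int m * a = - (real (nat (- m)) * a)" by simp
    then show ?thesis using neg[OF nat_mult[OF that, of "nat (- m)"]] by (simp only:)
  qed
  have "\<gamma> t = e (t *\<^sub>R z)" for t
  proof -
    define a where "a n = t0 / 2 ^ n" for n :: nat
    define u where "u n = real_of_int \<lfloor>t / a n\<rfloor> * a n" for n
    have a: "0 < a n" for n using t0(1) by (simp add: a_def)
    have bd: "norm (u n - t) \<le> a n" for n
    proof -
      have "u n \<le> t" using a[of n] by (simp add: u_def flip: pos_le_divide_eq)
      moreover have "t \<le> u n + a n"
      proof -
        define k where "k = real_of_int \<lfloor>t / a n\<rfloor>"
        have "t / a n \<le> k + 1" unfolding k_def by linarith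
        then have "t \<le> (k + 1) * a n" using pos_divide_le_eq[OF a[of n]] by blast
        then show ?thesis by (simp add: u_def k_def[symmetric] distrib_right)
      qed
      ultimately show ?thesis by simp
    qed
    have "(\<lambda>n. t0 * (1 / 2) ^ n) \<longlonglongrightarrow> t0 * 0" by (intro tendsto_intros LIMSEQ_power_zero) auto
    then have "a \<longlonglongrightarrow> 0" by (simp add: a_def[abs_def] power_divide)
    then have "(\<lambda>n. u n - t) \<longlonglongrightarrow> 0" by (intro Lim_null_comparison[OF always_eventually[OF allI[OF bd]]])
    then have u: "u \<longlonglongrightarrow> t" by (simp add: LIM_zero_iff)
    have eq: "\<gamma> (u n) = e (u n *\<^sub>R z)" for n unfolding u_def a_def by (rule int_mult[OF pow])
    have "isCont \<gamma> t" using cont by (simp add: continuous_on_eq_continuous_at)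
    then have lim1: "(\<lambda>n. \<gamma> (u n)) \<longlonglongrightarrow> \<gamma> t" using u by (rule isCont_tendsto_compose)
    have "(\<lambda>n. e (u n *\<^sub>R z)) \<longlonglongrightarrow> e (t *\<^sub>R z)"
    proof -
      have "isCont e (t *\<^sub>R z)" using cont_e by (simp add: continuous_on_eq_continuous_at)
      then show ?thesis by (rule isCont_tendsto_compose) (intro tendsto_intros u)
    qed
    then show ?thesis using LIMSEQ_unique[OF lim1] unfolding eq by blast
  qed
  then show ?thesis by blast
qed

lemma e_ray_inj: assumes "\<And>t. e (t *\<^sub>R z) = e (t *\<^sub>R z')" shows "z = z'"
proof -
  have "((\<lambda>t. t *\<^sub>R w) \<longlongrightarrow> 0 *\<^sub>R w) (at_right 0)" for w :: 'a by (intro tendsto_intros)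
  then have ev: "\<forall>\<^sub>F t in at_right 0. t *\<^sub>R w \<in> W" for w using W topological_tendstoD by fastforce
  have "\<forall>\<^sub>F t in at_right (0::real). 0 < t \<and> t *\<^sub>R z \<in> W \<and> t *\<^sub>R z' \<in> W"
    using ev[of z] ev[of z'] eventually_at_right_less[of "0::real"] by eventually_elim simp
  then obtain t :: real where "0 < t" "t *\<^sub>R z \<in> W" "t *\<^sub>R z' \<in> W"
    using eventually_happens[of _ "at_right (0::real)"] trivial_limit_at_right_real by blast
  then show ?thesis using e_inj[OF _ _ assms[of t]] by simp
qed

section \<open>The adjoint representation as a map on the Lie algebra\<close>

definition Adj :: "'g \<Rightarrow> 'a \<Rightarrow> 'a" where
  "Adj g y = (THE z. \<forall>t. e (t *\<^sub>R z) = g \<cdot> e (t *\<^sub>R y) \<cdot> iv g)"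

text \<open>A conjugate of a one-parameter subgroup is again one, so it has the form
  \<open>t \<mapsto> e (t z)\<close>; uniqueness of \<open>z\<close> is
  \<open>e_ray_inj\<close>.\<close>

lemma e_Adj: "e (t *\<^sub>R Adj g y) = g \<cdot> e (t *\<^sub>R y) \<cdot> iv g"
proof -
  have "\<exists>z. \<forall>t. g \<cdot> e (t *\<^sub>R y) \<cdot> iv g = e (t *\<^sub>R z)"
  proof (rule one_parameter_subgroup)
    show "continuous_on UNIV (\<lambda>t. g \<cdot> e (t *\<^sub>R y) \<cdot> iv g)" by (intro continuous_intros)
    show "g \<cdot> e ((s + t) *\<^sub>R y) \<cdot> iv g = g \<cdot> e (s *\<^sub>R y) \<cdot> iv g \<cdot> (g \<cdot> e (t *\<^sub>R y) \<cdot> iv g)" for s t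
      by (simp add: e_add mul_assoc)
  qed
  then obtain z where z: "\<forall>t. e (t *\<^sub>R z) = g \<cdot> e (t *\<^sub>R y) \<cdot> iv g" by metis
  have "Adj g y = z" unfolding Adj_def
  proof (rule the_equality)
    show "\<forall>t. e (t *\<^sub>R z) = g \<cdot> e (t *\<^sub>R y) \<cdot> iv g" by (rule z)
    fix w assume w: "\<forall>t. e (t *\<^sub>R w) = g \<cdot> e (t *\<^sub>R y) \<cdot> iv g"
    show "w = z" by (rule e_ray_inj) (simp add: z w)
  qed
  then show ?thesis using z by simp
qed

lemma AdjI: "(\<And>t. e (t *\<^sub>R z) = g \<cdot> e (t *\<^sub>R y) \<cdot> iv g) \<Longrightarrow> Adj g y = z"
  by (rule e_ray_inj) (simp add: e_Adj)

lemma e_Adj_1: "e (Adj g y) = g \<cdot> e y \<cdot> iv g" using e_Adj[of 1 g y] by simp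

lemma Adj_scaleR: "Adj g (c *\<^sub>R y) = c *\<^sub>R Adj g y"
  by (rule AdjI) (simp add: e_Adj)

lemma Adj_mul: "Adj (g \<cdot> h) y = Adj g (Adj h y)"
  by (rule AdjI) (simp add: e_Adj iv_mul mul_assoc)

lemma Adj_un [simp]: "Adj un y = y"
proof (rule AdjI)
  have "iv un = un" by (rule iv_eqI) simp
  then show "e (t *\<^sub>R y) = un \<cdot> e (t *\<^sub>R y) \<cdot> iv un" for t by simp
qed

section \<open>The product in logarithmic coordinates and its differential\<close>

definition \<mu> :: "'a \<Rightarrow> 'a \<Rightarrow> 'a" where "\<mu> x y = L (e x \<cdot> e y)"

lemma mu_radius: "\<exists>r>0. ball 0 r \<subseteq> W \<and> (\<forall>a\<in>ball 0 r. \<forall>b\<in>ball 0 r. e a \<cdot> e b \<in> e ` W)"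
proof -
  have "continuous_on UNIV (\<lambda>p. e (fst p) \<cdot> e (snd p))" by (intro continuous_intros)
  then have "open ((\<lambda>p. e (fst p) \<cdot> e (snd p)) -` (e ` W))" using open_eW by (simp add: open_vimage)
  moreover have "(0, 0) \<in> (\<lambda>p. e (fst p) \<cdot> e (snd p)) -` (e ` W)" using W by (auto intro!: image_eqI[of _ _ 0])
  ultimately obtain A B where AB: "open A" "open B" "0 \<in> A" "0 \<in> B" "A \<times> B \<subseteq> (\<lambda>p. e (fst p) \<cdot> e (snd p)) -` (e ` W)"
    by (rule open_prod_elim) blast
  then have "open (A \<inter> B \<inter> W)" "0 \<in> A \<inter> B \<inter> W" using W by auto
  then obtain r where r: "0 < r" "ball 0 r \<subseteq> A \<inter> B \<inter> W" using open_contains_ball by blast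
  show ?thesis
  proof (intro exI[of _ r] conjI ballI r(1))
    show "ball 0 r \<subseteq> W" using r by auto
    fix a b assume "a \<in> ball (0::'a) r" "b \<in> ball (0::'a) r"
    then have "(a, b) \<in> A \<times> B" using r by blast
    then show "e a \<cdot> e b \<in> e ` W" using AB(5) by auto
  qed
qed

definition r1 :: real where "r1 = (SOME r. 0 < r \<and> ball 0 r \<subseteq> W \<and> (\<forall>a\<in>ball 0 r. \<forall>b\<in>ball 0 r. e a \<cdot> e b \<in> e ` W))"

lemma r1: "0 < r1" "ball 0 r1 \<subseteq> W" "\<And>a b. norm a < r1 \<Longrightarrow> norm b < r1 \<Longrightarrow> e a \<cdot> e b \<in> e ` W"
proof -
  have "0 < r1 \<and> ball 0 r1 \<subseteq> W \<and> (\<forall>a\<in>ball 0 r1. \<forall>b\<in>ball 0 r1. e a \<cdot> e b \<in> e ` W)"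
    unfolding r1_def using mu_radius by (rule someI_ex)
  then show "0 < r1" "ball 0 r1 \<subseteq> W" "\<And>a b. norm a < r1 \<Longrightarrow> norm b < r1 \<Longrightarrow> e a \<cdot> e b \<in> e ` W" by auto
qed

lemma r1_W: "norm a < r1 \<Longrightarrow> a \<in> W" using r1(2) by auto

lemma e_mu: "norm a < r1 \<Longrightarrow> norm b < r1 \<Longrightarrow> e (\<mu> a b) = e a \<cdot> e b"
  unfolding \<mu>_def using r1(3) e_L by blast

lemma mu_W: "norm a < r1 \<Longrightarrow> norm b < r1 \<Longrightarrow> \<mu> a b \<in> W"
  unfolding \<mu>_def using r1(3) L_in_W by blast

lemma mu_eqI: "z \<in> W \<Longrightarrow> e z = e a \<cdot> e b \<Longrightarrow> \<mu> a b = z"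
  unfolding \<mu>_def using L_e by metis

lemma mu_0_right [simp]: "norm a < r1 \<Longrightarrow> \<mu> a 0 = a" by (rule mu_eqI) (auto intro: r1_W)
lemma mu_0_left [simp]: "norm a < r1 \<Longrightarrow> \<mu> 0 a = a" by (rule mu_eqI) (auto intro: r1_W)
lemma mu_minus_left [simp]: "\<mu> (- a) a = 0" by (rule mu_eqI) (auto intro: W)

lemma smooth_mu_ball: "smooth_on (ball 0 r1 \<times> ball 0 r1) (\<lambda>p. \<mu> (fst p) (snd p))"
  unfolding \<mu>_def by (rule smooth_on_subset[OF smooth_mu]) (auto intro: r1_W r1(3))

definition dmu :: "'a \<times> 'a \<Rightarrow> 'a \<times> 'a \<Rightarrow> 'a" where
  "dmu q = frechet_derivative (\<lambda>p. \<mu> (fst p) (snd p)) (at q)"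

lemma dmu: "norm a < r1 \<Longrightarrow> norm b < r1 \<Longrightarrow> ((\<lambda>p. \<mu> (fst p) (snd p)) has_derivative dmu (a, b)) (at (a, b))"
  unfolding dmu_def by (rule smooth_on_has_derivative[OF smooth_mu_ball]) auto

lemma dmu_comp:
  assumes "(f has_derivative f') (at x)" "(g has_derivative g') (at x)" "norm (f x) < r1" "norm (g x) < r1"
  shows "((\<lambda>y. \<mu> (f y) (g y)) has_derivative (\<lambda>v. dmu (f x, g x) (f' v, g' v))) (at x)"
  using diff_chain_at[OF has_derivative_Pair[OF assms(1,2)] dmu[OF assms(3,4)]] by (simp add: o_def)

lemma linear_dmu: "norm a < r1 \<Longrightarrow> norm b < r1 \<Longrightarrow> linear (dmu (a, b))"
  by (rule has_derivative_linear[OF dmu])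

lemma eventually_norm_less: "continuous (at x) f \<Longrightarrow> norm (f x) < r \<Longrightarrow> \<forall>\<^sub>F y in nhds x. norm (f y) < (r::real)"
proof -
  assume f: "continuous (at x) f" "norm (f x) < r"
  have "((\<lambda>y. norm (f y)) \<longlongrightarrow> norm (f x)) (at x)" using f(1) by (intro tendsto_norm) (simp add: isCont_def)
  then have "\<forall>\<^sub>F y in at x. norm (f y) < r" using f(2) by (rule order_tendstoD(2))
  then show ?thesis using f(2) by (simp add: eventually_nhds_conv_at)
qed

text \<open>Differentiates the identity \<open>\<mu> y 0 = y\<close>.\<close>

lemma dmu_left: assumes a: "norm a < r1" shows "dmu (a, 0) (u, 0) = u"
proof -
  have "((\<lambda>y. \<mu> y 0) has_derivative (\<lambda>v. dmu (a, 0) (v, 0))) (at a)"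
    by (rule dmu_comp) (use a r1(1) in auto)
  moreover have "((\<lambda>y. y) has_derivative (\<lambda>v. v)) (at a)" by (rule has_derivative_ident)
  moreover have "\<forall>\<^sub>F y in nhds a. \<mu> y 0 = y"
    using eventually_norm_less[OF continuous_ident a] by eventually_elim simp
  ultimately have "(\<lambda>v. dmu (a, 0) (v, 0)) = (\<lambda>v. v)" by (rule has_derivative_unique_eventually)
  then show ?thesis by (rule fun_cong)
qed

lemma dmu_right: assumes a: "norm a < r1" shows "dmu (0, a) (0, u) = u"
proof -
  have "((\<lambda>y. \<mu> 0 y) has_derivative (\<lambda>v. dmu (0, a) (0, v))) (at a)"
    by (rule dmu_comp) (use a r1(1) in auto)
  moreover have "((\<lambda>y. y) has_derivative (\<lambda>v. v)) (at a)" by (rule has_derivative_ident)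
  moreover have "\<forall>\<^sub>F y in nhds a. \<mu> 0 y = y"
    using eventually_norm_less[OF continuous_ident a] by eventually_elim simp
  ultimately have "(\<lambda>v. dmu (0, a) (0, v)) = (\<lambda>v. v)" by (rule has_derivative_unique_eventually)
  then show ?thesis by (rule fun_cong)
qed

lemma dmu_split: assumes "norm a < r1" "norm b < r1" shows "dmu (a, b) (u, v) = dmu (a, b) (u, 0) + dmu (a, b) (0, v)"
  using linear_add[OF linear_dmu[OF assms], of "(u, 0)" "(0, v)"] by simp

lemma dmu_0 [simp]: "dmu (0, 0) (u, v) = u + v"
  using dmu_split[of 0 0 u v] dmu_left[of 0 u] dmu_right[of 0 v] r1(1) by simp

lemma mu_radius2: "\<exists>r>0. r \<le> r1 \<and> (\<forall>a b. norm a < r \<longrightarrow> norm b < r \<longrightarrow> norm (\<mu> a b) < r1)"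
proof -
  have "isCont (\<lambda>p. \<mu> (fst p) (snd p)) (0, 0)"
    using has_derivative_continuous[OF dmu[of 0 0]] r1(1) by simp
  then have "\<forall>\<^sub>F p in nhds (0, 0). norm (\<mu> (fst p) (snd p)) < r1"
    by (rule eventually_norm_less) (use r1(1) in simp)
  then obtain r where r: "0 < r" "\<And>p. dist p (0, 0) < r \<Longrightarrow> norm (\<mu> (fst p) (snd p)) < r1"
    unfolding eventually_nhds_ball by blast
  show ?thesis
  proof (intro exI[of _ "min r1 (r / 2)"] conjI allI impI)
    fix a b assume ab: "norm (a::'a) < min r1 (r / 2)" "norm (b::'a) < min r1 (r / 2)"
    have "norm (a, b) \<le> norm a + norm b" by (rule norm_Pair_le)
    then have "dist (a, b) (0, 0) < r" using ab by (simp add: dist_norm zero_prod_def[symmetric])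
    from r(2)[OF this] show "norm (\<mu> a b) < r1" by simp
  qed (use r r1 in auto)
qed

text \<open>Small enough for products of three factors, as in associativity and conjugation.\<close>

definition r2 :: real where "r2 = (SOME r. 0 < r \<and> r \<le> r1 \<and> (\<forall>a b. norm a < r \<longrightarrow> norm b < r \<longrightarrow> norm (\<mu> a b) < r1))"

lemma r2: "0 < r2" "r2 \<le> r1" "norm a < r2 \<Longrightarrow> norm b < r2 \<Longrightarrow> norm (\<mu> a b) < r1"
proof -
  have "0 < r2 \<and> r2 \<le> r1 \<and> (\<forall>a b. norm a < r2 \<longrightarrow> norm b < r2 \<longrightarrow> norm (\<mu> a b) < r1)"
    unfolding r2_def using mu_radius2 by (rule someI_ex)
  then show "0 < r2" "r2 \<le> r1" "norm a < r2 \<Longrightarrow> norm b < r2 \<Longrightarrow> norm (\<mu> a b) < r1" by auto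
qed

lemma r2_r1: "norm a < r2 \<Longrightarrow> norm a < r1" using r2(2) by linarith

lemma mu_assoc: assumes "norm a < r2" "norm b < r2" "norm c < r2" shows "\<mu> (\<mu> a b) c = \<mu> a (\<mu> b c)"
proof (rule mu_eqI)
  show "\<mu> a (\<mu> b c) \<in> W" using assms by (intro mu_W) (auto intro: r2(3) r2_r1)
  show "e (\<mu> a (\<mu> b c)) = e (\<mu> a b) \<cdot> e c"
    using assms by (simp add: e_mu mul_assoc r2(3) r2_r1)
qed

definition cj :: "'a \<times> 'a \<Rightarrow> 'a" where "cj p = \<mu> (\<mu> (fst p) (snd p)) (- fst p)"

lemma smooth_cj: "smooth_on (ball 0 r2 \<times> ball 0 r2) cj"
proof -
  let ?S = "ball 0 r2 \<times> ball 0 r2 :: ('a \<times> 'a) set"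
  have S: "open ?S" by (intro open_Times) auto
  have "smooth_on ?S (\<lambda>p. (\<mu> (fst p) (snd p), - fst p))"
  proof (intro smooth_on_Pair[OF S])
    show "smooth_on ?S (\<lambda>p. \<mu> (fst p) (snd p))"
      by (rule smooth_on_subset[OF smooth_mu_ball]) (use r2_r1 in auto)
    show "smooth_on ?S (\<lambda>p. - fst p)" by (rule smooth_on_linear) (auto simp: linear_iff)
  qed
  then have "smooth_on ?S (\<lambda>p. (\<lambda>q. \<mu> (fst q) (snd q)) (\<mu> (fst p) (snd p), - fst p))"
    by (intro smooth_on_compose[OF S _ _ _ smooth_mu_ball]) (use r2 r2_r1 in \<open>auto intro!: open_Times\<close>)
  then show ?thesis by (simp add: cj_def[abs_def])
qed

text \<open>For small \<open>t\<close> the conjugate of \<open>e (t y)\<close> has logarithm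
  \<open>t Adj (e x) y\<close>, so the derivative of conjugation at \<open>t = 0\<close> recovers
  \<open>Adj\<close>. Linearity and smooth dependence on \<open>x\<close>, not visible in the
  definition of \<open>Adj\<close>, follow from this.\<close>

lemma Adj_eq_frechet:
  assumes x: "norm x < r2" shows "Adj (e x) y = frechet_derivative cj (at (x, 0)) (0, y)"
proof -
  have der: "(cj has_derivative frechet_derivative cj (at (x, 0))) (at (x, 0))"
    by (rule smooth_on_has_derivative[OF smooth_cj]) (use x r2(1) in auto)
  have "((\<lambda>t::real. (x, t *\<^sub>R y)) has_derivative (\<lambda>t. (0, t *\<^sub>R y))) (at 0)"
    by (auto intro!: derivative_eq_intros)
  moreover have "(cj has_derivative frechet_derivative cj (at (x, 0))) (at (x, 0 *\<^sub>R y))" using der by simp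
  ultimately have "((\<lambda>t::real. cj (x, t *\<^sub>R y)) has_derivative (\<lambda>t. frechet_derivative cj (at (x, 0)) (0, t *\<^sub>R y))) (at 0)"
    by (rule diff_chain_at[unfolded o_def])
  moreover have "((\<lambda>t::real. t *\<^sub>R Adj (e x) y) has_derivative (\<lambda>t. t *\<^sub>R Adj (e x) y)) (at 0)"
    by (auto intro!: derivative_eq_intros)
  moreover have "\<forall>\<^sub>F t in nhds 0. cj (x, t *\<^sub>R y) = t *\<^sub>R Adj (e x) y"
  proof -
    have "\<forall>\<^sub>F t in nhds (0::real). norm (t *\<^sub>R y) < r2"
      by (rule eventually_norm_less) (use r2(1) in \<open>auto intro!: continuous_intros\<close>)
    moreover have "\<forall>\<^sub>F t in nhds (0::real). norm (t *\<^sub>R Adj (e x) y) < r1"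
      by (rule eventually_norm_less) (use r1(1) in \<open>auto intro!: continuous_intros\<close>)
    ultimately show ?thesis
    proof eventually_elim
      case (elim t)
      show ?case unfolding cj_def fst_conv snd_conv
      proof (rule mu_eqI)
        show "t *\<^sub>R Adj (e x) y \<in> W" using elim r1_W by blast
        show "e (t *\<^sub>R Adj (e x) y) = e (\<mu> x (t *\<^sub>R y)) \<cdot> e (- x)"
          unfolding e_mu[OF r2_r1[OF x] r2_r1[OF elim(1)]] by (simp only: e_Adj e_minus)
      qed
    qed
  qed
  ultimately have "(\<lambda>t. frechet_derivative cj (at (x, 0)) (0, t *\<^sub>R y)) = (\<lambda>t. t *\<^sub>R Adj (e x) y)"
    by (rule has_derivative_unique_eventually)
  from fun_cong[OF this, of 1] show ?thesis by simp
qed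

lemma linear_Adj_small: assumes x: "norm x < r2" shows "linear (Adj (e x))"
proof -
  have der: "(cj has_derivative frechet_derivative cj (at (x, 0))) (at (x, 0))"
    by (rule smooth_on_has_derivative[OF smooth_cj]) (use x r2(1) in auto)
  have "linear (\<lambda>y. frechet_derivative cj (at (x, 0)) (0, y))"
    using linear_compose[OF _ has_derivative_linear[OF der], of "\<lambda>y. (0, y)"] by (simp add: o_def linear_iff)
  then show ?thesis using Adj_eq_frechet[OF x] by (simp add: linear_iff)
qed

lemma e_nat: "e (real n *\<^sub>R x) \<cdot> e x = e (real (Suc n) *\<^sub>R x)"
  using e_add[of "real n" 1 x] by (simp add: add.commute)

text \<open>Linearity near 0 spreads because \<open>e x\<close> is the \<open>n\<close>-th power of
  \<open>e (x / n)\<close> and \<open>Adj\<close> is multiplicative.\<close>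

lemma linear_Adj: "linear (Adj (e x))"
proof -
  obtain n :: nat where n: "norm x / r2 < real n" using reals_Archimedean2 by blast
  then have n0: "0 < n" using r2(1) by (metis divide_nonneg_pos gr0I norm_ge_zero not_less of_nat_0)
  define w where "w = (1 / real n) *\<^sub>R x"
  have "norm w < r2" using n n0 r2(1) by (simp add: w_def divide_less_eq mult.commute)
  then have lw: "linear (Adj (e w))" by (rule linear_Adj_small)
  have "linear (Adj (e (real m *\<^sub>R w)))" for m
  proof (induction m)
    case 0
    have "linear (\<lambda>y::'a. y)" by (simp add: linear_iff)
    then show ?case by (simp add: linear_iff)
  next
    case (Suc m)
    have "Adj (e (real (Suc m) *\<^sub>R w)) = Adj (e (real m *\<^sub>R w)) \<circ> Adj (e w)"
      unfolding e_nat[symmetric] by (auto simp: Adj_mul)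
    then show ?case using linear_compose[OF lw Suc] by (simp only:)
  qed
  from this[of n] show ?thesis using n0 by (simp add: w_def)
qed

section \<open>The bracket and the differential of the exponential map\<close>

definition br :: "'a \<Rightarrow> 'a \<Rightarrow> 'a" where
  "br x y = vector_derivative (\<lambda>s. Adj (e (s *\<^sub>R x)) y) (at 0)"

text \<open>Certifies that the derivative named by \<open>br\<close> exists. Near 0 the curve is a
  directional derivative of the smooth map \<open>cj\<close>, evaluated along a line.\<close>

lemma br_deriv: "((\<lambda>s. Adj (e (s *\<^sub>R x)) y) has_vector_derivative br x y) (at 0)"
proof -
  let ?F = "\<lambda>p. frechet_derivative cj (at p) (0, y)"
  have "?F differentiable (at (0, 0))"
    by (rule smooth_on_differentiable[OF smooth_on_frechet[OF smooth_cj]]) (use r2(1) in auto)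
  then obtain D where D: "(?F has_derivative D) (at (0, 0))" unfolding differentiable_def by blast
  have "((\<lambda>s::real. (s *\<^sub>R x, 0::'a)) has_derivative (\<lambda>s. (s *\<^sub>R x, 0))) (at 0)"
    by (auto intro!: derivative_eq_intros)
  moreover have "(?F has_derivative D) (at (0 *\<^sub>R x, 0))" using D by simp
  ultimately have "((\<lambda>s::real. ?F (s *\<^sub>R x, 0)) has_derivative (\<lambda>s. D (s *\<^sub>R x, 0))) (at 0)"
    by (rule diff_chain_at[unfolded o_def])
  moreover have "\<forall>\<^sub>F s in nhds (0::real). norm (s *\<^sub>R x) < r2"
    by (rule eventually_norm_less) (use r2(1) in \<open>auto intro!: continuous_intros\<close>)
  then obtain S where S: "open S" "(0::real) \<in> S" "\<And>s. s \<in> S \<Longrightarrow> norm (s *\<^sub>R x) < r2" unfolding eventually_nhds by blast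
  ultimately have "((\<lambda>s::real. Adj (e (s *\<^sub>R x)) y) has_derivative (\<lambda>s. D (s *\<^sub>R x, 0))) (at 0)"
    by (elim has_derivative_transform_within_open[OF _ S(1,2)]) (simp add: Adj_eq_frechet S)
  then have "(\<lambda>s::real. Adj (e (s *\<^sub>R x)) y) differentiable (at 0)" unfolding differentiable_def by blast
  then show ?thesis unfolding br_def by (simp add: vector_derivative_works)
qed

text \<open>Continuity at 0 is moved to the other parameters by the group law.\<close>

lemma Adj_cont: "continuous_on UNIV (\<lambda>s. Adj (e (s *\<^sub>R x)) y)"
proof (rule continuous_at_imp_continuous_on, rule ballI)
  fix t :: real
  have "isCont (\<lambda>s. Adj (e (s *\<^sub>R x)) y) 0" by (rule has_vector_derivative_continuous[OF br_deriv])
  then have "isCont (\<lambda>s. Adj (e ((s - t) *\<^sub>R x)) y) t"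
    using isCont_o2[of t "\<lambda>s. s - t" "\<lambda>s. Adj (e (s *\<^sub>R x)) y"] by simp
  moreover have "isCont (Adj (e (t *\<^sub>R x))) z" for z
    using linear_Adj by (simp add: linear_continuous_at linear_conv_bounded_linear)
  ultimately have "isCont (\<lambda>s. Adj (e (t *\<^sub>R x)) (Adj (e ((s - t) *\<^sub>R x)) y)) t"
    by (rule isCont_o2)
  moreover have "Adj (e (t *\<^sub>R x)) (Adj (e ((s - t) *\<^sub>R x)) y) = Adj (e (s *\<^sub>R x)) y" for s
    using e_add[of t "s - t" x] by (simp add: Adj_mul)
  ultimately show "isCont (\<lambda>s. Adj (e (s *\<^sub>R x)) y) t" by simp
qed

lemma linear_br: "linear (br x)"
proof (rule linearI)
  fix y z :: 'a and c :: real
  have "((\<lambda>s. Adj (e (s *\<^sub>R x)) y + Adj (e (s *\<^sub>R x)) z) has_vector_derivative br x y + br x z) (at 0)"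
    by (intro has_vector_derivative_add br_deriv)
  then have "((\<lambda>s. Adj (e (s *\<^sub>R x)) (y + z)) has_vector_derivative br x y + br x z) (at 0)"
    by (simp add: linear_add[OF linear_Adj])
  then show "br x (y + z) = br x y + br x z" using vector_derivative_unique_at[OF br_deriv] by blast
  have "((\<lambda>s. c *\<^sub>R Adj (e (s *\<^sub>R x)) y) has_vector_derivative c *\<^sub>R br x y) (at 0)"
    using bounded_linear.has_vector_derivative[OF bounded_linear_scaleR_right br_deriv] .
  then have "((\<lambda>s. Adj (e (s *\<^sub>R x)) (c *\<^sub>R y)) has_vector_derivative c *\<^sub>R br x y) (at 0)"
    by (simp add: Adj_scaleR)
  then show "br x (c *\<^sub>R y) = c *\<^sub>R br x y" using vector_derivative_unique_at[OF br_deriv] by blast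
qed

lemma Adj_bounded_linear: "bounded_linear (Adj (e x))"
  using linear_Adj by (simp add: linear_conv_bounded_linear)

lemma Adj_add: "Adj (e ((s + t) *\<^sub>R x)) y = Adj (e (s *\<^sub>R x)) (Adj (e (t *\<^sub>R x)) y)"
  by (simp add: e_add Adj_mul)

text \<open>The differential of the exponential map at \<open>y\<close>, translated back to the origin.\<close>

definition Bd :: "'a \<Rightarrow> 'a \<Rightarrow> 'a" where "Bd y v = dmu (- y, y) (0, v)"

lemma linear_Bd: "norm y < r1 \<Longrightarrow> linear (Bd y)"
  using linear_compose[OF _ linear_dmu[of "- y" y], of "\<lambda>v. (0, v)"] by (simp add: o_def Bd_def[abs_def] linear_iff)

lemma Bd_deriv:
  assumes x: "norm (r *\<^sub>R x) < r1"
  shows "((\<lambda>v. \<mu> (- (r *\<^sub>R x)) (r *\<^sub>R x + r *\<^sub>R v)) has_derivative (\<lambda>v. r *\<^sub>R Bd (r *\<^sub>R x) v)) (at 0)"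
proof -
  have d1: "((\<lambda>v. - (r *\<^sub>R x)) has_derivative (\<lambda>v. 0)) (at (0::'a))" by (rule has_derivative_const)
  have d2: "((\<lambda>v. r *\<^sub>R x + r *\<^sub>R v) has_derivative (\<lambda>v. r *\<^sub>R v)) (at (0::'a))"
    by (auto intro!: derivative_eq_intros)
  have "((\<lambda>v. \<mu> (- (r *\<^sub>R x)) (r *\<^sub>R x + r *\<^sub>R v)) has_derivative (\<lambda>v. dmu (- (r *\<^sub>R x), r *\<^sub>R x + r *\<^sub>R 0) (0, r *\<^sub>R v))) (at 0)"
    by (rule dmu_comp[OF d1 d2]) (use x in auto)
  moreover have "dmu (- (r *\<^sub>R x), r *\<^sub>R x) (0, r *\<^sub>R v) = r *\<^sub>R Bd (r *\<^sub>R x) v" for v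
    using linear_scale[OF linear_dmu[of "- (r *\<^sub>R x)" "r *\<^sub>R x"], of r "(0, v)"] x by (simp add: Bd_def)
  ultimately show ?thesis by simp
qed

text \<open>\<open>F r v\<close> is the logarithm of \<open>e (- r x) e (r (x + v))\<close>. The
  group law gives \<open>e (F (s + t) v) = (e (- s x) e (F t v) e (s x)) e (F s v)\<close>, and the
  bracketed factor is the exponential of \<open>Adj (e (- s x)) (F t v)\<close>. Differentiating at
  \<open>v = 0\<close> yields the identity.\<close>

lemma Bd_cocycle:
  assumes x: "norm (s *\<^sub>R x) < r1" "norm (t *\<^sub>R x) < r1" "norm ((s + t) *\<^sub>R x) < r1"
  shows "(s + t) *\<^sub>R Bd ((s + t) *\<^sub>R x) v = Adj (e (- (s *\<^sub>R x))) (t *\<^sub>R Bd (t *\<^sub>R x) v) + s *\<^sub>R Bd (s *\<^sub>R x) v"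
proof -
  define F where "F r v = \<mu> (- (r *\<^sub>R x)) (r *\<^sub>R x + r *\<^sub>R v)" for r v
  let ?A = "Adj (e (- (s *\<^sub>R x)))"
  have F0: "F r 0 = 0" for r by (simp add: F_def)
  have A0: "?A 0 = 0" using linear_0[OF linear_Adj] .
  have dF: "(F r has_derivative (\<lambda>v. r *\<^sub>R Bd (r *\<^sub>R x) v)) (at 0)" if "norm (r *\<^sub>R x) < r1" for r
    unfolding F_def by (rule Bd_deriv[OF that])
  have dA: "((\<lambda>v. ?A (F t v)) has_derivative (\<lambda>v. ?A (t *\<^sub>R Bd (t *\<^sub>R x) v))) (at 0)"
    by (rule bounded_linear.has_derivative[OF Adj_bounded_linear dF[OF x(2)]])
  have "((\<lambda>v. \<mu> (?A (F t v)) (F s v)) has_derivative (\<lambda>v. dmu (?A (F t 0), F s 0) (?A (t *\<^sub>R Bd (t *\<^sub>R x) v), s *\<^sub>R Bd (s *\<^sub>R x) v))) (at 0)"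
    by (rule dmu_comp[OF dA dF[OF x(1)]]) (simp_all add: r1(1) F0 A0)
  moreover have "\<forall>\<^sub>F v in nhds 0. F (s + t) v = \<mu> (?A (F t v)) (F s v)"
  proof -
    have ev: "\<forall>\<^sub>F v in nhds (0::'a). norm (r *\<^sub>R x + r *\<^sub>R v) < r1" if "norm (r *\<^sub>R x) < r1" for r
      by (rule eventually_norm_less) (use that in \<open>auto intro!: continuous_intros\<close>)
    have "\<forall>\<^sub>F v in nhds 0. norm (?A (F t v)) < r1"
      by (rule eventually_norm_less[OF has_derivative_continuous[OF dA]]) (simp add: r1(1) F0 A0)
    moreover have "\<forall>\<^sub>F v in nhds 0. norm (F s v) < r1"
      by (rule eventually_norm_less[OF has_derivative_continuous[OF dF[OF x(1)]]]) (simp add: r1(1) F0)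
    ultimately show ?thesis using ev[OF x(1)] ev[OF x(2)] ev[OF x(3)]
    proof eventually_elim
      case (elim v)
      have eF: "e (F r v) = e (- (r *\<^sub>R x)) \<cdot> e (r *\<^sub>R (x + v))" if "norm (r *\<^sub>R x) < r1" "norm (r *\<^sub>R x + r *\<^sub>R v) < r1" for r
        unfolding F_def scaleR_add_right by (rule e_mu) (use that in auto)
      have m: "e (- ((s + t) *\<^sub>R x)) = e (- (s *\<^sub>R x)) \<cdot> e (- (t *\<^sub>R x))"
      proof -
        have "- ((s + t) *\<^sub>R x) = (- s + - t) *\<^sub>R x" by (simp add: algebra_simps)
        then show ?thesis by (simp only: e_add scaleR_minus_left)
      qed
      have p: "e ((s + t) *\<^sub>R (x + v)) = e (t *\<^sub>R (x + v)) \<cdot> e (s *\<^sub>R (x + v))"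
        using e_add[of t s "x + v"] by (simp add: add.commute)
      have i: "iv (e (- (s *\<^sub>R x))) = e (s *\<^sub>R x)" using e_minus[of "- (s *\<^sub>R x)"] by simp
      have c: "e (s *\<^sub>R x) \<cdot> (e (- (s *\<^sub>R x)) \<cdot> g) = g" for g by (simp flip: mul_assoc)
      have "\<mu> (?A (F t v)) (F s v) = F (s + t) v"
      proof (rule mu_eqI)
        show "F (s + t) v \<in> W" unfolding F_def by (rule mu_W) (use x(3) elim(5) in auto)
        show "e (F (s + t) v) = e (?A (F t v)) \<cdot> e (F s v)"
          unfolding e_Adj_1 eF[OF x(1) elim(3)] eF[OF x(2) elim(4)] eF[OF x(3) elim(5)] m p i
          by (simp only: mul_assoc c)
      qed
      then show ?case by simp
    qed
  qed
  ultimately have "(\<lambda>v. (s + t) *\<^sub>R Bd ((s + t) *\<^sub>R x) v) = (\<lambda>v. dmu (?A (F t 0), F s 0) (?A (t *\<^sub>R Bd (t *\<^sub>R x) v), s *\<^sub>R Bd (s *\<^sub>R x) v))"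
    by (rule has_derivative_unique_eventually[OF dF[OF x(3)]])
  from fun_cong[OF this, of v] show ?thesis by (simp only: F0 A0 dmu_0)
qed

lemma Bd_tendsto: "isCont (\<lambda>y. Bd y v) 0"
proof -
  have "smooth_on (ball 0 r1 \<times> ball 0 r1) (\<lambda>p. dmu p (0, v))"
    unfolding dmu_def by (rule smooth_on_frechet[OF smooth_mu_ball])
  then have "continuous_on (ball 0 r1 \<times> ball 0 r1) (\<lambda>p. dmu p (0, v))" by (rule smooth_on_continuous)
  then have "isCont (\<lambda>p. dmu p (0, v)) (- 0, 0)"
    using r1(1) by (subst (asm) continuous_on_eq_continuous_at) (auto intro!: open_Times)
  moreover have "isCont (\<lambda>y::'a. (- y, y)) 0" by (intro continuous_intros)
  ultimately have "isCont (\<lambda>y. dmu (- y, y) (0, v)) 0" by (intro isCont_o2[of 0 "\<lambda>y. (- y, y)" "\<lambda>p. dmu p (0, v)"])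
  then show ?thesis by (simp only: Bd_def)
qed

lemma Bd_0 [simp]: "Bd 0 v = v" by (simp add: Bd_def)

text \<open>Differentiates \<open>a ((- a) (a + v)) = a + v\<close>, products taken with
  \<open>\<mu>\<close>: the differential at 0 of left translation by \<open>a\<close> undoes
  \<open>Bd a\<close>.\<close>

lemma dmu_Bd: assumes a: "norm a < r1" shows "dmu (a, 0) (0, Bd a v) = v"
proof -
  have dF: "((\<lambda>v. \<mu> (- a) (a + v)) has_derivative Bd a) (at 0)"
    using Bd_deriv[of 1 a] a by simp
  have dc: "((\<lambda>v. a) has_derivative (\<lambda>v. 0)) (at (0::'a))" by (rule has_derivative_const)
  have "((\<lambda>v. \<mu> a (\<mu> (- a) (a + v))) has_derivative (\<lambda>v. dmu (a, \<mu> (- a) (a + 0)) (0, Bd a v))) (at 0)"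
    by (rule dmu_comp[OF dc dF]) (simp_all add: a r1(1))
  moreover have "((\<lambda>v. a + v) has_derivative (\<lambda>v. v)) (at 0)" by (auto intro!: derivative_eq_intros)
  moreover have "\<forall>\<^sub>F v in nhds 0. \<mu> a (\<mu> (- a) (a + v)) = a + v"
  proof -
    have "\<forall>\<^sub>F v in nhds (0::'a). norm (a + v) < r1"
      by (rule eventually_norm_less) (use a in \<open>auto intro!: continuous_intros\<close>)
    moreover have "\<forall>\<^sub>F v in nhds 0. norm (\<mu> (- a) (a + v)) < r1"
      by (rule eventually_norm_less[OF has_derivative_continuous[OF dF]]) (simp add: r1(1))
    ultimately show ?thesis
    proof eventually_elim
      case (elim v)
      have na: "norm (- a) < r1" using a by simp
      show ?case
      proof (rule mu_eqI)
        show "a + v \<in> W" using elim(1) by (rule r1_W)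
        show "e (a + v) = e a \<cdot> e (\<mu> (- a) (a + v))"
          unfolding e_mu[OF na elim(1)] by (simp flip: mul_assoc)
      qed
    qed
  qed
  ultimately have "(\<lambda>v. dmu (a, \<mu> (- a) (a + 0)) (0, Bd a v)) = (\<lambda>v. v)" by (rule has_derivative_unique_eventually)
  from fun_cong[OF this, of v] show ?thesis by simp
qed

section \<open>Lie algebra homomorphisms respect the local product\<close>

context
  fixes T :: "'a \<Rightarrow> 'a"
  assumes T: "linear T" and T_br: "T (br x y) = br (T x) (T y)"
begin

lemma T_bounded_linear: "bounded_linear T" using T by (simp add: linear_conv_bounded_linear)

text \<open>The claim is that \<open>Adj (e (- s T x)) (T (Adj (e (s x)) y))\<close>, called
  \<open>h s\<close>, does not depend on \<open>s\<close>. By the one-parameter law its derivative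
  at any \<open>s\<close> reduces to a derivative at 0, which vanishes because \<open>T\<close>
  preserves brackets.\<close>

lemma Adj_equivariant: "T (Adj (e x) y) = Adj (e (T x)) (T y)"
proof -
  define U where "U s = Adj (e (s *\<^sub>R x))" for s
  define V where "V s = Adj (e (s *\<^sub>R T x))" for s
  have Vlin: "linear (V s)" for s unfolding V_def by (rule linear_Adj)
  define k where "k z \<delta> = V (- \<delta>) (T (U \<delta> z))" for z \<delta>
  have k: "(k z has_vector_derivative 0) (at 0)" for z
  proof -
    have k_eq: "k z = (\<lambda>\<delta>. \<Sum>b\<in>Basis. (T (U \<delta> z) \<bullet> b) *\<^sub>R V (- \<delta>) b)"
      unfolding k_def by (rule ext, rule linear_basis_expansion[OF Vlin])
    have dU: "((\<lambda>\<delta>. T (U \<delta> z)) has_vector_derivative T (br x z)) (at 0)"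
      unfolding U_def by (rule bounded_linear.has_vector_derivative[OF T_bounded_linear br_deriv])
    have dUb: "((\<lambda>\<delta>. T (U \<delta> z) \<bullet> b) has_real_derivative T (br x z) \<bullet> b) (at 0)" for b
      using bounded_linear.has_vector_derivative[OF bounded_linear_inner_left dU]
      by (simp add: has_real_derivative_iff_has_vector_derivative)
    have dV: "((\<lambda>\<delta>. V (- \<delta>) b) has_vector_derivative - br (T x) b) (at 0)" for b
    proof -
      have "((\<lambda>\<delta>::real. - \<delta>) has_vector_derivative - 1) (at 0)"
        by (auto intro!: derivative_eq_intros)
      moreover have "((\<lambda>s. V s b) has_vector_derivative br (T x) b) (at (- 0))"
        unfolding V_def using br_deriv by simp
      ultimately show ?thesis using vector_diff_chain_at[of "\<lambda>\<delta>. - \<delta>" "- 1" 0 "\<lambda>s. V s b"] by (simp add: o_def)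
    qed
    have "(k z has_vector_derivative (\<Sum>b\<in>Basis. (T (U 0 z) \<bullet> b) *\<^sub>R (- br (T x) b) + (T (br x z) \<bullet> b) *\<^sub>R V (- 0) b)) (at 0)"
      unfolding k_eq by (intro has_vector_derivative_sum has_vector_derivative_scaleR dUb dV)
    moreover have "(\<Sum>b\<in>Basis. (T (U 0 z) \<bullet> b) *\<^sub>R (- br (T x) b) + (T (br x z) \<bullet> b) *\<^sub>R V (- 0) b) = 0"
    proof -
      have "(\<Sum>b\<in>Basis. (T (U 0 z) \<bullet> b) *\<^sub>R br (T x) b) = br (T x) (T z)"
        using linear_basis_expansion[OF linear_br, of "T x" "T z"] by (simp add: U_def)
      moreover have "(\<Sum>b\<in>Basis. (T (br x z) \<bullet> b) *\<^sub>R V (- 0) b) = T (br x z)"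
        by (simp add: V_def euclidean_representation)
      ultimately show ?thesis by (simp add: sum.distrib sum_negf sum_subtractf T_br)
    qed
    ultimately show ?thesis by simp
  qed
  define h where "h s = V (- s) (T (U s y))" for s
  have h: "(h has_vector_derivative 0) (at s)" for s
  proof -
    have h_eq: "h r = V (- s) (k (U s y) (r - s))" for r
    proof -
      have "V (- r) z = V (- s) (V (- (r - s)) z)" for z
        using Adj_add[of "- s" "- (r - s)" "T x" z] by (simp add: V_def)
      moreover have "U r y = U (r - s) (U s y)"
        using Adj_add[of "r - s" s x y] by (simp add: U_def)
      ultimately show ?thesis by (simp add: h_def k_def)
    qed
    have "((\<lambda>r. r - s) has_vector_derivative 1) (at s)" by (auto intro!: derivative_eq_intros)
    moreover have "(k (U s y) has_vector_derivative 0) (at (s - s))" using k by simp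
    ultimately have "((\<lambda>r. k (U s y) (r - s)) has_vector_derivative 0) (at s)"
      using vector_diff_chain_at[of "\<lambda>r. r - s" 1 s "k (U s y)" 0] by (simp add: o_def)
    from bounded_linear.has_vector_derivative[OF _ this, of "V (- s)"]
    have "((\<lambda>r. V (- s) (k (U s y) (r - s))) has_vector_derivative V (- s) 0) (at s)"
      unfolding V_def using Adj_bounded_linear by blast
    then show ?thesis using linear_0[OF Vlin] by (simp add: h_eq[abs_def])
  qed
  obtain c where c: "\<And>s. s \<in> UNIV \<Longrightarrow> h s = c"
    by (rule has_vector_derivative_zero_constant[of UNIV h, OF convex_UNIV]) (use h in blast)+
  then have "h 1 = h 0" using c[of 0] c[of 1] by simp
  then have "Adj (e (- T x)) (T (Adj (e x) y)) = T y" by (simp add: h_def U_def V_def)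
  then have "Adj (e (T x)) (Adj (e (- T x)) (T (Adj (e x) y))) = Adj (e (T x)) (T y)" by simp
  then show ?thesis by (simp flip: Adj_mul)
qed

text \<open>By the cocycle identity the defect satisfies
  \<open>D (s + t) = Adj (e (- s T x)) (D t) + D s\<close>. Cutting the unit interval into
  \<open>n\<close> pieces bounds \<open>norm (D 1)\<close> by
  \<open>C * n * norm (D (1 / n))\<close>, and \<open>n D (1 / n)\<close> tends to
  \<open>T v - T v\<close> since \<open>Bd\<close> is continuous at 0.\<close>

lemma Bd_equivariant:
  assumes x: "norm x < r1" "norm (T x) < r1"
  shows "T (Bd x v) = Bd (T x) (T v)"
proof -
  define D where "D s = T (s *\<^sub>R Bd (s *\<^sub>R x) v) - s *\<^sub>R Bd (s *\<^sub>R T x) (T v)" for s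
  have small: "norm (s *\<^sub>R z) < r1" if "0 \<le> s" "s \<le> 1" "norm z < r1" for s and z :: 'a
    using that mult_right_mono[of s 1 "norm z"] by auto
  let ?A = "\<lambda>s. Adj (e (- (s *\<^sub>R T x)))"
  have D_add: "D (s + t) = ?A s (D t) + D s" if st: "0 \<le> s" "0 \<le> t" "s + t \<le> 1" for s t
  proof -
    have c1: "(s + t) *\<^sub>R Bd ((s + t) *\<^sub>R x) v = Adj (e (- (s *\<^sub>R x))) (t *\<^sub>R Bd (t *\<^sub>R x) v) + s *\<^sub>R Bd (s *\<^sub>R x) v"
      by (intro Bd_cocycle small x) (use st in auto)
    have c2: "(s + t) *\<^sub>R Bd ((s + t) *\<^sub>R T x) (T v) = ?A s (t *\<^sub>R Bd (t *\<^sub>R T x) (T v)) + s *\<^sub>R Bd (s *\<^sub>R T x) (T v)"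
      by (intro Bd_cocycle small x) (use st in auto)
    have "T (- (s *\<^sub>R x)) = - (s *\<^sub>R T x)" by (simp add: linear_neg[OF T] linear_scale[OF T])
    then show ?thesis
      unfolding D_def c1 c2 linear_add[OF T] Adj_equivariant linear_diff[OF linear_Adj] by simp
  qed
  \<comment> \<open>A bound uniform in \<open>s\<close>: each of the \<open>n\<close> increments of
    the defect is the same small vector moved by one of these operators.\<close>
  have "\<exists>C. \<forall>s\<in>{0..1}. norm (?A s b) \<le> C" for b
  proof -
    have "continuous_on {0..1::real} (\<lambda>s. Adj (e (s *\<^sub>R (- T x))) b)" by (rule continuous_on_subset[OF Adj_cont]) simp
    then have "compact ((\<lambda>s. Adj (e (s *\<^sub>R (- T x))) b) ` {0..1::real})" by (rule compact_continuous_image) simp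
    then have "bounded ((\<lambda>s. Adj (e (s *\<^sub>R (- T x))) b) ` {0..1::real})" by (rule compact_imp_bounded)
    then show ?thesis unfolding bounded_iff by auto
  qed
  then have "\<exists>Cb. \<forall>b. \<forall>s\<in>{0..1}. norm (?A s b) \<le> Cb b" by (intro choice allI)
  then obtain Cb where Cb: "\<And>b s. s \<in> {0..1} \<Longrightarrow> norm (?A s b) \<le> Cb b" by blast
  define C where "C = (\<Sum>b\<in>Basis. Cb b)"
  have C: "norm (?A s w) \<le> C * norm w" if "s \<in> {0..1}" for s w
  proof -
    have "?A s w = (\<Sum>b\<in>Basis. (w \<bullet> b) *\<^sub>R ?A s b)" by (rule linear_basis_expansion[OF linear_Adj])
    also have "norm \<dots> \<le> (\<Sum>b\<in>Basis. norm w * Cb b)"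
    proof (rule sum_norm_le)
      fix b :: 'a assume b: "b \<in> Basis"
      show "norm ((w \<bullet> b) *\<^sub>R ?A s b) \<le> norm w * Cb b"
        unfolding norm_scaleR using Basis_le_norm[OF b, of w] Cb[OF that, of b] by (intro mult_mono) auto
    qed
    finally show ?thesis by (simp add: C_def sum_distrib_left mult.commute)
  qed
  have bound: "norm (D 1) \<le> C * norm (T (Bd ((1 / real n) *\<^sub>R x) v) - Bd ((1 / real n) *\<^sub>R T x) (T v))" if n: "0 < n" for n
  proof -
    have ind: "norm (D (real k / real n)) \<le> real k * (C * norm (D (1 / real n)))" if "k \<le> n" for k
      using that
    proof (induction k)
      case 0
      then show ?case by (simp add: D_def linear_0[OF T])
    next
      case (Suc k)
      have s: "real k / real n + 1 / real n \<le> 1" using Suc.prems n by (simp add: field_simps)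
      have k1: "real k / real n \<in> {0..1}" using Suc.prems n by (simp add: divide_le_eq)
      have "D (real k / real n + 1 / real n) = ?A (real k / real n) (D (1 / real n)) + D (real k / real n)"
        using s by (intro D_add) auto
      then have "norm (D (real k / real n + 1 / real n)) \<le> norm (?A (real k / real n) (D (1 / real n))) + norm (D (real k / real n))"
        by (simp add: norm_triangle_ineq)
      also have "\<dots> \<le> C * norm (D (1 / real n)) + real k * (C * norm (D (1 / real n)))"
        using Suc by (intro add_mono C k1) auto
      finally show ?case by (simp add: add_divide_distrib distrib_right add.commute)
    qed
    have "D (1 / real n) = (1 / real n) *\<^sub>R (T (Bd ((1 / real n) *\<^sub>R x) v) - Bd ((1 / real n) *\<^sub>R T x) (T v))"
      unfolding D_def linear_scale[OF T] scaleR_diff_right ..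
    then have "norm (D (1 / real n)) = (1 / real n) * norm (T (Bd ((1 / real n) *\<^sub>R x) v) - Bd ((1 / real n) *\<^sub>R T x) (T v))"
      by simp
    then show ?thesis using ind[of n] n by simp
  qed
  have inv0: "(\<lambda>n. 1 / real (Suc n)) \<longlonglongrightarrow> 0" using LIMSEQ_inverse_real_of_nat by (simp add: inverse_eq_divide)
  have Blim: "(\<lambda>n. Bd ((1 / real (Suc n)) *\<^sub>R z) w) \<longlonglongrightarrow> w" for z w
  proof -
    have "(\<lambda>n. (1 / real (Suc n)) *\<^sub>R z) \<longlonglongrightarrow> 0 *\<^sub>R z" by (intro tendsto_scaleR inv0 tendsto_const)
    then have "(\<lambda>n. (1 / real (Suc n)) *\<^sub>R z) \<longlonglongrightarrow> 0" by (simp only: scaleR_zero_left)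
    from isCont_tendsto_compose[OF Bd_tendsto this, of w] show ?thesis by simp
  qed
  have "(\<lambda>n. T (Bd ((1 / real (Suc n)) *\<^sub>R x) v)) \<longlonglongrightarrow> T v"
    by (rule bounded_linear.tendsto[OF T_bounded_linear Blim])
  then have "(\<lambda>n. C * norm (T (Bd ((1 / real (Suc n)) *\<^sub>R x) v) - Bd ((1 / real (Suc n)) *\<^sub>R T x) (T v))) \<longlonglongrightarrow> C * norm (T v - T v)"
    by (intro tendsto_mult tendsto_const tendsto_norm tendsto_diff Blim)
  then have "norm (D 1) \<le> C * norm (T v - T v)"
    by (rule LIMSEQ_le_const) (use bound in blast)
  then show ?thesis by (simp add: D_def)
qed

text \<open>The differential of left translation at 0 is inverse to \<open>Bd a\<close>, whose
  equivariance is known; \<open>Bd a\<close> is injective and hence, by dimension, onto.\<close>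

lemma dmu_equivariant:
  assumes a: "norm a < r1" "norm (T a) < r1"
  shows "T (dmu (a, 0) (0, y)) = dmu (T a, 0) (0, T y)"
proof -
  have "inj (Bd a)"
  proof (rule injI)
    fix v w assume "Bd a v = Bd a w"
    then have "dmu (a, 0) (0, Bd a v) = dmu (a, 0) (0, Bd a w)" by (rule arg_cong)
    then show "v = w" unfolding dmu_Bd[OF a(1)] .
  qed
  with linear_Bd[OF a(1)] have "surj (Bd a)" by (rule linear_inj_imp_surj)
  then obtain v where v: "y = Bd a v" by (rule surjE)
  have "T (dmu (a, 0) (0, y)) = T v" by (simp only: v dmu_Bd[OF a(1)])
  also have "\<dots> = dmu (T a, 0) (0, T y)" by (simp only: v Bd_equivariant[OF a] dmu_Bd[OF a(2)])
  finally show ?thesis .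
qed

text \<open>The path \<open>t \<mapsto> T (\<mu> x (t y))\<close> solves the left-invariant equation
  with velocity \<open>T y\<close>, because the differentials of left translations are equivariant.
  Hence its quotient \<open>f\<close> by the one-parameter subgroup of \<open>T y\<close> is
  constant. The last hypothesis keeps the path in the domain of the local product.\<close>

theorem local_automorphism:
  assumes x: "norm x < r2" and y: "norm y < r2" "norm (T y) < r2"
    and p: "\<And>t. 0 \<le> t \<Longrightarrow> t \<le> 1 \<Longrightarrow> norm (T (\<mu> x (t *\<^sub>R y))) < r2"
  shows "T (\<mu> x y) = \<mu> (T x) (T y)"
proof -
  define f where "f t = \<mu> (T (\<mu> x (t *\<^sub>R y))) (- (t *\<^sub>R T y))" for t
  have small: "norm (t *\<^sub>R z) < r2" if "0 \<le> t" "t \<le> 1" "norm z < r2" for t and z :: 'a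
    using that mult_right_mono[of t 1 "norm z"] by auto
  have f: "(f has_vector_derivative 0) (at t)" if t: "0 \<le> t" "t \<le> 1" for t
  proof -
    define q where "q = \<mu> x (t *\<^sub>R y)"
    have ty: "norm (t *\<^sub>R y) < r2" "norm (t *\<^sub>R T y) < r2" using small[OF t] y by auto
    have q: "norm q < r1" "norm (T q) < r2" unfolding q_def using r2(3)[OF x ty(1)] p[OF t] by auto
    have Tq: "norm (T q) < r1" using q(2) by (rule r2_r1)
    define g where "g h = \<mu> x ((t + h) *\<^sub>R y)" for h
    have ev1: "\<forall>\<^sub>F h in nhds (0::real). norm ((t + h) *\<^sub>R z) < r2" if "norm (t *\<^sub>R z) < r2" for z :: 'a
      by (rule eventually_norm_less) (use that in \<open>auto intro!: continuous_intros\<close>)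
    have ev2: "\<forall>\<^sub>F h in nhds (0::real). norm (h *\<^sub>R z) < r1" for z :: 'a
      by (rule eventually_norm_less) (use r1(1) in \<open>auto intro!: continuous_intros\<close>)
    have "\<forall>\<^sub>F h in nhds 0. \<mu> q (h *\<^sub>R y) = g h"
      using ev1[OF ty(1)] ev2[of y]
    proof eventually_elim
      case (elim h)
      show ?case
      proof (rule mu_eqI)
        show "g h \<in> W" unfolding g_def by (rule mu_W[OF r2_r1[OF x] r2_r1[OF elim(1)]])
        show "e (g h) = e q \<cdot> e (h *\<^sub>R y)"
          unfolding g_def q_def e_mu[OF r2_r1[OF x] r2_r1[OF elim(1)]] e_mu[OF r2_r1[OF x] r2_r1[OF ty(1)]] e_add mul_assoc ..
      qed
    qed
    then obtain S where S: "open S" "0 \<in> S" "\<And>h. h \<in> S \<Longrightarrow> \<mu> q (h *\<^sub>R y) = g h" unfolding eventually_nhds by blast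
    have ds: "((\<lambda>h::real. h *\<^sub>R z) has_derivative (\<lambda>h. h *\<^sub>R z)) (at 0)" for z :: 'a
      by (auto intro!: derivative_eq_intros)
    have dc: "((\<lambda>h::real. z) has_derivative (\<lambda>v. 0)) (at 0)" for z :: 'a by (rule has_derivative_const)
    have "((\<lambda>h. \<mu> q (h *\<^sub>R y)) has_derivative (\<lambda>h. dmu (q, 0 *\<^sub>R y) (0, h *\<^sub>R y))) (at 0)"
      by (rule dmu_comp[OF dc ds q(1)]) (simp add: r1(1))
    from has_derivative_transform_within_open[OF this S]
    have dg: "(g has_derivative (\<lambda>h. dmu (q, 0) (0, h *\<^sub>R y))) (at 0)" by (simp only: scaleR_zero_left)
    have dTg: "((\<lambda>h. T (g h)) has_derivative (\<lambda>h. T (dmu (q, 0) (0, h *\<^sub>R y)))) (at 0)"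
      by (rule bounded_linear.has_derivative[OF T_bounded_linear dg])
    define w where "w h = \<mu> (T (g h)) (h *\<^sub>R (- T y))" for h
    have g0: "g 0 = q" by (simp add: g_def q_def)
    have nTg: "norm (T (g 0)) < r1" using Tq g0 by simp
    have "(w has_derivative (\<lambda>h. dmu (T (g 0), 0 *\<^sub>R (- T y)) (T (dmu (q, 0) (0, h *\<^sub>R y)), h *\<^sub>R (- T y)))) (at 0)"
      unfolding w_def by (rule dmu_comp[OF dTg ds nTg]) (simp add: r1(1))
    \<comment> \<open>The velocity of \<open>T (g h)\<close> is cancelled by that of the factor
      \<open>- h T y\<close>; this is where \<open>dmu_equivariant\<close> enters.\<close>
    moreover have "dmu (T (g 0), 0 *\<^sub>R (- T y)) (T (dmu (q, 0) (0, h *\<^sub>R y)), h *\<^sub>R (- T y)) = 0" for h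
    proof -
      have n0: "norm (0::'a) < r1" using r1(1) by simp
      have "dmu (T q, 0) (T (dmu (q, 0) (0, h *\<^sub>R y)), h *\<^sub>R (- T y))
        = T (dmu (q, 0) (0, h *\<^sub>R y)) + dmu (T q, 0) (0, h *\<^sub>R (- T y))"
        by (subst dmu_split[OF Tq n0]) (simp only: dmu_left[OF Tq])
      also have "dmu (T q, 0) (0, h *\<^sub>R (- T y)) = - dmu (T q, 0) (0, T (h *\<^sub>R y))"
        using linear_neg[OF linear_dmu[OF Tq n0], of "(0, T (h *\<^sub>R y))"] by (simp add: linear_scale[OF T])
      also have "dmu (T q, 0) (0, T (h *\<^sub>R y)) = T (dmu (q, 0) (0, h *\<^sub>R y))"
        using dmu_equivariant[OF q(1) Tq] by simp
      finally show ?thesis by (simp add: g0)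
    qed
    ultimately have dw: "(w has_derivative (\<lambda>h. 0)) (at 0)" by simp
    have w0: "w 0 = T q" by (simp add: w_def g0 Tq)
    have nw: "norm (w 0) < r1" using w0 Tq by simp
    have nty: "norm (- (t *\<^sub>R T y)) < r1" using r2_r1[OF ty(2)] by simp
    have "((\<lambda>h. \<mu> (w h) (- (t *\<^sub>R T y))) has_derivative (\<lambda>h. dmu (w 0, - (t *\<^sub>R T y)) (0, 0))) (at 0)"
      by (rule dmu_comp[OF dw dc nw nty])
    moreover have "dmu (w 0, - (t *\<^sub>R T y)) (0, 0) = 0"
      using linear_0[OF linear_dmu[OF nw nty]] by (simp add: zero_prod_def)
    ultimately have dm: "((\<lambda>h. \<mu> (w h) (- (t *\<^sub>R T y))) has_derivative (\<lambda>h. 0)) (at 0)" by simp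
    have "\<forall>\<^sub>F h in nhds 0. norm (w h) < r1"
      by (rule eventually_norm_less[OF has_derivative_continuous[OF dw] nw])
    moreover have "\<forall>\<^sub>F h in nhds 0. norm (T (g h)) < r1"
      by (rule eventually_norm_less[OF has_derivative_continuous[OF dTg] nTg])
    ultimately have "\<forall>\<^sub>F h in nhds 0. \<mu> (w h) (- (t *\<^sub>R T y)) = f (t + h)"
      using ev1[OF ty(2)] ev2[of "- T y"]
    proof eventually_elim
      case (elim h)
      have n: "norm (- ((t + h) *\<^sub>R T y)) < r1" using r2_r1[OF elim(3)] by simp
      show ?case
      proof (rule mu_eqI)
        show "f (t + h) \<in> W" unfolding f_def g_def[symmetric] by (rule mu_W[OF elim(2) n])
        have "e (- ((t + h) *\<^sub>R T y)) = e (h *\<^sub>R (- T y)) \<cdot> e (- (t *\<^sub>R T y))"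
          using e_add[of h t "- T y"] by (simp add: add.commute)
        then show "e (f (t + h)) = e (w h) \<cdot> e (- (t *\<^sub>R T y))"
          unfolding f_def g_def[symmetric] w_def e_mu[OF elim(2) n] e_mu[OF elim(2) elim(4)] by (simp only: mul_assoc)
      qed
    qed
    then obtain S where S: "open S" "0 \<in> S" "\<And>h. h \<in> S \<Longrightarrow> \<mu> (w h) (- (t *\<^sub>R T y)) = f (t + h)" unfolding eventually_nhds by blast
    have "((\<lambda>h. f (t + h)) has_derivative (\<lambda>h. 0)) (at 0)"
      by (rule has_derivative_transform_within_open[OF dm S])
    then have "((\<lambda>h. f (t + h)) has_derivative (\<lambda>h. 0)) (at (t - t))" by simp
    moreover have "((\<lambda>r. r - t) has_derivative (\<lambda>r. r)) (at t)" by (auto intro!: derivative_eq_intros)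
    ultimately have "((\<lambda>r. f (t + (r - t))) has_derivative (\<lambda>h. 0)) (at t)"
      using diff_chain_at[of "\<lambda>r. r - t" "\<lambda>r. r" t "\<lambda>h. f (t + h)" "\<lambda>h. 0"] by (simp add: o_def)
    then show ?thesis by (simp add: has_vector_derivative_def)
  qed
  obtain c where c: "\<And>t. t \<in> {0..1} \<Longrightarrow> f t = c"
  proof (rule has_vector_derivative_zero_constant[of "{0..1}" f])
    show "(f has_vector_derivative 0) (at t within {0..1})" if "t \<in> {0..1}" for t
      using f[of t] that by (auto intro: has_vector_derivative_at_within)
  qed auto
  then have "f 1 = f 0" using c[of 0] c[of 1] by simp
  moreover have "f 0 = T x"
  proof -
    have m: "\<mu> x 0 = x" by (rule mu_0_right[OF r2_r1[OF x]])
    then have "norm (T x) < r1" using p[of 0] r2_r1 by simp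
    then show ?thesis by (simp add: f_def m)
  qed
  ultimately have f1: "\<mu> (T (\<mu> x y)) (- T y) = T x" by (simp add: f_def)
  have n: "norm (T (\<mu> x y)) < r1" using p[of 1] r2_r1 by simp
  have nTy: "norm (- T y) < r1" using y(2) r2_r1 by simp
  have "e (T (\<mu> x y)) \<cdot> e (- T y) = e (T x)"
    using e_mu[OF n nTy] f1 by simp
  then have "e (T (\<mu> x y)) \<cdot> e (- T y) \<cdot> e (T y) = e (T x) \<cdot> e (T y)" by simp
  then have "e (T (\<mu> x y)) = e (T x) \<cdot> e (T y)" by (simp add: mul_assoc)
  then show ?thesis using mu_eqI[OF r1_W[OF n]] by simp
qed

end

end

section \<open>The group law on the Lie algebra\<close>

text \<open>\<open>nn\<close> is a gauge of smallness that every dilation with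
  \<open>l \<le> 1\<close> shrinks by at least the factor \<open>l\<close>, so that dilating pulls
  any given vectors into the domain of the local product and keeps them there.\<close>

locale dilated_exp = local_exp mul iv un e W L
  for mul :: "'g::t2_space \<Rightarrow> 'g \<Rightarrow> 'g" (infixl "\<cdot>" 70) and iv :: "'g \<Rightarrow> 'g" and un :: 'g
    and e :: "'a::euclidean_space \<Rightarrow> 'g" and W :: "'a set" and L :: "'g \<Rightarrow> 'a" +
  fixes dil :: "real \<Rightarrow> 'a \<Rightarrow> 'a" and nn :: "'a \<Rightarrow> real"
  assumes dil_linear: "0 < l \<Longrightarrow> linear (dil l)"
    and dil_br: "0 < l \<Longrightarrow> dil l (br v w) = br (dil l v) (dil l w)"
    and dil_dil: "0 < l \<Longrightarrow> 0 < m \<Longrightarrow> dil l (dil m v) = dil (l * m) v"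
    and dil_1 [simp]: "dil 1 v = v"
    and nn_nonneg [simp]: "0 \<le> nn v"
    and nn_scaleR: "nn (c *\<^sub>R v) = \<bar>c\<bar> * nn v"
    and nn_dil: "0 < l \<Longrightarrow> l \<le> 1 \<Longrightarrow> nn (dil l v) \<le> l * nn v"
    and nn_nhds: "0 < r \<Longrightarrow> \<exists>\<rho>>0. \<forall>v. nn v < \<rho> \<longrightarrow> norm v < r"
    and cont_nn: "continuous_on UNIV nn"
begin

lemma nn_0 [simp]: "nn 0 = 0" using nn_scaleR[of 0 0] by simp

lemma nn_minus [simp]: "nn (- v) = nn v" using nn_scaleR[of "- 1" v] by simp

lemma isCont_nn: "isCont nn v" using cont_nn by (simp add: continuous_on_eq_continuous_at)

lemma eventually_nn_less: "isCont f x \<Longrightarrow> nn (f x) < r \<Longrightarrow> \<forall>\<^sub>F y in nhds x. nn (f y) < r"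
proof -
  assume f: "isCont f x" "nn (f x) < r"
  have "isCont (\<lambda>y. nn (f y)) x" using f(1) isCont_nn by (rule isCont_o2)
  then have "\<forall>\<^sub>F y in at x. nn (f y) < r" using f(2) unfolding isCont_def by (rule order_tendstoD(2))
  then show ?thesis using f(2) by (simp add: eventually_nhds_conv_at)
qed

lemma dil_scaleR: "0 < l \<Longrightarrow> dil l (c *\<^sub>R v) = c *\<^sub>R dil l v" using linear_scale[OF dil_linear] .

lemma dil_inverse [simp]: "0 < l \<Longrightarrow> dil (1 / l) (dil l v) = v" "0 < l \<Longrightarrow> dil l (dil (1 / l) v) = v"
  by (simp_all add: dil_dil)

lemma dil_inj: "0 < l \<Longrightarrow> dil l v = dil l w \<Longrightarrow> v = w" by (metis dil_inverse(1))

lemma nn_dil_le: "0 < l \<Longrightarrow> l \<le> 1 \<Longrightarrow> nn (dil l v) \<le> nn v"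
  using nn_dil[of l v] mult_right_mono[of l 1 "nn v"] by simp

text \<open>The radius has to serve all \<open>l \<le> 1\<close> at once: since such dilations do
  not increase \<open>nn\<close>, one bound on the path in \<open>local_automorphism\<close> covers
  all of them.\<close>

lemma rho0_ex: "\<exists>\<rho>>0. (\<forall>v. nn v < \<rho> \<longrightarrow> norm v < r2) \<and>
  (\<forall>x y l. nn x < \<rho> \<longrightarrow> nn y < \<rho> \<longrightarrow> 0 < l \<longrightarrow> l \<le> 1 \<longrightarrow> dil l (\<mu> x y) = \<mu> (dil l x) (dil l y))"
proof -
  obtain \<rho>a where \<rho>a: "0 < \<rho>a" "\<And>v. nn v < \<rho>a \<Longrightarrow> norm v < r2" using nn_nhds[OF r2(1)] by blast
  have n0: "norm (0::'a) < r1" using r1(1) by simp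
  have m0: "\<mu> 0 0 = 0" using n0 by (rule mu_0_left)
  have "isCont (\<lambda>p. \<mu> (fst p) (snd p)) (0, 0)"
    by (rule has_derivative_continuous[OF dmu[OF n0 n0]])
  then have "\<forall>\<^sub>F p in nhds (0, 0). nn (\<mu> (fst p) (snd p)) < \<rho>a"
    by (rule eventually_nn_less) (simp add: m0 \<rho>a)
  then obtain r where r: "0 < r" "\<And>p. dist p (0, 0) < r \<Longrightarrow> nn (\<mu> (fst p) (snd p)) < \<rho>a"
    unfolding eventually_nhds_ball by blast
  obtain \<rho>b where \<rho>b: "0 < \<rho>b" "\<And>v. nn v < \<rho>b \<Longrightarrow> norm v < r / 2" using nn_nhds[of "r / 2"] r by auto
  define \<rho> where "\<rho> = min \<rho>a \<rho>b"
  have \<rho>: "0 < \<rho>" "\<rho> \<le> \<rho>a" "\<rho> \<le> \<rho>b" using \<rho>a \<rho>b by (auto simp: \<rho>_def)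
  have sm: "norm v < r2" if "nn v < \<rho>" for v using \<rho>a(2) \<rho>(2) that by (meson less_le_trans)
  show ?thesis
  proof (intro exI[of _ \<rho>] conjI allI impI)
    fix x y :: 'a and l :: real assume xy: "nn x < \<rho>" "nn y < \<rho>" and l: "0 < l" "l \<le> 1"
    show "dil l (\<mu> x y) = \<mu> (dil l x) (dil l y)"
    proof (rule local_automorphism[OF dil_linear[OF l(1)] dil_br[OF l(1)]])
      show "norm x < r2" "norm y < r2" using sm xy by auto
      show "norm (dil l y) < r2" using nn_dil_le[OF l, of y] xy by (intro sm) linarith
      fix t :: real assume t: "0 \<le> t" "t \<le> 1"
      have "nn (t *\<^sub>R y) \<le> nn y" using t mult_right_mono[of t 1 "nn y"] by (simp add: nn_scaleR)
      then have "nn (t *\<^sub>R y) < \<rho>b" "nn x < \<rho>b" using xy \<rho>(3) by linarith+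
      then have "norm (t *\<^sub>R y) < r / 2" "norm x < r / 2" using \<rho>b(2) by blast+
      then have "norm x + norm (t *\<^sub>R y) < r" by linarith
      moreover have "dist (x, t *\<^sub>R y) (0, 0) \<le> norm x + norm (t *\<^sub>R y)"
        using norm_Pair_le[of x "t *\<^sub>R y"] by (simp add: dist_norm)
      ultimately have "dist (x, t *\<^sub>R y) (0, 0) < r" by linarith
      from r(2)[OF this] have "nn (\<mu> x (t *\<^sub>R y)) < \<rho>a" by simp
      then show "norm (dil l (\<mu> x (t *\<^sub>R y))) < r2"
        using nn_dil_le[OF l, of "\<mu> x (t *\<^sub>R y)"] by (intro \<rho>a(2)) linarith
    qed
  qed (use \<rho> sm in auto)
qed

definition \<rho>0 :: real where "\<rho>0 = (SOME \<rho>. 0 < \<rho> \<and> (\<forall>v. nn v < \<rho> \<longrightarrow> norm v < r2) \<and>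
  (\<forall>x y l. nn x < \<rho> \<longrightarrow> nn y < \<rho> \<longrightarrow> 0 < l \<longrightarrow> l \<le> 1 \<longrightarrow> dil l (\<mu> x y) = \<mu> (dil l x) (dil l y)))"

lemma rho0: "0 < \<rho>0" "nn v < \<rho>0 \<Longrightarrow> norm v < r2"
  and dil_mu: "nn x < \<rho>0 \<Longrightarrow> nn y < \<rho>0 \<Longrightarrow> 0 < l \<Longrightarrow> l \<le> 1 \<Longrightarrow> dil l (\<mu> x y) = \<mu> (dil l x) (dil l y)"
  using someI_ex[OF rho0_ex] unfolding \<rho>0_def[symmetric] by blast+

lemma rho0_r1: "nn v < \<rho>0 \<Longrightarrow> norm v < r1" using rho0(2) r2_r1 by blast

lemma small_dil: assumes "0 \<le> B" obtains l where "0 < l" "l \<le> 1" "\<And>v. nn v \<le> B \<Longrightarrow> nn (dil l v) < \<rho>0"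
proof (rule that[of "\<rho>0 / (\<rho>0 + B)"])
  let ?l = "\<rho>0 / (\<rho>0 + B)"
  show l: "0 < ?l" "?l \<le> 1" using rho0(1) assms by (auto simp: divide_le_eq)
  fix v assume v: "nn v \<le> B"
  have "nn (dil ?l v) \<le> ?l * nn v" by (rule nn_dil[OF l])
  also have "\<dots> \<le> ?l * B" using v l by (intro mult_left_mono) auto
  also have "\<dots> < \<rho>0" using rho0(1) assms by (simp add: divide_less_eq algebra_simps)
  finally show "nn (dil ?l v) < \<rho>0" .
qed

text \<open>The local product, transported from a small scale to the whole space; by
  \<open>star_eq\<close> the scale chosen here is immaterial.\<close>

definition star :: "'a \<Rightarrow> 'a \<Rightarrow> 'a" (infixl "\<odot>" 70) where
  "x \<odot> y = (let l = (SOME l. 0 < l \<and> l \<le> 1 \<and> nn (dil l x) < \<rho>0 \<and> nn (dil l y) < \<rho>0)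
     in dil (1 / l) (\<mu> (dil l x) (dil l y)))"

lemma star_eq_aux:
  assumes l: "0 < l" "l \<le> 1" "nn (dil l x) < \<rho>0" "nn (dil l y) < \<rho>0" and m: "0 < m" "m \<le> l"
  shows "dil (1 / m) (\<mu> (dil m x) (dil m y)) = dil (1 / l) (\<mu> (dil l x) (dil l y))"
proof -
  have ml: "0 < m / l" "m / l \<le> 1" using l m by auto
  have d: "dil m z = dil (m / l) (dil l z)" for z using l m by (simp add: dil_dil)
  have "\<mu> (dil m x) (dil m y) = dil (m / l) (\<mu> (dil l x) (dil l y))"
    unfolding d by (rule dil_mu[OF l(3,4) ml, symmetric])
  then show ?thesis using l m by (simp add: dil_dil)
qed

lemma star_eq:
  assumes l: "0 < l" "l \<le> 1" "nn (dil l x) < \<rho>0" "nn (dil l y) < \<rho>0"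
  shows "x \<odot> y = dil (1 / l) (\<mu> (dil l x) (dil l y))"
proof -
  define m where "m = (SOME l. 0 < l \<and> l \<le> 1 \<and> nn (dil l x) < \<rho>0 \<and> nn (dil l y) < \<rho>0)"
  have m: "0 < m \<and> m \<le> 1 \<and> nn (dil m x) < \<rho>0 \<and> nn (dil m y) < \<rho>0"
    unfolding m_def by (rule someI[of _ l]) (use l in auto)
  have "x \<odot> y = dil (1 / m) (\<mu> (dil m x) (dil m y))" by (simp add: star_def m_def Let_def)
  also have "\<dots> = dil (1 / l) (\<mu> (dil l x) (dil l y))"
  proof (cases "m \<le> l")
    case True
    then show ?thesis using m by (intro star_eq_aux l) auto
  next
    case False
    then show ?thesis using m l by (intro star_eq_aux[symmetric]) auto
  qed
  finally show ?thesis .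
qed

lemma dil_star_small:
  "0 < l \<Longrightarrow> l \<le> 1 \<Longrightarrow> nn (dil l x) < \<rho>0 \<Longrightarrow> nn (dil l y) < \<rho>0 \<Longrightarrow> dil l (x \<odot> y) = \<mu> (dil l x) (dil l y)"
  by (simp add: star_eq)

lemma star_mu: "nn x < \<rho>0 \<Longrightarrow> nn y < \<rho>0 \<Longrightarrow> x \<odot> y = \<mu> x y"
  using star_eq[of 1 x y] by simp

lemma e_star_small: "nn x < \<rho>0 \<Longrightarrow> nn y < \<rho>0 \<Longrightarrow> e (x \<odot> y) = e x \<cdot> e y"
  by (simp add: star_mu e_mu rho0_r1)

text \<open>One scale brings the three factors and both intermediate products into the small ball,
  where associativity is that of \<open>\<mu>\<close>.\<close>

lemma star_assoc: "x \<odot> y \<odot> z = x \<odot> (y \<odot> z)"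
proof -
  obtain l where l: "0 < l" "l \<le> 1" "\<And>v. nn v \<le> nn x + nn y + nn z + nn (x \<odot> y) + nn (y \<odot> z) \<Longrightarrow> nn (dil l v) < \<rho>0"
    using small_dil[of "nn x + nn y + nn z + nn (x \<odot> y) + nn (y \<odot> z)"] by auto
  have s: "nn (dil l x) < \<rho>0" "nn (dil l y) < \<rho>0" "nn (dil l z) < \<rho>0" "nn (dil l (x \<odot> y)) < \<rho>0" "nn (dil l (y \<odot> z)) < \<rho>0"
    by (auto intro!: l(3) simp: add_nonneg_nonneg)
  have "dil l (x \<odot> y \<odot> z) = \<mu> (\<mu> (dil l x) (dil l y)) (dil l z)"
    unfolding dil_star_small[OF l(1,2) s(4,3)] dil_star_small[OF l(1,2) s(1,2)] ..
  also have "\<dots> = \<mu> (dil l x) (\<mu> (dil l y) (dil l z))"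
    by (intro mu_assoc rho0(2) s)
  also have "\<dots> = dil l (x \<odot> (y \<odot> z))"
    unfolding dil_star_small[OF l(1,2) s(1,5)] dil_star_small[OF l(1,2) s(2,3)] ..
  finally show ?thesis by (rule dil_inj[OF l(1)])
qed

text \<open>On a line \<open>e\<close> is a homomorphism, so the product there is addition. In
  particular the inverse is the negative and the square root is the half.\<close>

lemma star_add: "(s *\<^sub>R x) \<odot> (t *\<^sub>R x) = (s + t) *\<^sub>R x"
proof -
  let ?B = "nn (s *\<^sub>R x) + nn (t *\<^sub>R x) + nn ((s + t) *\<^sub>R x)"
  obtain l where l: "0 < l" "l \<le> 1" "\<And>v. nn v \<le> ?B \<Longrightarrow> nn (dil l v) < \<rho>0"
    using small_dil[of ?B] by auto
  have sm: "nn (dil l (s *\<^sub>R x)) < \<rho>0" "nn (dil l (t *\<^sub>R x)) < \<rho>0" "nn (dil l ((s + t) *\<^sub>R x)) < \<rho>0"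
    by (auto intro!: l(3))
  have "dil l ((s *\<^sub>R x) \<odot> (t *\<^sub>R x)) = \<mu> (dil l (s *\<^sub>R x)) (dil l (t *\<^sub>R x))"
    by (rule dil_star_small[OF l(1,2) sm(1,2)])
  also have "\<dots> = dil l ((s + t) *\<^sub>R x)"
  proof (rule mu_eqI)
    show "dil l ((s + t) *\<^sub>R x) \<in> W" by (rule r1_W[OF rho0_r1[OF sm(3)]])
    show "e (dil l ((s + t) *\<^sub>R x)) = e (dil l (s *\<^sub>R x)) \<cdot> e (dil l (t *\<^sub>R x))"
      unfolding dil_scaleR[OF l(1)] by (rule e_add)
  qed
  finally show ?thesis by (rule dil_inj[OF l(1)])
qed

lemma star_minus_right [simp]: "x \<odot> - x = 0" using star_add[of 1 x "- 1"] by simp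
lemma star_minus_left [simp]: "- x \<odot> x = 0" using star_add[of "- 1" x 1] by simp

lemma star_0_right [simp]: "x \<odot> 0 = x" using star_add[of 1 x 0] by simp
lemma star_0_left [simp]: "0 \<odot> x = x" using star_add[of 0 x 1] by simp

lemma star_half: "(1 / 2) *\<^sub>R x \<odot> (1 / 2) *\<^sub>R x = x" using star_add[of "1 / 2" x "1 / 2"] by simp

lemma star_double: "x \<odot> x = 2 *\<^sub>R x" using star_add[of 1 x 1] by simp

lemma star_cancel [simp]: "- x \<odot> (x \<odot> y) = y" "x \<odot> (- x \<odot> y) = y"
  by (simp_all flip: star_assoc)

lemma dil_star: assumes m: "0 < m" shows "dil m (x \<odot> y) = dil m x \<odot> dil m y"
proof -
  obtain l' where l': "0 < l'" "l' \<le> 1" "\<And>v. nn v \<le> nn (dil m x) + nn (dil m y) \<Longrightarrow> nn (dil l' v) < \<rho>0"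
    using small_dil[of "nn (dil m x) + nn (dil m y)"] by auto
  \<comment> \<open>The bound \<open>1 / m\<close> ensures \<open>l * m \<le> 1\<close>, because
    \<open>dil_star_small\<close> is also applied to the dilation by \<open>l * m\<close>.\<close>
  define l where "l = min l' (1 / m)"
  have l: "0 < l" "l \<le> 1" using l' m by (auto simp: l_def)
  have "l \<le> 1 / m" by (simp add: l_def)
  then have lm1: "l * m \<le> 1" using m by (simp add: pos_le_divide_eq)
  have sm: "nn (dil l v) < \<rho>0" if "nn v \<le> nn (dil m x) + nn (dil m y)" for v
  proof -
    have "dil l v = dil (l / l') (dil l' v)" using l l' by (simp add: dil_dil)
    moreover have "0 < l / l'" "l / l' \<le> 1" using l l' by (auto simp: l_def)
    ultimately have "nn (dil l v) \<le> nn (dil l' v)" using nn_dil_le by simp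
    then show ?thesis using l'(3)[OF that] by linarith
  qed
  have s: "nn (dil l (dil m x)) < \<rho>0" "nn (dil l (dil m y)) < \<rho>0" by (auto intro!: sm)
  have s': "nn (dil (l * m) x) < \<rho>0" "nn (dil (l * m) y) < \<rho>0" using s l m by (simp_all add: dil_dil)
  have lm: "0 < l * m" using l m by simp
  have "dil l (dil m x \<odot> dil m y) = \<mu> (dil (l * m) x) (dil (l * m) y)"
    unfolding dil_star_small[OF l(1,2) s] using l m by (simp add: dil_dil)
  also have "\<dots> = dil (l * m) (x \<odot> y)"
    by (rule dil_star_small[OF lm lm1 s', symmetric])
  also have "\<dots> = dil l (dil m (x \<odot> y))" using l m by (simp add: dil_dil)
  finally show ?thesis by (rule dil_inj[OF l(1), symmetric])
qed

lemma smooth_star: "smooth_on UNIV (\<lambda>p. fst p \<odot> snd p)"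
proof (rule smooth_on_local)
  fix p :: "'a \<times> 'a"
  define B where "B = nn (fst p) + nn (snd p) + 1"
  obtain l where l: "0 < l" "l \<le> 1" "\<And>v. nn v \<le> B \<Longrightarrow> nn (dil l v) < \<rho>0" using small_dil[of B] by (auto simp: B_def)
  define S where "S = {q :: 'a \<times> 'a. nn (fst q) < B \<and> nn (snd q) < B}"
  have "continuous_on UNIV (\<lambda>q :: 'a \<times> 'a. nn (fst q))" "continuous_on UNIV (\<lambda>q :: 'a \<times> 'a. nn (snd q))"
    by (auto intro!: continuous_on_compose2[OF cont_nn] continuous_intros)
  then have S: "open S" unfolding S_def by (intro open_Collect_conj open_Collect_less) auto
  have sm: "nn (dil l (fst q)) < \<rho>0" "nn (dil l (snd q)) < \<rho>0" if "q \<in> S" for q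
    using that by (auto simp: S_def intro!: l(3))
  have lin: "linear (\<lambda>q :: 'a \<times> 'a. (dil l (fst q), dil l (snd q)))"
    using dil_linear[OF l(1)] by (simp add: linear_iff)
  have "smooth_on S (\<lambda>q. (\<lambda>q. \<mu> (fst q) (snd q)) (dil l (fst q), dil l (snd q)))"
  proof (rule smooth_on_compose[OF S _ _ smooth_on_linear[OF lin] smooth_mu_ball])
    show "(\<lambda>q. (dil l (fst q), dil l (snd q))) ` S \<subseteq> ball 0 r1 \<times> ball 0 r1"
      using sm rho0_r1 by (auto simp: image_subset_iff)
  qed (auto intro!: open_Times)
  from smooth_on_linear_compose[OF S dil_linear this, of "1 / l"]
  have "smooth_on S (\<lambda>q. dil (1 / l) (\<mu> (dil l (fst q)) (dil l (snd q))))" using l(1) by simp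
  then have "smooth_on S (\<lambda>p. fst p \<odot> snd p)"
    by (rule smooth_on_cong[OF S, rotated]) (rule star_eq[OF l(1,2) sm, symmetric])
  moreover have "p \<in> S" by (simp add: S_def B_def add_nonneg_pos add_pos_nonneg)
  ultimately show "\<exists>S. open S \<and> p \<in> S \<and> smooth_on S (\<lambda>p. fst p \<odot> snd p)" using S by blast
qed

lemma continuous_star: "continuous_on UNIV (\<lambda>p. fst p \<odot> snd p)"
  by (rule smooth_on_continuous[OF smooth_star])

lemma continuous_on_star [continuous_intros]:
  "continuous_on A f \<Longrightarrow> continuous_on A g \<Longrightarrow> continuous_on A (\<lambda>x. f x \<odot> g x)"
  using continuous_on_compose2[OF continuous_star, of A "\<lambda>x. (f x, g x)"] by (simp add: continuous_on_Pair)

lemma continuous_on_UNIV_filterlim: fixes f :: "'x::t2_space \<Rightarrow> 'y::t2_space" assumes "continuous_on UNIV f" shows "filterlim f (nhds (f x)) (nhds x)"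
proof -
  have "isCont f x" using assms by (simp add: continuous_on_eq_continuous_at)
  then show ?thesis unfolding isCont_def tendsto_at_iff_tendsto_nhds .
qed

lemma continuous_on_UNIV_isCont: "continuous_on UNIV f \<Longrightarrow> isCont f x" by (simp add: continuous_on_eq_continuous_at)

text \<open>Passing from \<open>c\<close> to its double needs the conjugation identity as well as the translation
  identity, so both are carried along the induction.\<close>

lemma e_left_near: "\<forall>\<^sub>F w in nhds 0. e (w \<odot> c) = e w \<cdot> e c"
proof -
  define C where "C c \<longleftrightarrow> (\<forall>\<^sub>F v in nhds 0. e (c \<odot> v \<odot> - c) = e c \<cdot> e v \<cdot> e (- c))" for c
  define Q where "Q c \<longleftrightarrow> (\<forall>\<^sub>F w in nhds 0. e (w \<odot> c) = e w \<cdot> e c)" for c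
  have ev0: "\<forall>\<^sub>F v in nhds 0. nn (f v) < \<rho>0" if "continuous_on UNIV f" "nn (f 0) < \<rho>0" for f :: "'a \<Rightarrow> 'a"
    using eventually_nn_less[OF continuous_on_UNIV_isCont[OF that(1)] that(2)] .
  have base: "C c \<and> Q c" if c: "nn c < \<rho>0" for c
  proof
    have "\<forall>\<^sub>F v in nhds 0. nn (c \<odot> v) < \<rho>0" by (rule ev0) (auto intro!: continuous_intros c)
    moreover have ev: "\<forall>\<^sub>F v in nhds 0. nn v < \<rho>0" by (rule ev0) (auto intro!: continuous_intros rho0)
    ultimately show "C c" unfolding C_def
    proof eventually_elim
      case (elim v)
      have "nn (- c) < \<rho>0" using c by simp
      show ?case unfolding e_star_small[OF elim(1) \<open>nn (- c) < \<rho>0\<close>] e_star_small[OF c elim(2)] ..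
    qed
    show "Q c" unfolding Q_def using ev by eventually_elim (rule e_star_small[OF _ c])
  qed
  have step: "C (2 *\<^sub>R c) \<and> Q (2 *\<^sub>R c)" if c: "C c" "Q c" for c
  proof
    define k where "k v = c \<odot> v \<odot> - c" for v
    have kc: "continuous_on UNIV k" unfolding k_def by (intro continuous_intros)
    have k0: "k 0 = 0" by (simp add: k_def)
    have ek: "\<forall>\<^sub>F v in nhds 0. e (k v) = e c \<cdot> e v \<cdot> e (- c)" using c(1) unfolding C_def k_def .
    have "filterlim k (nhds 0) (nhds 0)" using continuous_on_UNIV_filterlim[OF kc, of 0] k0 by simp
    from eventually_compose_filterlim[OF ek this]
    have "\<forall>\<^sub>F v in nhds 0. e (k (k v)) = e c \<cdot> e (k v) \<cdot> e (- c)" .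
    then show "C (2 *\<^sub>R c)" unfolding C_def using ek
    proof eventually_elim
      case (elim v)
      have "2 *\<^sub>R c \<odot> v \<odot> - (2 *\<^sub>R c) = k (k v)"
      proof -
        have "- (2 *\<^sub>R c) = - c \<odot> - c" using star_double[of "- c"] by simp
        then show ?thesis by (simp add: k_def star_assoc flip: star_double)
      qed
      moreover have "e (2 *\<^sub>R c) = e c \<cdot> e c" using e_add[of 1 1 c] by simp
      moreover have "e (- (2 *\<^sub>R c)) = e (- c) \<cdot> e (- c)" using e_add[of 1 1 "- c"] by simp
      ultimately show ?case using elim by (simp add: mul_assoc)
    qed
    \<comment> \<open>\<open>h w\<close> is the square root of \<open>w \<odot> 2 c\<close>, and
      \<open>v w\<close> its deviation from \<open>c\<close>. From
      \<open>h w = v w \<odot> c\<close> follows \<open>w = v w \<odot> k (v w)\<close>, a product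
      of two small factors, for which \<open>e\<close> is already multiplicative.\<close>
    define h where "h w = (1 / 2) *\<^sub>R (w \<odot> 2 *\<^sub>R c)" for w
    define v where "v w = h w \<odot> - c" for w
    have vc: "continuous_on UNIV v" unfolding v_def h_def by (intro continuous_intros)
    have v0: "v 0 = 0" by (simp add: v_def h_def)
    have vl: "filterlim v (nhds 0) (nhds 0)" using continuous_on_UNIV_filterlim[OF vc, of 0] v0 by simp
    have "\<forall>\<^sub>F w in nhds 0. nn w < \<rho>0" by (rule ev0) (auto intro!: continuous_intros rho0)
    from eventually_compose_filterlim[OF this vl] have 1: "\<forall>\<^sub>F w in nhds 0. nn (v w) < \<rho>0" .
    have "\<forall>\<^sub>F w in nhds 0. nn (k w) < \<rho>0" by (rule ev0[OF kc]) (simp add: k0 rho0)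
    from eventually_compose_filterlim[OF this vl] have 2: "\<forall>\<^sub>F w in nhds 0. nn (k (v w)) < \<rho>0" .
    from eventually_compose_filterlim[OF ek vl] have 3: "\<forall>\<^sub>F w in nhds 0. e (k (v w)) = e c \<cdot> e (v w) \<cdot> e (- c)" .
    from eventually_compose_filterlim[OF c(2)[unfolded Q_def] vl] have 4: "\<forall>\<^sub>F w in nhds 0. e (v w \<odot> c) = e (v w) \<cdot> e c" .
    show "Q (2 *\<^sub>R c)" unfolding Q_def using 1 2 3 4
    proof eventually_elim
      case (elim w)
      have hv: "h w = v w \<odot> c" by (simp add: v_def star_assoc)
      have z: "w \<odot> 2 *\<^sub>R c = h w \<odot> h w" unfolding h_def by (simp add: star_half)
      have w: "w = v w \<odot> k (v w)"
      proof -
        have "w = (w \<odot> 2 *\<^sub>R c) \<odot> - (2 *\<^sub>R c)" by (simp add: star_assoc)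
        also have "\<dots> = v w \<odot> c \<odot> (v w \<odot> c) \<odot> (- c \<odot> - c)"
          using star_double[of "- c"] by (simp add: z hv)
        also have "\<dots> = v w \<odot> k (v w)" by (simp add: k_def star_assoc)
        finally show ?thesis .
      qed
      have "e (w \<odot> 2 *\<^sub>R c) = e (h w) \<cdot> e (h w)"
        using e_add[of "1 / 2" "1 / 2" "w \<odot> 2 *\<^sub>R c"] by (simp add: h_def)
      also have "\<dots> = e (v w) \<cdot> e c \<cdot> (e (v w) \<cdot> e c)" unfolding hv elim(4) ..
      also have "\<dots> = e (v w) \<cdot> (e c \<cdot> e (v w) \<cdot> e (- c)) \<cdot> (e c \<cdot> e c)"
      proof -
        have "e (- c) \<cdot> (e c \<cdot> g) = g" for g by (simp flip: mul_assoc)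
        then show ?thesis by (simp add: mul_assoc)
      qed
      also have "\<dots> = e (v w) \<cdot> e (k (v w)) \<cdot> e (2 *\<^sub>R c)"
        unfolding elim(3) using e_add[of 1 1 c] by simp
      also have "e (v w) \<cdot> e (k (v w)) = e (v w \<odot> k (v w))" by (rule e_star_small[OF elim(1,2), symmetric])
      finally show ?case using w by simp
    qed
  qed
  have all: "C c \<and> Q c" for c
  proof -
    have "(\<lambda>n. nn c * (1 / 2) ^ n) \<longlonglongrightarrow> nn c * 0" by (intro tendsto_intros LIMSEQ_power_zero) auto
    then have "\<forall>\<^sub>F n in sequentially. nn c * (1 / 2) ^ n < \<rho>0" using rho0(1) by (intro order_tendstoD) auto
    then obtain n where n: "nn c * (1 / 2) ^ n < \<rho>0" by (auto simp: eventually_sequentially)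
    define c' where "c' = ((1 / 2) ^ n) *\<^sub>R c"
    have "nn c' < \<rho>0" using n by (simp add: c'_def nn_scaleR mult.commute)
    then have "C ((2 ^ m) *\<^sub>R c') \<and> Q ((2 ^ m) *\<^sub>R c')" for m
    proof (induction m)
      case 0
      then show ?case using base by simp
    next
      case (Suc m)
      then show ?case using step[of "(2 ^ m) *\<^sub>R c'"] by (simp add: mult.commute)
    qed
    from this[of n] show ?thesis by (simp add: c'_def power_one_over)
  qed
  show "\<forall>\<^sub>F w in nhds 0. e (w \<odot> c) = e w \<cdot> e c" using all unfolding Q_def by blast
qed

text \<open>\<open>e (- t x) e (t x \<odot> y)\<close> is locally constant in \<open>t\<close> by
  \<open>e_left_near\<close>, hence has equal values at 0 and 1.\<close>

theorem e_star: "e (x \<odot> y) = e x \<cdot> e y"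
proof -
  define f where "f t = e (- (t *\<^sub>R x)) \<cdot> e (t *\<^sub>R x \<odot> y)" for t :: real
  have "f 0 = f 1"
  proof (rule connected_local_const[where A = "UNIV :: real set"])
    show "connected (UNIV :: real set)" by (rule connected_UNIV)
    show "\<forall>t\<in>UNIV. \<forall>\<^sub>F s in at t. f t = f s"
    proof
      fix t :: real
      have "filterlim (\<lambda>s. (s - t) *\<^sub>R x) (nhds ((t - t) *\<^sub>R x)) (nhds t)"
        by (rule continuous_on_UNIV_filterlim) (intro continuous_intros)
      then have fl: "filterlim (\<lambda>s. (s - t) *\<^sub>R x) (nhds 0) (nhds t)" by simp
      have "\<forall>\<^sub>F s in nhds t. e ((s - t) *\<^sub>R x \<odot> (t *\<^sub>R x \<odot> y)) = e ((s - t) *\<^sub>R x) \<cdot> e (t *\<^sub>R x \<odot> y)"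
        by (rule eventually_compose_filterlim[OF e_left_near fl])
      then have "\<forall>\<^sub>F s in nhds t. f t = f s"
      proof eventually_elim
        case (elim s)
        have 1: "s *\<^sub>R x \<odot> y = (s - t) *\<^sub>R x \<odot> (t *\<^sub>R x \<odot> y)"
          using star_add[of "s - t" x t] by (simp flip: star_assoc)
        have "e (- (s *\<^sub>R x)) \<cdot> e ((s - t) *\<^sub>R x) = e (- (t *\<^sub>R x))"
          using e_add[of "- s" "s - t" x] by simp
        then show ?case unfolding f_def 1 elim by (simp flip: mul_assoc)
      qed
      then show "\<forall>\<^sub>F s in at t. f t = f s" by (simp add: eventually_nhds_conv_at)
    qed
  qed auto
  then have "e y = e (- x) \<cdot> e (x \<odot> y)" by (simp add: f_def)
  then have "e x \<cdot> e y = (e x \<cdot> e (- x)) \<cdot> e (x \<odot> y)" by (simp only: mul_assoc)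
  then show ?thesis by simp
qed

text \<open>By \<open>e_star\<close> the range is a subgroup, and it contains a neighbourhood of the
  identity. Its cosets are therefore open, so it is closed as well.\<close>

lemma e_surj: assumes conn: "connected (UNIV :: 'g set)" shows "surj e"
proof -
  define H where "H = range e"
  have op: "open ((\<lambda>g. h \<cdot> g) ` H)" for h
  proof (subst open_subopen, rule ballI)
    fix g assume "g \<in> (\<lambda>g. h \<cdot> g) ` H"
    then obtain x where x: "g = h \<cdot> e x" by (auto simp: H_def)
    have "continuous_on UNIV (\<lambda>k. iv g \<cdot> k)" by (intro continuous_intros)
    then have "open ((\<lambda>k. iv g \<cdot> k) -` (e ` W))" using open_eW by (simp add: open_vimage)
    moreover have "g \<in> (\<lambda>k. iv g \<cdot> k) -` (e ` W)" using W(2) by (auto intro!: image_eqI[of _ _ 0])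
    moreover have "(\<lambda>k. iv g \<cdot> k) -` (e ` W) \<subseteq> (\<lambda>g. h \<cdot> g) ` H"
    proof
      fix k assume "k \<in> (\<lambda>k. iv g \<cdot> k) -` (e ` W)"
      then obtain w where "iv g \<cdot> k = e w" by auto
      then have "k = g \<cdot> e w" by (metis iv_cancel(2))
      then have "k = h \<cdot> e (x \<odot> w)" by (simp add: x e_star mul_assoc)
      then show "k \<in> (\<lambda>g. h \<cdot> g) ` H" by (auto simp: H_def)
    qed
    ultimately show "\<exists>T. open T \<and> g \<in> T \<and> T \<subseteq> (\<lambda>g. h \<cdot> g) ` H" by blast
  qed
  have "open H" using op[of un] by simp
  moreover have "open (- H)"
  proof -
    have "- H = (\<Union>h\<in>- H. (\<lambda>g. h \<cdot> g) ` H)"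
    proof (intro equalityI subsetI)
      fix g assume "g \<in> - H"
      moreover have "g = g \<cdot> e 0" by simp
      ultimately show "g \<in> (\<Union>h\<in>- H. (\<lambda>g. h \<cdot> g) ` H)" unfolding H_def by blast
    next
      fix g assume "g \<in> (\<Union>h\<in>- H. (\<lambda>g. h \<cdot> g) ` H)"
      then obtain h x where hx: "h \<notin> H" "g = h \<cdot> e x" by (auto simp: H_def)
      show "g \<in> - H"
      proof
        assume "g \<in> H"
        then obtain y where "g = e y" by (auto simp: H_def)
        then have "h \<cdot> e x \<cdot> e (- x) = e y \<cdot> e (- x)" using hx(2) by simp
        then have "h = e (y \<odot> - x)" by (simp add: e_star mul_assoc)
        then show False using hx(1) by (simp add: H_def)
      qed
    qed
    then show ?thesis using op by (metis open_UN)
  qed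
  ultimately have "H = {} \<or> H = UNIV"
    using conn connected_clopen[of "UNIV :: 'g set"] by (auto simp: closed_def)
  then show ?thesis by (auto simp: H_def)
qed

text \<open>A loop \<open>t \<mapsto> e (t z)\<close> is contracted by a homotopy; the \<open>\<odot>\<close>-product of the logarithms of
  its small increments varies locally constantly along the homotopy, from \<open>z\<close> to \<open>0\<close>.\<close>

lemma e_inj_global: assumes sc: "simply_connected (UNIV :: 'g set)" shows "inj e"
proof -
  have ker: "z = 0" if z: "e z = un" for z
  proof -
    have pt: "path (\<lambda>t. e (t *\<^sub>R z))" unfolding path_def by (intro continuous_intros)
    have pu: "path (\<lambda>t. un)" unfolding path_def by (intro continuous_intros)
    have "homotopic_loops UNIV (\<lambda>t. e (t *\<^sub>R z)) (\<lambda>t. un)"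
      using sc pt pu unfolding simply_connected_def by (simp add: pathfinish_def pathstart_def z)
    then obtain h :: "real \<times> real \<Rightarrow> 'g" where hc: "continuous_on ({0..1} \<times> {0..1}) h"
      and h0: "\<And>t. t \<in> {0..1} \<Longrightarrow> h (0, t) = e (t *\<^sub>R z)" and h1: "\<And>t. t \<in> {0..1} \<Longrightarrow> h (1, t) = un"
      and hl: "\<And>s. s \<in> {0..1} \<Longrightarrow> h (s, 1) = h (s, 0)"
      unfolding homotopic_loops by (auto simp: pathfinish_def pathstart_def)
    define F where "F q = iv (h (fst q, fst (snd q))) \<cdot> h (fst q, snd (snd q))" for q
    define K :: "(real \<times> real \<times> real) set" where "K = {0..1} \<times> ({0..1} \<times> {0..1})"
    have K: "compact K" unfolding K_def by (intro compact_Times) auto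
    have Fc: "continuous_on K F"
      unfolding F_def K_def
      by (intro continuous_intros continuous_on_compose2[OF hc]) auto
    \<comment> \<open>Parameters and pairs of times whose increment leaves the domain of
      \<open>L\<close>. The set is compact and misses the diagonal of the two times, which yields a
      positive gap \<open>\<delta>\<close>, a Lebesgue number for the partition.\<close>
    define C where "C = K \<inter> F -` (- (e ` W))"
    have Cc: "compact C"
    proof -
      have "closed C" unfolding C_def
        using continuous_closed_preimage[OF Fc compact_imp_closed[OF K], of "- (e ` W)"] open_eW by (simp add: closed_def)
      then show ?thesis using K compact_Int_closed[OF K, of C] by (simp add: C_def Int_absorb1 inf_assoc[symmetric])
    qed
    have Cne: "fst (snd q) \<noteq> snd (snd q)" if "q \<in> C" for q
    proof
      assume "fst (snd q) = snd (snd q)"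
      then have "F q = e 0" by (simp add: F_def)
      then have "F q \<in> e ` W" using W(2) by blast
      then show False using that by (simp add: C_def)
    qed
    have "\<exists>\<delta>>0. \<forall>q\<in>C. \<delta> \<le> \<bar>fst (snd q) - snd (snd q)\<bar>"
    proof (cases "C = {}")
      case False
      have "continuous_on C (\<lambda>q. \<bar>fst (snd q) - snd (snd q)\<bar>)" by (intro continuous_intros)
      from continuous_attains_inf[OF Cc False this] obtain q where q: "q \<in> C"
        "\<forall>y\<in>C. \<bar>fst (snd q) - snd (snd q)\<bar> \<le> \<bar>fst (snd y) - snd (snd y)\<bar>" by blast
      then show ?thesis using Cne[OF q(1)] by (intro exI[of _ "\<bar>fst (snd q) - snd (snd q)\<bar>"]) auto
    qed (auto intro: exI[of _ 1])
    then obtain \<delta> where \<delta>: "0 < \<delta>" "\<And>q. q \<in> C \<Longrightarrow> \<delta> \<le> \<bar>fst (snd q) - snd (snd q)\<bar>" by blast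
    \<comment> \<open>The partition has to be finer than \<open>\<delta>\<close>, and the increments
      of the original loop, with logarithm candidates \<open>z / n\<close>, must fall into
      \<open>W\<close> for \<open>L\<close> to return exactly \<open>z / n\<close>.\<close>
    have "(\<lambda>n. (1 / real (Suc n)) *\<^sub>R z) \<longlonglongrightarrow> 0 *\<^sub>R z"
      using LIMSEQ_inverse_real_of_nat by (intro tendsto_scaleR tendsto_const) (simp add: inverse_eq_divide)
    then have "\<forall>\<^sub>F n in sequentially. (1 / real (Suc n)) *\<^sub>R z \<in> W"
      using W topological_tendstoD by (metis scaleR_zero_left)
    moreover have "\<forall>\<^sub>F n in sequentially. inverse (real (Suc n)) < \<delta>"
      using LIMSEQ_inverse_real_of_nat \<delta>(1) by (rule order_tendstoD)
    ultimately have "\<forall>\<^sub>F n in sequentially. (1 / real (Suc n)) *\<^sub>R z \<in> W \<and> inverse (real (Suc n)) < \<delta>"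
      by eventually_elim simp
    then obtain n' where n': "(1 / real (Suc n')) *\<^sub>R z \<in> W" "inverse (real (Suc n')) < \<delta>"
      by (auto simp: eventually_sequentially)
    define n where "n = Suc n'"
    have n: "0 < n" "(1 / real n) *\<^sub>R z \<in> W" "1 / real n < \<delta>" using n' by (auto simp: n_def inverse_eq_divide)
    define t where "t i = real i / real n" for i
    have t01: "t i \<in> {0..1}" if "i \<le> n" for i using that n by (simp add: t_def divide_le_eq)
    have FW: "F (s, t i, t (Suc i)) \<in> e ` W" if "s \<in> {0..1}" "Suc i \<le> n" for s i
    proof (rule ccontr)
      assume "F (s, t i, t (Suc i)) \<notin> e ` W"
      then have "(s, t i, t (Suc i)) \<in> C" using that t01[of i] t01[of "Suc i"] by (auto simp: C_def K_def)
      from \<delta>(2)[OF this] have "\<delta> \<le> 1 / real n" by (simp add: t_def diff_divide_distrib[symmetric])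
      then show False using n by simp
    qed
    \<comment> \<open>In effect a lift through \<open>e\<close> of the loop with parameter
      \<open>s\<close>, translated to start at the identity and sampled at the times
      \<open>t m\<close>.\<close>
    define w where "w m s = rec_nat (0::'a) (\<lambda>i x. x \<odot> L (F (s, t i, t (Suc i)))) m" for m s
    have w0: "w 0 s = 0" and wS: "w (Suc m) s = w m s \<odot> L (F (s, t m, t (Suc m)))" for m s
      by (simp_all add: w_def)
    have we: "e (w m s) = iv (h (s, 0)) \<cdot> h (s, t m)" if "m \<le> n" "s \<in> {0..1}" for m s
      using that
    proof (induction m)
      case 0
      then show ?case by (simp add: w0 t_def)
    next
      case (Suc m)
      have "e (L (F (s, t m, t (Suc m)))) = F (s, t m, t (Suc m))" using FW Suc.prems by (intro e_L) auto
      then show ?case using Suc by (simp add: wS e_star F_def mul_assoc)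
    qed
    have wc: "continuous_on {0..1} (w m)" if "m \<le> n" for m
      using that
    proof (induction m)
      case 0
      have "w 0 = (\<lambda>s. 0)" by (rule ext) (simp add: w0)
      then show ?case by simp
    next
      case (Suc m)
      have "continuous_on {0..1} (\<lambda>s. F (s, t m, t (Suc m)))"
        using t01[of m] t01[of "Suc m"] Suc.prems
        by (intro continuous_on_compose2[OF Fc] continuous_intros) (auto simp: K_def)
      then have "continuous_on {0..1} (\<lambda>s. L (F (s, t m, t (Suc m))))"
        using FW Suc.prems by (intro continuous_on_compose2[OF cont_L]) auto
      then have "continuous_on {0..1} (\<lambda>s. w m s \<odot> L (F (s, t m, t (Suc m))))"
        using Suc by (intro continuous_intros) auto
      moreover have "w (Suc m) = (\<lambda>s. w m s \<odot> L (F (s, t m, t (Suc m))))" by (rule ext) (rule wS)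
      ultimately show ?case by simp
    qed
    have tn: "t n = 1" using n by (simp add: t_def)
    have wun: "e (w n s) = un" if "s \<in> {0..1}" for s
      using we[of n s] that hl[OF that] by (simp add: tn)
    \<comment> \<open>The endpoint of the lift stays in the kernel of \<open>e\<close>, where 0 is
      isolated because \<open>e\<close> is injective on \<open>W\<close>; so it cannot move along
      the homotopy.\<close>
    have "w n 0 = w n 1"
    proof (rule connected_local_const[of "{0..1::real}"])
      show "\<forall>s\<in>{0..1}. \<forall>\<^sub>F r in at s within {0..1}. w n s = w n r"
      proof
        fix s :: real assume s: "s \<in> {0..1}"
        have "continuous_on {0..1} (\<lambda>r. - w n s \<odot> w n r)" using wc[of n] by (intro continuous_intros) auto
        then have "((\<lambda>r. - w n s \<odot> w n r) \<longlongrightarrow> - w n s \<odot> w n s) (at s within {0..1})"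
          unfolding continuous_on_def using s by (rule bspec)
        then have "((\<lambda>r. - w n s \<odot> w n r) \<longlongrightarrow> 0) (at s within {0..1})" by simp
        then have "\<forall>\<^sub>F r in at s within {0..1}. - w n s \<odot> w n r \<in> W" using W by (rule topological_tendstoD)
        moreover have "\<forall>\<^sub>F r in at s within {0..1}. r \<in> {0..1}" by (simp add: eventually_at_filter)
        ultimately show "\<forall>\<^sub>F r in at s within {0..1}. w n s = w n r"
        proof eventually_elim
          case (elim r)
          have "e (- w n s \<odot> w n r) = e 0" using wun[OF s] wun[OF elim(2)] by (simp add: e_star e_minus iv_eqI)
          then have "- w n s \<odot> w n r = 0" using elim(1) W(2) e_inj by blast
          then have "w n s \<odot> (- w n s \<odot> w n r) = w n s" by simp
          then show ?case by simp
        qed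
      qed
    qed auto
    moreover have "w m 1 = 0" if "m \<le> n" for m
      using that
    proof (induction m)
      case (Suc m)
      have "F (1, t m, t (Suc m)) = e 0" using h1 t01[of m] t01[of "Suc m"] Suc.prems by (simp add: F_def iv_eqI)
      then show ?case using Suc L_e[OF W(2)] by (simp add: wS)
    qed (simp add: w0)
    moreover have "w m 0 = t m *\<^sub>R z" if "m \<le> n" for m
      using that
    proof (induction m)
      case (Suc m)
      have "F (0, t m, t (Suc m)) = e (- (t m *\<^sub>R z)) \<cdot> e (t (Suc m) *\<^sub>R z)"
        using h0 t01[of m] t01[of "Suc m"] Suc.prems by (simp add: F_def e_minus)
      also have "\<dots> = e ((- t m + t (Suc m)) *\<^sub>R z)" by (simp only: e_add scaleR_minus_left)
      also have "- t m + t (Suc m) = 1 / real n" by (simp add: t_def diff_divide_distrib[symmetric] add_divide_distrib)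
      finally have "L (F (0, t m, t (Suc m))) = (1 / real n) *\<^sub>R z" using L_e[OF n(2)] by simp
      then show ?case using Suc star_add[of "t m" z "1 / real n"] by (simp add: wS t_def add_divide_distrib add.commute)
    qed (simp add: w0 t_def)
    ultimately show "z = 0" using tn by simp
  qed
  show ?thesis
  proof (rule injI)
    fix x y assume "e x = e y"
    then have "e (- x \<odot> y) = un" by (simp add: e_star e_minus)
    then have "- x \<odot> y = 0" by (rule ker)
    then have "x \<odot> (- x \<odot> y) = x" by simp
    then show "x = y" by simp
  qed
qed

end

section \<open>Invariance of Lebesgue measure\<close>

lemma nn_integral_lborel_shift:
  fixes f :: "'a::euclidean_space \<Rightarrow> ennreal"
  assumes [measurable]: "f \<in> borel_measurable borel"
  shows "(\<integral>\<^sup>+y. f (y + c) \<partial>lborel) = (\<integral>\<^sup>+y. f y \<partial>lborel)"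
proof -
  have "(\<integral>\<^sup>+y. f y \<partial>lborel) = (\<integral>\<^sup>+y. f y \<partial>distr lborel borel ((+) c))" by (simp only: lborel_distr_plus)
  also have "\<dots> = (\<integral>\<^sup>+y. f (c + y) \<partial>lborel)" by (rule nn_integral_distr) auto
  finally show ?thesis by (simp add: add.commute)
qed

lemma nn_integral_unit_interval: "(\<integral>\<^sup>+t. indicator {0..1::real} (t + c) \<partial>lborel) = 1"
  using nn_integral_lborel_shift[of "indicator {0..1::real}" c] by simp

text \<open>Fubini with the extra variable \<open>t\<close>, running along the lines parallel to \<open>v\<close>, reduces
  the invariance to translations.\<close>

lemma nn_integral_shear:
  fixes g :: "'a::euclidean_space \<Rightarrow> ennreal" and f :: "'a \<Rightarrow> real"
  assumes [measurable]: "g \<in> borel_measurable borel" "f \<in> borel_measurable borel"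
    and f: "\<And>y t. f (y + t *\<^sub>R v) = f y"
  shows "(\<integral>\<^sup>+y. g (y + f y *\<^sub>R v) \<partial>lborel) = (\<integral>\<^sup>+y. g y \<partial>lborel)"
proof -
  let ?I = "indicator {0..1::real} :: real \<Rightarrow> ennreal"
  have "(\<integral>\<^sup>+y. g (y + f y *\<^sub>R v) \<partial>lborel) = (\<integral>\<^sup>+t. ?I (t + 0) \<partial>lborel) * (\<integral>\<^sup>+y. g (y + f y *\<^sub>R v) \<partial>lborel)"
    by (simp only: nn_integral_unit_interval) simp
  also have "\<dots> = (\<integral>\<^sup>+t. ?I t * (\<integral>\<^sup>+y. g (y + f y *\<^sub>R v) \<partial>lborel) \<partial>lborel)"
    by (simp add: nn_integral_multc)
  also have "\<dots> = (\<integral>\<^sup>+t. \<integral>\<^sup>+y. ?I t * g (y + t *\<^sub>R v + f y *\<^sub>R v) \<partial>lborel \<partial>lborel)"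
  proof (rule nn_integral_cong)
    fix t :: real
    have "(\<integral>\<^sup>+y. g (y + f y *\<^sub>R v) \<partial>lborel) = (\<integral>\<^sup>+y. (\<lambda>y. g (y + f y *\<^sub>R v)) (y + t *\<^sub>R v) \<partial>lborel)"
      by (rule nn_integral_lborel_shift[symmetric]) measurable
    then show "?I t * (\<integral>\<^sup>+y. g (y + f y *\<^sub>R v) \<partial>lborel) = (\<integral>\<^sup>+y. ?I t * g (y + t *\<^sub>R v + f y *\<^sub>R v) \<partial>lborel)"
      by (simp add: f nn_integral_cmult)
  qed
  also have "\<dots> = (\<integral>\<^sup>+y. \<integral>\<^sup>+t. ?I t * g (y + t *\<^sub>R v + f y *\<^sub>R v) \<partial>lborel \<partial>lborel)"
    by (rule lborel_pair.Fubini') measurable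
  also have "\<dots> = (\<integral>\<^sup>+y. \<integral>\<^sup>+t. ?I (t - f y) * g (y + t *\<^sub>R v) \<partial>lborel \<partial>lborel)"
  proof (rule nn_integral_cong)
    fix y :: 'a
    have "(\<integral>\<^sup>+t. ?I (t - f y) * g (y + t *\<^sub>R v) \<partial>lborel) = (\<integral>\<^sup>+t. (\<lambda>t. ?I (t - f y) * g (y + t *\<^sub>R v)) (t + f y) \<partial>lborel)"
      by (rule nn_integral_lborel_shift[symmetric]) measurable
    then show "(\<integral>\<^sup>+t. ?I t * g (y + t *\<^sub>R v + f y *\<^sub>R v) \<partial>lborel) = (\<integral>\<^sup>+t. ?I (t - f y) * g (y + t *\<^sub>R v) \<partial>lborel)"
      by (simp add: scaleR_add_left add.assoc)
  qed
  also have "\<dots> = (\<integral>\<^sup>+t. \<integral>\<^sup>+y. ?I (t - f y) * g (y + t *\<^sub>R v) \<partial>lborel \<partial>lborel)"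
    by (rule lborel_pair.Fubini') measurable
  also have "\<dots> = (\<integral>\<^sup>+t. \<integral>\<^sup>+y. ?I (t - f y) * g y \<partial>lborel \<partial>lborel)"
  proof (rule nn_integral_cong)
    fix t :: real
    have "(\<integral>\<^sup>+y. ?I (t - f y) * g y \<partial>lborel) = (\<integral>\<^sup>+y. (\<lambda>y. ?I (t - f y) * g y) (y + t *\<^sub>R v) \<partial>lborel)"
      by (rule nn_integral_lborel_shift[symmetric]) measurable
    then show "(\<integral>\<^sup>+y. ?I (t - f y) * g (y + t *\<^sub>R v) \<partial>lborel) = (\<integral>\<^sup>+y. ?I (t - f y) * g y \<partial>lborel)"
      by (simp add: f)
  qed
  also have "\<dots> = (\<integral>\<^sup>+y. \<integral>\<^sup>+t. ?I (t - f y) * g y \<partial>lborel \<partial>lborel)"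
    by (rule lborel_pair.Fubini') measurable
  also have "\<dots> = (\<integral>\<^sup>+y. (\<integral>\<^sup>+t. ?I (t + (- f y)) \<partial>lborel) * g y \<partial>lborel)"
    by (simp add: nn_integral_multc)
  finally show ?thesis by (simp only: nn_integral_unit_interval) simp
qed

text \<open>\<open>c\<close> is a coordinate along \<open>v\<close>, and the map stretches it by
  \<open>r\<close>. An extra variable reduces the claim to an affine substitution on lines; the
  integral that remains does not depend on \<open>r\<close>, and the case \<open>r = 1\<close>
  identifies it as the integral of \<open>g\<close>.\<close>

lemma nn_integral_stretch:
  fixes g :: "'a::euclidean_space \<Rightarrow> ennreal" and c :: "'a \<Rightarrow> real"
  assumes [measurable]: "g \<in> borel_measurable borel" "c \<in> borel_measurable borel"
    and c: "\<And>y t. c (y + t *\<^sub>R v) = c y + t" and r: "0 < r"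
  shows "(\<integral>\<^sup>+y. g (y + ((r - 1) * c y) *\<^sub>R v) \<partial>lborel) = ennreal (1 / r) * (\<integral>\<^sup>+y. g y \<partial>lborel)"
proof -
  let ?I = "indicator {0..1::real} :: real \<Rightarrow> ennreal"
  have *: "(\<integral>\<^sup>+y. g (y + ((r - 1) * c y) *\<^sub>R v) \<partial>lborel)
    = ennreal (1 / r) * (\<integral>\<^sup>+y. ?I (- c y) * (\<integral>\<^sup>+t. g (y + t *\<^sub>R v) \<partial>lborel) \<partial>lborel)" if r: "0 < r" for r
  proof -
    have "(\<integral>\<^sup>+y. g (y + ((r - 1) * c y) *\<^sub>R v) \<partial>lborel) = (\<integral>\<^sup>+y. (\<integral>\<^sup>+t. ?I (t + (- c y)) \<partial>lborel) * g (y + ((r - 1) * c y) *\<^sub>R v) \<partial>lborel)"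
      by (simp only: nn_integral_unit_interval) simp
    also have "\<dots> = (\<integral>\<^sup>+y. \<integral>\<^sup>+t. ?I (t - c y) * g (y + ((r - 1) * c y) *\<^sub>R v) \<partial>lborel \<partial>lborel)"
      by (simp add: nn_integral_multc)
    also have "\<dots> = (\<integral>\<^sup>+t. \<integral>\<^sup>+y. ?I (t - c y) * g (y + ((r - 1) * c y) *\<^sub>R v) \<partial>lborel \<partial>lborel)"
      by (rule lborel_pair.Fubini') measurable
    also have "\<dots> = (\<integral>\<^sup>+t. \<integral>\<^sup>+y. ?I (- c y) * g (y + ((r - 1) * c y) *\<^sub>R v + (r * t) *\<^sub>R v) \<partial>lborel \<partial>lborel)"
    proof (rule nn_integral_cong)
      fix t :: real
      have "(\<integral>\<^sup>+y. ?I (t - c y) * g (y + ((r - 1) * c y) *\<^sub>R v) \<partial>lborel)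
        = (\<integral>\<^sup>+y. (\<lambda>y. ?I (t - c y) * g (y + ((r - 1) * c y) *\<^sub>R v)) (y + t *\<^sub>R v) \<partial>lborel)"
        by (rule nn_integral_lborel_shift[symmetric]) measurable
      moreover have "y + t *\<^sub>R v + ((r - 1) * (c y + t)) *\<^sub>R v = y + ((r - 1) * c y) *\<^sub>R v + (r * t) *\<^sub>R v" for y
        by (simp add: algebra_simps)
      ultimately show "(\<integral>\<^sup>+y. ?I (t - c y) * g (y + ((r - 1) * c y) *\<^sub>R v) \<partial>lborel)
        = (\<integral>\<^sup>+y. ?I (- c y) * g (y + ((r - 1) * c y) *\<^sub>R v + (r * t) *\<^sub>R v) \<partial>lborel)"
        by (simp add: c)
    qed
    also have "\<dots> = (\<integral>\<^sup>+y. \<integral>\<^sup>+t. ?I (- c y) * g (y + ((r - 1) * c y) *\<^sub>R v + (r * t) *\<^sub>R v) \<partial>lborel \<partial>lborel)"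
      by (rule lborel_pair.Fubini') measurable
    also have "\<dots> = (\<integral>\<^sup>+y. ?I (- c y) * (ennreal (1 / r) * (\<integral>\<^sup>+t. g (y + t *\<^sub>R v) \<partial>lborel)) \<partial>lborel)"
    proof (rule nn_integral_cong)
      fix y :: 'a
      let ?h = "\<lambda>t. g (y + t *\<^sub>R v)"
      have "(\<integral>\<^sup>+t. ?h t \<partial>lborel) = ennreal r * (\<integral>\<^sup>+t. ?h ((r - 1) * c y + r * t) \<partial>lborel)"
        using nn_integral_real_affine[of ?h r "(r - 1) * c y"] r by simp
      then have "ennreal (1 / r) * (\<integral>\<^sup>+t. ?h t \<partial>lborel) = (\<integral>\<^sup>+t. ?h ((r - 1) * c y + r * t) \<partial>lborel)"
        using r by (simp flip: mult.assoc ennreal_mult)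
      then show "(\<integral>\<^sup>+t. ?I (- c y) * g (y + ((r - 1) * c y) *\<^sub>R v + (r * t) *\<^sub>R v) \<partial>lborel)
        = ?I (- c y) * (ennreal (1 / r) * (\<integral>\<^sup>+t. g (y + t *\<^sub>R v) \<partial>lborel))"
        by (simp add: nn_integral_cmult scaleR_add_left add.assoc)
    qed
    also have "\<dots> = ennreal (1 / r) * (\<integral>\<^sup>+y. ?I (- c y) * (\<integral>\<^sup>+t. g (y + t *\<^sub>R v) \<partial>lborel) \<partial>lborel)"
      by (subst nn_integral_cmult[symmetric]) (auto simp: mult.left_commute)
    finally show ?thesis .
  qed
  have "(\<integral>\<^sup>+y. g y \<partial>lborel) = (\<integral>\<^sup>+y. ?I (- c y) * (\<integral>\<^sup>+t. g (y + t *\<^sub>R v) \<partial>lborel) \<partial>lborel)"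
    using *[of 1] by simp
  then show ?thesis using *[OF r] by (simp only:)
qed

lemma smooth_Lipschitz_cball:
  fixes F :: "'a::euclidean_space \<Rightarrow> real"
  assumes F: "smooth_on UNIV F"
  obtains C where "0 \<le> C" "\<And>p q. p \<in> cball 0 R \<Longrightarrow> q \<in> cball 0 R \<Longrightarrow> \<bar>F p - F q\<bar> \<le> C * norm (p - q)"
proof -
  have "\<exists>B. \<forall>p\<in>cball 0 R. \<bar>frechet_derivative F (at p) b\<bar> \<le> B" for b
  proof -
    have "continuous_on (cball 0 R) (\<lambda>p. frechet_derivative F (at p) b)"
      by (rule continuous_on_subset[OF smooth_on_continuous[OF smooth_on_frechet[OF F]]]) simp
    then have "bounded ((\<lambda>p. frechet_derivative F (at p) b) ` cball 0 R)"
      by (intro compact_imp_bounded compact_continuous_image) auto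
    then show ?thesis unfolding bounded_iff by auto
  qed
  then obtain B where B: "\<And>b p. p \<in> cball 0 R \<Longrightarrow> \<bar>frechet_derivative F (at p) b\<bar> \<le> B b" by metis
  define C where "C = max 0 (\<Sum>b\<in>Basis. B b)"
  have der: "(F has_derivative frechet_derivative F (at p)) (at p)" for p
    by (rule smooth_on_has_derivative[OF F]) simp
  have on: "onorm (frechet_derivative F (at p)) \<le> C" if p: "p \<in> cball 0 R" for p
  proof (rule onorm_le)
    fix v
    have "frechet_derivative F (at p) v = (\<Sum>b\<in>Basis. (v \<bullet> b) *\<^sub>R frechet_derivative F (at p) b)"
      by (rule linear_basis_expansion[OF has_derivative_linear[OF der]])
    also have "norm \<dots> \<le> (\<Sum>b\<in>Basis. norm v * B b)"
    proof (rule sum_norm_le)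
      fix b :: 'a assume b: "b \<in> Basis"
      show "norm ((v \<bullet> b) *\<^sub>R frechet_derivative F (at p) b) \<le> norm v * B b"
        unfolding norm_scaleR using Basis_le_norm[OF b, of v] B[OF p, of b] by (intro mult_mono) auto
    qed
    also have "\<dots> = norm v * (\<Sum>b\<in>Basis. B b)" by (simp add: sum_distrib_left)
    also have "\<dots> \<le> norm v * C" by (intro mult_left_mono) (auto simp: C_def)
    finally show "norm (frechet_derivative F (at p) v) \<le> C * norm v" by (simp add: mult.commute)
  qed
  show thesis
  proof (rule that[of C])
    show "0 \<le> C" by (simp add: C_def)
    fix p q :: 'a assume pq: "p \<in> cball 0 R" "q \<in> cball 0 R"
    have "norm (F p - F q) \<le> C * norm (p - q)"
      by (rule differentiable_bound[OF convex_cball has_derivative_at_withinI[OF der] on pq])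
    then show "\<bar>F p - F q\<bar> \<le> C * norm (p - q)" by simp
  qed
qed

locale graded_space =
  fixes dil :: "real \<Rightarrow> 'a::euclidean_space \<Rightarrow> 'a"
    and X :: "nat \<Rightarrow> 'a" and w :: "nat \<Rightarrow> real"
  assumes X: "inj_on X {1..DIM('a)}" "independent (X ` {1..DIM('a)})" "span (X ` {1..DIM('a)}) = UNIV"
    and w_mono: "i \<in> {1..DIM('a)} \<Longrightarrow> j \<in> {1..DIM('a)} \<Longrightarrow> i \<le> j \<Longrightarrow> w i \<le> w j" and w_1: "w 1 = 1"
    and dil_linear: "0 < l \<Longrightarrow> linear (dil l)"
    and dil_X: "0 < l \<Longrightarrow> j \<in> {1..DIM('a)} \<Longrightarrow> dil l (X j) = (l powr w j) *\<^sub>R X j"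
begin

section \<open>Coordinates, dilations and homogeneous functions\<close>

lemma DIM_ge_1: "1 \<le> DIM('a)" using DIM_positive[where 'a = 'a] by linarith

lemma w_ge_1: "j \<in> {1..DIM('a)} \<Longrightarrow> 1 \<le> w j" using w_mono[of 1 j] DIM_ge_1 w_1 by auto

definition c :: "nat \<Rightarrow> 'a \<Rightarrow> real" where "c j v = representation (X ` {1..DIM('a)}) v (X j)"

lemma linear_c: "linear (c j)"
  unfolding c_def using X by (intro linearI) (auto simp: real_vector.representation_add real_vector.representation_scale)

lemma c_X: "j \<in> {1..DIM('a)} \<Longrightarrow> k \<in> {1..DIM('a)} \<Longrightarrow> c j (X k) = (if j = k then 1 else 0)"
  unfolding c_def using X by (subst real_vector.representation_basis) (auto simp: inj_on_eq_iff)

lemma expand: "v = (\<Sum>j\<in>{1..DIM('a)}. c j v *\<^sub>R X j)"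
proof -
  have "v = (\<Sum>b\<in>X ` {1..DIM('a)}. representation (X ` {1..DIM('a)}) v b *\<^sub>R b)"
    using X by (subst real_vector.sum_representation_eq) auto
  also have "\<dots> = (\<Sum>j\<in>{1..DIM('a)}. c j v *\<^sub>R X j)" unfolding c_def using X(1) by (subst sum.reindex) auto
  finally show ?thesis .
qed

lemma c_sum: "j \<in> {1..DIM('a)} \<Longrightarrow> c j (\<Sum>k\<in>{1..DIM('a)}. a k *\<^sub>R X k) = a j"
proof -
  assume j: "j \<in> {1..DIM('a)}"
  have "c j (\<Sum>k\<in>{1..DIM('a)}. a k *\<^sub>R X k) = (\<Sum>k\<in>{1..DIM('a)}. a k * c j (X k))"
    using linear_c[of j] by (simp add: linear_sum linear_scale)
  also have "\<dots> = (\<Sum>k\<in>{1..DIM('a)}. if j = k then a k else 0)" using j by (intro sum.cong) (auto simp: c_X)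
  also have "\<dots> = a j" using j by simp
  finally show ?thesis .
qed

lemma coords_eqI: "(\<And>j. j \<in> {1..DIM('a)} \<Longrightarrow> c j v = c j u) \<Longrightarrow> v = u"
  using expand[of v] expand[of u] by (metis (no_types, lifting) sum.cong)

lemma continuous_c: "continuous_on A (c j)"
  using linear_c by (simp add: linear_continuous_on linear_conv_bounded_linear)

lemma measurable_c [measurable]: "c j \<in> borel_measurable borel"
  by (rule borel_measurable_continuous_onI[OF continuous_c])

lemma dil_expand: assumes l: "0 < l" shows "dil l v = (\<Sum>j\<in>{1..DIM('a)}. (l powr w j * c j v) *\<^sub>R X j)"
proof -
  have "dil l v = dil l (\<Sum>j\<in>{1..DIM('a)}. c j v *\<^sub>R X j)" using expand[of v] by simp
  also have "\<dots> = (\<Sum>j\<in>{1..DIM('a)}. c j v *\<^sub>R dil l (X j))"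
    using dil_linear[OF l] by (simp add: linear_sum linear_scale)
  also have "\<dots> = (\<Sum>j\<in>{1..DIM('a)}. (l powr w j * c j v) *\<^sub>R X j)"
    using l by (intro sum.cong) (auto simp: dil_X mult.commute)
  finally show ?thesis .
qed

lemma c_dil: "0 < l \<Longrightarrow> j \<in> {1..DIM('a)} \<Longrightarrow> c j (dil l v) = l powr w j * c j v"
  using c_sum[of j "\<lambda>j. l powr w j * c j v"] by (simp only: dil_expand)

lemma dil_dil: "0 < l \<Longrightarrow> 0 < m \<Longrightarrow> dil l (dil m v) = dil (l * m) v"
  by (rule coords_eqI) (simp add: c_dil powr_mult)

lemma dil_1: "dil 1 v = v"
  by (rule coords_eqI) (simp add: c_dil)

text \<open>Not homogeneous under dilations; the choice is made because it is absolutely homogeneous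
  under scalars and still contracts under dilations, all weights being at least 1.\<close>

definition nn :: "'a \<Rightarrow> real" where "nn v = (\<Sum>j\<in>{1..DIM('a)}. \<bar>c j v\<bar>)"

lemma nn_nonneg: "0 \<le> nn v" by (simp add: nn_def sum_nonneg)

lemma nn_scaleR: "nn (a *\<^sub>R v) = \<bar>a\<bar> * nn v"
  using linear_c by (simp add: nn_def linear_scale abs_mult sum_distrib_left)

lemma continuous_nn: "continuous_on UNIV nn"
  unfolding nn_def by (intro continuous_intros continuous_c)

lemma nn_dil: assumes l: "0 < l" "l \<le> 1" shows "nn (dil l v) \<le> l * nn v"
proof -
  have "\<bar>c j (dil l v)\<bar> \<le> l * \<bar>c j v\<bar>" if j: "j \<in> {1..DIM('a)}" for j
  proof -
    have "l powr w j \<le> l powr 1" using l w_ge_1[OF j] by (intro powr_mono') auto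
    then show ?thesis using l j by (simp add: c_dil abs_mult mult_right_mono)
  qed
  then show ?thesis unfolding nn_def sum_distrib_left by (rule sum_mono)
qed

lemma nn_dil_ge: assumes l: "1 \<le> l" shows "l * nn v \<le> nn (dil l v)"
proof -
  have "nn (dil (1 / l) (dil l v)) \<le> (1 / l) * nn (dil l v)" using l by (intro nn_dil) auto
  then show ?thesis using l by (simp add: dil_dil dil_1 field_simps)
qed

lemma nn_dil_le: assumes l: "1 \<le> l" shows "nn (dil l v) \<le> l powr w (DIM('a)) * nn v"
proof -
  have "\<bar>c j (dil l v)\<bar> \<le> l powr w (DIM('a)) * \<bar>c j v\<bar>" if j: "j \<in> {1..DIM('a)}" for j
  proof -
    have "l powr w j \<le> l powr w (DIM('a))" using l w_mono[of j "DIM('a)"] j by (intro powr_mono) auto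
    then show ?thesis using l j by (simp add: c_dil abs_mult mult_right_mono)
  qed
  then show ?thesis unfolding nn_def sum_distrib_left by (rule sum_mono)
qed

lemma norm_le_nn: "\<exists>M>0. \<forall>v. norm v \<le> M * nn v"
proof (intro exI conjI allI)
  let ?M = "1 + (\<Sum>j\<in>{1..DIM('a)}. norm (X j))"
  show "0 < ?M" by (intro add_pos_nonneg sum_nonneg) auto
  fix v
  have "norm v \<le> (\<Sum>j\<in>{1..DIM('a)}. norm (c j v *\<^sub>R X j))" using expand[of v] norm_sum by metis
  also have "\<dots> \<le> (\<Sum>j\<in>{1..DIM('a)}. \<bar>c j v\<bar> * ?M)"
  proof (rule sum_mono)
    fix j assume "j \<in> {1..DIM('a)}"
    then have "norm (X j) \<le> (\<Sum>j\<in>{1..DIM('a)}. norm (X j))" by (intro member_le_sum) auto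
    then show "norm (c j v *\<^sub>R X j) \<le> \<bar>c j v\<bar> * ?M" by (simp add: mult_left_mono)
  qed
  finally show "norm v \<le> ?M * nn v" unfolding nn_def sum_distrib_right[symmetric] by (simp only: mult.commute)
qed

lemma nn_nhds: assumes "0 < r" shows "\<exists>\<rho>>0. \<forall>v. nn v < \<rho> \<longrightarrow> norm v < r"
proof -
  obtain M where M: "0 < M" "\<And>v. norm v \<le> M * nn v" using norm_le_nn by blast
  show ?thesis
  proof (intro exI[of _ "r / M"] conjI allI impI)
    show "0 < r / M" using assms M by simp
    fix v assume "nn v < r / M"
    then have "M * nn v < r" using M(1) by (simp add: field_simps)
    then show "norm v < r" using M(2)[of v] by linarith
  qed
qed

lemma nn_eq_0: "nn v = 0 \<Longrightarrow> v = 0"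
  using norm_le_nn by (metis mult_zero_right norm_le_zero_iff)

lemma continuous_dil_left: "continuous_on {0<..} (\<lambda>l. dil l v)"
proof -
  have "continuous_on {0<..} (\<lambda>l. \<Sum>j\<in>{1..DIM('a)}. (l powr w j * c j v) *\<^sub>R X j)"
    by (intro continuous_intros) auto
  then show ?thesis by (rule continuous_on_cong[THEN iffD1, rotated 2]) (auto simp: dil_expand)
qed

text \<open>Projection to the sphere \<open>nn v = 1\<close> along a dilation orbit, by the
  intermediate value theorem. The equivalence records on which side of the sphere \<open>v\<close>
  lies.\<close>

lemma nn_dil_eq_1: assumes "v \<noteq> 0" obtains l where "0 < l" "nn (dil l v) = 1" "nn v \<le> 1 \<longleftrightarrow> 1 \<le> l"
proof -
  have nv: "0 < nn v" using assms nn_eq_0[of v] nn_nonneg[of v] by (cases "nn v = 0") auto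
  define a where "a = min 1 (1 / nn v)"
  define b where "b = max 1 (1 / nn v)"
  have ab: "0 < a" "a \<le> 1" "1 \<le> b" using nv by (auto simp: a_def b_def)
  have "nn (dil a v) \<le> a * nn v" by (rule nn_dil[OF ab(1,2)])
  also have "\<dots> \<le> 1" using nv by (auto simp: a_def min_def field_simps)
  finally have lo: "nn (dil a v) \<le> 1" .
  have "1 \<le> b * nn v" using nv by (auto simp: b_def max_def field_simps)
  also have "\<dots> \<le> nn (dil b v)" by (rule nn_dil_ge[OF ab(3)])
  finally have hi: "1 \<le> nn (dil b v)" .
  have "continuous_on {a..b} (\<lambda>l. nn (dil l v))"
    by (rule continuous_on_compose2[OF continuous_nn continuous_on_subset[OF continuous_dil_left]]) (use ab in auto)
  then obtain l where l: "a \<le> l" "l \<le> b" "nn (dil l v) = 1"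
    using IVT'[of "\<lambda>l. nn (dil l v)" a 1 b] lo hi ab by auto
  have lp: "0 < l" using l ab by linarith
  consider "nn v < 1" | "nn v = 1" | "1 < nn v" by linarith
  then show thesis
  proof cases
    case 1
    have "1 \<le> l"
    proof (rule ccontr)
      assume "\<not> 1 \<le> l"
      then have "nn (dil l v) \<le> l * nn v" "l * nn v \<le> nn v" using lp nv nn_dil[of l v] by auto
      then show False using l 1 by linarith
    qed
    then show thesis using that lp l 1 by auto
  next
    case 2
    then show thesis using that[of 1] by (simp add: dil_1)
  next
    case 3
    have "l < 1"
    proof (rule ccontr)
      assume "\<not> l < 1"
      then have "l * nn v \<le> nn (dil l v)" "nn v \<le> l * nn v" using nv nn_dil_ge[of l v] by auto
      then show False using l 3 by linarith
    qed
    then show thesis using that lp l 3 by auto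
  qed
qed

text \<open>\<open>N\<close> has a positive lower bound \<open>m\<close> on the compact sphere
  \<open>nn v = 1\<close>, and dilations carry the comparison elsewhere. Below \<open>m\<close> the
  bound is linear because all weights are at least 1; far out the largest weight gives a polynomial
  bound.\<close>

lemma homogeneous_function_bounds:
  fixes N :: "'a \<Rightarrow> real"
  assumes N: "continuous_on UNIV N" "\<And>v. 0 \<le> N v" "\<And>v. N v = 0 \<longleftrightarrow> v = 0" "\<And>l v. 0 < l \<Longrightarrow> N (dil l v) = l * N v"
  obtains m C where "0 < m" "0 < C" "\<And>v. N v < m \<Longrightarrow> norm v \<le> C * N v" "\<And>r. bounded {v. N v < r}"
proof -
  obtain M where M: "0 < M" "\<And>v. norm v \<le> M * nn v" using norm_le_nn by blast
  define S where "S = {v. nn v = 1}"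
  have "closed S" unfolding S_def using continuous_nn by (intro closed_Collect_eq) auto
  moreover have "bounded S" unfolding S_def using M(2) by (intro boundedI[of _ M]) (auto, metis mult_1_right)
  ultimately have S: "compact S" by (simp add: compact_eq_bounded_closed)
  obtain m where m: "0 < m" "\<And>v. v \<in> S \<Longrightarrow> m \<le> N v"
  proof (cases "S = {}")
    case False
    obtain u where u: "u \<in> S" "\<And>v. v \<in> S \<Longrightarrow> N u \<le> N v"
      using continuous_attains_inf[OF S False continuous_on_subset[OF N(1)]] by auto
    have "u \<noteq> 0" using u(1) by (auto simp: S_def nn_def linear_0[OF linear_c])
    then have "0 < N u" using N(2,3) by (metis order_le_less)
    then show thesis using that u by blast
  qed (use that[of 1] in auto)
  have large: "m \<le> N v \<and> nn v \<le> (N v / m) powr w (DIM('a))" if v: "1 < nn v" for v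
  proof -
    have "v \<noteq> 0" using v by (auto simp: nn_def linear_0[OF linear_c])
    then obtain l where l: "0 < l" "nn (dil l v) = 1" "nn v \<le> 1 \<longleftrightarrow> 1 \<le> l" by (rule nn_dil_eq_1)
    have l1: "l < 1" using l v by linarith
    have ml: "m \<le> l * N v" using m(2)[of "dil l v"] l N(4) by (simp add: S_def)
    then have Nv: "m / N v \<le> l" using m(1) l(1) by (cases "N v = 0") (auto simp: divide_le_eq N(2) less_le)
    have Npos: "0 < N v" using ml m(1) l(1) by (metis N(2) less_le_not_le mult_eq_0_iff order_le_less order_less_le_trans)
    have "l * N v \<le> 1 * N v" using l1 Npos by (intro mult_right_mono) auto
    then have "m \<le> N v" using ml by linarith
    moreover have "nn v \<le> (1 / l) powr w (DIM('a)) * nn (dil l v)"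
      using nn_dil_le[of "1 / l" "dil l v"] l l1 by (simp add: dil_dil dil_1)
    moreover have "(1 / l) powr w (DIM('a)) \<le> (N v / m) powr w (DIM('a))"
    proof (rule powr_mono2)
      show "0 \<le> w (DIM('a))" using w_ge_1[of "DIM('a)"] DIM_ge_1 by auto
      show "1 / l \<le> N v / m" using ml l m by (simp add: field_simps)
    qed (use l in auto)
    ultimately show ?thesis using l(2) by simp
  qed
  have small: "nn v \<le> N v / m" if v: "nn v \<le> 1" for v
  proof (cases "v = 0")
    case False
    then obtain l where l: "0 < l" "nn (dil l v) = 1" "nn v \<le> 1 \<longleftrightarrow> 1 \<le> l" by (rule nn_dil_eq_1)
    have l1: "1 \<le> l" using l v by blast
    have ml: "m \<le> l * N v" using m(2)[of "dil l v"] l N(4) by (simp add: S_def)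
    have "nn v \<le> (1 / l) * nn (dil l v)"
      using nn_dil[of "1 / l" "dil l v"] l l1 by (simp add: dil_dil dil_1)
    also have "\<dots> \<le> N v / m" using ml l m by (simp add: field_simps)
    finally show ?thesis .
  qed (use N(2) m(1) in \<open>auto simp: nn_def linear_0[OF linear_c]\<close>)
  show thesis
  proof (rule that[of m "M / m"])
    fix v assume v: "N v < m"
    then have "nn v \<le> 1" using large[of v] by force
    then have "nn v \<le> N v / m" by (rule small)
    then have "M * nn v \<le> M * (N v / m)" using M(1) by (intro mult_left_mono) auto
    then show "norm v \<le> M / m * N v" using M(2)[of v] by simp
  next
    fix r
    have "norm v \<le> M * (1 + (max 0 r / m) powr w (DIM('a)))" if v: "N v < r" for v
    proof -
      have "nn v \<le> 1 + (max 0 r / m) powr w (DIM('a))"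
      proof (cases "1 < nn v")
        case True
        have "(N v / m) powr w (DIM('a)) \<le> (max 0 r / m) powr w (DIM('a))"
          using v m(1) N(2)[of v] w_ge_1[of "DIM('a)"] DIM_ge_1 by (intro powr_mono2 divide_right_mono) auto
        then show ?thesis using large[OF True] by linarith
      qed (simp add: add_increasing2)
      then show ?thesis using M by (meson mult_left_mono order_trans less_imp_le)
    qed
    then show "bounded {v. N v < r}" by (intro boundedI) auto
  qed (use m M in auto)
qed

text \<open>Coordinates are stretched one at a time: \<open>D m\<close> has treated the first
  \<open>m\<close> and left the others untouched, so each step is an instance of
  \<open>nn_integral_stretch\<close>.\<close>

lemma nn_integral_dil:
  fixes g :: "'a \<Rightarrow> ennreal"
  assumes l: "0 < l" and g [measurable]: "g \<in> borel_measurable borel"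
  shows "(\<integral>\<^sup>+y. g (dil l y) \<partial>lborel) = ennreal (l powr - (\<Sum>j\<in>{1..DIM('a)}. w j)) * (\<integral>\<^sup>+y. g y \<partial>lborel)"
proof -
  define D where "D m y = y + (\<Sum>i\<in>{1..m}. ((l powr w i - 1) * c i y) *\<^sub>R X i)" for m y
  have D_meas [measurable]: "D m \<in> borel_measurable borel" for m unfolding D_def by measurable
  have cD: "c j (D m y) = c j y" if "j \<in> {1..DIM('a)}" "m < j" for j m y
  proof -
    have "c j (D m y) = c j y + (\<Sum>i\<in>{1..m}. ((l powr w i - 1) * c i y) * c j (X i))"
      using linear_c[of j] by (simp add: D_def linear_add linear_sum linear_scale)
    also have "(\<Sum>i\<in>{1..m}. ((l powr w i - 1) * c i y) * c j (X i)) = 0"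
      using that by (intro sum.neutral) (auto simp: c_X)
    finally show ?thesis by simp
  qed
  have "\<forall>g::'a \<Rightarrow> ennreal. g \<in> borel_measurable borel \<longrightarrow>
    (\<integral>\<^sup>+y. g (D m y) \<partial>lborel) = ennreal (l powr - (\<Sum>j\<in>{1..m}. w j)) * (\<integral>\<^sup>+y. g y \<partial>lborel)" if "m \<le> DIM('a)" for m
    using that
  proof (induction m)
    case 0
    then show ?case using l by (simp add: D_def)
  next
    case (Suc m)
    show ?case
    proof (intro allI impI)
      fix g :: "'a \<Rightarrow> ennreal" assume [measurable]: "g \<in> borel_measurable borel"
      have j: "Suc m \<in> {1..DIM('a)}" using Suc.prems by auto
      define s where "s y = y + ((l powr w (Suc m) - 1) * c (Suc m) y) *\<^sub>R X (Suc m)" for y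
      have [measurable]: "s \<in> borel_measurable borel" unfolding s_def by measurable
      have "D (Suc m) y = s (D m y)" for y
        using cD[OF j, of m y] by (simp add: s_def) (simp add: D_def add.assoc)
      then have "(\<integral>\<^sup>+y. g (D (Suc m) y) \<partial>lborel) = (\<integral>\<^sup>+y. g (s (D m y)) \<partial>lborel)" by simp
      also have "\<dots> = ennreal (l powr - (\<Sum>j\<in>{1..m}. w j)) * (\<integral>\<^sup>+y. g (s y) \<partial>lborel)"
        using Suc.IH[rule_format, of "\<lambda>y. g (s y)"] Suc.prems by simp
      also have "(\<integral>\<^sup>+y. g (s y) \<partial>lborel) = ennreal (1 / l powr w (Suc m)) * (\<integral>\<^sup>+y. g y \<partial>lborel)"
        unfolding s_def
      proof (rule nn_integral_stretch)
        show "c (Suc m) (y + t *\<^sub>R X (Suc m)) = c (Suc m) y + t" for y t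
          using linear_c[of "Suc m"] j by (simp add: linear_add linear_scale c_X)
      qed (use l in auto)
      also have "ennreal (l powr - (\<Sum>j\<in>{1..m}. w j)) * (ennreal (1 / l powr w (Suc m)) * (\<integral>\<^sup>+y. g y \<partial>lborel))
        = ennreal (l powr - (\<Sum>j\<in>{1..Suc m}. w j)) * (\<integral>\<^sup>+y. g y \<partial>lborel)"
      proof -
        have "l powr - (\<Sum>j\<in>{1..m}. w j) * (1 / l powr w (Suc m)) = l powr - (\<Sum>j\<in>{1..Suc m}. w j)"
          by (simp add: powr_minus_divide[symmetric] powr_add[symmetric])
        then show ?thesis by (subst mult.assoc[symmetric], subst ennreal_mult[symmetric]) auto
      qed
      finally show "(\<integral>\<^sup>+y. g (D (Suc m) y) \<partial>lborel) = ennreal (l powr - (\<Sum>j\<in>{1..Suc m}. w j)) * (\<integral>\<^sup>+y. g y \<partial>lborel)" .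
    qed
  qed
  from this[OF order_refl, rule_format, OF g]
  have "(\<integral>\<^sup>+y. g (D (DIM('a)) y) \<partial>lborel) = ennreal (l powr - (\<Sum>j\<in>{1..DIM('a)}. w j)) * (\<integral>\<^sup>+y. g y \<partial>lborel)" .
  moreover have "D (DIM('a)) y = dil l y" for y
  proof (rule coords_eqI)
    fix j assume j: "j \<in> {1..DIM('a)}"
    have "c j (D (DIM('a)) y) = c j y + c j (\<Sum>i\<in>{1..DIM('a)}. ((l powr w i - 1) * c i y) *\<^sub>R X i)"
      using linear_c[of j] by (simp add: D_def linear_add)
    also have "\<dots> = c j (dil l y)"
      unfolding c_sum[OF j] c_dil[OF l j] by (simp add: left_diff_distrib)
    finally show "c j (D (DIM('a)) y) = c j (dil l y)" .
  qed
  ultimately show ?thesis by (simp only:)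
qed

end

section \<open>Left translations as products of shears\<close>

lemma tendsto_powr_at_right_0: "0 < a \<Longrightarrow> ((\<lambda>l::real. l powr a) \<longlongrightarrow> 0) (at_right 0)"
  by (rule tendsto_zero_powrI[OF tendsto_ident_at tendsto_const])
    (auto simp: eventually_at_right_field intro!: exI[of _ 1])

locale graded_group = graded_space dil X w
  for dil :: "real \<Rightarrow> 'a::euclidean_space \<Rightarrow> 'a" and X :: "nat \<Rightarrow> 'a" and w :: "nat \<Rightarrow> real" +
  fixes star :: "'a \<Rightarrow> 'a \<Rightarrow> 'a" (infixl "\<odot>" 70)
  assumes star_0_left [simp]: "0 \<odot> x = x"
    and dil_star: "0 < l \<Longrightarrow> dil l (x \<odot> y) = dil l x \<odot> dil l y"
    and smooth_star: "smooth_on UNIV (\<lambda>p. fst p \<odot> snd p)"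
begin

lemma smooth_on_star:
  fixes f g :: "'b::euclidean_space \<Rightarrow> 'a"
  assumes "open S" "smooth_on S f" "smooth_on S g" shows "smooth_on S (\<lambda>x. f x \<odot> g x)"
  using smooth_on_compose[OF assms(1) open_UNIV _ smooth_on_Pair[OF assms] smooth_star] by simp

lemma smooth_on_translation: "smooth_on UNIV (\<lambda>y. x \<odot> y)"
  by (intro smooth_on_star smooth_on_const smooth_on_id) simp

text \<open>Column \<open>k\<close> of the Jacobian of the left translation by
  \<open>x\<close>.\<close>

definition dstar :: "nat \<Rightarrow> 'a \<Rightarrow> 'a \<Rightarrow> 'a" where
  "dstar k x y = frechet_derivative (\<lambda>p. fst p \<odot> snd p) (at (x, y)) (0, X k)"

lemma star_has_derivative:
  "((\<lambda>t. x \<odot> (y + (t * a) *\<^sub>R X k)) has_derivative (\<lambda>t. (t * a) *\<^sub>R dstar k x (y + (t0 * a) *\<^sub>R X k))) (at t0)"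
proof -
  let ?D = "frechet_derivative (\<lambda>p. fst p \<odot> snd p) (at (x, y + (t0 * a) *\<^sub>R X k))"
  have D: "((\<lambda>p. fst p \<odot> snd p) has_derivative ?D) (at (x, y + (t0 * a) *\<^sub>R X k))"
    by (rule smooth_on_has_derivative[OF smooth_star]) simp
  have "((\<lambda>t. (x, y + (t * a) *\<^sub>R X k)) has_derivative (\<lambda>t. (0, (t * a) *\<^sub>R X k))) (at t0)"
    by (auto intro!: derivative_eq_intros)
  from has_derivative_compose[OF this D]
  have "((\<lambda>t. x \<odot> (y + (t * a) *\<^sub>R X k)) has_derivative (\<lambda>t. ?D (0, (t * a) *\<^sub>R X k))) (at t0)" by simp
  moreover have "?D (0, (t * a) *\<^sub>R X k) = (t * a) *\<^sub>R dstar k x (y + (t0 * a) *\<^sub>R X k)" for t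
    using linear_scale[OF has_derivative_linear[OF D], of "t * a" "(0, X k)"] by (simp add: dstar_def)
  ultimately show ?thesis by simp
qed

lemma dstar_dil:
  assumes l: "0 < l" and k: "k \<in> {1..DIM('a)}"
  shows "dil l (dstar k x y) = (l powr w k) *\<^sub>R dstar k (dil l x) (dil l y)"
proof -
  have "((\<lambda>t. dil l (x \<odot> (y + (t * 1) *\<^sub>R X k))) has_derivative (\<lambda>t. dil l ((t * 1) *\<^sub>R dstar k x (y + (0 * 1) *\<^sub>R X k)))) (at 0)"
    by (rule bounded_linear.has_derivative[OF linear_conv_bounded_linear[THEN iffD1, OF dil_linear[OF l]] star_has_derivative])
  moreover have "dil l (x \<odot> (y + (t * 1) *\<^sub>R X k)) = dil l x \<odot> (dil l y + (t * l powr w k) *\<^sub>R X k)" for t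
    using dil_linear[OF l] by (simp add: dil_star[OF l] linear_add linear_scale dil_X[OF l k])
  ultimately have "((\<lambda>t. dil l x \<odot> (dil l y + (t * l powr w k) *\<^sub>R X k)) has_derivative (\<lambda>t. dil l (t *\<^sub>R dstar k x y))) (at 0)"
    by simp
  from fun_cong[OF has_derivative_unique[OF this star_has_derivative[of "dil l x" "dil l y" "l powr w k" k 0]], of 1]
  show ?thesis by simp
qed

lemma dstar_0: "dstar k 0 y = X k"
proof -
  have "((\<lambda>t. y + (t * 1) *\<^sub>R X k) has_derivative (\<lambda>t. t *\<^sub>R X k)) (at 0)" by (auto intro!: derivative_eq_intros)
  moreover have "((\<lambda>t. y + (t * 1) *\<^sub>R X k) has_derivative (\<lambda>t. (t * 1) *\<^sub>R dstar k 0 y)) (at 0)"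
    using star_has_derivative[of 0 y 1 k 0] by simp
  ultimately have "(\<lambda>t. t *\<^sub>R X k) = (\<lambda>t::real. (t * 1) *\<^sub>R dstar k 0 y)" by (rule has_derivative_unique)
  from fun_cong[OF this, of 1] show ?thesis by simp
qed

lemma dil_tendsto_0: "((\<lambda>l. dil l v) \<longlongrightarrow> 0) (at_right 0)"
proof -
  have "((\<lambda>l. \<Sum>j\<in>{1..DIM('a)}. (l powr w j * c j v) *\<^sub>R X j) \<longlongrightarrow> (\<Sum>j\<in>{1..DIM('a)}. (0 * c j v) *\<^sub>R X j)) (at_right 0)"
  proof (intro tendsto_sum tendsto_scaleR tendsto_mult tendsto_const)
    fix j assume "j \<in> {1..DIM('a)}"
    then have "0 < w j" using w_ge_1[of j] by simp
    then show "((\<lambda>l. l powr w j) \<longlongrightarrow> 0) (at_right 0)" by (rule tendsto_powr_at_right_0)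
  qed
  moreover have "\<forall>\<^sub>F l in at_right 0. (\<Sum>j\<in>{1..DIM('a)}. (l powr w j * c j v) *\<^sub>R X j) = dil l v"
    unfolding eventually_at_right_field by (intro exI[of _ 1] conjI allI impI dil_expand[symmetric]) auto
  ultimately have "((\<lambda>l. dil l v) \<longlongrightarrow> (\<Sum>j\<in>{1..DIM('a)}. (0 * c j v) *\<^sub>R X j)) (at_right 0)"
    by (rule Lim_transform_eventually)
  then show ?thesis by simp
qed

text \<open>Homogeneity transports the value of the derivative at the origin to every point: the
  translations are unipotent with respect to the flag spanned by \<open>X\<^sub>j\<close>, \<open>j \<ge> m\<close>.\<close>

lemma c_dstar:
  assumes j: "j \<in> {1..DIM('a)}" and k: "k \<in> {1..DIM('a)}" and jk: "j \<le> k"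
  shows "c j (dstar k x y) = (if j = k then 1 else 0)"
proof -
  \<comment> \<open>For \<open>j \<le> k\<close> the powers from the direction and from the
    coordinate combine to a nonnegative exponent. Letting \<open>l\<close> tend to 0 moves both
    arguments to the origin, where \<open>dstar_0\<close> applies.\<close>
  have eq: "c j (dstar k x y) = l powr (w k - w j) * c j (dstar k (dil l x) (dil l y))" if l: "0 < l" for l
  proof -
    have "l powr w j * c j (dstar k x y) = l powr w k * c j (dstar k (dil l x) (dil l y))"
      using arg_cong[OF dstar_dil[OF l k, of x y], of "c j"] linear_c[of j] by (simp only: c_dil[OF l j] linear_scale) simp
    then show ?thesis using l by (simp add: powr_diff field_simps)
  qed
  have "continuous_on UNIV (\<lambda>p. dstar k (fst p) (snd p))"
    using smooth_on_continuous[OF smooth_on_frechet[OF smooth_star, of "(0, X k)"]] by (simp add: dstar_def)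
  then have "continuous_on UNIV (\<lambda>p. c j (dstar k (fst p) (snd p)))"
    by (rule continuous_on_compose2[OF continuous_c[of UNIV j]]) simp
  then have "isCont (\<lambda>p. c j (dstar k (fst p) (snd p))) (0, 0)" by (simp add: continuous_on_eq_continuous_at)
  moreover have "((\<lambda>l. (dil l x, dil l y)) \<longlongrightarrow> (0, 0)) (at_right 0)"
    by (intro tendsto_Pair dil_tendsto_0)
  ultimately have "((\<lambda>l. c j (dstar k (fst (dil l x, dil l y)) (snd (dil l x, dil l y))))
      \<longlongrightarrow> c j (dstar k (fst (0::'a, 0::'a)) (snd (0::'a, 0::'a)))) (at_right 0)"
    by (rule isCont_tendsto_compose)
  then have lim: "((\<lambda>l. c j (dstar k (dil l x) (dil l y))) \<longlongrightarrow> c j (X k)) (at_right 0)" by (simp add: dstar_0)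
  have wjk: "w j \<le> w k" using w_mono[OF j k jk] .
  have "((\<lambda>l. l powr (w k - w j) * c j (dstar k (dil l x) (dil l y))) \<longlongrightarrow> c j (X k)) (at_right 0)"
  proof (cases "w j = w k")
    case True
    have "\<forall>\<^sub>F l::real in at_right 0. c j (dstar k (dil l x) (dil l y)) = l powr (w k - w j) * c j (dstar k (dil l x) (dil l y))"
      unfolding eventually_at_right_field using True by (intro exI[of _ 1]) simp
    then show ?thesis by (rule Lim_transform_eventually[OF lim])
  next
    case False
    then have "0 < w k - w j" "j \<noteq> k" using wjk by auto
    then have "((\<lambda>l. l powr (w k - w j)) \<longlongrightarrow> 0) (at_right 0)" by (intro tendsto_powr_at_right_0)
    from tendsto_mult[OF this lim] show ?thesis using \<open>j \<noteq> k\<close> by (simp add: c_X[OF j k])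
  qed
  moreover have "\<forall>\<^sub>F l in at_right 0. l powr (w k - w j) * c j (dstar k (dil l x) (dil l y)) = c j (dstar k x y)"
    unfolding eventually_at_right_field by (intro exI[of _ 1] conjI allI impI eq[symmetric]) auto
  ultimately have "((\<lambda>l::real. c j (dstar k x y)) \<longlongrightarrow> c j (X k)) (at_right 0)"
    by (rule Lim_transform_eventually)
  then have "c j (dstar k x y) = c j (X k)" by (simp add: tendsto_const_iff)
  then show ?thesis by (simp add: c_X[OF j k])
qed

text \<open>Along \<open>X k\<close> with \<open>j \<le> k\<close> both terms have the same
  derivative, by \<open>c_dstar\<close>. So the \<open>j\<close>-th component of the displacement
  depends only on earlier coordinates.\<close>

lemma translation_coordinate_invariant:
  assumes j: "j \<in> {1..DIM('a)}" and k: "k \<in> {1..DIM('a)}" and jk: "j \<le> k"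
  shows "c j (x \<odot> (y + t *\<^sub>R X k)) - c j (y + t *\<^sub>R X k) = c j (x \<odot> y) - c j y"
proof -
  let ?g = "\<lambda>t. c j (x \<odot> (y + t *\<^sub>R X k)) - c j (y + t *\<^sub>R X k)"
  have "(?g has_real_derivative 0) (at t)" for t
  proof -
    have bl: "bounded_linear (c j)" using linear_c by (simp add: linear_conv_bounded_linear)
    have "((\<lambda>t. c j (x \<odot> (y + (t * 1) *\<^sub>R X k))) has_derivative (\<lambda>s. c j ((s * 1) *\<^sub>R dstar k x (y + (t * 1) *\<^sub>R X k)))) (at t)"
      by (rule bounded_linear.has_derivative[OF bl star_has_derivative])
    then have d1: "((\<lambda>t. c j (x \<odot> (y + t *\<^sub>R X k))) has_derivative (\<lambda>s. c j (s *\<^sub>R dstar k x (y + t *\<^sub>R X k)))) (at t)"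
      by (simp only: mult_1_right)
    have d2: "((\<lambda>t. c j (y + t *\<^sub>R X k)) has_derivative (\<lambda>s. c j (s *\<^sub>R X k))) (at t)"
      by (rule bounded_linear.has_derivative[OF bl]) (auto intro!: derivative_eq_intros)
    have "(?g has_derivative (\<lambda>s. c j (s *\<^sub>R dstar k x (y + t *\<^sub>R X k)) - c j (s *\<^sub>R X k))) (at t)"
      by (rule has_derivative_diff[OF d1 d2])
    moreover have "(\<lambda>s. c j (s *\<^sub>R dstar k x (y + t *\<^sub>R X k)) - c j (s *\<^sub>R X k)) = times 0"
      using linear_c[of j] by (auto simp: linear_scale c_dstar[OF j k jk] c_X[OF j k])
    ultimately show ?thesis unfolding has_field_derivative_def by (simp only:)
  qed
  then have "?g t = ?g 0" by (intro DERIV_isconst_all[of ?g] allI)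
  then show ?thesis by simp
qed

lemma measurable_translation [measurable]: "(\<lambda>y. x \<odot> y) \<in> borel_measurable borel"
  by (rule borel_measurable_continuous_onI[OF smooth_on_continuous[OF smooth_on_translation]])

text \<open>\<open>F j\<close> is the \<open>j\<close>-th component of the displacement. Adding the
  components from the last to the first makes every step a shear: \<open>F m\<close> is not affected
  by the components added before it, which point along \<open>X i\<close> with
  \<open>i > m\<close>.\<close>

theorem nn_integral_star:
  fixes g :: "'a \<Rightarrow> ennreal"
  assumes g [measurable]: "g \<in> borel_measurable borel"
  shows "(\<integral>\<^sup>+y. g (x \<odot> y) \<partial>lborel) = (\<integral>\<^sup>+y. g y \<partial>lborel)"
proof -
  define F where "F j y = c j (x \<odot> y) - c j y" for j y
  have F_meas [measurable]: "F j \<in> borel_measurable borel" for j unfolding F_def by measurable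
  have F_add: "F j (y + t *\<^sub>R X k) = F j y" if "j \<in> {1..DIM('a)}" "k \<in> {1..DIM('a)}" "j \<le> k" for j k y t
    unfolding F_def by (rule translation_coordinate_invariant[OF that])
  have F_sum: "F j (y + (\<Sum>k\<in>K. a k *\<^sub>R X k)) = F j y" if K: "finite K" "K \<subseteq> {j..DIM('a)}" and j: "j \<in> {1..DIM('a)}" for j y K a
    using K
  proof (induction K)
    case (insert k K)
    then have "F j (y + (\<Sum>k\<in>insert k K. a k *\<^sub>R X k)) = F j (y + (\<Sum>k\<in>K. a k *\<^sub>R X k) + a k *\<^sub>R X k)"
      by (simp add: add_ac)
    also have "\<dots> = F j (y + (\<Sum>k\<in>K. a k *\<^sub>R X k))" using insert.prems j by (intro F_add) auto
    finally show ?case using insert by simp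
  qed simp
  define S where "S m y = y + (\<Sum>i\<in>{m..DIM('a)}. F i y *\<^sub>R X i)" for m y
  have S_meas [measurable]: "S m \<in> borel_measurable borel" for m unfolding S_def by measurable
  have "\<forall>g::'a \<Rightarrow> ennreal. g \<in> borel_measurable borel \<longrightarrow> (\<integral>\<^sup>+y. g (S 1 y) \<partial>lborel) = (\<integral>\<^sup>+y. g y \<partial>lborel)"
  proof (rule inc_induct[of 1 "Suc (DIM('a))"])
    show "\<forall>g::'a \<Rightarrow> ennreal. g \<in> borel_measurable borel \<longrightarrow> (\<integral>\<^sup>+y. g (S (Suc (DIM('a))) y) \<partial>lborel) = (\<integral>\<^sup>+y. g y \<partial>lborel)"
      by (simp add: S_def)
  next
    fix m assume m: "1 \<le> m" "m < Suc (DIM('a))"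
      and IH: "\<forall>g::'a \<Rightarrow> ennreal. g \<in> borel_measurable borel \<longrightarrow> (\<integral>\<^sup>+y. g (S (Suc m) y) \<partial>lborel) = (\<integral>\<^sup>+y. g y \<partial>lborel)"
    have mj: "m \<in> {1..DIM('a)}" using m by auto
    show "\<forall>g::'a \<Rightarrow> ennreal. g \<in> borel_measurable borel \<longrightarrow> (\<integral>\<^sup>+y. g (S m y) \<partial>lborel) = (\<integral>\<^sup>+y. g y \<partial>lborel)"
    proof (intro allI impI)
      fix g :: "'a \<Rightarrow> ennreal" assume [measurable]: "g \<in> borel_measurable borel"
      have "S m y = S (Suc m) y + F m (S (Suc m) y) *\<^sub>R X m" for y
      proof -
        have "F m (S (Suc m) y) = F m y" unfolding S_def by (rule F_sum) (use mj in auto)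
        moreover have "{m..DIM('a)} = insert m {Suc m..DIM('a)}" using m by auto
        ultimately show ?thesis by (simp add: S_def add_ac)
      qed
      then have "(\<integral>\<^sup>+y. g (S m y) \<partial>lborel) = (\<integral>\<^sup>+y. (\<lambda>z. g (z + F m z *\<^sub>R X m)) (S (Suc m) y) \<partial>lborel)" by simp
      also have "\<dots> = (\<integral>\<^sup>+z. g (z + F m z *\<^sub>R X m) \<partial>lborel)"
        by (rule IH[rule_format]) measurable
      also have "\<dots> = (\<integral>\<^sup>+y. g y \<partial>lborel)"
        by (rule nn_integral_shear) (use F_add[OF mj mj] in auto)
      finally show "(\<integral>\<^sup>+y. g (S m y) \<partial>lborel) = (\<integral>\<^sup>+y. g y \<partial>lborel)" .
    qed
  qed (use DIM_ge_1 in auto)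
  moreover have "S 1 y = x \<odot> y" for y
  proof -
    have "(\<Sum>i\<in>{1..DIM('a)}. F i y *\<^sub>R X i) = x \<odot> y - y"
      unfolding F_def scaleR_diff_left sum_subtractf expand[symmetric] ..
    then show ?thesis by (simp only: S_def) simp
  qed
  ultimately show ?thesis using g by simp
qed

section \<open>Test functions in coordinates\<close>

definition tests :: "('a \<Rightarrow> real) set" where
  "tests = {u. smooth_on UNIV u \<and> bounded {x. u x \<noteq> 0}}"

lemma tests_linear:
  assumes "u \<in> tests" "v \<in> tests" shows "(\<lambda>x. a * u x + b * v x) \<in> tests"
proof -
  have sm: "smooth_on UNIV (\<lambda>x. a *\<^sub>R u x + b *\<^sub>R v x)"
    using assms unfolding tests_def by (intro smooth_on_add smooth_on_scaleR smooth_on_const open_UNIV) auto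
  have "bounded ({x. u x \<noteq> 0} \<union> {x. v x \<noteq> 0})" using assms by (simp add: tests_def)
  then have "bounded {x. a * u x + b * v x \<noteq> 0}" by (rule bounded_subset) auto
  then show ?thesis using sm by (simp add: tests_def)
qed

text \<open>The continuous left inverse \<open>g\<close> maps the compact support of
  \<open>u\<close> to a compact set that contains the support of the composite.\<close>

lemma tests_compose:
  assumes u: "u \<in> tests" and f: "smooth_on UNIV f" and g: "continuous_on UNIV g" "\<And>x. g (f x) = x"
  shows "(\<lambda>x. u (f x)) \<in> tests"
proof -
  have "smooth_on UNIV (\<lambda>x. u (f x))"
    using u smooth_on_compose[OF open_UNIV open_UNIV _ f, of u] by (simp add: tests_def)
  moreover have "compact (g ` closure {x. u x \<noteq> 0})"
    using u by (intro compact_continuous_image continuous_on_subset[OF g(1)]) (auto simp: tests_def compact_closure)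
  then have "bounded (g ` closure {x. u x \<noteq> 0})" by (rule compact_imp_bounded)
  then have "bounded {x. u (f x) \<noteq> 0}"
  proof (rule bounded_subset, intro subsetI)
    fix x assume "x \<in> {x. u (f x) \<noteq> 0}"
    then have "f x \<in> closure {x. u x \<noteq> 0}" using closure_subset[of "{x. u x \<noteq> 0}"] by auto
    then show "x \<in> g ` closure {x. u x \<noteq> 0}" by (intro image_eqI[of _ _ "f x"]) (simp_all add: g(2))
  qed
  ultimately show ?thesis by (simp add: tests_def)
qed

lemma tests_dil: assumes u: "u \<in> tests" and l: "0 < l" shows "(\<lambda>x. u (dil l x)) \<in> tests"
proof (rule tests_compose[OF u, of _ "dil (1 / l)"])
  show "smooth_on UNIV (dil l)" by (rule smooth_on_linear[OF dil_linear[OF l]])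
  show "continuous_on UNIV (dil (1 / l))" using l by (intro smooth_on_continuous smooth_on_linear dil_linear) simp
  show "dil (1 / l) (dil l x) = x" for x using l by (simp add: dil_dil dil_1)
qed

lemma tests_nonzero: "\<exists>u\<in>tests. \<exists>x. u x \<noteq> 0"
  using smooth_bump[where 'a = 'a] by (auto simp: tests_def)

end

locale homogeneous_space = graded_group dil X w star
  for dil :: "real \<Rightarrow> 'a::euclidean_space \<Rightarrow> 'a" and X :: "nat \<Rightarrow> 'a" and w :: "nat \<Rightarrow> real"
    and star :: "'a \<Rightarrow> 'a \<Rightarrow> 'a" (infixl "\<odot>" 70) +
  fixes N :: "'a \<Rightarrow> real" and s :: real
  assumes star_assoc: "x \<odot> y \<odot> z = x \<odot> (y \<odot> z)" and star_0_right [simp]: "x \<odot> 0 = x"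
    and star_minus_right [simp]: "x \<odot> - x = 0" and star_minus_left [simp]: "- x \<odot> x = 0"
    and continuous_N: "continuous_on UNIV N"
    and N_nonneg [simp]: "0 \<le> N x" and N_eq_0_iff [simp]: "N x = 0 \<longleftrightarrow> x = 0"
    and N_minus [simp]: "N (- x) = N x"
    and N_dil: "0 < l \<Longrightarrow> N (dil l x) = l * N x"
    and N_star: "N (x \<odot> y) \<le> N x + N y"
    and s: "0 < s" "s < 1" "2 * s < (\<Sum>j\<in>{1..DIM('a)}. w j)"
begin

lemma tests_star: assumes u: "u \<in> tests" shows "(\<lambda>x. u (z \<odot> x)) \<in> tests"
  by (rule tests_compose[OF u smooth_on_translation smooth_on_continuous[OF smooth_on_translation[of "- z"]]])
    (simp add: star_assoc[symmetric])

text \<open>Points close in the left-invariant distance differ by a small right factor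
  \<open>z\<close>. For \<open>N z < m\<close> the Euclidean norm of \<open>z\<close> is at most a
  multiple of \<open>N z\<close>, and the smooth function
  \<open>(y, z) \<mapsto> u (y \<odot> z)\<close> is Lipschitz on bounded sets; for larger
  \<open>N z\<close> boundedness of \<open>u\<close> suffices.\<close>

lemma tests_Lipschitz:
  assumes u: "u \<in> tests" shows "\<exists>C. \<forall>x y. \<bar>u x - u y\<bar> \<le> C * N (- y \<odot> x)"
proof -
  obtain m C0 where m: "0 < m" "0 < C0" and C0: "\<And>v. N v < m \<Longrightarrow> norm v \<le> C0 * N v"
  proof (rule homogeneous_function_bounds[OF continuous_N N_nonneg N_eq_0_iff N_dil])
    fix m C assume "0 < m" "0 < C" "\<And>v. N v < m \<Longrightarrow> norm v \<le> C * N v"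
    then show thesis by (rule that)
  qed assumption
  have sm: "smooth_on UNIV u" and bd: "bounded {x. u x \<noteq> 0}" using u by (auto simp: tests_def)
  define A where "A = closure {x. u x \<noteq> 0}"
  have A: "compact A" using bd by (simp add: A_def compact_closure)
  have uA: "y \<in> A" if "u y \<noteq> 0" for y unfolding A_def by (rule subsetD[OF closure_subset]) (simp add: that)
  have "bounded (u ` A)"
    by (rule compact_imp_bounded[OF compact_continuous_image[OF continuous_on_subset[OF smooth_on_continuous[OF sm] subset_UNIV] A]])
  then obtain M where "\<forall>y\<in>u ` A. norm y \<le> M" unfolding bounded_iff ..
  then have M0: "\<bar>u y\<bar> \<le> M" if "y \<in> A" for y using that by simp
  have M: "\<bar>u y\<bar> \<le> max 0 M" for y using M0[of y] uA[of y] by (cases "u y = 0") auto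
  \<comment> \<open>Recovers \<open>y\<close> from \<open>y \<odot> z\<close> and \<open>z\<close>;
    this confines \<open>y\<close> to a bounded set when only \<open>y \<odot> z\<close> lies in the
    support.\<close>
  define f where "f p = fst p \<odot> - snd p" for p :: "'a \<times> 'a"
  have "smooth_on UNIV f" unfolding f_def
    by (rule smooth_on_star[OF open_UNIV smooth_on_fst smooth_on_linear]) (simp add: linear_iff)
  then have "bounded (f ` (A \<times> cball 0 (C0 * m)))"
    by (intro compact_imp_bounded[OF compact_continuous_image[OF continuous_on_subset[OF smooth_on_continuous subset_UNIV] compact_Times[OF A compact_cball]]])
  then have "bounded (A \<union> f ` (A \<times> cball 0 (C0 * m)))" using A by (simp add: compact_imp_bounded)
  then obtain R where "\<forall>y\<in>A \<union> f ` (A \<times> cball 0 (C0 * m)). norm y \<le> R" unfolding bounded_iff ..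
  then have R: "norm y \<le> R" if "y \<in> A \<or> y \<in> f ` (A \<times> cball 0 (C0 * m))" for y using that by (simp only: Un_iff)
  have us: "smooth_on UNIV (\<lambda>p. u (fst p \<odot> snd p))"
    by (rule smooth_on_compose[OF open_UNIV open_UNIV _ smooth_star sm]) (rule subset_UNIV)
  obtain L where L: "0 \<le> L" "\<And>p q. p \<in> cball 0 (R + C0 * m) \<Longrightarrow> q \<in> cball 0 (R + C0 * m) \<Longrightarrow>
      \<bar>u (fst p \<odot> snd p) - u (fst q \<odot> snd q)\<bar> \<le> L * norm (p - q)"
  proof (rule smooth_Lipschitz_cball[OF us, of "R + C0 * m"])
    fix L assume "0 \<le> L" "\<And>p q. p \<in> cball 0 (R + C0 * m) \<Longrightarrow> q \<in> cball 0 (R + C0 * m) \<Longrightarrow>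
      \<bar>u (fst p \<odot> snd p) - u (fst q \<odot> snd q)\<bar> \<le> L * norm (p - q)"
    then show thesis by (rule that)
  qed
  have key: "\<bar>u (y \<odot> z) - u y\<bar> \<le> (L * C0 + 2 * max 0 M / m) * N z" for y z
  proof (cases "N z < m")
    case True
    have nz: "norm z \<le> C0 * N z" using C0 True .
    also have "\<dots> \<le> C0 * m" using True m by simp
    finally have z: "norm z \<le> C0 * m" .
    show ?thesis
    proof (cases "u y = 0 \<and> u (y \<odot> z) = 0")
      case True
      then show ?thesis using L m by simp
    next
      case False
      have "norm y \<le> R"
      proof (cases "u y = 0")
        case True
        then have "y \<odot> z \<in> A" using False uA by blast
        moreover have "y = f (y \<odot> z, z)" by (simp add: f_def star_assoc)
        ultimately have "y \<in> f ` (A \<times> cball 0 (C0 * m))" using z by (intro image_eqI) auto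
        then show ?thesis using R[of y] by (simp only: simp_thms)
      qed (use R[of y] uA[of y] in simp)
      have C0m: "0 \<le> C0 * m" using m by simp
      have "norm (y, z) \<le> R + C0 * m" "norm (y, 0::'a) \<le> R + C0 * m"
        using norm_Pair_le[of y z] norm_Pair_le[of y "0::'a"] \<open>norm y \<le> R\<close> z C0m by auto
      then have "\<bar>u (y \<odot> z) - u y\<bar> \<le> L * norm z"
        using L(2)[of "(y, z)" "(y, 0)"] by (simp add: norm_Pair)
      also have "\<dots> \<le> L * (C0 * N z)" using nz L by (intro mult_left_mono)
      also have "\<dots> \<le> (L * C0 + 2 * max 0 M / m) * N z" using m by (simp add: distrib_right)
      finally show ?thesis .
    qed
  next
    case False
    have "\<bar>u (y \<odot> z) - u y\<bar> \<le> 2 * max 0 M" using M[of y] M[of "y \<odot> z"] by linarith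
    also have "\<dots> \<le> (2 * max 0 M / m) * N z" using False m by (simp add: field_simps mult_right_mono)
    also have "\<dots> \<le> (L * C0 + 2 * max 0 M / m) * N z" using L m by (simp add: distrib_right)
    finally show ?thesis .
  qed
  have "y \<odot> (- y \<odot> x) = x" for x y by (simp add: star_assoc[symmetric])
  then have "\<bar>u x - u y\<bar> \<le> (L * C0 + 2 * max 0 M / m) * N (- y \<odot> x)" for x y
    using key[of y "- y \<odot> x"] by simp
  then show ?thesis by (intro exI allI)
qed

sublocale model: homogeneous_model_test star dil N "\<Sum>j\<in>{1..DIM('a)}. w j" s tests
proof
  show "continuous_on UNIV (\<lambda>p. fst p \<odot> snd p)" by (rule smooth_on_continuous[OF smooth_star])
  show "continuous_on UNIV (dil l)" if "0 < l" for l
    by (rule smooth_on_continuous[OF smooth_on_linear[OF dil_linear[OF that]]])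
  show "bounded {x. N x < r}" for r
    by (rule homogeneous_function_bounds[OF continuous_N N_nonneg N_eq_0_iff N_dil])
  show "continuous_on UNIV u" if "u \<in> tests" for u using that by (auto simp: tests_def smooth_on_continuous)
  show "bounded {x. u x \<noteq> 0}" if "u \<in> tests" for u using that by (auto simp: tests_def)
qed (fact star_assoc star_0_left star_0_right star_minus_right star_minus_left dil_star dil_dil dil_1
    nn_integral_star nn_integral_dil continuous_N N_nonneg N_eq_0_iff N_minus N_dil N_star s
    tests_linear tests_star tests_dil tests_Lipschitz tests_nonzero)+

end

section \<open>Smooth maps into a manifold\<close>

text \<open>Charts as homeomorphisms onto open sets, without compatibility. This part of
  \<open>smooth_atlas\<close> passes to products and suffices for composing smooth maps.\<close>

definition charts_ok :: "('m::topological_space, 'a::euclidean_space) charts \<Rightarrow> bool" where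
  "charts_ok A \<longleftrightarrow> (\<forall>(U, \<phi>)\<in>A. open U \<and> inj_on \<phi> U \<and> continuous_on U \<phi> \<and> (\<forall>V. open V \<longrightarrow> V \<subseteq> U \<longrightarrow> open (\<phi> ` V))) \<and>
     (\<Union>(U, \<phi>)\<in>A. U) = UNIV"

lemma charts_okD:
  assumes "charts_ok A" "(U, \<phi>) \<in> A"
  shows "open U" "inj_on \<phi> U" "continuous_on U \<phi>" "\<And>V. open V \<Longrightarrow> V \<subseteq> U \<Longrightarrow> open (\<phi> ` V)"
  using assms unfolding charts_ok_def by auto

lemma charts_ok_cover: assumes "charts_ok A" obtains U \<phi> where "(U, \<phi>) \<in> A" "x \<in> U"
proof -
  have "x \<in> (\<Union>(U, \<phi>)\<in>A. U)" using assms unfolding charts_ok_def by simp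
  then show thesis using that by auto
qed

lemma smooth_atlas_charts_ok: assumes "smooth_atlas A" shows "charts_ok A"
  unfolding charts_ok_def
proof (intro conjI)
  show "(\<Union>(U, \<phi>)\<in>A. U) = UNIV" using assms by (simp add: smooth_atlas_def)
  show "\<forall>(U, \<phi>)\<in>A. open U \<and> inj_on \<phi> U \<and> continuous_on U \<phi> \<and> (\<forall>V. open V \<longrightarrow> V \<subseteq> U \<longrightarrow> open (\<phi> ` V))"
  proof (clarify, intro conjI allI impI)
    fix U \<phi> assume "(U, \<phi>) \<in> A"
    then have "open U \<and> open (\<phi> ` U) \<and> (\<exists>\<psi>. homeomorphism U (\<phi> ` U) \<phi> \<psi>)"
      using assms unfolding smooth_atlas_def by auto
    then obtain \<psi> where U: "open U" "open (\<phi> ` U)" and h: "homeomorphism U (\<phi> ` U) \<phi> \<psi>" by blast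
    show "open U" by fact
    show "inj_on \<phi> U" using homeomorphism_apply1[OF h] by (rule inj_on_inverseI)
    show "continuous_on U \<phi>" by (rule homeomorphism_cont1[OF h])
    fix V assume V: "open V" "V \<subseteq> U"
    have "openin (top_of_set (\<phi> ` U)) (\<phi> ` V)"
      by (rule homeomorphism_imp_open_map[OF h]) (use V U in \<open>simp add: openin_open_eq\<close>)
    then show "open (\<phi> ` V)" using U(2) by (simp add: openin_open_eq)
  qed
qed

lemma flat_charts_ok: "charts_ok flat_atlas"
  by (auto simp: charts_ok_def flat_atlas_def)

lemma prod_charts_ok:
  assumes A: "charts_ok A" and B: "charts_ok B" shows "charts_ok (prod_atlas A B)"
  unfolding charts_ok_def
proof (intro conjI)
  show "(\<Union>(U, \<phi>)\<in>prod_atlas A B. U) = UNIV"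
  proof (rule Set.set_eqI, rule iffI)
    fix x :: "'a \<times> 'c"
    obtain U \<phi> where U: "(U, \<phi>) \<in> A" "fst x \<in> U" by (rule charts_ok_cover[OF A])
    obtain V \<psi> where V: "(V, \<psi>) \<in> B" "snd x \<in> V" by (rule charts_ok_cover[OF B])
    have "(U \<times> V, map_prod \<phi> \<psi>) \<in> prod_atlas A B" using U V by (auto simp: prod_atlas_def)
    moreover have "x \<in> U \<times> V" using U V by (simp add: mem_Times_iff)
    ultimately show "x \<in> (\<Union>(U, \<phi>)\<in>prod_atlas A B. U)" by blast
  qed simp
  show "\<forall>(W, \<theta>)\<in>prod_atlas A B. open W \<and> inj_on \<theta> W \<and> continuous_on W \<theta> \<and> (\<forall>P. open P \<longrightarrow> P \<subseteq> W \<longrightarrow> open (\<theta> ` P))"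
  proof (clarify, intro conjI allI impI)
    fix W \<theta> assume "(W, \<theta>) \<in> prod_atlas A B"
    then obtain U \<phi> V \<psi> where W: "W = U \<times> V" "\<theta> = map_prod \<phi> \<psi>" and U: "(U, \<phi>) \<in> A" and V: "(V, \<psi>) \<in> B"
      by (auto simp: prod_atlas_def)
    note U = charts_okD[OF A U] and V = charts_okD[OF B V]
    show "open W" unfolding W using U(1) V(1) by (rule open_Times)
    show "inj_on \<theta> W" unfolding W using U(2) V(2) by (rule map_prod_inj_on)
    have "continuous_on (U \<times> V) (\<lambda>x. (\<phi> (fst x), \<psi> (snd x)))"
      by (intro continuous_on_Pair continuous_on_compose2[OF U(3)] continuous_on_compose2[OF V(3)] continuous_intros) auto
    then show "continuous_on W \<theta>" unfolding W by (simp add: map_prod_def case_prod_unfold)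
    fix P assume P: "open P" "P \<subseteq> W"
    have "\<exists>T. open T \<and> y \<in> T \<and> T \<subseteq> \<theta> ` P" if "y \<in> \<theta> ` P" for y
    proof -
      from that obtain x where x: "x \<in> P" "y = \<theta> x" by blast
      obtain C D where CD: "open C" "open D" "x \<in> C \<times> D" "C \<times> D \<subseteq> P" by (rule open_prod_elim[OF P(1) x(1)])
      then have "C \<times> D \<subseteq> U \<times> V" using P W by blast
      then have "C \<subseteq> U" "D \<subseteq> V" using CD(3) by auto
      then have "open (\<phi> ` C \<times> \<psi> ` D)" using U(4) V(4) CD by (intro open_Times) auto
      moreover have "\<phi> ` C \<times> \<psi> ` D = \<theta> ` (C \<times> D)" unfolding W by (rule map_prod_surj_on[OF refl refl, symmetric])
      ultimately show ?thesis using x CD by (intro exI[of _ "\<theta> ` (C \<times> D)"]) auto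
    qed
    then show "open (\<theta> ` P)" by (subst open_subopen) blast
  qed
qed

text \<open>Involves charts on the target only, so it composes without changes of coordinates on the
  source.\<close>

definition chart_smooth :: "('m::topological_space, 'a::euclidean_space) charts \<Rightarrow> 'b::euclidean_space set \<Rightarrow> ('b \<Rightarrow> 'm) \<Rightarrow> bool" where
  "chart_smooth A S f \<longleftrightarrow> continuous_on S f \<and> (\<forall>(U, \<phi>)\<in>A. smooth_on (S \<inter> f -` U) (\<lambda>x. \<phi> (f x)))"

lemma chart_smoothD:
  assumes "chart_smooth A S f" shows "continuous_on S f" "(U, \<phi>) \<in> A \<Longrightarrow> smooth_on (S \<inter> f -` U) (\<lambda>x. \<phi> (f x))"
  using assms unfolding chart_smooth_def by auto

lemma chart_smooth_flat: "chart_smooth flat_atlas S f \<longleftrightarrow> smooth_on S f"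
  by (auto simp: chart_smooth_def flat_atlas_def smooth_on_continuous)

lemma open_vimage_on: "continuous_on S f \<Longrightarrow> open S \<Longrightarrow> open B \<Longrightarrow> open (S \<inter> f -` B)"
  using continuous_open_preimage by blast

text \<open>Smooth maps in the sense of the definition are those preserving the smooth
  maps from open subsets of Euclidean spaces.\<close>

lemma chart_smooth_compose:
  assumes A: "charts_ok A" and B: "charts_ok B" and S: "open S" and f: "chart_smooth A S f" and h: "smooth_map_on A B UNIV h"
  shows "chart_smooth B S (\<lambda>x. h (f x))"
proof -
  have ch: "continuous_on UNIV h" using h by (simp add: smooth_map_on_def)
  have cont: "continuous_on S (\<lambda>x. h (f x))"
    by (rule continuous_on_compose2[OF ch chart_smoothD(1)[OF f] subset_UNIV])
  have "smooth_on (S \<inter> (\<lambda>x. h (f x)) -` V) (\<lambda>x. \<psi> (h (f x)))" if V: "(V, \<psi>) \<in> B" for V \<psi>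
  proof (rule smooth_on_local)
    fix x assume x: "x \<in> S \<inter> (\<lambda>x. h (f x)) -` V"
    obtain U \<phi> where U: "(U, \<phi>) \<in> A" "f x \<in> U" by (rule charts_ok_cover[OF A])
    define T where "T = (S \<inter> (\<lambda>x. h (f x)) -` V) \<inter> (S \<inter> f -` U)"
    have T: "open T"
      unfolding T_def by (intro open_Int open_vimage_on cont chart_smoothD(1)[OF f] S charts_okD(1)[OF B V] charts_okD(1)[OF A U(1)])
    have sm: "smooth_on (\<phi> ` (U \<inter> UNIV \<inter> h -` V)) (\<psi> \<circ> h \<circ> inv_into U \<phi>)"
      using h U(1) V unfolding smooth_map_on_def by blast
    have op: "open (\<phi> ` (U \<inter> UNIV \<inter> h -` V))"
    proof (rule charts_okD(4)[OF A U(1)])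
      have "open (UNIV \<inter> h -` V)" by (rule open_vimage_on[OF ch open_UNIV charts_okD(1)[OF B V]])
      then show "open (U \<inter> UNIV \<inter> h -` V)" using charts_okD(1)[OF A U(1)] by (simp add: open_Int)
    qed auto
    have "smooth_on T (\<lambda>x. (\<psi> \<circ> h \<circ> inv_into U \<phi>) (\<phi> (f x)))"
    proof (rule smooth_on_compose[OF T op _ _ sm])
      show "smooth_on T (\<lambda>x. \<phi> (f x))"
        by (rule smooth_on_subset[OF chart_smoothD(2)[OF f U(1)]]) (auto simp: T_def)
    qed (auto simp: T_def)
    then have "smooth_on T (\<lambda>x. \<psi> (h (f x)))"
      by (rule smooth_on_cong[OF T, rotated])
        (auto simp: T_def inv_into_f_f[OF charts_okD(2)[OF A U(1)]])
    then show "\<exists>T. open T \<and> x \<in> T \<and> smooth_on T (\<lambda>x. \<psi> (h (f x)))"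
      using T x U by (intro exI[of _ T]) (auto simp: T_def)
  qed
  with cont show ?thesis unfolding chart_smooth_def by blast
qed

lemma chart_smooth_Pair:
  assumes A: "charts_ok A" and B: "charts_ok B" and S: "open S" and f: "chart_smooth A S f" and g: "chart_smooth B S g"
  shows "chart_smooth (prod_atlas A B) S (\<lambda>x. (f x, g x))"
  unfolding chart_smooth_def
proof (intro conjI ballI, goal_cases)
  case 1
  show ?case by (intro continuous_on_Pair chart_smoothD(1)[OF f] chart_smoothD(1)[OF g])
next
  case (2 W)
  then obtain U \<phi> V \<psi> where W: "W = (U \<times> V, map_prod \<phi> \<psi>)" and U: "(U, \<phi>) \<in> A" and V: "(V, \<psi>) \<in> B"
    by (auto simp: prod_atlas_def)
  let ?T = "(S \<inter> f -` U) \<inter> (S \<inter> g -` V)"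
  have T: "open ?T"
    by (intro open_Int open_vimage_on chart_smoothD(1)[OF f] chart_smoothD(1)[OF g] S charts_okD(1)[OF B V] charts_okD(1)[OF A U])
  have "smooth_on ?T (\<lambda>x. (\<phi> (f x), \<psi> (g x)))"
    by (intro smooth_on_Pair T smooth_on_subset[OF chart_smoothD(2)[OF f U]] smooth_on_subset[OF chart_smoothD(2)[OF g V]]) auto
  moreover have "S \<inter> (\<lambda>x. (f x, g x)) -` (U \<times> V) = ?T" by auto
  ultimately show ?case unfolding W by simp
qed

text \<open>Here the smoothness of the transition maps enters.\<close>

lemma chart_smooth_inv_chart:
  assumes A: "smooth_atlas A" and U: "(U, \<phi>) \<in> A"
  shows "chart_smooth A (\<phi> ` U) (inv_into U \<phi>)"
proof -
  note ok = charts_okD[OF smooth_atlas_charts_ok[OF A] U]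
  have inv: "inv_into U \<phi> (\<phi> x) = x" if "x \<in> U" for x using inv_into_f_f[OF ok(2) that] .
  have op: "open (\<phi> ` U)" using ok(4)[OF ok(1) order_refl] .
  have pre: "\<phi> ` U \<inter> inv_into U \<phi> -` V = \<phi> ` (U \<inter> V)" for V
  proof (rule Set.set_eqI, rule iffI)
    fix y assume "y \<in> \<phi> ` U \<inter> inv_into U \<phi> -` V"
    then obtain x where "x \<in> U" "y = \<phi> x" "inv_into U \<phi> y \<in> V" by blast
    then show "y \<in> \<phi> ` (U \<inter> V)" using inv by (intro image_eqI[of _ _ x]) auto
  qed (use inv in auto)
  have "continuous_on (\<phi> ` U) (inv_into U \<phi>)"
    unfolding continuous_on_open_vimage[OF op]
  proof (intro allI impI)
    fix B :: "'a set" assume "open B"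
    then have "open (\<phi> ` (U \<inter> B))" by (intro ok(4) open_Int ok(1)) auto
    moreover have "inv_into U \<phi> -` B \<inter> \<phi> ` U = \<phi> ` (U \<inter> B)" using pre[of B] by blast
    ultimately show "open (inv_into U \<phi> -` B \<inter> \<phi> ` U)" by simp
  qed
  moreover have "smooth_on (\<phi> ` U \<inter> inv_into U \<phi> -` V) (\<lambda>x. \<psi> (inv_into U \<phi> x))" if V: "(V, \<psi>) \<in> A" for V \<psi>
  proof -
    have "smooth_on (\<phi> ` (U \<inter> V)) (\<psi> \<circ> inv_into U \<phi>)"
      using A U V unfolding smooth_atlas_def by fast
    then show ?thesis unfolding pre o_def .
  qed
  ultimately show ?thesis unfolding chart_smooth_def by blast
qed

lemma smooth_map_on_flat_target:
  fixes u :: "'m::topological_space \<Rightarrow> 'b::euclidean_space"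
  shows "smooth_map_on A flat_atlas UNIV u \<longleftrightarrow> continuous_on UNIV u \<and> (\<forall>(U, \<phi>)\<in>A. smooth_on (\<phi> ` U) (\<lambda>x. u (inv_into U \<phi> x)))"
  by (simp add: smooth_map_on_def flat_atlas_def o_def)

section \<open>Homogeneous groups\<close>

lemma chart_smooth_const: "chart_smooth A S (\<lambda>x. c)"
  by (auto simp: chart_smooth_def smooth_on_const)

locale homogeneous_lie_group =
  fixes G :: "('g::{t2_space, second_countable_topology}, 'a::euclidean_space) hgroup"
  assumes homogeneous_group: "homogeneous_group G"
begin

lemma G_parts: "lie_group G" "connected (UNIV :: 'g set)" "simply_connected (UNIV :: 'g set)" "exponential_map G"
  "dilations G" "homogeneous_norm G"
  using homogeneous_group by (simp_all add: homogeneous_group_def)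

lemma atlas: "smooth_atlas (atlas G)"
  and smooth_mult: "smooth_map_on (prod_atlas (atlas G) (atlas G)) (atlas G) UNIV (\<lambda>(g, h). g \<otimes>\<^bsub>G\<^esub> h)"
  and smooth_inv: "smooth_map_on (atlas G) (atlas G) UNIV (\<lambda>g. inv\<^bsub>G\<^esub> g)"
  using G_parts(1) by (simp_all add: lie_group_def)

lemma group_laws: "x \<otimes>\<^bsub>G\<^esub> y \<otimes>\<^bsub>G\<^esub> z = x \<otimes>\<^bsub>G\<^esub> (y \<otimes>\<^bsub>G\<^esub> z)" "\<one>\<^bsub>G\<^esub> \<otimes>\<^bsub>G\<^esub> x = x" "x \<otimes>\<^bsub>G\<^esub> \<one>\<^bsub>G\<^esub> = x"
  "inv\<^bsub>G\<^esub> x \<otimes>\<^bsub>G\<^esub> x = \<one>\<^bsub>G\<^esub>" "x \<otimes>\<^bsub>G\<^esub> inv\<^bsub>G\<^esub> x = \<one>\<^bsub>G\<^esub>"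
proof -
  have "group G" and c: "carrier G = UNIV" using G_parts(1) by (simp_all add: lie_group_def)
  then interpret G: group G by simp
  show "x \<otimes>\<^bsub>G\<^esub> y \<otimes>\<^bsub>G\<^esub> z = x \<otimes>\<^bsub>G\<^esub> (y \<otimes>\<^bsub>G\<^esub> z)" by (rule G.m_assoc) (simp_all add: c)
  show "\<one>\<^bsub>G\<^esub> \<otimes>\<^bsub>G\<^esub> x = x" "x \<otimes>\<^bsub>G\<^esub> \<one>\<^bsub>G\<^esub> = x" "inv\<^bsub>G\<^esub> x \<otimes>\<^bsub>G\<^esub> x = \<one>\<^bsub>G\<^esub>" "x \<otimes>\<^bsub>G\<^esub> inv\<^bsub>G\<^esub> x = \<one>\<^bsub>G\<^esub>"
    using G.l_one[of x] G.r_one[of x] G.l_inv[of x] G.r_inv[of x] by (simp_all add: c)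
qed

lemmas atlas_ok = smooth_atlas_charts_ok[OF atlas]

lemma continuous_mult: "continuous_on UNIV (\<lambda>p. fst p \<otimes>\<^bsub>G\<^esub> snd p)"
  using smooth_mult by (simp add: smooth_map_on_def case_prod_unfold)

lemma continuous_inv: "continuous_on UNIV (\<lambda>g. inv\<^bsub>G\<^esub> g)"
  using smooth_inv by (simp add: smooth_map_on_def)

lemma chart_smooth_mult:
  assumes "open S" "chart_smooth (atlas G) S f" "chart_smooth (atlas G) S h"
  shows "chart_smooth (atlas G) S (\<lambda>x. f x \<otimes>\<^bsub>G\<^esub> h x)"
  using chart_smooth_compose[OF prod_charts_ok[OF atlas_ok atlas_ok] atlas_ok assms(1)
      chart_smooth_Pair[OF atlas_ok atlas_ok assms] smooth_mult] by simp

lemma smooth_lexp: "smooth_map_on flat_atlas (atlas G) UNIV (lexp G)"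
  and lexp_add: "lexp G ((s + t) *\<^sub>R x) = lexp G (s *\<^sub>R x) \<otimes>\<^bsub>G\<^esub> lexp G (t *\<^sub>R x)"
  and lexp_derivative: "(U, \<phi>) \<in> atlas G \<Longrightarrow> \<one>\<^bsub>G\<^esub> \<in> U \<Longrightarrow> \<exists>D. (\<phi> \<circ> lexp G has_derivative D) (at 0) \<and> bij D"
  using G_parts(4) by (auto simp: exponential_map_def)

lemma chart_smooth_lexp:
  assumes "open S" "smooth_on S f" shows "chart_smooth (atlas G) S (\<lambda>x. lexp G (f x))"
  by (rule chart_smooth_compose[OF flat_charts_ok atlas_ok assms(1) _ smooth_lexp])
    (simp add: chart_smooth_flat assms(2))

lemma continuous_lexp: "continuous_on UNIV (lexp G)"
  using smooth_lexp by (simp add: smooth_map_on_def)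

lemma lexp_0: "lexp G 0 = \<one>\<^bsub>G\<^esub>"
proof -
  have "lexp G 0 \<otimes>\<^bsub>G\<^esub> lexp G 0 = lexp G 0" using lexp_add[of 0 0 0] by simp
  then have "inv\<^bsub>G\<^esub> lexp G 0 \<otimes>\<^bsub>G\<^esub> (lexp G 0 \<otimes>\<^bsub>G\<^esub> lexp G 0) = \<one>\<^bsub>G\<^esub>" by (simp only: group_laws(4))
  then show ?thesis by (simp only: group_laws(1)[symmetric] group_laws(2,4))
qed

text \<open>In a chart the differential of the exponential map at 0 is bijective, so the inverse
  function theorem provides a local logarithm.\<close>

lemma local_logarithm:
  obtains U \<phi> W V \<psi> where "(U, \<phi>) \<in> atlas G" "lexp G ` W \<subseteq> U" "open W" "0 \<in> W" "open V"
    "homeomorphism W V (\<lambda>v. \<phi> (lexp G v)) \<psi>" "smooth_on V \<psi>"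
proof -
  obtain U \<phi> where U: "(U, \<phi>) \<in> atlas G" "\<one>\<^bsub>G\<^esub> \<in> U" by (rule charts_ok_cover[OF atlas_ok])
  obtain D where D: "(\<phi> \<circ> lexp G has_derivative D) (at 0)" "bij D" using lexp_derivative[OF U] by blast
  define S where "S = UNIV \<inter> lexp G -` U"
  have S: "open S" unfolding S_def by (rule open_vimage_on[OF continuous_lexp open_UNIV charts_okD(1)[OF atlas_ok U(1)]])
  have S0: "0 \<in> S" using U(2) by (simp add: S_def lexp_0)
  have sm: "smooth_on S (\<lambda>v. \<phi> (lexp G v))"
    unfolding S_def by (rule chart_smoothD(2)[OF chart_smooth_lexp[OF open_UNIV smooth_on_id] U(1)])
  obtain W V \<psi> where W: "open W" "W \<subseteq> S" "0 \<in> W" "open V" "homeomorphism W V (\<lambda>v. \<phi> (lexp G v)) \<psi>" "smooth_on V \<psi>"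
    by (rule smooth_inverse_function[OF S sm S0 D[unfolded o_def]])
  have "lexp G ` W \<subseteq> U" using W(2) by (auto simp: S_def)
  then show thesis using that U(1) W by blast
qed

lemma graded_basis:
  obtains X where "graded_space (dil G) X (weight G)"
proof -
  have dl: "linear (dil G l)" if "0 < l" for l
    using G_parts(5) that by (simp add: dilations_def lie_algebra_automorphism_def)
  obtain X :: "nat \<Rightarrow> 'a" where X: "inj_on X {1..DIM('a)}" "independent (X ` {1..DIM('a)})" "span (X ` {1..DIM('a)}) = UNIV"
      "\<forall>l>0. \<forall>j\<in>{1..DIM('a)}. dil G l (X j) = (l powr weight G j) *\<^sub>R X j"
    using G_parts(5) unfolding dilations_def by blast
  have w: "weight G 1 = 1" "\<forall>i\<in>{1..DIM('a)}. \<forall>j\<in>{1..DIM('a)}. i \<le> j \<longrightarrow> weight G i \<le> weight G j"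
    using G_parts(5) unfolding dilations_def by blast+
  have "graded_space (dil G) X (weight G)"
    by (rule graded_space.intro) (use X w dl in blast)+
  then show thesis by (rule that)
qed

end

locale homogeneous_lie_group_log = homogeneous_lie_group G + graded_space "dil G" X "weight G"
  for G :: "('g::{t2_space, second_countable_topology}, 'a::euclidean_space) hgroup" and X :: "nat \<Rightarrow> 'a" +
  fixes U :: "'g set" and \<phi> :: "'g \<Rightarrow> 'a" and W V :: "'a set" and \<psi> :: "'a \<Rightarrow> 'a"
  assumes U: "(U, \<phi>) \<in> atlas G" "lexp G ` W \<subseteq> U"
    and W: "open W" "0 \<in> W" and V: "open V"
    and homeo: "homeomorphism W V (\<lambda>v. \<phi> (lexp G v)) \<psi>" and smooth_psi: "smooth_on V \<psi>"
begin

definition L :: "'g \<Rightarrow> 'a" where "L h = \<psi> (\<phi> h)"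

lemma L_lexp: "v \<in> W \<Longrightarrow> L (lexp G v) = v"
  unfolding L_def by (rule homeomorphism_apply1[OF homeo])

lemma lexp_W: "lexp G ` W = U \<inter> \<phi> -` V"
proof (rule subset_antisym)
  show "lexp G ` W \<subseteq> U \<inter> \<phi> -` V"
    using U(2) homeomorphism_image1[OF homeo] by blast
  show "U \<inter> \<phi> -` V \<subseteq> lexp G ` W"
  proof
    fix h assume h: "h \<in> U \<inter> \<phi> -` V"
    then have "\<phi> h \<in> (\<lambda>v. \<phi> (lexp G v)) ` W" using homeomorphism_image1[OF homeo] by simp
    then obtain v where v: "v \<in> W" "\<phi> h = \<phi> (lexp G v)" by blast
    then have "h = lexp G v"
      using h U by (intro inj_onD[OF charts_okD(2)[OF atlas_ok U(1)] v(2)]) auto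
    then show "h \<in> lexp G ` W" using v(1) by blast
  qed
qed

lemma open_lexp_W: "open (lexp G ` W)"
  unfolding lexp_W by (rule open_vimage_on[OF charts_okD(3,1)[OF atlas_ok U(1)] V])

lemma continuous_L: "continuous_on (lexp G ` W) L"
  unfolding L_def lexp_W
  by (rule continuous_on_compose2[OF homeomorphism_cont2[OF homeo]
        continuous_on_subset[OF charts_okD(3)[OF atlas_ok U(1)]]]) auto

lemma smooth_L:
  assumes S: "open S" and h: "chart_smooth (atlas G) S h"
  shows "smooth_on (S \<inter> h -` (lexp G ` W)) (\<lambda>x. L (h x))"
  unfolding L_def
proof (rule smooth_on_compose[OF _ V _ _ smooth_psi])
  show "open (S \<inter> h -` (lexp G ` W))" by (rule open_vimage_on[OF chart_smoothD(1)[OF h] S open_lexp_W])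
  show "smooth_on (S \<inter> h -` (lexp G ` W)) (\<lambda>x. \<phi> (h x))"
    by (rule smooth_on_subset[OF chart_smoothD(2)[OF h U(1)]]) (auto simp: lexp_W)
  show "(\<lambda>x. \<phi> (h x)) ` (S \<inter> h -` (lexp G ` W)) \<subseteq> V" by (auto simp: lexp_W)
qed

sublocale lc: local_exp "mult G" "m_inv G" "one G" "lexp G" W L
proof (rule local_exp.intro)
  show "smooth_on {p. fst p \<in> W \<and> snd p \<in> W \<and> lexp G (fst p) \<otimes>\<^bsub>G\<^esub> lexp G (snd p) \<in> lexp G ` W}
     (\<lambda>p. L (lexp G (fst p) \<otimes>\<^bsub>G\<^esub> lexp G (snd p)))"
    by (rule smooth_on_subset[OF smooth_L[OF open_UNIV chart_smooth_mult[OF open_UNIV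
          chart_smooth_lexp[OF open_UNIV smooth_on_fst] chart_smooth_lexp[OF open_UNIV smooth_on_snd]]]]) auto
qed (fact group_laws continuous_mult continuous_inv continuous_lexp lexp_add W open_lexp_W L_lexp continuous_L)+

text \<open>Makes the automorphism property of the dilations, stated for \<open>bracket\<close>,
  available to the local theory.\<close>

lemma bracket_eq: "bracket G x y = lc.br x y"
  unfolding bracket_def lc.br_def Ad_def lc.Adj_def ..

sublocale ex: dilated_exp "mult G" "m_inv G" "one G" "lexp G" W L "dil G" nn
proof (rule dilated_exp.intro[OF lc.local_exp_axioms], rule dilated_exp_axioms.intro)
  show "dil G l (lc.br v w) = lc.br (dil G l v) (dil G l w)" if "0 < l" for l v w
    using G_parts(5) that unfolding bracket_eq[symmetric] dilations_def lie_algebra_automorphism_def by blast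
qed (fact dil_linear dil_dil dil_1 nn_nonneg nn_scaleR nn_dil nn_nhds continuous_nn)+

lemma bij_lexp: "bij (lexp G)"
  using ex.e_surj[OF G_parts(2)] ex.e_inj_global[OF G_parts(3)] by (rule bijI[rotated])

abbreviation log :: "'g \<Rightarrow> 'a" where "log \<equiv> inv_into UNIV (lexp G)"

lemma log_lexp [simp]: "log (lexp G x) = x" by (rule inv_into_f_f[OF bij_is_inj[OF bij_lexp]]) simp

lemma lexp_log [simp]: "lexp G (log g) = g" using bij_lexp by (intro f_inv_into_f) (simp add: bij_is_surj)

text \<open>Near \<open>g0\<close> the global logarithm is a left translate of the local one, from
  which it inherits continuity and smoothness.\<close>

lemma log_near:
  assumes "inv\<^bsub>G\<^esub> g0 \<otimes>\<^bsub>G\<^esub> g \<in> lexp G ` W"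
  shows "log g = ex.star (log g0) (L (inv\<^bsub>G\<^esub> g0 \<otimes>\<^bsub>G\<^esub> g))"
proof -
  have "lexp G (ex.star (log g0) (L (inv\<^bsub>G\<^esub> g0 \<otimes>\<^bsub>G\<^esub> g))) = g0 \<otimes>\<^bsub>G\<^esub> (inv\<^bsub>G\<^esub> g0 \<otimes>\<^bsub>G\<^esub> g)"
    unfolding ex.e_star lc.e_L[OF assms] by simp
  also have "\<dots> = g" by (rule lc.iv_cancel)
  finally have "log (lexp G (ex.star (log g0) (L (inv\<^bsub>G\<^esub> g0 \<otimes>\<^bsub>G\<^esub> g)))) = log g" by (simp only:)
  then show ?thesis by (simp only: log_lexp)
qed

lemma continuous_log: "continuous_on UNIV log"
  unfolding continuous_on_eq_continuous_at[OF open_UNIV]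
proof
  fix g0 :: 'g
  let ?t = "\<lambda>g. inv\<^bsub>G\<^esub> g0 \<otimes>\<^bsub>G\<^esub> g"
  define T where "T = UNIV \<inter> ?t -` (lexp G ` W)"
  have ct: "continuous_on UNIV ?t" by (rule lc.continuous_on_mul[OF continuous_on_const continuous_on_id])
  have T: "open T" unfolding T_def by (rule open_vimage_on[OF ct open_UNIV open_lexp_W])
  have g0T: "g0 \<in> T" using imageI[OF W(2), of "lexp G"] by (simp add: T_def group_laws lexp_0)
  have "continuous_on T (\<lambda>g. ex.star (log g0) (L (?t g)))"
    by (rule ex.continuous_on_star[OF continuous_on_const continuous_on_compose2[OF continuous_L continuous_on_subset[OF ct subset_UNIV]]])
      (auto simp: T_def)
  then have "continuous_on T log"
    by (rule continuous_on_cong[THEN iffD1, OF refl, rotated]) (simp add: T_def log_near)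
  then show "isCont log g0" using T g0T by (simp add: continuous_on_eq_continuous_at)
qed

lemma smooth_log_inv_chart:
  assumes P: "(P, \<theta>) \<in> atlas G"
  shows "smooth_on (\<theta> ` P) (\<lambda>x. log (inv_into P \<theta> x))"
proof (rule smooth_on_local)
  fix x0 assume x0: "x0 \<in> \<theta> ` P"
  let ?g0 = "inv_into P \<theta> x0"
  let ?t = "\<lambda>x. inv\<^bsub>G\<^esub> ?g0 \<otimes>\<^bsub>G\<^esub> inv_into P \<theta> x"
  define T where "T = \<theta> ` P \<inter> ?t -` (lexp G ` W)"
  have op: "open (\<theta> ` P)" by (rule charts_okD(4)[OF atlas_ok P charts_okD(1)[OF atlas_ok P] order_refl])
  have t: "chart_smooth (atlas G) (\<theta> ` P) ?t"
    by (rule chart_smooth_mult[OF op chart_smooth_const chart_smooth_inv_chart[OF atlas P]])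
  have T: "open T" unfolding T_def by (rule open_vimage_on[OF chart_smoothD(1)[OF t] op open_lexp_W])
  have x0T: "x0 \<in> T" using imageI[OF W(2), of "lexp G"] x0 by (simp add: T_def group_laws lexp_0)
  have "smooth_on T (\<lambda>x. L (?t x))" unfolding T_def by (rule smooth_L[OF op t])
  from smooth_on_compose[OF T open_UNIV subset_UNIV smooth_on_Pair[OF T smooth_on_const[of T "log ?g0"] this] ex.smooth_star]
  have "smooth_on T (\<lambda>x. ex.star (log ?g0) (L (?t x)))" by simp
  then have "smooth_on T (\<lambda>x. log (inv_into P \<theta> x))"
    by (rule smooth_on_cong[OF T, rotated]) (rule log_near[symmetric], simp add: T_def)
  then show "\<exists>T. open T \<and> x0 \<in> T \<and> smooth_on T (\<lambda>x. log (inv_into P \<theta> x))" using T x0T by blast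
qed

end

section \<open>Transfer from exponential coordinates to the group\<close>

lemma Lp_norm_nn_integral:
  assumes "u \<in> borel_measurable M"
  shows "Lp_norm M q u = enn2real (\<integral>\<^sup>+x. ennreal (\<bar>u x\<bar> powr q) \<partial>M) powr (1 / q)"
  unfolding Lp_norm_def using assms by (subst integral_eq_nn_integral) auto

lemma in_Lp_nn_integral:
  "in_Lp M q u \<longleftrightarrow> u \<in> borel_measurable M \<and> (\<integral>\<^sup>+x. ennreal (\<bar>u x\<bar> powr q) \<partial>M) < \<infinity>"
  unfolding in_Lp_def by (auto simp: integrable_iff_bounded)

locale homogeneous_group_sobolev = homogeneous_lie_group_log G X U \<phi> W V \<psi>
  for G :: "('g::{t2_space, second_countable_topology}, 'a::euclidean_space) hgroup" and X :: "nat \<Rightarrow> 'a"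
    and U :: "'g set" and \<phi> :: "'g \<Rightarrow> 'a" and W V :: "'a set" and \<psi> :: "'a \<Rightarrow> 'a" +
  fixes s :: real
  assumes s: "0 < s" "s < 1" "2 * s < hom_dim G"
begin

lemma norm_facts: "continuous_on UNIV (hnorm G)" "0 \<le> hnorm G g" "hnorm G g = 0 \<longleftrightarrow> g = \<one>\<^bsub>G\<^esub>"
  "hnorm G (inv\<^bsub>G\<^esub> g) = hnorm G g" "0 < l \<Longrightarrow> hnorm G (gdil G l g) = l * hnorm G g"
  "hnorm G (g \<otimes>\<^bsub>G\<^esub> h) \<le> hnorm G g + hnorm G h"
  using G_parts(6) by (simp_all add: homogeneous_norm_def)

text \<open>The axioms for \<open>hnorm\<close> pass to coordinates because \<open>lexp G\<close> is
  an isomorphism from \<open>ex.star\<close> to the group product and intertwines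
  \<open>dil G\<close> with \<open>gdil G\<close>.\<close>

sublocale hs: homogeneous_space "dil G" X "weight G" ex.star "\<lambda>x. hnorm G (lexp G x)" s
proof (rule homogeneous_space.intro[OF graded_group.intro], rule graded_space_axioms, rule graded_group_axioms.intro)
  show "homogeneous_space_axioms (dil G) (weight G) ex.star (\<lambda>x. hnorm G (lexp G x)) s"
  proof (rule homogeneous_space_axioms.intro)
    show "continuous_on UNIV (\<lambda>x. hnorm G (lexp G x))"
      by (rule continuous_on_compose2[OF norm_facts(1) continuous_lexp subset_UNIV])
    show "hnorm G (lexp G x) = 0 \<longleftrightarrow> x = 0" for x
      unfolding norm_facts(3) lexp_0[symmetric] by (rule inj_eq[OF bij_is_inj[OF bij_lexp]])
    show "hnorm G (lexp G (- x)) = hnorm G (lexp G x)" for x by (simp only: lc.e_minus norm_facts(4))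
    show "hnorm G (lexp G (dil G l x)) = l * hnorm G (lexp G x)" if "0 < l" for l x
      using norm_facts(5)[OF that, of "lexp G x"] by (simp add: gdil_def)
    show "hnorm G (lexp G (ex.star x y)) \<le> hnorm G (lexp G x) + hnorm G (lexp G y)" for x y
      unfolding ex.e_star by (rule norm_facts(6))
    show "2 * s < (\<Sum>j\<in>{1..DIM('a)}. weight G j)" using s(3) unfolding hom_dim_def .
  qed (fact ex.star_assoc ex.star_0_right ex.star_minus_right ex.star_minus_left norm_facts s)+
qed (fact ex.star_0_left ex.dil_star ex.smooth_star)+

lemma measurable_lexp [measurable]: "lexp G \<in> borel_measurable borel"
  by (rule borel_measurable_continuous_onI[OF continuous_lexp])

lemma measurable_log [measurable]: "log \<in> borel_measurable borel"
  by (rule borel_measurable_continuous_onI[OF continuous_log])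

lemma sets_haar [measurable_cong]: "sets (haar G) = sets borel" by (simp add: haar_def)

lemma measurable_haar: "borel_measurable (haar G) = borel_measurable borel"
  by (rule measurable_cong_sets[OF sets_haar refl])

lemma measurable_lexp_iff: "(\<lambda>x. f (lexp G x)) \<in> borel_measurable borel \<longleftrightarrow> f \<in> borel_measurable borel"
proof
  assume "(\<lambda>x. f (lexp G x)) \<in> borel_measurable borel"
  from measurable_compose[OF measurable_log this] show "f \<in> borel_measurable borel" by simp
next
  assume "f \<in> borel_measurable borel"
  from measurable_compose[OF measurable_lexp this] show "(\<lambda>x. f (lexp G x)) \<in> borel_measurable borel" .
qed

lemma nn_integral_haar:
  assumes "(\<lambda>x. f (lexp G x)) \<in> borel_measurable borel"
  shows "(\<integral>\<^sup>+g. f g \<partial>haar G) = (\<integral>\<^sup>+x. f (lexp G x) \<partial>lborel)"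
  unfolding haar_def
proof (rule nn_integral_distr)
  show "lexp G \<in> lborel \<rightarrow>\<^sub>M borel" using measurable_lexp by simp
  show "f \<in> borel_measurable (distr lborel borel (lexp G))" using assms measurable_lexp_iff[of f] by simp
qed

lemma gagliardo_eq:
  assumes [measurable]: "(\<lambda>x. u (lexp G x)) \<in> borel_measurable borel"
  shows "gagliardo G s u = hs.model.ga (\<lambda>x. u (lexp G x))"
proof -
  let ?I = "\<lambda>h. \<integral>\<^sup>+g. ennreal (\<bar>u g - u h\<bar>\<^sup>2 / hnorm G (inv\<^bsub>G\<^esub> h \<otimes>\<^bsub>G\<^esub> g) powr (hom_dim G + 2 * s)) \<partial>haar G"
  have K: "ennreal (\<bar>u (lexp G x) - u (lexp G y)\<bar>\<^sup>2 / hnorm G (inv\<^bsub>G\<^esub> lexp G y \<otimes>\<^bsub>G\<^esub> lexp G x) powr (hom_dim G + 2 * s))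
    = hs.model.K (\<lambda>x. u (lexp G x)) y x" for x y
    unfolding hs.model.K_def hs.model.d_def ex.e_star lc.e_minus hom_dim_def power2_abs ..
  have I: "?I (lexp G y) = (\<integral>\<^sup>+x. hs.model.K (\<lambda>x. u (lexp G x)) y x \<partial>lborel)" for y
    by (subst nn_integral_haar) (simp_all only: K, measurable)
  have "(\<integral>\<^sup>+h. ?I h \<partial>haar G) = (\<integral>\<^sup>+y. ?I (lexp G y) \<partial>lborel)"
    by (rule nn_integral_haar) (unfold I, measurable)
  also have "\<dots> = hs.model.E (\<lambda>x. u (lexp G x))" unfolding I hs.model.E_def ..
  finally show ?thesis unfolding gagliardo_def hs.model.ga_def by (simp only:)
qed

lemma crit_exp_eq: "crit_exp G s = hs.model.p"
  unfolding crit_exp_def hs.model.p_def hom_dim_def ..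

lemma nn_integral_haar_P:
  assumes [measurable]: "(\<lambda>x. u (lexp G x)) \<in> borel_measurable borel"
  shows "(\<integral>\<^sup>+g. ennreal (\<bar>u g\<bar> powr crit_exp G s) \<partial>haar G) = hs.model.P (\<lambda>x. u (lexp G x))"
  unfolding hs.model.P_def crit_exp_eq by (rule nn_integral_haar) measurable

lemma Lp_norm_eq:
  assumes "(\<lambda>x. u (lexp G x)) \<in> borel_measurable borel"
  shows "Lp_norm (haar G) (crit_exp G s) u = hs.model.nrm (\<lambda>x. u (lexp G x))"
proof -
  have "u \<in> borel_measurable (haar G)" using assms by (simp add: measurable_haar measurable_lexp_iff)
  then show ?thesis
    unfolding hs.model.nrm_def nn_integral_haar_P[OF assms, symmetric]
    by (subst Lp_norm_nn_integral) (simp_all add: crit_exp_eq)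
qed

lemma in_Lp_eq:
  "in_Lp (haar G) (crit_exp G s) u \<longleftrightarrow> (\<lambda>x. u (lexp G x)) \<in> borel_measurable borel \<and> hs.model.P (\<lambda>x. u (lexp G x)) < \<infinity>"
proof (cases "(\<lambda>x. u (lexp G x)) \<in> borel_measurable borel")
  case True
  show ?thesis unfolding in_Lp_nn_integral nn_integral_haar_P[OF True]
    using True by (simp add: measurable_haar measurable_lexp_iff)
next
  case False
  then show ?thesis unfolding in_Lp_nn_integral by (simp add: measurable_haar measurable_lexp_iff)
qed

text \<open>The exponential map is a homeomorphism, under which bounded sets of coordinates
  correspond to relatively compact sets; smoothness is transported by
  \<open>chart_smooth_lexp\<close> in one direction and by \<open>smooth_log_inv_chart\<close> in
  the other.\<close>

lemma test_functions_eq: "u \<in> test_functions G \<longleftrightarrow> (\<lambda>x. u (lexp G x)) \<in> hs.tests"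
proof
  assume u: "u \<in> test_functions G"
  then have sm: "smooth_map_on (atlas G) flat_atlas UNIV u" and cpt: "compact (closure {g. u g \<noteq> 0})"
    by (simp_all add: test_functions_def)
  have "chart_smooth flat_atlas UNIV (\<lambda>x. u (lexp G x))"
    by (rule chart_smooth_compose[OF atlas_ok flat_charts_ok open_UNIV chart_smooth_lexp[OF open_UNIV smooth_on_id] sm])
  then have "smooth_on UNIV (\<lambda>x. u (lexp G x))" by (simp only: chart_smooth_flat)
  moreover have "bounded (log ` closure {g. u g \<noteq> 0})"
    by (rule compact_imp_bounded[OF compact_continuous_image[OF continuous_on_subset[OF continuous_log subset_UNIV] cpt]])
  then have "bounded {x. u (lexp G x) \<noteq> 0}"
  proof (rule bounded_subset, intro subsetI)
    fix x assume "x \<in> {x. u (lexp G x) \<noteq> 0}"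
    then have "lexp G x \<in> closure {g. u g \<noteq> 0}" by (intro subsetD[OF closure_subset]) simp
    then show "x \<in> log ` closure {g. u g \<noteq> 0}" by (intro image_eqI[of _ _ "lexp G x"]) simp_all
  qed
  ultimately show "(\<lambda>x. u (lexp G x)) \<in> hs.tests" by (simp add: hs.tests_def)
next
  assume "(\<lambda>x. u (lexp G x)) \<in> hs.tests"
  then have sm: "smooth_on UNIV (\<lambda>x. u (lexp G x))" and bd: "bounded {x. u (lexp G x) \<noteq> 0}"
    by (simp_all add: hs.tests_def)
  have "continuous_on UNIV (\<lambda>g. u (lexp G (log g)))"
    by (rule continuous_on_compose2[OF smooth_on_continuous[OF sm] continuous_log subset_UNIV])
  then have cont: "continuous_on UNIV u" by simp
  have "smooth_on (\<theta> ` P) (\<lambda>x. u (inv_into P \<theta> x))" if P: "(P, \<theta>) \<in> atlas G" for P \<theta>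
  proof -
    have "open (\<theta> ` P)" by (rule charts_okD(4)[OF atlas_ok P charts_okD(1)[OF atlas_ok P] order_refl])
    from smooth_on_compose[OF this open_UNIV subset_UNIV smooth_log_inv_chart[OF P] sm] show ?thesis by simp
  qed
  then have "smooth_map_on (atlas G) flat_atlas UNIV u"
    unfolding smooth_map_on_flat_target using cont by blast
  moreover have "compact (closure {g. u g \<noteq> 0})"
  proof -
    have c: "compact (lexp G ` closure {x. u (lexp G x) \<noteq> 0})"
      by (rule compact_continuous_image[OF continuous_on_subset[OF continuous_lexp subset_UNIV]]) (simp add: bd compact_closure)
    have sub: "{g. u g \<noteq> 0} \<subseteq> lexp G ` closure {x. u (lexp G x) \<noteq> 0}"
    proof
      fix g assume "g \<in> {g. u g \<noteq> 0}"
      then have "log g \<in> closure {x. u (lexp G x) \<noteq> 0}" by (intro subsetD[OF closure_subset]) simp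
      then show "g \<in> lexp G ` closure {x. u (lexp G x) \<noteq> 0}" by (intro image_eqI[of _ _ "log g"]) simp_all
    qed
    have "closure {g. u g \<noteq> 0} \<subseteq> lexp G ` closure {x. u (lexp G x) \<noteq> 0}"
      by (rule closure_minimal[OF sub compact_imp_closed[OF c]])
    then show ?thesis using compact_Int_closed[OF c closed_closure[of "{g. u g \<noteq> 0}"]] by (simp add: Int_absorb1)
  qed
  ultimately show "u \<in> test_functions G" by (simp add: test_functions_def)
qed

lemma dirichlet_space_eq: "u \<in> dirichlet_space G s \<longleftrightarrow> (\<lambda>x. u (lexp G x)) \<in> hs.model.Dir"
proof
  assume "u \<in> dirichlet_space G s"
  then obtain \<Phi> where inLp: "in_Lp (haar G) (crit_exp G s) u" and \<Phi>: "\<And>k. \<Phi> k \<in> test_functions G"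
    and cauchy: "\<forall>\<epsilon>>0. \<exists>M. \<forall>j\<ge>M. \<forall>k\<ge>M. gagliardo G s (\<lambda>g. \<Phi> j g - \<Phi> k g) < \<epsilon>"
    and lim: "(\<lambda>k. Lp_norm (haar G) (crit_exp G s) (\<lambda>g. \<Phi> k g - u g)) \<longlonglongrightarrow> 0"
    unfolding dirichlet_space_def by blast
  have um [measurable]: "(\<lambda>x. u (lexp G x)) \<in> borel_measurable borel" using inLp by (simp add: in_Lp_eq)
  have T: "(\<lambda>x. \<Phi> k (lexp G x)) \<in> hs.tests" for k using \<Phi> by (simp add: test_functions_eq)
  have Tm [measurable]: "(\<lambda>x. \<Phi> k (lexp G x)) \<in> borel_measurable borel" for k
    by (rule hs.model.T_measurable[OF T])
  have g: "gagliardo G s (\<lambda>g. \<Phi> j g - \<Phi> k g) = hs.model.ga (\<lambda>x. \<Phi> j (lexp G x) - \<Phi> k (lexp G x))" for j k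
    by (rule gagliardo_eq[OF borel_measurable_diff[OF Tm Tm]])
  have n: "Lp_norm (haar G) (crit_exp G s) (\<lambda>g. \<Phi> k g - u g) = hs.model.nrm (\<lambda>x. \<Phi> k (lexp G x) - u (lexp G x))" for k
    by (rule Lp_norm_eq[OF borel_measurable_diff[OF Tm um]])
  show "(\<lambda>x. u (lexp G x)) \<in> hs.model.Dir"
    unfolding hs.model.Dir_def
    using inLp T cauchy lim unfolding in_Lp_eq g n by (intro CollectI conjI exI[of _ "\<lambda>k x. \<Phi> k (lexp G x)"]) auto
next
  assume "(\<lambda>x. u (lexp G x)) \<in> hs.model.Dir"
  then obtain \<Phi> where um: "(\<lambda>x. u (lexp G x)) \<in> borel_measurable borel" and fin: "hs.model.P (\<lambda>x. u (lexp G x)) < \<infinity>"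
    and T: "\<And>k. \<Phi> k \<in> hs.tests"
    and cauchy: "\<forall>\<epsilon>>0. \<exists>M. \<forall>j\<ge>M. \<forall>k\<ge>M. hs.model.ga (\<lambda>x. \<Phi> j x - \<Phi> k x) < \<epsilon>"
    and lim: "(\<lambda>k. hs.model.nrm (\<lambda>x. \<Phi> k x - u (lexp G x))) \<longlonglongrightarrow> 0"
    unfolding hs.model.Dir_def by blast
  have Tm: "\<Phi> k \<in> borel_measurable borel" for k by (rule hs.model.T_measurable[OF T])
  have g: "gagliardo G s (\<lambda>g. \<Phi> j (log g) - \<Phi> k (log g)) = hs.model.ga (\<lambda>x. \<Phi> j x - \<Phi> k x)" for j k
    by (subst gagliardo_eq) (simp_all add: borel_measurable_diff[OF Tm Tm])
  have n: "Lp_norm (haar G) (crit_exp G s) (\<lambda>g. \<Phi> k (log g) - u g) = hs.model.nrm (\<lambda>x. \<Phi> k x - u (lexp G x))" for k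
    by (subst Lp_norm_eq) (simp_all add: borel_measurable_diff[OF Tm um])
  have "(\<lambda>g. \<Phi> k (log g)) \<in> test_functions G" for k using T by (simp add: test_functions_eq)
  moreover have "in_Lp (haar G) (crit_exp G s) u" using um fin by (simp add: in_Lp_eq)
  ultimately show "u \<in> dirichlet_space G s"
    unfolding dirichlet_space_def using cauchy lim unfolding g[symmetric] n[symmetric]
    by (intro CollectI conjI exI[of _ "\<lambda>k g. \<Phi> k (log g)"]) auto
qed

lemma sobolev_ineq_eq:
  "(\<lambda>x. u (lexp G x)) \<in> borel_measurable borel \<Longrightarrow>
    sobolev_ineq G s S u \<longleftrightarrow> hs.model.nrm (\<lambda>x. u (lexp G x)) \<le> S * hs.model.ga (\<lambda>x. u (lexp G x))"
  by (simp add: sobolev_ineq_def Lp_norm_eq gagliardo_eq)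

lemma sobolev_extremal:
  "\<exists>S. best_sobolev_const G s S \<and> (\<forall>u\<in>test_functions G. sobolev_ineq G s S u) \<and>
    (\<exists>u\<in>dirichlet_space G s. \<not> (AE g in haar G. u g = 0) \<and> Lp_norm (haar G) (crit_exp G s) u = S * gagliardo G s u)"
proof -
  obtain S u0 where S: "\<forall>u\<in>hs.model.Dir. hs.model.nrm u \<le> S * hs.model.ga u"
    and best: "\<forall>C. (\<forall>u\<in>hs.tests. hs.model.nrm u \<le> C * hs.model.ga u) \<longrightarrow> S \<le> C"
    and u0: "u0 \<in> hs.model.Dir" "\<not> (AE x in lborel. u0 x = 0)" "hs.model.nrm u0 = S * hs.model.ga u0"
    using hs.model.extremal by blast
  have dir: "sobolev_ineq G s S u" if "u \<in> dirichlet_space G s" for u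
  proof -
    have D: "(\<lambda>x. u (lexp G x)) \<in> hs.model.Dir" using that by (simp only: dirichlet_space_eq)
    show ?thesis unfolding sobolev_ineq_eq[OF hs.model.Dir_measurable[OF D]] using S D by blast
  qed
  have test: "sobolev_ineq G s S u" if "u \<in> test_functions G" for u
  proof (rule dir)
    have "(\<lambda>x. u (lexp G x)) \<in> hs.tests" using that by (simp only: test_functions_eq)
    then show "u \<in> dirichlet_space G s" unfolding dirichlet_space_eq by (rule hs.model.T_subset_Dir)
  qed
  have le: "S \<le> C" if C: "\<forall>u\<in>test_functions G. sobolev_ineq G s C u" for C
  proof (rule best[rule_format])
    fix v assume v: "v \<in> hs.tests"
    have "(\<lambda>g. v (log g)) \<in> test_functions G" unfolding test_functions_eq using v by simp
    then have "sobolev_ineq G s C (\<lambda>g. v (log g))" using C by blast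
    then show "hs.model.nrm v \<le> C * hs.model.ga v"
      by (subst (asm) sobolev_ineq_eq) (simp_all add: hs.model.T_measurable[OF v])
  qed
  have u0m [measurable]: "u0 \<in> borel_measurable borel" by (rule hs.model.Dir_measurable[OF u0(1)])
  have 1: "(\<lambda>g. u0 (log g)) \<in> dirichlet_space G s" unfolding dirichlet_space_eq using u0(1) by simp
  have 2: "\<not> (AE g in haar G. u0 (log g) = 0)"
  proof -
    have "(AE g in haar G. u0 (log g) = 0) \<longleftrightarrow> (AE x in lborel. u0 (log (lexp G x)) = 0)"
      unfolding haar_def by (rule AE_distr_iff) measurable
    then show ?thesis using u0(2) by simp
  qed
  have 3: "Lp_norm (haar G) (crit_exp G s) (\<lambda>g. u0 (log g)) = S * gagliardo G s (\<lambda>g. u0 (log g))"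
    using u0(3) by (simp add: Lp_norm_eq gagliardo_eq)
  have "best_sobolev_const G s S" unfolding best_sobolev_const_def using dir le by blast
  then show ?thesis
    by (intro exI[of _ S] conjI ballI test bexI[of _ "\<lambda>g. u0 (log g)"] 1 2 3)
qed

lemma restricted_nn_integral:
  assumes [measurable]: "(\<lambda>x. f (lexp G x)) \<in> borel_measurable borel" and \<Omega>: "open \<Omega>"
  shows "(\<integral>\<^sup>+g. ennreal (\<bar>f g\<bar> powr q) \<partial>restrict_space (haar G) \<Omega>)
    = (\<integral>\<^sup>+x. ennreal (\<bar>f (lexp G x)\<bar> powr q) * indicator (lexp G -` \<Omega>) x \<partial>lborel)"
proof -
  have [measurable]: "\<Omega> \<in> sets borel" using \<Omega> by simp
  have pre [measurable]: "lexp G -` \<Omega> \<in> sets borel"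
    using measurable_sets[OF measurable_lexp, of \<Omega>] by simp
  have ind: "indicator \<Omega> (lexp G x) = (indicator (lexp G -` \<Omega>) x :: ennreal)" for x by (simp add: indicator_def)
  have "(\<integral>\<^sup>+g. ennreal (\<bar>f g\<bar> powr q) \<partial>restrict_space (haar G) \<Omega>) = (\<integral>\<^sup>+g. ennreal (\<bar>f g\<bar> powr q) * indicator \<Omega> g \<partial>haar G)"
    by (rule nn_integral_restrict_space) (simp add: haar_def)
  also have "\<dots> = (\<integral>\<^sup>+x. ennreal (\<bar>f (lexp G x)\<bar> powr q) * indicator \<Omega> (lexp G x) \<partial>lborel)"
    by (rule nn_integral_haar) (unfold ind, measurable)
  finally show ?thesis by (simp only: ind)
qed

lemma compact_restriction_bounded:
  assumes \<Omega>: "bounded_domain G \<Omega>" and q: "1 \<le> q" "q < crit_exp G s"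
  shows "compact_restriction G s \<Omega> q"
proof -
  obtain R where op: "open \<Omega>" and R: "\<Omega> \<subseteq> hball G \<one>\<^bsub>G\<^esub> R" using \<Omega> by (auto simp: bounded_domain_def)
  \<comment> \<open>Boundedness of the domain enters as finite measure of its preimage in
    coordinates.\<close>
  define Z where "Z = lexp G -` \<Omega>"
  have Zm: "Z \<in> sets borel"
    using measurable_sets[OF measurable_lexp, of \<Omega>] op by (simp add: Z_def)
  have "inv\<^bsub>G\<^esub> \<one>\<^bsub>G\<^esub> \<otimes>\<^bsub>G\<^esub> g = g" for g
    using group_laws(5)[of "\<one>\<^bsub>G\<^esub>"] group_laws(2)[of "inv\<^bsub>G\<^esub> \<one>\<^bsub>G\<^esub>"] by (simp add: group_laws(2))
  then have "Z \<subseteq> {x. hnorm G (lexp G x) < R}" using R by (auto simp: Z_def hball_def)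
  then have "emeasure lborel Z \<le> emeasure lborel {x. hnorm G (lexp G x) < R}"
    by (rule emeasure_mono) measurable
  also have "\<dots> < \<infinity>" by (rule hs.model.emeasure_N_finite)
  finally have Zfin: "emeasure lborel Z < \<infinity>" .
  note q' = q[unfolded crit_exp_eq]
  have inLq: "in_Lp (restrict_space (haar G) \<Omega>) q f"
    if f: "(\<lambda>x. f (lexp G x)) \<in> borel_measurable borel" "hs.model.P (\<lambda>x. f (lexp G x)) < \<infinity>" for f
  proof -
    have "f \<in> borel_measurable (restrict_space (haar G) \<Omega>)"
      using f(1) by (intro measurable_restrict_space1) (simp add: measurable_haar measurable_lexp_iff)
    then show ?thesis unfolding in_Lp_nn_integral restricted_nn_integral[OF f(1) op] Z_def[symmetric]
      using hs.model.Lq_finite[OF f(1) Zm f(2) Zfin q'] by blast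
  qed
  show ?thesis unfolding compact_restriction_def
  proof (intro conjI ballI allI impI)
    fix u assume "u \<in> dirichlet_space G s"
    then have D: "(\<lambda>x. u (lexp G x)) \<in> hs.model.Dir" by (simp only: dirichlet_space_eq)
    show "in_Lp (restrict_space (haar G) \<Omega>) q u"
      by (rule inLq[OF hs.model.Dir_measurable[OF D] hs.model.Dir_P[OF D]])
  next
    fix u :: "nat \<Rightarrow> 'g \<Rightarrow> real"
    assume u: "(\<forall>k. u k \<in> dirichlet_space G s) \<and> (\<exists>B. \<forall>k. gagliardo G s (u k) \<le> B)"
    then obtain B where B: "\<And>k. gagliardo G s (u k) \<le> B" by blast
    have D: "(\<lambda>x. u k (lexp G x)) \<in> hs.model.Dir" for k using u by (simp only: dirichlet_space_eq)
    have um: "(\<lambda>x. u k (lexp G x)) \<in> borel_measurable borel" for k by (rule hs.model.Dir_measurable[OF D])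
    have gB: "hs.model.ga (\<lambda>x. u k (lexp G x)) \<le> B" for k using B[of k] by (simp only: gagliardo_eq[OF um])
    obtain r v where r: "strict_mono r" and v: "v \<in> borel_measurable borel" "hs.model.P v < \<infinity>"
      and lim: "(\<lambda>k. \<integral>\<^sup>+x. ennreal (\<bar>u (r k) (lexp G x) - v x\<bar> powr q) * indicator Z x \<partial>lborel) \<longlonglongrightarrow> 0"
      by (rule hs.model.compact_embedding[OF D gB Zm Zfin q'])
    let ?v = "\<lambda>g. v (log g)"
    have vm: "(\<lambda>x. ?v (lexp G x)) \<in> borel_measurable borel" "hs.model.P (\<lambda>x. ?v (lexp G x)) < \<infinity>" using v by simp_all
    have diff: "(\<lambda>x. u (r k) (lexp G x) - ?v (lexp G x)) \<in> borel_measurable borel" for k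
      by (rule borel_measurable_diff[OF um vm(1)])
    have "Lp_norm (restrict_space (haar G) \<Omega>) q (\<lambda>g. u (r k) g - ?v g)
      = enn2real (\<integral>\<^sup>+x. ennreal (\<bar>u (r k) (lexp G x) - v x\<bar> powr q) * indicator Z x \<partial>lborel) powr (1 / q)" for k
    proof -
      have "(\<lambda>g. u (r k) g - ?v g) \<in> borel_measurable (haar G)"
        unfolding measurable_haar using diff[of k] measurable_lexp_iff[of "\<lambda>g. u (r k) g - ?v g"] by simp
      then have "(\<lambda>g. u (r k) g - ?v g) \<in> borel_measurable (restrict_space (haar G) \<Omega>)"
        by (rule measurable_restrict_space1)
      from Lp_norm_nn_integral[OF this, of q] restricted_nn_integral[OF diff[of k] op, of q]
      show ?thesis by (simp add: Z_def)
    qed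
    moreover have "(\<lambda>k. enn2real (\<integral>\<^sup>+x. ennreal (\<bar>u (r k) (lexp G x) - v x\<bar> powr q) * indicator Z x \<partial>lborel) powr (1 / q)) \<longlonglongrightarrow> 0 powr (1 / q)"
    proof (rule tendsto_powr'[OF _ tendsto_const])
      show "(\<lambda>k. enn2real (\<integral>\<^sup>+x. ennreal (\<bar>u (r k) (lexp G x) - v x\<bar> powr q) * indicator Z x \<partial>lborel)) \<longlonglongrightarrow> 0"
        using tendsto_enn2real[of _ 0, unfolded ennreal_0, OF lim] by simp
    qed (use q in auto)
    ultimately have "(\<lambda>k. Lp_norm (restrict_space (haar G) \<Omega>) q (\<lambda>g. u (r k) g - ?v g)) \<longlonglongrightarrow> 0" by simp
    with r inLq[OF vm] show "\<exists>r v. strict_mono (r :: nat \<Rightarrow> nat) \<and> in_Lp (restrict_space (haar G) \<Omega>) q v \<and>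
      (\<lambda>k. Lp_norm (restrict_space (haar G) \<Omega>) q (\<lambda>g. u (r k) g - v g)) \<longlonglongrightarrow> 0" by blast
  qed
qed

end

theorem theorem1p3:
  fixes G :: "('g::{t2_space, second_countable_topology}, 'a::euclidean_space) hgroup"
    and s :: real
  assumes "homogeneous_group G" and "0 < s" and "s < 1" and "hom_dim G > 2 * s"
  shows "(\<exists>S. \<forall>u\<in>test_functions G. sobolev_ineq G s S u) \<and>
    (\<exists>S. best_sobolev_const G s S \<and>
       (\<exists>u\<in>dirichlet_space G s. \<not> (AE g in haar G. u g = 0) \<and>
          Lp_norm (haar G) (crit_exp G s) u = S * gagliardo G s u)) \<and>
    (\<forall>\<Omega> q. bounded_domain G \<Omega> \<and> 1 \<le> q \<and> q < crit_exp G s \<longrightarrow> compact_restriction G s \<Omega> q)"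
proof -
  interpret homogeneous_lie_group G by (rule homogeneous_lie_group.intro[OF assms(1)])
  obtain U \<phi> W V \<psi> where chart: "(U, \<phi>) \<in> atlas G" "lexp G ` W \<subseteq> U" "open W" "0 \<in> W" "open V"
    "homeomorphism W V (\<lambda>v. \<phi> (lexp G v)) \<psi>" "smooth_on V \<psi>"
    by (rule local_logarithm)
  obtain X where X: "graded_space (dil G) X (weight G)" by (rule graded_basis)
  interpret homogeneous_group_sobolev G X U \<phi> W V \<psi> s
    by (intro homogeneous_group_sobolev.intro homogeneous_lie_group_log.intro
        homogeneous_lie_group_log_axioms.intro homogeneous_group_sobolev_axioms.intro homogeneous_lie_group_axioms X chart assms(2-4))
  \<comment> \<open>The best constant also witnesses the first claim.\<close>
  show ?thesis using sobolev_extremal compact_restriction_bounded by blast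
qed

end
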